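(* Let $\mathcal C$ be a smooth cyclic $A_\infty$-category of dimension $d$ and $\lambda\in\mathcal C$ an object. Assume that there is an element $S^{oc}\in\mathcal F^c(\mathcal C)\otimes\mathcal F^o(\lambda)$ of degree $6-2d$ such that $$(d_{oc}+\Delta_{oc})(S^{oc})+\tfrac12\{S^{oc},S^{oc}\}_{oc}+\nu\langle ch(\lambda),S^{oc}\rangle_M=0$$ and such that the projection of $S^{oc}$ to $Sym^0(\mathcal H)\otimes Sym^1(Cyc^*(\lambda)[d-4])\gamma^0$ is the cyclic potential $I$ of the cyclic $A_\infty$-algebra $End_{\mathcal C}(\lambda)$. Assume moreover that $ch(\lambda)=dh$. Let $$I^{oc}(\lambda,h):=e^{\nu\langle h,-\rangle_M}S^{oc}.$$ Then $$I^{oc}(\lambda,h)\in MCE\big(\mathcal F^c(\mathcal C)\otimes\mathcal F^o(\lambda)\big).$$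
   Context: **Conventions.** $k$ is a field of characteristic $0$. Signs written $\pm$ are Koszul signs. $V[n]$ denotes the shift with $V[n]^i=V^{i+n}$ in cohomological grading (so it raises homological degree by $n$). **BD algebras.** For odd $r$, an $r$-twisted Beilinson–Drinfeld (BD) algebra is a graded commutative unital $k\llbracket\gamma\rrbracket$-algebra $A$ ($\gamma$ of cohomological degree $1-r$) with a $k\llbracket\gamma\rrbracket$-bilinear shifted Poisson bracket $\{\_,\_\}$ of degree $r$ (a shifted Lie bracket, $\{a,b\}=-(-1)^{(|a|+1)(|b|+1)}\{b,a\}$, and a derivation in each variable) and a $k\llbracket\gamma\rrbracket$-linear differential $D$ of degree $1$, $D^2=0$, with $D(ab)=D(a)b+(-1)^{|a|}aD(b)+(-1)^{|a|}\gamma\{a,b\}$. The tensor product (over $k\llbracket\gamma\rrbracket$, completed) of two such algebras $A,B$ is the BD algebra with differential $D_A\otimes 1+1\otimes D_B$ and bracket $\{a_1\otimes b_1,a_2\otimes b_2\}=(-1)^{|a_2|(|b_1|+r)}a_1a_2\otimes\{b_1,b_2\}+(-1)^{|b_1|(|a_2|+r)}\{a_1,a_2\}\otimes b_1b_2$. For a $(2d-5)$-twisted BD algebra $A$, $A[5-2d]$ is a dg Lie algebra, and $MCE(A)$ denotes its Maurer–Cartan elements: elements $S\in A$ of degree $6-2d$ with $DS+\tfrac12\{S,S\}=0$. **Categories.** $A_\infty$-categories over $k$ are strictly unital, with compositions $m^n$; smooth means that the diagonal bimodule is perfect. A cyclic $A_\infty$-category of dimension $d$ is an $A_\infty$-category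 with finite-dimensional Hom spaces together with symmetric non-degenerate chain maps $\langle\_,\_\rangle: Hom(\mu,\lambda)\otimes Hom(\lambda,\mu)\to k[-d]$ such that $\langle m^n(a_1,\dots,a_n),a_{n+1}\rangle$ is (graded) cyclically invariant for all $n$. $CH_*(\mathcal C)$ is the (reduced) Hochschild chain complex, homologically graded, with differential $d_{Hoch}$ and Connes operator $B$ of degree $+1$; $u$ has homological degree $-2$. The Mukai pairing is the degree $0$ pairing $$\langle a_0[a_1|\dots|a_p],b_0[b_1|\dots|b_q]\rangle_M=\sum\pm\, \mathrm{str}\big(c\mapsto m(a_j,\dots,a_p,a_0,\dots,a_i,m(a_{i+1},\dots,a_{j-1},c,b_l,\dots,b_q,b_0,\dots,b_t),b_{t+1},\dots,b_{l-1})\big),$$ where $c$ runs over the Hom spaces for which the expression is composable, $\mathrm{str}$ is the supertrace, and the sum is over all $i<j$, $t<l$. **Closed BD algebra.** Let $\mathcal H:=(CH_*(\mathcal C)[u^{-1}][d-2])^{-*}$, where $-*$ means reversing the grading, so that $xu^{-i}$ with $x$ of homological degree $n$ has degree $2-d-n-2i$ in $\mathcal H$. Then $\mathcal F^c(\mathcal C)=(Sym(\mathcal H)\llbracket\gamma\rrbracket,\ d_{Hoch}+uB+\gamma\Delta_c,\ \{\_,\_\}_c)$ is a $(2d-5)$-twisted BD algebra: $d_{Hoch}+uB$ is extended as a derivation ($u\cdot xu^{0}=0$); $\Delta_c$ is the second order operator vanishing on $Sym^{\le1}$ with $\Delta_c(x\cdot y)=\pm\langle Bx_0,y_0\rangle_M$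 for $x=\sum_i x_iu^{-i}$, $y=\sum_i y_iu^{-i}$; $\{\_,\_\}_c$ is determined by the BD relation. **Open BD algebra.** Let $\mathcal W(\lambda)$ be the space of (completed, i.e. product over word length) cyclic words $(\varphi_1\cdots\varphi_n)$, $n\ge0$, with letters in $(End_{\mathcal C}(\lambda)[1])^\vee$, modulo signed cyclic rotation; the empty word is denoted $\nu$ and has degree $0$ in $\mathcal W(\lambda)$. Put $Cyc^*(\lambda)[d-4]:=\mathcal W(\lambda)[d-3]$. Then $\mathcal F^o(\lambda)=(Sym(Cyc^*(\lambda)[d-4])\llbracket\gamma\rrbracket,\ d+\nabla+\gamma\delta,\ \{\_,\_\}_o)$ (symmetric algebra suitably completed) is a $(2d-5)$-twisted BD algebra, $|\gamma|=6-2d$. Here $d$ is the derivation induced by the internal differential $m^1$; with $\omega^{-1}$ the inverse pairing on letters, $\nabla$ is the derivation with $\nabla(\varphi_1\cdots\varphi_n)=\sum_{i<j}\pm\omega^{-1}(\varphi_i,\varphi_j)(\varphi_{i+1}\cdots\varphi_{j-1})(\varphi_{j+1}\cdots\varphi_{i-1})$ (indices cyclic, empty words giving $\nu$); $\{\_,\_\}_o$ is the biderivation with $\{(\varphi_1\cdots\varphi_p),(\psi_1\cdots\psi_q)\}_o=\sum_{i,j}\pm\omega^{-1}(\varphi_i,\psi_j)(\varphi_{i+1}\cdots\varphi_{i-1}\psi_{j+1}\cdots\psi_{j-1})$, so $\nu$ is central; $\delta$ is the second order operator vanishing on $Sym^{\le1}$ determined by $\{\_,\_\}_o$ through the BD relation.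 **Open-closed notation.** $d_{oc}=d+d_{Hoch}+uB$, $\Delta_{oc}=\nabla+\gamma\delta+\gamma\Delta_c$ (so $d_{oc}+\Delta_{oc}$ is the differential of $\mathcal F^c(\mathcal C)\otimes\mathcal F^o(\lambda)$), and $\{\_,\_\}_{oc}$ is the tensor product bracket. **Chern character.** $ch(\lambda)$ is represented by the unit $1_\lambda\in End_{\mathcal C}(\lambda)$ viewed as a (reduced) Hochschild chain. For $h=\sum_i h_iu^i\in CH_*(\mathcal C)\llbracket u\rrbracket$ and $y=\sum_iy_iu^{-i}\in\mathcal H$ set $\langle h,y\rangle_M=\sum_i(-1)^i\langle h_i,y_i\rangle_M$, extended to $Sym(\mathcal H)\llbracket\gamma\rrbracket$ as a derivation; $\nu\langle h,-\rangle_M$ is this operator followed by multiplication by $\nu$. The condition $ch(\lambda)=dh$ means $h\in CH_*(\mathcal C)\llbracket u\rrbracket$ (of homological degree $1$) satisfies $(d_{Hoch}+uB)h=1_\lambda$; signs are such that $[d_{oc},\nu\langle h,-\rangle_M]=\nu\langle (d_{Hoch}+uB)h,-\rangle_M$. **Cyclic potential.** $I=\sum_{k\ge2}\langle m^k(\_,\dots,\_),\_\rangle$, i.e. the element of $\mathcal W(\lambda)$ whose sum over cyclic rotations is the family of cyclically invariant functionals $(a_1,\dots,a_{k+1})\mapsto\langle m^k(a_1,\dots,a_k),a_{k+1}\rangle$, $k\ge 2$. *)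

theory Defs
  imports Complex_Main "HOL-Library.Function_Algebras"
begin

text \<open>
  Sign conventions. All \<open>A\<^sub>\<infinity>\<close>-operations are written on the shifted spaces \<open>Hom[1]\<close>, where they
  have degree 1; \<open>sdeg a = deg a - 1\<close> is the shifted degree. Paths are read from left to right:
  \<open>m\<^sup>n : Hom(X\<^sub>0,X\<^sub>1) \<otimes> \<dots> \<otimes> Hom(X\<^sub>n\<^sub>-\<^sub>1,X\<^sub>n) \<rightarrow> Hom(X\<^sub>0,X\<^sub>n)\<close>.
  All signs are Koszul signs with respect to these degrees.
\<close>

definition ksign :: "int \<Rightarrow> 'k::ring_1" where
  "ksign n = (if even n then 1 else - 1)"

definition slice :: "nat \<Rightarrow> nat \<Rightarrow> 'a list \<Rightarrow> 'a list" where
  "slice i j xs = take (j - i) (drop i xs)"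


section \<open>Formal linear combinations\<close>

text \<open>Functions \<open>'a \<Rightarrow> 'k\<close> serve as (possibly infinite) formal linear combinations of elements of
  \<open>'a\<close>. The sums in \<open>lext\<close> and in the completed algebras below range over the nonzero terms.\<close>

definition sgl :: "'a \<Rightarrow> 'a \<Rightarrow> 'k::zero_neq_one" where
  "sgl a = (\<lambda>x. if x = a then 1 else 0)"

definition smul :: "'k::times \<Rightarrow> ('a \<Rightarrow> 'k) \<Rightarrow> 'a \<Rightarrow> 'k" where
  "smul c f = (\<lambda>x. c * f x)"

definition lext :: "('a \<Rightarrow> 'b \<Rightarrow> 'k) \<Rightarrow> ('a \<Rightarrow> 'k) \<Rightarrow> 'b \<Rightarrow> 'k::field" where
  "lext F x = (\<lambda>y. \<Sum>a | x a * F a y \<noteq> 0. x a * F a y)"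

abbreviation fspan :: "('a \<Rightarrow> 'k::field) set \<Rightarrow> ('a \<Rightarrow> 'k) set" where
  "fspan \<equiv> module.span smul"


section \<open>Cyclic \<open>A\<^sub>\<infinity>\<close>-categories\<close>

text \<open>A homogeneous morphism carries its source, target and (cohomological) degree. The spaces
  \<open>Hom X Y i\<close> are subspaces of one ambient vector space and need not be independent in it.\<close>

datatype ('o, 'v) arr = Arr (src: 'o) (tgt: 'o) (deg: int) (vec: 'v)

record ('k, 'o, 'v) ainf =
  scl :: "'k \<Rightarrow> 'v \<Rightarrow> 'v"
  Obj :: "'o set"
  Hom :: "'o \<Rightarrow> 'o \<Rightarrow> int \<Rightarrow> 'v set"
  mop :: "('o, 'v) arr list \<Rightarrow> 'v"
  idt :: "'o \<Rightarrow> 'v"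

record ('k, 'o, 'v) cyc_ainf = "('k, 'o, 'v) ainf" +
  cpair :: "('o, 'v) arr \<Rightarrow> ('o, 'v) arr \<Rightarrow> 'k"

definition arrows :: "('k, 'o, 'v, 'z) ainf_scheme \<Rightarrow> ('o, 'v) arr set" where
  "arrows C = {a. src a \<in> Obj C \<and> tgt a \<in> Obj C \<and> vec a \<in> Hom C (src a) (tgt a) (deg a)}"

definition sdeg :: "('o, 'v) arr \<Rightarrow> int" where
  "sdeg a = deg a - 1"

definition sd :: "('o, 'v) arr list \<Rightarrow> int" where
  "sd as = sum_list (map sdeg as)"

fun path :: "('k, 'o, 'v, 'z) ainf_scheme \<Rightarrow> 'o \<Rightarrow> ('o, 'v) arr list \<Rightarrow> 'o \<Rightarrow> bool" where
  "path C X [] Y \<longleftrightarrow> X \<in> Obj C \<and> X = Y"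
| "path C X (a # as) Y \<longleftrightarrow> a \<in> arrows C \<and> src a = X \<and> path C (tgt a) as Y"

definition mres :: "('k, 'o, 'v, 'z) ainf_scheme \<Rightarrow> ('o, 'v) arr list \<Rightarrow> ('o, 'v) arr" where
  "mres C as = Arr (src (hd as)) (tgt (last as)) (sd as + 2) (mop C as)"

definition unit_arr :: "('k, 'o, 'v, 'z) ainf_scheme \<Rightarrow> 'o \<Rightarrow> ('o, 'v) arr" where
  "unit_arr C X = Arr X X 0 (idt C X)"

text \<open>In the unit axiom \<open>m\<^sup>2\<close> is the shifted operation
  \<open>m\<^sup>2(a,b) = (-1)\<^bsup>|a|\<^esup> a\<cdot>b\<close>; hence the sign for the right unit.\<close>

definition ainf_category ::
  "('k::field_char_0, 'o, 'v::ab_group_add, 'z) ainf_scheme \<Rightarrow> bool" where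
  "ainf_category C \<longleftrightarrow>
     vector_space (scl C) \<and>
     (\<forall>X\<in>Obj C. \<forall>Y\<in>Obj C. \<forall>i. module.subspace (scl C) (Hom C X Y i)) \<and>
     (\<forall>X as Y. as \<noteq> [] \<and> path C X as Y \<longrightarrow> mres C as \<in> arrows C) \<and>
     (\<forall>X as Y Z i v w c bs W.
        path C X (as @ Arr Y Z i v # bs) W \<and> path C X (as @ Arr Y Z i w # bs) W \<longrightarrow>
        mop C (as @ Arr Y Z i (scl C c v + w) # bs) =
          scl C c (mop C (as @ Arr Y Z i v # bs)) + mop C (as @ Arr Y Z i w # bs)) \<and>
     (\<forall>X as Y. as \<noteq> [] \<and> path C X as Y \<longrightarrow>
        (\<Sum>j\<le>length as. \<Sum>i<j. scl C (ksign (sd (take i as)))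
           (mop C (take i as @ mres C (slice i j as) # drop j as))) = 0) \<and>
     (\<forall>X\<in>Obj C. unit_arr C X \<in> arrows C) \<and>
     (\<forall>a\<in>arrows C. mop C [unit_arr C (src a), a] = vec a \<and>
                    mop C [a, unit_arr C (tgt a)] = scl C (ksign (deg a)) (vec a)) \<and>
     (\<forall>X as Y Z. path C X as Y \<and> unit_arr C Z \<in> set as \<and> length as \<noteq> 2 \<longrightarrow> mop C as = 0)"

text \<open>The pairing transported to the shifted spaces.\<close>

definition spair :: "('k::field, 'o, 'v, 'z) cyc_ainf_scheme \<Rightarrow> ('o, 'v) arr \<Rightarrow> ('o, 'v) arr \<Rightarrow> 'k" where
  "spair C a b = ksign (deg a) * cpair C a b"

definition cyclic_ainf_category ::
  "int \<Rightarrow> ('k::field_char_0, 'o, 'v::ab_group_add, 'z) cyc_ainf_scheme \<Rightarrow> bool" where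
  "cyclic_ainf_category d C \<longleftrightarrow>
     ainf_category C \<and>
     (\<forall>X\<in>Obj C. \<forall>Y\<in>Obj C. finite {i. Hom C X Y i \<noteq> {0}} \<and>
        (\<forall>i. \<exists>B. finite B \<and> Hom C X Y i = module.span (scl C) B)) \<and>
     (\<forall>X Y i v w c b. Arr X Y i v \<in> arrows C \<and> Arr X Y i w \<in> arrows C \<and>
        b \<in> arrows C \<and> src b = Y \<and> tgt b = X \<longrightarrow>
        cpair C (Arr X Y i (scl C c v + w)) b =
          c * cpair C (Arr X Y i v) b + cpair C (Arr X Y i w) b) \<and>
     (\<forall>a\<in>arrows C. \<forall>b\<in>arrows C. src b = tgt a \<and> tgt b = src a \<longrightarrow>
        (deg a + deg b \<noteq> d \<longrightarrow> cpair C a b = 0) \<and>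
        cpair C a b = ksign (deg a * deg b) * cpair C b a \<and>
        cpair C (mres C [a]) b + ksign (deg a) * cpair C a (mres C [b]) = 0) \<and>
     (\<forall>a\<in>arrows C. vec a \<noteq> 0 \<longrightarrow>
        (\<exists>b\<in>arrows C. src b = tgt a \<and> tgt b = src a \<and> cpair C a b \<noteq> 0)) \<and>
     (\<forall>X a as. as \<noteq> [] \<and> path C X (a # as) X \<longrightarrow>
        spair C (mres C (a # butlast as)) (last as) =
          ksign (sdeg a * sd as) * spair C (mres C as) a)"


section \<open>Bimodules and smoothness\<close>

text \<open>An \<open>A\<^sub>\<infinity>\<close>-bimodule has operations \<open>\<mu>(a\<^sub>1,\<dots>,a\<^sub>r | p | b\<^sub>1,\<dots>,b\<^sub>s)\<close> of degree 1, where the \<open>a\<^sub>i, b\<^sub>j\<close>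
  count with their shifted degree and \<open>p\<close> with its degree in the bimodule. A homogeneous element
  of the bimodule is again recorded as an \<open>arr\<close>.\<close>

record ('k, 'o, 'v, 'w) bimod =
  bscl :: "'k \<Rightarrow> 'w \<Rightarrow> 'w"
  bsp :: "'o \<Rightarrow> 'o \<Rightarrow> int \<Rightarrow> 'w set"
  bop :: "('o, 'v) arr list \<Rightarrow> ('o, 'w) arr \<Rightarrow> ('o, 'v) arr list \<Rightarrow> 'w"

definition bres ::
  "int \<Rightarrow> (('o, 'v) arr list \<Rightarrow> ('o, 'w) arr \<Rightarrow> ('o, 'v) arr list \<Rightarrow> 'u) \<Rightarrow>
   ('o, 'v) arr list \<Rightarrow> ('o, 'w) arr \<Rightarrow> ('o, 'v) arr list \<Rightarrow> ('o, 'u) arr" where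
  "bres e F as p bs =
     Arr (if as = [] then src p else src (hd as)) (if bs = [] then tgt p else tgt (last bs))
         (sd as + deg p + sd bs + e) (F as p bs)"

definition belems ::
  "('k, 'o, 'v, 'z) ainf_scheme \<Rightarrow> ('k, 'o, 'v, 'w) bimod \<Rightarrow> ('o, 'w) arr set" where
  "belems C P = {p. src p \<in> Obj C \<and> tgt p \<in> Obj C \<and> vec p \<in> bsp P (src p) (tgt p) (deg p)}"

definition bar ::
  "('k, 'o, 'v, 'z) ainf_scheme \<Rightarrow> ('k, 'o, 'v, 'w) bimod \<Rightarrow>
   ('o, 'v) arr list \<Rightarrow> ('o, 'w) arr \<Rightarrow> ('o, 'v) arr list \<Rightarrow> bool" where
  "bar C P as p bs \<longleftrightarrow> p \<in> belems C P \<and> (\<exists>X. path C X as (src p)) \<and> (\<exists>Y. path C (tgt p) bs Y)"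

text \<open>Pre-morphisms of degree \<open>e\<close>: families of multilinear maps.\<close>

definition premor ::
  "('k, 'o, 'v::ab_group_add, 'z) ainf_scheme \<Rightarrow> ('k, 'o, 'v, 'w::ab_group_add) bimod \<Rightarrow>
   ('k, 'o, 'v, 'u::ab_group_add) bimod \<Rightarrow> int \<Rightarrow>
   (('o, 'v) arr list \<Rightarrow> ('o, 'w) arr \<Rightarrow> ('o, 'v) arr list \<Rightarrow> 'u) \<Rightarrow> bool" where
  "premor C P Q e F \<longleftrightarrow>
     (\<forall>as p bs. bar C P as p bs \<longrightarrow> bres e F as p bs \<in> belems C Q) \<and>
     (\<forall>as X Y i v w c bs. bar C P as (Arr X Y i v) bs \<and> bar C P as (Arr X Y i w) bs \<longrightarrow>
        F as (Arr X Y i (bscl P c v + w)) bs =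
          bscl Q c (F as (Arr X Y i v) bs) + F as (Arr X Y i w) bs) \<and>
     (\<forall>as as' X Y i v w c p bs.
        bar C P (as @ Arr X Y i v # as') p bs \<and> bar C P (as @ Arr X Y i w # as') p bs \<longrightarrow>
        F (as @ Arr X Y i (scl C c v + w) # as') p bs =
          bscl Q c (F (as @ Arr X Y i v # as') p bs) + F (as @ Arr X Y i w # as') p bs) \<and>
     (\<forall>as X Y i v w c p bs bs'.
        bar C P as p (bs @ Arr X Y i v # bs') \<and> bar C P as p (bs @ Arr X Y i w # bs') \<longrightarrow>
        F as p (bs @ Arr X Y i (scl C c v + w) # bs') =
          bscl Q c (F as p (bs @ Arr X Y i v # bs')) + F as p (bs @ Arr X Y i w # bs'))"

text \<open>\<open>bcomp sc G e F\<close> is the sum of all \<open>\<plusminus>G(a,\<dots>,F(a,\<dots>,p,\<dots>,b),\<dots>,b)\<close>, where \<open>F\<close> has degree \<open>e\<close>;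
  \<open>bins C sc G\<close> is the sum of all insertions of an \<open>m\<^sup>n\<close> among the \<open>a\<close>'s or among the \<open>b\<close>'s.\<close>

definition bcomp ::
  "('k::ring_1 \<Rightarrow> 'u \<Rightarrow> 'u::comm_monoid_add) \<Rightarrow>
   (('o, 'v) arr list \<Rightarrow> ('o, 'x) arr \<Rightarrow> ('o, 'v) arr list \<Rightarrow> 'u) \<Rightarrow> int \<Rightarrow>
   (('o, 'v) arr list \<Rightarrow> ('o, 'w) arr \<Rightarrow> ('o, 'v) arr list \<Rightarrow> 'x) \<Rightarrow>
   ('o, 'v) arr list \<Rightarrow> ('o, 'w) arr \<Rightarrow> ('o, 'v) arr list \<Rightarrow> 'u" where
  "bcomp sc G e F as p bs =
     (\<Sum>i\<le>length as. \<Sum>j\<le>length bs. sc (ksign (e * sd (take i as)))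
        (G (take i as) (bres e F (drop i as) p (take j bs)) (drop j bs)))"

definition bins ::
  "('k::ring_1, 'o, 'v, 'z) ainf_scheme \<Rightarrow> ('k \<Rightarrow> 'u \<Rightarrow> 'u::comm_monoid_add) \<Rightarrow>
   (('o, 'v) arr list \<Rightarrow> ('o, 'w) arr \<Rightarrow> ('o, 'v) arr list \<Rightarrow> 'u) \<Rightarrow>
   ('o, 'v) arr list \<Rightarrow> ('o, 'w) arr \<Rightarrow> ('o, 'v) arr list \<Rightarrow> 'u" where
  "bins C sc G as p bs =
     (\<Sum>j\<le>length as. \<Sum>i<j. sc (ksign (sd (take i as)))
        (G (take i as @ mres C (slice i j as) # drop j as) p bs)) +
     (\<Sum>j\<le>length bs. \<Sum>i<j. sc (ksign (sd as + deg p + sd (take i bs)))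
        (G as p (take i bs @ mres C (slice i j bs) # drop j bs)))"

definition ainf_bimodule ::
  "('k::field_char_0, 'o, 'v::ab_group_add, 'z) ainf_scheme \<Rightarrow>
   ('k, 'o, 'v, 'w::ab_group_add) bimod \<Rightarrow> bool" where
  "ainf_bimodule C P \<longleftrightarrow>
     vector_space (bscl P) \<and>
     (\<forall>X\<in>Obj C. \<forall>Y\<in>Obj C. \<forall>i. module.subspace (bscl P) (bsp P X Y i)) \<and>
     premor C P P 1 (bop P) \<and>
     (\<forall>as p bs. bar C P as p bs \<longrightarrow>
        bcomp (bscl P) (bop P) 1 (bop P) as p bs + bins C (bscl P) (bop P) as p bs = 0)"

definition bimod_morphism ::
  "('k::field_char_0, 'o, 'v::ab_group_add, 'z) ainf_scheme \<Rightarrow>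
   ('k, 'o, 'v, 'w::ab_group_add) bimod \<Rightarrow> ('k, 'o, 'v, 'u::ab_group_add) bimod \<Rightarrow>
   (('o, 'v) arr list \<Rightarrow> ('o, 'w) arr \<Rightarrow> ('o, 'v) arr list \<Rightarrow> 'u) \<Rightarrow> bool" where
  "bimod_morphism C P Q F \<longleftrightarrow>
     premor C P Q 0 F \<and>
     (\<forall>as p bs. bar C P as p bs \<longrightarrow>
        bcomp (bscl Q) (bop Q) 0 F as p bs =
          bcomp (bscl Q) F 1 (bop P) as p bs + bins C (bscl Q) F as p bs)"

text \<open>\<open>R \<simeq> id\<close> for an endomorphism \<open>R\<close> of \<open>P\<close>, via a homotopy of degree \<open>-1\<close>.\<close>

definition homotopic_to_id ::
  "('k::field_char_0, 'o, 'v::ab_group_add, 'z) ainf_scheme \<Rightarrow>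
   ('k, 'o, 'v, 'w::ab_group_add) bimod \<Rightarrow>
   (('o, 'v) arr list \<Rightarrow> ('o, 'w) arr \<Rightarrow> ('o, 'v) arr list \<Rightarrow> 'w) \<Rightarrow> bool" where
  "homotopic_to_id C P R \<longleftrightarrow>
     (\<exists>H. premor C P P (- 1) H \<and>
        (\<forall>as p bs. bar C P as p bs \<longrightarrow>
           R as p bs - (if as = [] \<and> bs = [] then vec p else 0) =
             bcomp (bscl P) (bop P) (- 1) H as p bs + bcomp (bscl P) H 1 (bop P) as p bs
             + bins C (bscl P) H as p bs))"

text \<open>The diagonal bimodule, in the shifted degree, so that its operations are the \<open>m\<^sup>n\<close>.\<close>

definition diag_bimod :: "('k, 'o, 'v, 'z) ainf_scheme \<Rightarrow> ('k, 'o, 'v, 'v) bimod" where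
  "diag_bimod C = \<lparr> bscl = scl C, bsp = (\<lambda>X Y e. Hom C X Y (e + 1)),
     bop = (\<lambda>as p bs. mop C (as @ Arr (src p) (tgt p) (deg p + 1) (vec p) # bs)) \<rparr>"

definition hbasis ::
  "('k::field, 'o, 'v::ab_group_add, 'z) ainf_scheme \<Rightarrow> 'o \<Rightarrow> 'o \<Rightarrow> int \<Rightarrow> 'v set" where
  "hbasis C X Y i =
     (SOME B. \<not> module.dependent (scl C) B \<and> module.span (scl C) B = Hom C X Y i)"

definition coord ::
  "('k::field, 'o, 'v::ab_group_add, 'z) ainf_scheme \<Rightarrow> ('o, 'v) arr \<Rightarrow> 'v \<Rightarrow> 'k" where
  "coord C a = module.representation (scl C) (hbasis C (src a) (tgt a) (deg a)) (vec a)"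

text \<open>The tensor \<open>p \<otimes> q\<close> in the \<open>i\<close>-th summand of \<open>\<Oplus>\<^sub>i Hom(X,K\<^sub>i) \<otimes> Hom(L\<^sub>i,Y)\<close>, in coordinates.\<close>

definition tns ::
  "('k::field, 'o, 'v::ab_group_add, 'z) ainf_scheme \<Rightarrow> nat \<Rightarrow> ('o, 'v) arr \<Rightarrow> ('o, 'v) arr \<Rightarrow>
   nat \<times> ('o, 'v) arr \<times> ('o, 'v) arr \<Rightarrow> 'k" where
  "tns C i p q = (\<lambda>(i', b, c).
     if i' = i \<and> (src b, tgt b, deg b) = (src p, tgt p, deg p) \<and>
        (src c, tgt c, deg c) = (src q, tgt q, deg q)
     then coord C p (vec b) * coord C q (vec c) else 0)"

text \<open>The Yoneda bimodule \<open>Hom(_,K) \<otimes> Hom(L,_)\<close>, shifted by \<open>s\<close> (the shift symbol is placed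
  between the two tensor factors).\<close>

definition yoneda_op ::
  "('k::field, 'o, 'v::ab_group_add, 'z) ainf_scheme \<Rightarrow> nat \<Rightarrow> int \<Rightarrow> ('o, 'v) arr list \<Rightarrow>
   ('o, 'v) arr \<Rightarrow> ('o, 'v) arr \<Rightarrow> ('o, 'v) arr list \<Rightarrow>
   nat \<times> ('o, 'v) arr \<times> ('o, 'v) arr \<Rightarrow> 'k" where
  "yoneda_op C i s as p q bs =
     (if bs = [] then tns C i (mres C (as @ [p])) q else 0) +
     (if as = [] then smul (ksign (sdeg p + s)) (tns C i p (mres C (q # bs))) else 0)"

text \<open>A finite twisted complex (iterated cone) of shifted Yoneda bimodules: a bimodule structure
  on their direct sum that is triangular with the Yoneda structures on the diagonal.\<close>

definition twisted_yoneda ::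
  "('k::field_char_0, 'o, 'v::ab_group_add, 'z) ainf_scheme \<Rightarrow> nat \<Rightarrow> (nat \<Rightarrow> 'o) \<Rightarrow> (nat \<Rightarrow> 'o) \<Rightarrow>
   (nat \<Rightarrow> int) \<Rightarrow> ('k, 'o, 'v, nat \<times> ('o, 'v) arr \<times> ('o, 'v) arr \<Rightarrow> 'k) bimod \<Rightarrow> bool" where
  "twisted_yoneda C n K L s P \<longleftrightarrow>
     (\<forall>i<n. K i \<in> Obj C \<and> L i \<in> Obj C) \<and>
     ainf_bimodule C P \<and> bscl P = smul \<and>
     (\<forall>X\<in>Obj C. \<forall>Y\<in>Obj C. \<forall>e. bsp P X Y e =
        fspan {tns C i p q | i p q. i < n \<and> p \<in> arrows C \<and> q \<in> arrows C \<and>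
          src p = X \<and> tgt p = K i \<and> src q = L i \<and> tgt q = Y \<and> sdeg p + sdeg q + s i = e}) \<and>
     (\<forall>i<n. \<forall>p\<in>arrows C. \<forall>q\<in>arrows C. \<forall>X as bs Y.
        tgt p = K i \<and> src q = L i \<and> path C X as (src p) \<and> path C (tgt q) bs Y \<longrightarrow>
        bop P as (Arr (src p) (tgt q) (sdeg p + sdeg q + s i) (tns C i p q)) bs
          - yoneda_op C i (s i) as p q bs
        \<in> fspan {tns C j p' q' | j p' q'. j < i \<and> p' \<in> arrows C \<and> q' \<in> arrows C \<and>
             src p' = X \<and> tgt p' = K j \<and> src q' = L j \<and> tgt q' = Y})"

text \<open>Perfect: a direct summand, in the homotopy category, of such a twisted complex.\<close>

definition perfect_bimod ::
  "('k::field_char_0, 'o, 'v::ab_group_add, 'z) ainf_scheme \<Rightarrow>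
   ('k, 'o, 'v, 'w::ab_group_add) bimod \<Rightarrow> bool" where
  "perfect_bimod C Q \<longleftrightarrow>
     (\<exists>n K L s P F G. twisted_yoneda C n K L s P \<and>
        bimod_morphism C Q P F \<and> bimod_morphism C P Q G \<and>
        homotopic_to_id C Q (bcomp (bscl Q) G 0 F))"

definition smooth :: "('k::field_char_0, 'o, 'v::ab_group_add, 'z) ainf_scheme \<Rightarrow> bool" where
  "smooth C \<longleftrightarrow> perfect_bimod C (diag_bimod C)"


section \<open>Hochschild chains\<close>

text \<open>A list \<open>[a\<^sub>0,\<dots>,a\<^sub>p]\<close> stands for \<open>a\<^sub>0[a\<^sub>1|\<dots>|a\<^sub>p]\<close>. The complex \<open>CH\<^sub>*(C)\<close> consists of the finite
  formal combinations of cyclically composable lists, modulo the span of \<open>hrel C\<close>.\<close>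

definition hochs :: "('k, 'o, 'v, 'z) ainf_scheme \<Rightarrow> ('o, 'v) arr list set" where
  "hochs C = {as. as \<noteq> [] \<and> path C (src (hd as)) as (src (hd as))}"

definition hdeg :: "('o, 'v) arr list \<Rightarrow> int" where
  "hdeg as = - (sd as + 1)"

definition hrel ::
  "('k::field, 'o, 'v::ab_group_add, 'z) ainf_scheme \<Rightarrow> (('o, 'v) arr list \<Rightarrow> 'k) set" where
  "hrel C =
     {sgl (as @ Arr X Y i (scl C c v + w) # bs)
        - smul c (sgl (as @ Arr X Y i v # bs)) - sgl (as @ Arr X Y i w # bs)
      | as X Y i c v w bs. as @ Arr X Y i v # bs \<in> hochs C \<and> as @ Arr X Y i w # bs \<in> hochs C} \<union>
     {sgl (a # as @ unit_arr C X # bs) | a as X bs. a # as @ unit_arr C X # bs \<in> hochs C}"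

definition hoch_d ::
  "('k::field, 'o, 'v, 'z) ainf_scheme \<Rightarrow> ('o, 'v) arr list \<Rightarrow> ('o, 'v) arr list \<Rightarrow> 'k" where
  "hoch_d C as =
     (\<Sum>j\<le>length as. \<Sum>i\<in>{1..<j}. smul (ksign (sd (take i as)))
        (sgl (take i as @ mres C (slice i j as) # drop j as))) +
     (\<Sum>j\<le>length as. \<Sum>i<j. smul (ksign (sd (drop j as) * sd (take j as)))
        (sgl (mres C (drop j as @ take (Suc i) as) # slice (Suc i) j as)))"

definition connes_B ::
  "('k::field, 'o, 'v, 'z) ainf_scheme \<Rightarrow> ('o, 'v) arr list \<Rightarrow> ('o, 'v) arr list \<Rightarrow> 'k" where
  "connes_B C as =
     (\<Sum>i<length as. smul (ksign (sd (drop i as) * sd (take i as)))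
        (sgl (unit_arr C (src (as ! i)) # drop i as @ take i as)))"

text \<open>Supertrace of a homogeneous endomorphism \<open>T\<close> of the graded space \<open>Hom(X,Y)\<close>; it is \<open>0\<close>
  unless \<open>T\<close> has degree 0.\<close>

definition strace ::
  "('k::field, 'o, 'v::ab_group_add, 'z) ainf_scheme \<Rightarrow> 'o \<Rightarrow> 'o \<Rightarrow>
   (('o, 'v) arr \<Rightarrow> ('o, 'v) arr) \<Rightarrow> 'k" where
  "strace C X Y T =
     (\<Sum>i | Hom C X Y i \<noteq> {0}. \<Sum>b\<in>hbasis C X Y i.
        if deg (T (Arr X Y i b)) = i then ksign i * coord C (T (Arr X Y i b)) b else 0)"

text \<open>The Koszul sign is that of
  \<open>(a\<^sub>0,\<dots>,a\<^sub>p,b\<^sub>0,\<dots>,b\<^sub>q)\<close> being cyclically rotated to \<open>A\<^sub>1 A\<^sub>2 B\<^sub>1 B\<^sub>2\<close>, of the inner \<open>m\<close> passing \<open>A\<^sub>1\<close>,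
  and of \<open>c\<close> passing \<open>A\<^sub>1 A\<^sub>2\<close>. With it, for \<open>n\<close> the homological degree of \<open>x\<close>,
  \<open>\<langle>d\<^sub>H\<^sub>o\<^sub>c\<^sub>h x,y\<rangle> = (-1)\<^sup>n \<langle>x,d\<^sub>H\<^sub>o\<^sub>c\<^sub>h y\<rangle>\<close> and \<open>\<langle>Bx,y\<rangle> = -(-1)\<^sup>n \<langle>x,By\<rangle>\<close>.\<close>

definition mukai ::
  "('k::field, 'o, 'v::ab_group_add, 'z) ainf_scheme \<Rightarrow> ('o, 'v) arr list \<Rightarrow> ('o, 'v) arr list \<Rightarrow> 'k"
  where
  "mukai C as bs =
     (\<Sum>j\<le>length as. \<Sum>i<j. \<Sum>l\<le>length bs. \<Sum>t<l.
        (let A1 = drop j as @ take (Suc i) as; A2 = slice (Suc i) j as;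
             B1 = drop l bs @ take (Suc t) bs; B2 = slice (Suc t) l bs
         in ksign (sd (drop j as) * sd (take j as) + sd (drop l bs) * sd (take l bs) + sd A1) *
            strace C (src (hd A1)) (src (hd B1))
              (\<lambda>c. let r = mres C (A1 @ mres C (A2 @ c # B1) # B2)
                   in Arr (src r) (tgt r) (deg r) (scl C (ksign (sdeg c * sd as)) (vec r)))))"

definition mukai_l ::
  "('k::field, 'o, 'v::ab_group_add, 'z) ainf_scheme \<Rightarrow> (('o, 'v) arr list \<Rightarrow> 'k) \<Rightarrow>
   ('o, 'v) arr list \<Rightarrow> 'k" where
  "mukai_l C x bs = (\<Sum>as | x as \<noteq> 0. x as * mukai C as bs)"

text \<open>Elements \<open>\<Sum>\<^sub>i h\<^sub>i u\<^sup>i\<close> of \<open>CH\<^sub>*(C)[[u]]\<close> of homological degree \<open>n\<close>, where \<open>u\<close> has degree \<open>-2\<close>;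
  the differential \<open>d\<^sub>H\<^sub>o\<^sub>c\<^sub>h + uB\<close>; equality in \<open>CH\<^sub>*(C)[[u]]\<close>.\<close>

definition neg_chain ::
  "('k::field, 'o, 'v, 'z) ainf_scheme \<Rightarrow> int \<Rightarrow> (nat \<Rightarrow> ('o, 'v) arr list \<Rightarrow> 'k) \<Rightarrow> bool" where
  "neg_chain C n h \<longleftrightarrow>
     (\<forall>i. finite {as. h i as \<noteq> 0} \<and>
        (\<forall>as. h i as \<noteq> 0 \<longrightarrow> as \<in> hochs C \<and> hdeg as - 2 * int i = n))"

definition neg_d ::
  "('k::field, 'o, 'v, 'z) ainf_scheme \<Rightarrow> (nat \<Rightarrow> ('o, 'v) arr list \<Rightarrow> 'k) \<Rightarrow>
   nat \<Rightarrow> ('o, 'v) arr list \<Rightarrow> 'k" where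
  "neg_d C h = (\<lambda>i. lext (hoch_d C) (h i) + (if i = 0 then 0 else lext (connes_B C) (h (i - 1))))"

definition neg_eq ::
  "('k::field, 'o, 'v::ab_group_add, 'z) ainf_scheme \<Rightarrow> (nat \<Rightarrow> ('o, 'v) arr list \<Rightarrow> 'k) \<Rightarrow>
   (nat \<Rightarrow> ('o, 'v) arr list \<Rightarrow> 'k) \<Rightarrow> bool" where
  "neg_eq C h h' \<longleftrightarrow> (\<forall>i. h i - h' i \<in> fspan (hrel C))"

definition chern ::
  "('k::field, 'o, 'v, 'z) ainf_scheme \<Rightarrow> 'o \<Rightarrow> nat \<Rightarrow> ('o, 'v) arr list \<Rightarrow> 'k" where
  "chern C X = (\<lambda>i. if i = 0 then sgl [unit_arr C X] else 0)"


section \<open>BD algebras over \<open>k[[\<gamma>]]\<close>\<close>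

text \<open>
  The data of a BD algebra is given by homogeneous monomials that span it topologically over
  \<open>k[[\<gamma>]]\<close>, and by the operations on monomials, with values in finite combinations of \<open>\<gamma>\<^sup>g m\<close>,
  encoded as functions on pairs \<open>(g, m)\<close>. Monomials are sorted into blocks: an element is a family
  \<open>f(g, m)\<close> having, for each \<open>g\<close> and each block, only finitely many nonzero coefficients. Two such
  families are the same element iff in each \<open>g\<close> and each block they differ by an element of
  the span of the relations, i.e. the algebra is the product over all \<open>g\<close> and all blocks of
  (free vector space on the block) / (relations).
\<close>

record ('k, 'm, 'b) bd =
  mons :: "'m set"
  mdeg :: "'m \<Rightarrow> int"
  blk :: "'m \<Rightarrow> 'b"
  mlt :: "'m \<Rightarrow> 'm \<Rightarrow> 'm \<Rightarrow> 'k"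
  dif :: "'m \<Rightarrow> nat \<times> 'm \<Rightarrow> 'k"
  brk :: "'m \<Rightarrow> 'm \<Rightarrow> nat \<times> 'm \<Rightarrow> 'k"
  rels :: "('m \<Rightarrow> 'k) set"

definition bd_elem :: "('k::field, 'm, 'b) bd \<Rightarrow> (nat \<times> 'm \<Rightarrow> 'k) \<Rightarrow> bool" where
  "bd_elem A f \<longleftrightarrow>
     (\<forall>g m. f (g, m) \<noteq> 0 \<longrightarrow> m \<in> mons A) \<and>
     (\<forall>g \<beta>. finite {m. f (g, m) \<noteq> 0 \<and> blk A m = \<beta>})"

text \<open>Degree \<open>n\<close> in an \<open>r\<close>-twisted algebra, where \<open>\<gamma>\<close> has degree \<open>1 - r\<close>.\<close>

definition bd_homog :: "int \<Rightarrow> ('k::field, 'm, 'b) bd \<Rightarrow> int \<Rightarrow> (nat \<times> 'm \<Rightarrow> 'k) \<Rightarrow> bool" where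
  "bd_homog r A n f \<longleftrightarrow> (\<forall>g m. f (g, m) \<noteq> 0 \<longrightarrow> mdeg A m + int g * (1 - r) = n)"

definition bd_eq :: "('k::field, 'm, 'b) bd \<Rightarrow> (nat \<times> 'm \<Rightarrow> 'k) \<Rightarrow> (nat \<times> 'm \<Rightarrow> 'k) \<Rightarrow> bool" where
  "bd_eq A f f' \<longleftrightarrow>
     (\<forall>g \<beta>. (\<lambda>m. if blk A m = \<beta> then f (g, m) - f' (g, m) else 0) \<in> fspan (rels A))"

definition bd_D :: "('k::field, 'm, 'b) bd \<Rightarrow> (nat \<times> 'm \<Rightarrow> 'k) \<Rightarrow> nat \<times> 'm \<Rightarrow> 'k" where
  "bd_D A f = (\<lambda>(g, m).
     \<Sum>(h, n) | h \<le> g \<and> f (h, n) * dif A n (g - h, m) \<noteq> 0. f (h, n) * dif A n (g - h, m))"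

definition bd_br ::
  "('k::field, 'm, 'b) bd \<Rightarrow> (nat \<times> 'm \<Rightarrow> 'k) \<Rightarrow> (nat \<times> 'm \<Rightarrow> 'k) \<Rightarrow> nat \<times> 'm \<Rightarrow> 'k" where
  "bd_br A f f' = (\<lambda>(g, m).
     \<Sum>((h, n), (h', n')) | h + h' \<le> g \<and> f (h, n) * f' (h', n') * brk A n n' (g - h - h', m) \<noteq> 0.
       f (h, n) * f' (h', n') * brk A n n' (g - h - h', m))"

definition MCE :: "int \<Rightarrow> ('k::field, 'm, 'b) bd \<Rightarrow> (nat \<times> 'm \<Rightarrow> 'k) set" where
  "MCE r A = {S. bd_elem A S \<and> bd_homog r A (1 - r) S \<and>
                 bd_eq A (bd_D A S + smul (1 / 2) (bd_br A S S)) 0}"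

definition tensor_bd ::
  "int \<Rightarrow> ('k::field, 'm, 'b) bd \<Rightarrow> ('k, 'n, 'c) bd \<Rightarrow> ('k, 'm \<times> 'n, 'b \<times> 'c) bd" where
  "tensor_bd r A B = \<lparr>
     mons = mons A \<times> mons B,
     mdeg = (\<lambda>(a, b). mdeg A a + mdeg B b),
     blk = (\<lambda>(a, b). (blk A a, blk B b)),
     mlt = (\<lambda>(a1, b1) (a2, b2) (x, y).
        ksign (mdeg B b1 * mdeg A a2) * (mlt A a1 a2 x * mlt B b1 b2 y)),
     dif = (\<lambda>(a, b) (g, x, y).
        dif A a (g, x) * sgl b y + ksign (mdeg A a) * (sgl a x * dif B b (g, y))),
     brk = (\<lambda>(a1, b1) (a2, b2) (g, x, y).
        ksign (mdeg A a2 * (mdeg B b1 + r)) * (mlt A a1 a2 x * brk B b1 b2 (g, y)) +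
        ksign (mdeg B b1 * (mdeg A a2 + r)) * (brk A a1 a2 (g, x) * mlt B b1 b2 y)),
     rels = {(\<lambda>(x, y). \<rho> x * sgl b y) | \<rho> b. \<rho> \<in> rels A \<and> b \<in> mons B} \<union>
            {(\<lambda>(x, y). sgl a x * \<rho> y) | a \<rho>. a \<in> mons A \<and> \<rho> \<in> rels B} \<rparr>"


subsection \<open>BD structures on symmetric algebras\<close>

definition ldeg :: "('g \<Rightarrow> int) \<Rightarrow> 'g list \<Rightarrow> int" where
  "ldeg gd xs = sum_list (map gd xs)"

text \<open>The derivation of degree 1 with value \<open>\<theta> x\<close> on a generator \<open>x\<close>.\<close>

definition der1 :: "('g \<Rightarrow> int) \<Rightarrow> ('g \<Rightarrow> 'g list \<Rightarrow> 'k) \<Rightarrow> 'g list \<Rightarrow> 'g list \<Rightarrow> 'k::field" where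
  "der1 gd \<theta> xs = (\<Sum>i<length xs. smul (ksign (ldeg gd (take i xs)))
      (lext (\<lambda>ys. sgl (take i xs @ ys @ drop (Suc i) xs)) (\<theta> (xs ! i))))"

text \<open>The contribution \<open>\<plusminus>\<Delta>(x\<^sub>i x\<^sub>j)\<cdot>x\<^sub>1\<cdots>\<close> (with \<open>x\<^sub>i\<close>, \<open>x\<^sub>j\<close> omitted) of positions \<open>i < j\<close> to the second
  order operator \<open>\<Delta>\<close> that vanishes on \<open>Sym\<^sup>\<le>\<^sup>1\<close> and has value \<open>\<delta> x y\<close> on \<open>x\<cdot>y\<close>.\<close>

definition contr ::
  "('g \<Rightarrow> int) \<Rightarrow> ('g \<Rightarrow> 'g \<Rightarrow> 'g list \<Rightarrow> 'k) \<Rightarrow> 'g list \<Rightarrow> nat \<Rightarrow> nat \<Rightarrow> 'g list \<Rightarrow> 'k::field" where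
  "contr gd \<delta> xs i j =
     smul (ksign (gd (xs ! i) * ldeg gd (take i xs)
                  + gd (xs ! j) * (ldeg gd (take j xs) - gd (xs ! i))))
      (lext (\<lambda>ys. sgl (ys @ take i xs @ slice (Suc i) j xs @ drop (Suc j) xs))
            (\<delta> (xs ! i) (xs ! j)))"

text \<open>\<open>Sym(V)[[\<gamma>]]\<close> with differential \<open>\<theta> + \<gamma>\<Delta>\<close>, where \<open>V\<close> is spanned by \<open>G\<close> with relations \<open>R\<close>;
  a list is the product of its entries. The bracket is the one determined by
  \<open>D(ab) = D(a)b + (-1)\<^bsup>|a|\<^esup>aD(b) + (-1)\<^bsup>|a|\<^esup>\<gamma>{a,b}\<close>: it collects the terms of \<open>\<Delta>(ab)\<close> contracting a
  factor of \<open>a\<close> with a factor of \<open>b\<close>.\<close>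

definition sym_bd ::
  "'g set \<Rightarrow> ('g \<Rightarrow> int) \<Rightarrow> ('g list \<Rightarrow> 'b) \<Rightarrow> ('g \<Rightarrow> 'k) set \<Rightarrow> ('g \<Rightarrow> 'g list \<Rightarrow> 'k) \<Rightarrow>
   ('g \<Rightarrow> 'g \<Rightarrow> 'g list \<Rightarrow> 'k) \<Rightarrow> ('k::field, 'g list, 'b) bd" where
  "sym_bd G gd bl R \<theta> \<delta> = \<lparr>
     mons = lists G,
     mdeg = ldeg gd,
     blk = bl,
     mlt = (\<lambda>xs ys. sgl (xs @ ys)),
     dif = (\<lambda>xs (g, zs).
        if g = 0 then der1 gd \<theta> xs zs
        else if g = 1 then (\<Sum>j<length xs. \<Sum>i<j. contr gd \<delta> xs i j) zs
        else 0),
     brk = (\<lambda>xs ys (g, zs).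
        if g = 0 then ksign (ldeg gd xs) *
          (\<Sum>i<length xs. \<Sum>j<length ys. contr gd \<delta> (xs @ ys) i (length xs + j)) zs
        else 0),
     rels = {sgl (us @ x # y # vs) - smul (ksign (gd x * gd y)) (sgl (us @ y # x # vs))
              | us x y vs. us \<in> lists G \<and> x \<in> G \<and> y \<in> G \<and> vs \<in> lists G} \<union>
            {lext (\<lambda>x. sgl (us @ x # vs)) \<rho>
              | us \<rho> vs. us \<in> lists G \<and> \<rho> \<in> R \<and> vs \<in> lists G} \<rparr>"


section \<open>The closed BD algebra\<close>

text \<open>The generator \<open>(as, i)\<close> is \<open>as\<cdot>u\<^sup>-\<^sup>i\<close>. \<open>Sym(\<H>)\<close> is not completed, so there is only one block.\<close>

definition cgdeg :: "int \<Rightarrow> ('o, 'v) arr list \<times> nat \<Rightarrow> int" where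
  "cgdeg d = (\<lambda>(as, i). 2 - d - hdeg as - 2 * int i)"

definition closed_theta ::
  "('k::field, 'o, 'v, 'z) ainf_scheme \<Rightarrow> ('o, 'v) arr list \<times> nat \<Rightarrow>
   (('o, 'v) arr list \<times> nat) list \<Rightarrow> 'k" where
  "closed_theta C = (\<lambda>(as, i).
     lext (\<lambda>bs. sgl [(bs, i)]) (hoch_d C as) +
     (if i = 0 then 0 else lext (\<lambda>bs. sgl [(bs, i - 1)]) (connes_B C as)))"

text \<open>\<open>\<Delta>\<^sub>c(x\<cdot>y) = \<plusminus>\<langle>Bx\<^sub>0, y\<^sub>0\<rangle>\<close>; the sign is the one for which the right hand side is graded symmetric
  in \<open>x, y\<close> and compatible with \<open>d\<^sub>H\<^sub>o\<^sub>c\<^sub>h\<close> (it is unique up to a constant).\<close>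

definition closed_delta ::
  "int \<Rightarrow> ('k::field, 'o, 'v::ab_group_add, 'z) ainf_scheme \<Rightarrow> ('o, 'v) arr list \<times> nat \<Rightarrow>
   ('o, 'v) arr list \<times> nat \<Rightarrow> (('o, 'v) arr list \<times> nat) list \<Rightarrow> 'k" where
  "closed_delta d C = (\<lambda>(as, i) (bs, j).
     if i = 0 \<and> j = 0
     then smul (ksign ((d + 1) * hdeg as) * mukai_l C (connes_B C as) bs) (sgl [])
     else 0)"

definition Fc ::
  "int \<Rightarrow> ('k::field, 'o, 'v::ab_group_add, 'z) ainf_scheme \<Rightarrow>
   ('k, (('o, 'v) arr list \<times> nat) list, unit) bd" where
  "Fc d C = sym_bd (hochs C \<times> UNIV) (cgdeg d) (\<lambda>_. ())
     {(\<lambda>(as, j). \<rho> as * sgl i j) | \<rho> i. \<rho> \<in> hrel C} (closed_theta C) (closed_delta d C)"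


section \<open>The open BD algebra\<close>

text \<open>\<open>Lett n \<phi>\<close> is a letter of degree \<open>n\<close>: a linear functional on \<open>(End(\<lambda>)[1])\<^sup>-\<^sup>n = End(\<lambda>)\<^sup>1\<^sup>-\<^sup>n\<close>. Only the
  values of \<open>\<phi>\<close> on that space matter, which is part of the relations \<open>orel\<close>.\<close>

datatype ('k, 'v) lett = Lett (ltdeg: int) (ltfun: "'v \<Rightarrow> 'k")

definition letters ::
  "('k::field, 'o, 'v::ab_group_add, 'z) ainf_scheme \<Rightarrow> 'o \<Rightarrow> ('k, 'v) lett set" where
  "letters C X = {l. \<forall>v\<in>Hom C X X (1 - ltdeg l). \<forall>w\<in>Hom C X X (1 - ltdeg l). \<forall>c.
     ltfun l (scl C c v + w) = c * ltfun l v + ltfun l w}"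

definition wd :: "('k, 'v) lett list \<Rightarrow> int" where
  "wd ws = sum_list (map ltdeg ws)"

definition orel ::
  "('k::field, 'o, 'v::ab_group_add, 'z) ainf_scheme \<Rightarrow> 'o \<Rightarrow> (('k, 'v) lett list \<Rightarrow> 'k) set" where
  "orel C X =
     {sgl (us @ Lett n \<phi> # vs) - smul c (sgl (us @ Lett n \<psi> # vs)) - sgl (us @ Lett n \<chi> # vs)
      | us n \<phi> c \<psi> \<chi> vs. us \<in> lists (letters C X) \<and> vs \<in> lists (letters C X) \<and>
          {Lett n \<phi>, Lett n \<psi>, Lett n \<chi>} \<subseteq> letters C X \<and>
          (\<forall>v\<in>Hom C X X (1 - n). \<phi> v = c * \<psi> v + \<chi> v)} \<union>
     {sgl (x # ws) - smul (ksign (ltdeg x * wd ws)) (sgl (ws @ [x]))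
      | x ws. x \<in> letters C X \<and> ws \<in> lists (letters C X)}"

text \<open>The degree in \<open>\<W>(\<lambda>)[d - 3]\<close>. For the signs, the shift is a symbol of degree \<open>3 - d\<close> in front of
  the word.\<close>

definition ogdeg :: "int \<Rightarrow> ('k, 'v) lett list \<Rightarrow> int" where
  "ogdeg d ws = wd ws + 3 - d"

definition dlett ::
  "('k::field, 'o, 'v, 'z) ainf_scheme \<Rightarrow> 'o \<Rightarrow> ('k, 'v) lett \<Rightarrow> ('k, 'v) lett" where
  "dlett C X l = Lett (ltdeg l + 1)
     (\<lambda>v. - ksign (ltdeg l) * ltfun l (mop C [Arr X X (- ltdeg l) v]))"

text \<open>\<open>\<omega>\<^sup>-\<^sup>1(\<phi>,\<psi>) = \<phi>(x)\<close> where \<open>\<psi> = \<langle>_, x\<rangle>\<close>; in a basis, this is the inverse of the Gram matrix.\<close>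

definition ipair ::
  "('k::field, 'o, 'v, 'z) cyc_ainf_scheme \<Rightarrow> int \<Rightarrow> 'o \<Rightarrow> ('k, 'v) lett \<Rightarrow> ('k, 'v) lett \<Rightarrow> 'k" where
  "ipair C d X l l' =
     (if (1 - ltdeg l) + (1 - ltdeg l') = d
      then ltfun l (THE x. x \<in> Hom C X X (1 - ltdeg l) \<and>
             (\<forall>y\<in>Hom C X X (1 - ltdeg l').
                cpair C (Arr X X (1 - ltdeg l') y) (Arr X X (1 - ltdeg l) x) = ltfun l' y))
      else 0)"

text \<open>With the signs below, the cyclic potential \<open>I\<close> satisfies \<open>dI + \<onehalf>{I,I} = 0\<close> by the
  \<open>A\<^sub>\<infinity>\<close>-relations, and \<open>d\<close> is the bracket with the quadratic potential \<open>\<langle>m\<^sup>1(_),_\<rangle>\<close>.\<close>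

definition open_d ::
  "('k::field, 'o, 'v, 'z) cyc_ainf_scheme \<Rightarrow> int \<Rightarrow> 'o \<Rightarrow> ('k, 'v) lett list \<Rightarrow>
   ('k, 'v) lett list list \<Rightarrow> 'k" where
  "open_d C d X w = (\<Sum>i<length w. smul (ksign (3 - d + wd (take i w)))
     (sgl [take i w @ dlett C X (w ! i) # drop (Suc i) w]))"

definition open_nabla ::
  "('k::field, 'o, 'v, 'z) cyc_ainf_scheme \<Rightarrow> int \<Rightarrow> 'o \<Rightarrow> ('k, 'v) lett list \<Rightarrow>
   ('k, 'v) lett list list \<Rightarrow> 'k" where
  "open_nabla C d X w = (\<Sum>j<length w. \<Sum>i<j.
     let w1 = slice (Suc i) j w; w2 = drop (Suc j) w @ take i w
     in smul (ksign (wd (take i w) * wd (drop i w) + ltdeg (w ! j) * wd w1 + (3 - d) * wd w1) *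
              ipair C d X (w ! i) (w ! j))
          (sgl [w1, w2]))"

definition open_bracket ::
  "('k::field, 'o, 'v, 'z) cyc_ainf_scheme \<Rightarrow> int \<Rightarrow> 'o \<Rightarrow> ('k, 'v) lett list \<Rightarrow>
   ('k, 'v) lett list \<Rightarrow> ('k, 'v) lett list list \<Rightarrow> 'k" where
  "open_bracket C d X x y = (\<Sum>i<length x. \<Sum>j<length y.
     let w1 = drop (Suc i) x @ take i x; w2 = drop (Suc j) y @ take j y
     in smul (ksign (ogdeg d x + wd (take i x) * wd (drop i x) + wd (take j y) * wd (drop j y)
                     + (3 - d) * wd x + ltdeg (y ! j) * wd w1) *
              ipair C d X (x ! i) (y ! j))
          (sgl [w1 @ w2]))"

text \<open>The blocks are indexed by the number of cyclic words and the total number of letters.\<close>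

definition Fo ::
  "int \<Rightarrow> ('k::field, 'o, 'v::ab_group_add, 'z) cyc_ainf_scheme \<Rightarrow> 'o \<Rightarrow>
   ('k, ('k, 'v) lett list list, nat \<times> nat) bd" where
  "Fo d C X = sym_bd (lists (letters C X)) (ogdeg d)
     (\<lambda>ws. (length ws, sum_list (map length ws))) (orel C X)
     (\<lambda>w. open_d C d X w + open_nabla C d X w)
     (\<lambda>x y. smul (ksign (ogdeg d x)) (open_bracket C d X x y))"


section \<open>The open-closed algebra and the Chern character operator\<close>

type_synonym ('k, 'o, 'v) oc_mon = "(('o, 'v) arr list \<times> nat) list \<times> ('k, 'v) lett list list"

definition Foc ::
  "int \<Rightarrow> ('k::field, 'o, 'v::ab_group_add, 'z) cyc_ainf_scheme \<Rightarrow> 'o \<Rightarrow>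
   ('k, ('k, 'o, 'v) oc_mon, unit \<times> nat \<times> nat) bd" where
  "Foc d C X = tensor_bd (2 * d - 5) (Fc d C) (Fo d C X)"

text \<open>\<open>\<langle>h,_\<rangle>\<close> extended as a derivation to \<open>Sym(\<H>)\<close>; for \<open>h\<close> of homological degree \<open>n\<close> it has degree
  \<open>d - 2 - n\<close>.\<close>

definition mukai_der ::
  "int \<Rightarrow> ('k::field, 'o, 'v::ab_group_add, 'z) ainf_scheme \<Rightarrow> int \<Rightarrow>
   (nat \<Rightarrow> ('o, 'v) arr list \<Rightarrow> 'k) \<Rightarrow> (('o, 'v) arr list \<times> nat) list \<Rightarrow>
   (('o, 'v) arr list \<times> nat) list \<Rightarrow> 'k" where
  "mukai_der d C n h cs = (\<Sum>k<length cs. case cs ! k of (as, i) \<Rightarrow>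
     smul (ksign ((d - 2 - n) * ldeg (cgdeg d) (take k cs)) * ((- 1) ^ i * mukai_l C (h i) as))
       (sgl (take k cs @ drop (Suc k) cs)))"

text \<open>\<open>\<nu>\<langle>h,_\<rangle>\<close> on \<open>F\<^sup>c \<otimes> F\<^sup>o\<close>; here \<open>([], [[]])\<close> is \<open>1 \<otimes> \<nu>\<close>.\<close>

definition nu_pair ::
  "int \<Rightarrow> ('k::field, 'o, 'v::ab_group_add, 'z) cyc_ainf_scheme \<Rightarrow> 'o \<Rightarrow> int \<Rightarrow>
   (nat \<Rightarrow> ('o, 'v) arr list \<Rightarrow> 'k) \<Rightarrow> (nat \<times> ('k, 'o, 'v) oc_mon \<Rightarrow> 'k) \<Rightarrow>
   nat \<times> ('k, 'o, 'v) oc_mon \<Rightarrow> 'k" where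
  "nu_pair d C X n h f = (\<lambda>(g, m). lext (\<lambda>(cs, ws).
     lext (\<lambda>cs'. mlt (Foc d C X) ([], [[]]) (cs', ws)) (mukai_der d C n h cs)) (\<lambda>m'. f (g, m')) m)"

text \<open>\<open>e\<^sup>P f\<close>, coefficientwise; for \<open>P = \<nu>\<langle>h,_\<rangle>\<close> only finitely many terms contribute to each coefficient,
  because \<open>P\<close> raises the number of factors \<open>\<nu>\<close>.\<close>

definition exp_op :: "(('m \<Rightarrow> 'k) \<Rightarrow> 'm \<Rightarrow> 'k) \<Rightarrow> ('m \<Rightarrow> 'k) \<Rightarrow> 'm \<Rightarrow> 'k::field_char_0" where
  "exp_op P f = (\<lambda>m. \<Sum>k | (P ^^ k) f m \<noteq> 0. (P ^^ k) f m / fact k)"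


section \<open>The cyclic potential\<close>

text \<open>The value of \<open>\<phi>\<^sub>1 \<otimes> \<dots> \<otimes> \<phi>\<^sub>n\<close> on \<open>a\<^sub>1 \<otimes> \<dots> \<otimes> a\<^sub>n\<close>, with its Koszul sign.\<close>

definition word_eval :: "('k::field, 'v) lett list \<Rightarrow> ('o, 'v) arr list \<Rightarrow> 'k" where
  "word_eval w as =
     ksign (\<Sum>j<length as. \<Sum>i<j. sdeg (as ! i) * sdeg (as ! j)) *
     (\<Prod>i<length as. if ltdeg (w ! i) = - sdeg (as ! i) then ltfun (w ! i) (vec (as ! i)) else 0)"

text \<open>Sum over cyclic rotations of a combination of cyclic words, as a functional.\<close>

definition cyc_sum :: "(('k::field, 'v) lett list \<Rightarrow> 'k) \<Rightarrow> ('o, 'v) arr list \<Rightarrow> 'k" where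
  "cyc_sum f as = (\<Sum>w | length w = length as \<and> f w \<noteq> 0. f w *
     (\<Sum>r<length w. ksign (wd (take r w) * wd (drop r w)) *
        word_eval (drop r w @ take r w) as))"

text \<open>\<open>f\<close> represents \<open>\<Sum>\<^sub>k\<^sub>\<ge>\<^sub>2 \<langle>m\<^sup>k(_,\<dots>,_),_\<rangle>\<close>. The functionals are formed with the shifted pairing, since it is
  these that are cyclically invariant in the shifted degrees. A combination of cyclic words is
  determined by \<open>cyc_sum\<close> in positive length; length 0 is the coefficient of \<open>\<nu>\<close>.\<close>

definition is_cyclic_potential ::
  "('k::field, 'o, 'v, 'z) cyc_ainf_scheme \<Rightarrow> 'o \<Rightarrow> (('k, 'v) lett list \<Rightarrow> 'k) \<Rightarrow> bool" where
  "is_cyclic_potential C X f \<longleftrightarrow> f [] = 0 \<and>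
     (\<forall>as. as \<noteq> [] \<and> path C X as X \<and> (\<forall>a\<in>set as. src a = X \<and> tgt a = X) \<longrightarrow>
        cyc_sum f as =
          (if length as \<ge> 3 then spair C (mres C (butlast as)) (last as) else 0))"

text \<open>Projection to \<open>Sym\<^sup>0(\<H>) \<otimes> Sym\<^sup>1(Cyc\<^sup>*(\<lambda>)[d - 4])\<gamma>\<^sup>0\<close>.\<close>

definition proj_I ::
  "(nat \<times> ('k, 'o, 'v) oc_mon \<Rightarrow> 'k) \<Rightarrow> ('k, 'v) lett list \<Rightarrow> 'k" where
  "proj_I f = (\<lambda>w. f (0, [], [w]))"

end

theory Submission
  imports Defs
begin

text \<open>
  Let \<open>D\<close> be the differential of the open-closed algebra, \<open>P = \<nu>\<langle>h,_\<rangle>\<close> and \<open>Q = \<nu>\<langle>ch(\<lambda>),_\<rangle>\<close>. Modulo the relations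
  \<open>[D,P] = Q\<close>: up to sign, \<open>d\<^sub>H\<^sub>o\<^sub>c\<^sub>h\<close> and \<open>B\<close> are self-adjoint for the Mukai pairing, so that \<open>d\<^sub>o\<^sub>c\<close> contributes
  \<open>\<nu>\<langle>(d\<^sub>H\<^sub>o\<^sub>c\<^sub>h + uB)h,_\<rangle>\<close>, while \<open>\<nabla>\<close> kills \<open>\<nu>\<close> and the second order operators do not contract it. Moreover
  \<open>[P,Q] = 0\<close>, and \<open>P\<close> is a derivation of the bracket. Therefore \<open>D e\<^sup>P = e\<^sup>P (D + Q)\<close> and \<open>e\<^sup>P\<close> preserves the
  bracket, so that \<open>e\<^sup>P\<close> carries the equation for \<open>S\<close> to the Maurer-Cartan equation for \<open>e\<^sup>P S\<close>.

  These identities are identities of kernels on monomials, where \<open>e\<^sup>P\<close> is a finite sum since \<open>P\<close> removes a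
  closed factor. They extend to the completion because every operator lowers the size (number of words
  plus number of letters) of an open monomial by at most a constant.
\<close>

section \<open>Signs and decompositions of lists\<close>

text \<open>The equation for \<open>S\<close> and the primitive \<open>h\<close> are given only
  modulo relations, and this forces two well-definedness statements. The identity
  \<open>(d_Hoch + uB)h = ch\<close> holds in the reduced complex, so the Mukai pairing has to be
  multilinear and to vanish on chains with a unit behind the first place. Moreover
  \<open>e^P\<close> has to map the relations of the tensor product into their span, since it is
  applied to an equation between classes.

  The sign in \<open>[P,Q] = 0\<close> is delicate: removing two closed factors in the two possible
  orders differs by \<open>(-1)^(3-d)\<close>. For even \<open>d\<close> this is -1, but then
  \<open>\<nu>\<close> is odd, and both products vanish because they contain \<open>\<nu>\<close>
  twice.

  The adjointness of \<open>d_Hoch\<close> concerns traces of maps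
  \<open>c \<mapsto> m(.., m(.., c, ..), ..)\<close>. Cyclic words are cut into arcs instead of
  being indexed, so that terms can be matched arc by arc; the letter \<open>c\<close> turns the
  A-infinity relations into identities with a marked argument.\<close>

lemma ksign_add: "ksign (a + b) = (ksign a * ksign b :: 'k::comm_ring_1)"
  by (auto simp: ksign_def)

lemma ksign_0 [simp]: "ksign 0 = 1"
  by (simp add: ksign_def)

lemma ksign_sq [simp]: "ksign a * ksign a = (1::'k::comm_ring_1)"
  by (simp add: ksign_def)

lemma ksign_sq_left [simp]: "ksign a * (ksign a * x) = (x::'k::comm_ring_1)"
  by (simp add: ksign_def)

lemma ksign_eqI: "even (a - b) \<Longrightarrow> ksign a = ksign b"
  by (auto simp: ksign_def)

lemma ksign_nonzero [simp]: "ksign a \<noteq> (0::'k::field)"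
  by (simp add: ksign_def)

lemma sd_simps [simp]:
  "sd [] = 0" "sd (a # as) = sdeg a + sd as" "sd (as @ bs) = sd as + sd bs"
  by (simp_all add: sd_def)

lemma mres_simps [simp]:
  "src (mres C as) = src (hd as)" "tgt (mres C as) = tgt (last as)"
  "deg (mres C as) = sd as + 2" "vec (mres C as) = mop C as" "sdeg (mres C as) = sd as + 1"
  by (simp_all add: mres_def sdeg_def)

lemma unit_arr_simps [simp]:
  "src (unit_arr C X) = X" "tgt (unit_arr C X) = X" "deg (unit_arr C X) = 0"
  "vec (unit_arr C X) = idt C X" "sdeg (unit_arr C X) = - 1"
  by (simp_all add: unit_arr_def sdeg_def)

lemma path_Obj: "path C X as Y \<Longrightarrow> X \<in> Obj C \<and> Y \<in> Obj C"
  by (induction as arbitrary: X) (auto simp: arrows_def)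

lemma path_append:
  "path C X (as @ bs) Z \<longleftrightarrow> (\<exists>Y. path C X as Y \<and> path C Y bs Z)"
  by (induction as arbitrary: X) (use path_Obj in fastforce)+

lemma path_hd: "path C X as Y \<Longrightarrow> as \<noteq> [] \<Longrightarrow> src (hd as) = X"
  by (cases as) auto

lemma path_last: "path C X as Y \<Longrightarrow> as \<noteq> [] \<Longrightarrow> tgt (last as) = Y"
  by (induction as arbitrary: X) (auto split: if_splits)

text \<open>Sums over index ranges are rewritten as sums over decompositions into consecutive,
  possibly empty blocks. Nested sums can then be regrouped by renaming blocks, without arithmetic on
  indices.\<close>

definition D2 :: "'a list \<Rightarrow> ('a list \<times> 'a list) set" where
  "D2 xs = {(p, q). p @ q = xs}"

definition D3 :: "'a list \<Rightarrow> ('a list \<times> 'a list \<times> 'a list) set" where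
  "D3 xs = {(p, m, q). p @ m @ q = xs}"

definition D4 :: "'a list \<Rightarrow> ('a list \<times> 'a list \<times> 'a list \<times> 'a list) set" where
  "D4 xs = {(p, m, n, q). p @ m @ n @ q = xs}"

lemma D2_eq: "D2 xs = (\<lambda>i. (take i xs, drop i xs)) ` {..length xs}"
proof -
  have "(p, q) \<in> (\<lambda>i. (take i (p @ q), drop i (p @ q))) ` {..length (p @ q)}" for p q :: "'a list"
    by (rule image_eqI[of _ _ "length p"]) auto
  then show ?thesis
    by (auto simp: D2_def)
qed

lemma finite_D2 [simp]: "finite (D2 xs)"
  by (simp add: D2_eq)

lemma D3_eq: "D3 xs = (\<lambda>(p, r). (p, r)) ` (SIGMA p : fst ` D2 xs. \<Union>r\<in>snd ` D2 xs. D2 r) \<inter> D3 xs"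
  by (auto simp: D2_def D3_def image_iff)

lemma finite_D3 [simp]: "finite (D3 xs)"
  by (subst D3_eq) auto

text \<open>The middle block is empty for \<open>i = j\<close>. Sums restricted to
  \<open>i < j\<close> or \<open>1 \<le> i\<close> are recovered by giving coefficient 0 to the
  terms with an empty block.\<close>

lemma sum_D3_index:
  "(\<Sum>j\<le>length xs. \<Sum>i\<le>j. f (take i xs) (slice i j xs) (drop j xs)) =
   (\<Sum>(p, m, q)\<in>D3 xs. f p m q)"
proof -
  have "(\<Sum>j\<le>length xs. \<Sum>i\<le>j. f (take i xs) (slice i j xs) (drop j xs)) =
      (\<Sum>(j, i)\<in>(SIGMA j : {..length xs}. {..j}). f (take i xs) (slice i j xs) (drop j xs))"
    by (simp add: sum.Sigma)
  also have "\<dots> = (\<Sum>(p, m, q)\<in>D3 xs. f p m q)"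
    by (rule sum.reindex_bij_witness
        [where j = "\<lambda>(j, i). (take i xs, slice i j xs, drop j xs)"
           and i = "\<lambda>(p, m, q). (length p + length m, length p)"])
      (auto simp: D3_def slice_def min_def simp flip: drop_drop take_add
         simp: le_add_diff_inverse, metis append_take_drop_id le_add_diff_inverse drop_drop add.commute)
  finally show ?thesis .
qed

text \<open>The distinguished letter lies in the first, the middle or the last block. Applied to
  \<open>x = c\<close>, this sorts the terms of an A-infinity relation by the place of the inner
  operation relative to \<open>c\<close>.\<close>

lemma sum_D3_mid:
  "(\<Sum>(p, m, q)\<in>D3 (us @ x # vs). f p m q) =
   (\<Sum>(s, m, q)\<in>D3 vs. f (us @ x # s) m q) +
   (\<Sum>(p, s)\<in>D2 us. \<Sum>(s', q)\<in>D2 vs. f p (s @ x # s') q) +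
   (\<Sum>(p, m, s)\<in>D3 us. f p m (s @ x # vs))"
proof -
  let ?a = "\<lambda>(s, m, q). (us @ x # s, m, q)"
  let ?b = "\<lambda>((p, s), (s', q)). (p, s @ x # s', q)"
  let ?c = "\<lambda>(p, m, s). (p, m, s @ x # vs)"
  have D3: "D3 (us @ x # vs) = ?a ` D3 vs \<union> (?b ` (D2 us \<times> D2 vs) \<union> ?c ` D3 us)" (is "?L = ?R")
  proof
    show "?L \<subseteq> ?R"
    proof (rule subsetI)
      fix t assume *: "t \<in> D3 (us @ x # vs)"
      obtain p m q where t: "t = (p, m, q)"
        by (cases t)
      from * have "p @ m @ q = us @ x # vs"
        by (simp add: D3_def t)
      then consider s where "p = us @ x # s" "s @ m @ q = vs"
        | s s' where "p @ s = us" "m = s @ x # s'" "s' @ q = vs"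
        | s where "p @ m @ s = us" "q = s @ x # vs"
        by (auto simp: append_eq_append_conv2 append_eq_Cons_conv Cons_eq_append_conv)
      then show "t \<in> ?R"
      proof cases
        case 1
        then have "t \<in> ?a ` D3 vs"
          by (auto simp: D3_def image_iff t)
        then show ?thesis by blast
      next
        case 2
        then have "t \<in> ?b ` (D2 us \<times> D2 vs)"
          by (intro image_eqI[of _ _ "((p, s), (s', q))"]) (auto simp: D2_def t)
        then show ?thesis by blast
      next
        case 3
        then have "t \<in> ?c ` D3 us"
          by (intro image_eqI[of _ _ "(p, m, s)"]) (auto simp: D3_def t)
        then show ?thesis by blast
      qed
    qed
  qed (auto simp: D2_def D3_def)
  have inj: "inj_on ?a (D3 vs)" "inj_on ?b (D2 us \<times> D2 vs)" "inj_on ?c (D3 us)"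
    by (auto simp: inj_on_def D2_def D3_def)
  define A where "A = ?a ` D3 vs"
  define B where "B = ?b ` (D2 us \<times> D2 vs)"
  define E where "E = ?c ` D3 us"
  \<comment> \<open>The lengths of the first two blocks determine where the mark lies, hence the
    three images are disjoint.\<close>
  have lA: "length us < length (fst t)" if "t \<in> A" for t
    using that by (auto simp: A_def)
  have lB: "length (fst t) \<le> length us \<and> length us < length (fst t) + length (fst (snd t))"
    if "t \<in> B" for t
    using that by (auto simp: D2_def B_def)
  have lE: "length (fst t) + length (fst (snd t)) \<le> length us" if "t \<in> E" for t
    using that by (auto simp: D3_def E_def)
  have disj: "A \<inter> (B \<union> E) = {}" "B \<inter> E = {}"
    using lA lB lE by (meson Un_iff add_leD1 disjoint_iff leD)+
  have fin: "finite A" "finite B" "finite E"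
    by (simp_all add: A_def B_def E_def)
  define g where "g = (\<lambda>(p, m, q). f p m q)"
  have "sum g (D3 (us @ x # vs)) = sum g A + (sum g B + sum g E)"
    unfolding D3 A_def[symmetric] B_def[symmetric] E_def[symmetric]
    by (simp only: sum.union_disjoint disj fin finite_UnI)
  then show ?thesis
    using inj unfolding A_def B_def E_def g_def
    by (simp only: sum.reindex comp_def) (simp add: sum.cartesian_product split_def add.assoc)
qed

text \<open>A decomposition into five blocks arises from one into three in several ways: by cutting
  one block in three, or both outer blocks in two. Comparing these ways matches the terms of an
  iterated cut and contraction.\<close>

definition D5 :: "'a list \<Rightarrow> ('a list \<times> 'a list \<times> 'a list \<times> 'a list \<times> 'a list) set" where
  "D5 xs = {(p, l, m, n, q). p @ l @ m @ n @ q = xs}"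

lemma D2_Nil [simp]: "D2 [] = {([], [])}"
  by (auto simp: D2_def)

lemma D3_Nil [simp]: "D3 [] = {([], [], [])}"
  by (auto simp: D3_def)

lemma sum_D3_Cons:
  "(\<And>m q. f [] m q = 0) \<Longrightarrow>
   (\<Sum>(p, m, q)\<in>D3 (x # xs). f p m q) = (\<Sum>(p, m, q)\<in>D3 xs. f (x # p) m q)"
  using sum_D3_mid[of f "[]" x xs] by (simp add: split_def)

lemma D2D: "(p, q) \<in> D2 xs \<Longrightarrow> xs = p @ q"
  by (simp add: D2_def)

lemma D3D: "(p, m, q) \<in> D3 xs \<Longrightarrow> xs = p @ m @ q"
  by (simp add: D3_def)

lemma sum_D2_Cons:
  "(\<Sum>(p, q)\<in>D2 (x # xs). f p q) = f [] (x # xs) + (\<Sum>(p, q)\<in>D2 xs. f (x # p) q)"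
proof -
  have "D2 (x # xs) = insert ([], x # xs) ((\<lambda>(p, q). (x # p, q)) ` D2 xs)"
    by (auto simp: D2_def append_eq_Cons_conv image_iff)
  moreover have "([], x # xs) \<notin> (\<lambda>(p, q). (x # p, q)) ` D2 xs"
    by auto
  moreover have "inj_on (\<lambda>(p, q). (x # p, q)) (D2 xs)"
    by (auto simp: inj_on_def)
  ultimately show ?thesis
    by (simp add: sum.reindex split_def comp_def)
qed

lemma sum_D2_mid:
  "(\<Sum>(p, q)\<in>D2 (us @ x # vs). f p q) =
   (\<Sum>(s, q)\<in>D2 vs. f (us @ x # s) q) + (\<Sum>(p, s)\<in>D2 us. f p (s @ x # vs))"
proof (induction us arbitrary: f)
  case (Cons y us)
  show ?case
    using Cons.IH[of "\<lambda>p. f (y # p)"] by (simp add: sum_D2_Cons add_ac)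
qed (simp add: sum_D2_Cons add.commute)

lemma sum_D5_fst:
  "(\<Sum>(p, m, q)\<in>D3 xs. \<Sum>(a, b, c)\<in>D3 p. f a b c m q) = (\<Sum>(a, b, c, m, q)\<in>D5 xs. f a b c m q)"
proof -
  have "(\<Sum>(p, m, q)\<in>D3 xs. \<Sum>(a, b, c)\<in>D3 p. f a b c m q) =
      (\<Sum>((p, m, q), (a, b, c))\<in>(SIGMA t : D3 xs. D3 (fst t)). f a b c m q)"
    by (simp add: sum.Sigma split_def)
  also have "\<dots> = (\<Sum>(a, b, c, m, q)\<in>D5 xs. f a b c m q)"
    by (rule sum.reindex_bij_witness
        [where j = "\<lambda>((p, m, q), (a, b, c)). (a, b, c, m, q)"
           and i = "\<lambda>(a, b, c, m, q). ((a @ b @ c, m, q), (a, b, c))"])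
      (auto simp: D3_def D5_def)
  finally show ?thesis .
qed

lemma sum_D5_mid:
  "(\<Sum>(p, m, q)\<in>D3 xs. \<Sum>(a, b, c)\<in>D3 m. f p a b c q) = (\<Sum>(p, a, b, c, q)\<in>D5 xs. f p a b c q)"
proof -
  have "(\<Sum>(p, m, q)\<in>D3 xs. \<Sum>(a, b, c)\<in>D3 m. f p a b c q) =
      (\<Sum>((p, m, q), (a, b, c))\<in>(SIGMA t : D3 xs. D3 (fst (snd t))). f p a b c q)"
    by (simp add: sum.Sigma split_def)
  also have "\<dots> = (\<Sum>(p, a, b, c, q)\<in>D5 xs. f p a b c q)"
    by (rule sum.reindex_bij_witness
        [where j = "\<lambda>((p, m, q), (a, b, c)). (p, a, b, c, q)"
           and i = "\<lambda>(p, a, b, c, q). ((p, a @ b @ c, q), (a, b, c))"])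
      (auto simp: D3_def D5_def)
  finally show ?thesis .
qed

lemma sum_D5_lst:
  "(\<Sum>(p, m, q)\<in>D3 xs. \<Sum>(a, b, c)\<in>D3 q. f p m a b c) = (\<Sum>(p, m, a, b, c)\<in>D5 xs. f p m a b c)"
proof -
  have "(\<Sum>(p, m, q)\<in>D3 xs. \<Sum>(a, b, c)\<in>D3 q. f p m a b c) =
      (\<Sum>((p, m, q), (a, b, c))\<in>(SIGMA t : D3 xs. D3 (snd (snd t))). f p m a b c)"
    by (simp add: sum.Sigma split_def)
  also have "\<dots> = (\<Sum>(p, m, a, b, c)\<in>D5 xs. f p m a b c)"
    by (rule sum.reindex_bij_witness
        [where j = "\<lambda>((p, m, q), (a, b, c)). (p, m, a, b, c)"
           and i = "\<lambda>(p, m, a, b, c). ((p, m, a @ b @ c), (a, b, c))"])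
      (auto simp: D3_def D5_def)
  finally show ?thesis .
qed

lemma sum_D5_out:
  "(\<Sum>(p, m, q)\<in>D3 xs. \<Sum>(a, b)\<in>D2 p. \<Sum>(c, d)\<in>D2 q. f a b m c d) =
   (\<Sum>(a, b, m, c, d)\<in>D5 xs. f a b m c d)"
proof -
  have "(\<Sum>(p, m, q)\<in>D3 xs. \<Sum>(a, b)\<in>D2 p. \<Sum>(c, d)\<in>D2 q. f a b m c d) =
      (\<Sum>((p, m, q), ((a, b), (c, d)))\<in>(SIGMA t : D3 xs. D2 (fst t) \<times> D2 (snd (snd t))). f a b m c d)"
    by (simp add: sum.Sigma split_def sum.cartesian_product)
  also have "\<dots> = (\<Sum>(a, b, m, c, d)\<in>D5 xs. f a b m c d)"
    by (rule sum.reindex_bij_witness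
        [where j = "\<lambda>((p, m, q), ((a, b), (c, d))). (a, b, m, c, d)"
           and i = "\<lambda>(a, b, m, c, d). ((a @ b, m, c @ d), ((a, b), (c, d)))"])
      (auto simp: D2_def D3_def D5_def)
  finally show ?thesis .
qed

lemma sum_D4_fst:
  "(\<Sum>(p, m, q)\<in>D3 xs. \<Sum>(a, b)\<in>D2 p. f a b m q) = (\<Sum>(a, b, m, q)\<in>D4 xs. f a b m q)"
proof -
  have "(\<Sum>(p, m, q)\<in>D3 xs. \<Sum>(a, b)\<in>D2 p. f a b m q) =
      (\<Sum>((p, m, q), (a, b))\<in>(SIGMA t : D3 xs. D2 (fst t)). f a b m q)"
    by (simp add: sum.Sigma split_def)
  also have "\<dots> = (\<Sum>(a, b, m, q)\<in>D4 xs. f a b m q)"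
    by (rule sum.reindex_bij_witness
        [where j = "\<lambda>((p, m, q), (a, b)). (a, b, m, q)"
           and i = "\<lambda>(a, b, m, q). ((a @ b, m, q), (a, b))"])
      (auto simp: D2_def D3_def D4_def)
  finally show ?thesis .
qed

lemma sum_D4_mid:
  "(\<Sum>(p, m, q)\<in>D3 xs. \<Sum>(a, b)\<in>D2 m. f p a b q) = (\<Sum>(p, a, b, q)\<in>D4 xs. f p a b q)"
proof -
  have "(\<Sum>(p, m, q)\<in>D3 xs. \<Sum>(a, b)\<in>D2 m. f p a b q) =
      (\<Sum>((p, m, q), (a, b))\<in>(SIGMA t : D3 xs. D2 (fst (snd t))). f p a b q)"
    by (simp add: sum.Sigma split_def)
  also have "\<dots> = (\<Sum>(p, a, b, q)\<in>D4 xs. f p a b q)"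
    by (rule sum.reindex_bij_witness
        [where j = "\<lambda>((p, m, q), (a, b)). (p, a, b, q)"
           and i = "\<lambda>(p, a, b, q). ((p, a @ b, q), (a, b))"])
      (auto simp: D2_def D3_def D4_def)
  finally show ?thesis .
qed

lemma sum_D4_lst:
  "(\<Sum>(p, m, q)\<in>D3 xs. \<Sum>(a, b)\<in>D2 q. f p m a b) = (\<Sum>(p, m, a, b)\<in>D4 xs. f p m a b)"
proof -
  have "(\<Sum>(p, m, q)\<in>D3 xs. \<Sum>(a, b)\<in>D2 q. f p m a b) =
      (\<Sum>((p, m, q), (a, b))\<in>(SIGMA t : D3 xs. D2 (snd (snd t))). f p m a b)"
    by (simp add: sum.Sigma split_def)
  also have "\<dots> = (\<Sum>(p, m, a, b)\<in>D4 xs. f p m a b)"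
    by (rule sum.reindex_bij_witness
        [where j = "\<lambda>((p, m, q), (a, b)). (p, m, a, b)"
           and i = "\<lambda>(p, m, a, b). ((p, m, a @ b), (a, b))"])
      (auto simp: D2_def D3_def D4_def)
  finally show ?thesis .
qed

section \<open>Signed sums over cuts of a cyclic word\<close>

text \<open>The list is read as a cyclic word with its first letter marked. A triple cuts it into
  two arcs: \<open>q @ p\<close>, which runs across the end of the list and contains the mark
  because \<open>p\<close> is nonempty, and \<open>m\<close>. The coefficient is the Koszul sign of
  the rotation. The Mukai pairing is such a sum in each argument.\<close>

definition MA :: "('o, 'v) arr list \<Rightarrow> (('o, 'v) arr list \<Rightarrow> ('o, 'v) arr list \<Rightarrow> 'k::field) \<Rightarrow> 'k" where
  "MA as \<Phi> = (\<Sum>(p, m, q)\<in>D3 as. if p = [] then 0 else ksign (sd q * (sd p + sd m)) * \<Phi> (q @ p) m)"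

definition M1 :: "('o, 'v) arr list \<Rightarrow>
    (('o, 'v) arr list \<Rightarrow> ('o, 'v) arr list \<Rightarrow> ('o, 'v) arr list \<Rightarrow> 'k::field) \<Rightarrow> 'k" where
  "M1 as \<Psi> = MA as (\<lambda>A1 A2. \<Sum>(V, W)\<in>D2 A2. \<Psi> A1 V W)"

text \<open>The functional \<open>F\<close> evaluated on the bar differential of the word
  \<open>as\<close>.\<close>

definition ins :: "('k::field, 'o, 'v, 'z) ainf_scheme \<Rightarrow> ('o, 'v) arr list \<Rightarrow>
    (('o, 'v) arr list \<Rightarrow> 'k) \<Rightarrow> 'k" where
  "ins C as F = (\<Sum>(p, m, q)\<in>D3 as. if m = [] then 0 else ksign (sd p) * F (p @ mres C m # q))"

lemma MA_Cons:
  "MA (a # zs) \<Phi> =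
     (\<Sum>(p, m, q)\<in>D3 zs. ksign (sd q * (sdeg a + sd p + sd m)) * \<Phi> (q @ a # p) m)"
  unfolding MA_def by (subst sum_D3_Cons) (auto intro!: sum.cong)

lemma MA_Nil: "MA [] \<Phi> = 0"
  by (simp add: MA_def)

lemma MA_cong:
  assumes "\<And>p m q. p @ m @ q = as \<Longrightarrow> p \<noteq> [] \<Longrightarrow> \<Phi> (q @ p) m = \<Phi>' (q @ p) m"
  shows "MA as \<Phi> = MA as \<Phi>'"
  unfolding MA_def using assms by (intro sum.cong) (auto simp: D3_def)

lemma MA_add: "MA as (\<lambda>A1 A2. \<Phi> A1 A2 + \<Phi>' A1 A2) = MA as \<Phi> + MA as \<Phi>'"
  unfolding MA_def sum.distrib[symmetric] by (intro sum.cong) (auto simp: algebra_simps)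

lemma MA_mult: "MA as (\<lambda>A1 A2. c * \<Phi> A1 A2) = c * MA as \<Phi>"
  unfolding MA_def sum_distrib_left by (intro sum.cong) auto

lemma MA_uminus: "MA as (\<lambda>A1 A2. - \<Phi> A1 A2) = - MA as \<Phi>"
  using MA_mult[of as "- 1" \<Phi>] by simp

lemma MA_diff: "MA as (\<lambda>A1 A2. \<Phi> A1 A2 - \<Phi>' A1 A2) = MA as \<Phi> - MA as \<Phi>'"
  using MA_add[of as \<Phi> "\<lambda>x y. - \<Phi>' x y"] by (simp add: MA_uminus)

lemma MA_0 [simp]: "MA as (\<lambda>A1 A2. 0) = 0"
  by (auto simp: MA_def intro!: sum.neutral)

lemma MA_sum: "MA as (\<lambda>A1 A2. \<Sum>t\<in>T. \<Phi> t A1 A2) = (\<Sum>t\<in>T. MA as (\<Phi> t))"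
  by (induction T rule: infinite_finite_induct) (auto simp: MA_add)

lemma MA_alt: "MA as \<Phi> = (\<Sum>t\<in>D3 as.
    (if fst t = [] then 0 else ksign (sd (snd (snd t)) * (sd (fst t) + sd (fst (snd t))))) *
    \<Phi> (snd (snd t) @ fst t) (fst (snd t)))"
  unfolding MA_def by (intro sum.cong) auto

lemma MA_swap: "MA as (\<lambda>A1 A2. MA bs (\<lambda>B1 B2. F A1 A2 B1 B2)) =
    MA bs (\<lambda>B1 B2. MA as (\<lambda>A1 A2. F A1 A2 B1 B2))"
  unfolding MA_alt sum_distrib_left
  by (subst sum.swap) (simp only: mult.left_commute)

text \<open>A cut of the arc containing the marked letter is a cut of the word into three arcs with the
  mark either in the first or in the second one; the latter is rotated into the former.\<close>

lemma MA_split_fst: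
  fixes as :: "('o, 'v) arr list"
  shows "MA as (\<lambda>A1 A2. \<Sum>(A', A'')\<in>D2 A1. \<Psi> A' A'' A2) =
   M1 as \<Psi> + M1 as (\<lambda>U V W. ksign (sd W * (sd U + sd V)) * \<Psi> W U V)"
proof (cases as)
  case Nil
  then show ?thesis by (simp add: M1_def MA_Nil)
next
  case (Cons a zs)
  have 1: "M1 as \<Psi>' = (\<Sum>(p, V, W, q)\<in>D4 zs.
      ksign (sd q * (sdeg a + sd p + sd V + sd W)) * \<Psi>' (q @ a # p) V W)" for \<Psi>'
    unfolding M1_def Cons MA_Cons sum_D4_mid[symmetric] sum_distrib_left
    by (intro sum.cong refl) (auto simp: add_ac dest!: D2D intro!: sum.cong)
  \<comment> \<open>\<open>F1\<close> collects the cuts of the marked arc behind the mark,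
    \<open>F2\<close> those before it; in \<open>F2\<close> the mark ends up in the second
    part.\<close>
  define F1 where "F1 = (\<lambda>s t m q. ksign (sd q * (sdeg a + sd s + sd t + sd m)) * \<Psi> (q @ a # s) t m)"
  define F2 where "F2 = (\<lambda>p m s t. ksign ((sd s + sd t) * (sdeg a + sd p + sd m)) * \<Psi> s (t @ a # p) m)"
  have "MA as (\<lambda>A1 A2. \<Sum>(A', A'')\<in>D2 A1. \<Psi> A' A'' A2) =
     (\<Sum>(s, t, m, q)\<in>D4 zs. F1 s t m q) + (\<Sum>(p, m, s, t)\<in>D4 zs. F2 p m s t)"
    unfolding sum_D4_fst[of F1, symmetric] sum_D4_lst[of F2, symmetric] sum.distrib[symmetric]
      Cons MA_Cons
  proof (intro sum.cong refl, clarify)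
    fix p m q :: "('o, 'v) arr list"
    let ?k = "ksign (sd q * (sdeg a + sd p + sd m))"
    have "?k * (\<Sum>(s, t)\<in>D2 p. \<Psi> (q @ a # s) t m) = (\<Sum>(x, b)\<in>D2 p. F1 x b m q)"
      unfolding sum_distrib_left by (intro sum.cong refl) (auto simp: F1_def add_ac dest!: D2D)
    moreover have "?k * (\<Sum>(s, t)\<in>D2 q. \<Psi> s (t @ a # p) m) = (\<Sum>(x, b)\<in>D2 q. F2 p m x b)"
      unfolding sum_distrib_left by (intro sum.cong refl) (auto simp: F2_def add_ac dest!: D2D)
    ultimately show "?k * (\<Sum>(A', A'')\<in>D2 (q @ a # p). \<Psi> A' A'' m) =
      (\<Sum>(x, b)\<in>D2 p. F1 x b m q) + (\<Sum>(x, b)\<in>D2 q. F2 p m x b)"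
      unfolding sum_D2_mid distrib_left by argo
  qed
  also have "\<dots> = M1 as \<Psi> + M1 as (\<lambda>U V W. ksign (sd W * (sd U + sd V)) * \<Psi> W U V)"
    unfolding 1 F1_def F2_def
    by (intro arg_cong2[where f = "(+)"] sum.cong refl) (auto simp: ksign_def)
  finally show ?thesis .
qed

lemma ksign_mult_eqI: "even (a + b - c) \<Longrightarrow> ksign a * (ksign b * x) = ksign c * (x::'k::comm_ring_1)"
  by (auto simp: ksign_def)

section \<open>Functionals on finite formal combinations\<close>

definition fs :: "('a \<Rightarrow> 'k::zero) \<Rightarrow> bool" where
  "fs f \<longleftrightarrow> finite {x. f x \<noteq> 0}"

definition ev :: "('a \<Rightarrow> 'k::field) \<Rightarrow> ('a \<Rightarrow> 'k) \<Rightarrow> 'k" where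
  "ev \<phi> f = (\<Sum>a | f a \<noteq> 0. f a * \<phi> a)"

lemma sum_fun_apply: "(\<Sum>t\<in>T. f t) x = (\<Sum>t\<in>T. f t x)"
  by (induction T rule: infinite_finite_induct) auto

lemma ev_eq_sum: "finite S \<Longrightarrow> {a. f a \<noteq> 0} \<subseteq> S \<Longrightarrow> ev \<phi> f = (\<Sum>a\<in>S. f a * \<phi> a)"
  unfolding ev_def by (intro sum.mono_neutral_left) auto

lemma ev_sum_sgl:
  assumes "finite T"
  shows "ev \<phi> (\<Sum>t\<in>T. smul (c t) (sgl (w t))) = (\<Sum>t\<in>T. c t * \<phi> (w t))"
proof -
  \<comment> \<open>The words \<open>w t\<close> may coincide, so the sum is taken over the image of
    \<open>w\<close> and the coefficients are regrouped.\<close>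
  have "ev \<phi> (\<Sum>t\<in>T. smul (c t) (sgl (w t))) =
      (\<Sum>a\<in>w ` T. (\<Sum>t\<in>T. smul (c t) (sgl (w t))) a * \<phi> a)"
  proof (rule ev_eq_sum)
    show "{a. (\<Sum>t\<in>T. smul (c t) (sgl (w t))) a \<noteq> 0} \<subseteq> w ` T"
      by (auto simp: sum_fun_apply smul_def sgl_def intro!: sum.neutral)
  qed (use assms in auto)
  also have "\<dots> = (\<Sum>t\<in>T. \<Sum>a\<in>w ` T. (if a = w t then c t * \<phi> a else 0))"
    unfolding sum_fun_apply sum_distrib_right
    by (subst sum.swap) (auto simp: smul_def sgl_def intro!: sum.cong)
  also have "\<dots> = (\<Sum>t\<in>T. c t * \<phi> (w t))"
    using assms by (intro sum.cong refl) (simp add: sum.delta')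
  finally show ?thesis .
qed

lemma fs_sum_sgl: "finite T \<Longrightarrow> fs (\<Sum>t\<in>T. smul (c t) (sgl (w t)) :: 'a \<Rightarrow> 'k::field)"
  unfolding fs_def
  by (rule finite_subset[of _ "w ` T"])
    (auto simp: sum_fun_apply smul_def sgl_def intro!: sum.neutral)

lemma ev_add:
  assumes "fs f" "fs g"
  shows "ev \<phi> (f + g) = ev \<phi> f + ev \<phi> g"
proof -
  let ?S = "{a. f a \<noteq> 0} \<union> {a. g a \<noteq> 0}"
  have "finite ?S"
    using assms by (simp add: fs_def)
  moreover from this have "ev \<phi> (f + g) = (\<Sum>a\<in>?S. (f + g) a * \<phi> a)"
    "ev \<phi> f = (\<Sum>a\<in>?S. f a * \<phi> a)" "ev \<phi> g = (\<Sum>a\<in>?S. g a * \<phi> a)"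
    by (rule ev_eq_sum; auto)+
  ultimately show ?thesis
    by (simp add: algebra_simps sum.distrib)
qed

lemma smul_0 [simp]: "smul (0::'k::field) f = 0"
  by (simp add: smul_def fun_eq_iff)

section \<open>The Hochschild differential in terms of cuts\<close>

lemma take_slice: "i \<le> j \<Longrightarrow> take j xs = take i xs @ slice i j xs"
  by (simp add: slice_def flip: take_add)

text \<open>A block \<open>take (Suc i) xs\<close> is never empty: this shift by one is how the
  definitions keep the marked letter in the first block. For decompositions it becomes the condition
  on \<open>p\<close>.\<close>

lemma sum_D3_index_fst:
  "(\<Sum>j\<le>length xs. \<Sum>i<j. f (take (Suc i) xs) (slice (Suc i) j xs) (drop j xs)) =
   (\<Sum>(p, m, q)\<in>D3 xs. if p = [] then 0 else f p m q)"
  unfolding sum_D3_index[symmetric]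
proof (rule sum.cong[OF refl])
  fix j assume "j \<in> {..length xs}"
  then show "(\<Sum>i<j. f (take (Suc i) xs) (slice (Suc i) j xs) (drop j xs)) =
    (\<Sum>i\<le>j. if take i xs = [] then 0 else f (take i xs) (slice i j xs) (drop j xs))"
    unfolding sum.atMost_shift by (auto intro!: sum.cong)
qed

lemma MA_index:
  "(\<Sum>j\<le>length as. \<Sum>i<j. ksign (sd (drop j as) * sd (take j as)) *
      \<Phi> (drop j as @ take (Suc i) as) (slice (Suc i) j as)) = MA as \<Phi>"
  unfolding MA_def sum_D3_index_fst[symmetric]
proof (intro sum.cong refl)
  fix j i :: nat assume "i \<in> {..<j}"
  then have "sd (take j as) = sd (take (Suc i) as) + sd (slice (Suc i) j as)"
    using take_slice[of "Suc i" j as] by simp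
  then show "ksign (sd (drop j as) * sd (take j as)) *
      \<Phi> (drop j as @ take (Suc i) as) (slice (Suc i) j as) =
    ksign (sd (drop j as) * (sd (take (Suc i) as) + sd (slice (Suc i) j as))) *
      \<Phi> (drop j as @ take (Suc i) as) (slice (Suc i) j as)"
    by simp
qed

lemma hoch_d_D3:
  fixes C :: "('k::field, 'o, 'v, 'z) ainf_scheme"
  shows "hoch_d C as =
     (\<Sum>(p, m, q)\<in>D3 as. smul (if p = [] \<or> m = [] then 0 else ksign (sd p)) (sgl (p @ mres C m # q))) +
     (\<Sum>(p, m, q)\<in>D3 as. if p = [] then 0
        else smul (ksign (sd q * (sd p + sd m))) (sgl (mres C (q @ p) # m)))"
proof -
  \<comment> \<open>The range starts at 1 because operations that involve the first letter belong to
    the second sum of \<open>hoch_d\<close>.\<close>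
  have "(\<Sum>i\<in>{1..<j}. smul (ksign (sd (take i as)) :: 'k) (sgl (take i as @ mres C (slice i j as) # drop j as))) =
     (\<Sum>i\<le>j. smul (if take i as = [] \<or> slice i j as = [] then 0 else ksign (sd (take i as)))
       (sgl (take i as @ mres C (slice i j as) # drop j as)))" if "j \<in> {..length as}" for j
    using that by (intro sum.mono_neutral_cong_left) (auto simp: slice_def)
  then have 1: "(\<Sum>j\<le>length as. \<Sum>i\<in>{1..<j}. smul (ksign (sd (take i as)) :: 'k)
      (sgl (take i as @ mres C (slice i j as) # drop j as))) =
    (\<Sum>(p, m, q)\<in>D3 as. smul (if p = [] \<or> m = [] then 0 else ksign (sd p)) (sgl (p @ mres C m # q)))"
    unfolding sum_D3_index[symmetric] by (rule sum.cong[OF refl])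
  have 2: "(\<Sum>j\<le>length as. \<Sum>i<j. smul (ksign (sd (drop j as) * sd (take j as)) :: 'k)
       (sgl (mres C (drop j as @ take (Suc i) as) # slice (Suc i) j as))) =
     (\<Sum>j\<le>length as. \<Sum>i<j. smul (ksign (sd (drop j as) * (sd (take (Suc i) as) + sd (slice (Suc i) j as))))
       (sgl (mres C (drop j as @ take (Suc i) as) # slice (Suc i) j as)))"
  proof (intro sum.cong refl)
    fix j i :: nat assume "i \<in> {..<j}"
    then have "sd (take j as) = sd (take (Suc i) as) + sd (slice (Suc i) j as)"
      using take_slice[of "Suc i" j as] by simp
    then show "smul (ksign (sd (drop j as) * sd (take j as)) :: 'k)
       (sgl (mres C (drop j as @ take (Suc i) as) # slice (Suc i) j as)) =
     smul (ksign (sd (drop j as) * (sd (take (Suc i) as) + sd (slice (Suc i) j as))))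
       (sgl (mres C (drop j as @ take (Suc i) as) # slice (Suc i) j as))"
      by simp
  qed
  show ?thesis
    unfolding hoch_d_def 1 2
      sum_D3_index_fst[of "\<lambda>p m q. smul (ksign (sd q * (sd p + sd m))) (sgl (mres C (q @ p) # m))"] ..
qed

lemma hoch_d_Cons:
  "hoch_d C (a # zs) =
     (\<Sum>(p, m, q)\<in>D3 zs. smul (if m = [] then 0 else ksign (sdeg a + sd p)) (sgl (a # p @ mres C m # q))) +
     (\<Sum>(p, m, q)\<in>D3 zs. smul (ksign (sd q * (sdeg a + sd p + sd m))) (sgl (mres C (q @ a # p) # m)))"
  unfolding hoch_d_D3
  by (subst (1 2) sum_D3_Cons) (simp_all add: split_def cong: if_cong)

lemma ev_hoch_d_Cons:
  "ev \<phi> (hoch_d C (a # zs)) =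
     (\<Sum>(p, m, q)\<in>D3 zs. (if m = [] then 0 else ksign (sdeg a + sd p)) * \<phi> (a # p @ mres C m # q)) +
     (\<Sum>(p, m, q)\<in>D3 zs. ksign (sd q * (sdeg a + sd p + sd m)) * \<phi> (mres C (q @ a # p) # m))"
  unfolding hoch_d_Cons split_def by (simp add: ev_add ev_sum_sgl fs_sum_sgl)

lemma hoch_d_Nil: "hoch_d C [] = 0"
  by (simp add: hoch_d_D3)

text \<open>A block that is contracted to a single letter is not crossed by a later cut, so
  contracting and then cutting is the same as cutting and then contracting inside one of the two
  arcs.\<close>

lemma ev_hoch_d_MA:
  fixes as :: "('o, 'v) arr list"
  shows "ev (\<lambda>w. MA w \<Phi>) (hoch_d C as) =
   MA as (\<lambda>A1 A2. ins C A1 (\<lambda>A. \<Phi> A A2) + ksign (sd A1) * ins C A2 (\<lambda>A. \<Phi> A1 A))"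
proof (cases as)
  case Nil
  then show ?thesis by (simp add: hoch_d_Nil MA_Nil ev_def)
next
  case (Cons a zs)
  \<comment> \<open>The four positions of the contracted block: behind the mark in the marked arc
    (\<open>F1\<close>), in the other arc (\<open>F2\<close>), before the mark in the marked arc
    (\<open>F3\<close>), around the mark (\<open>F4\<close>).\<close>
  define F1 where "F1 = (\<lambda>p n s m q. if n = [] then 0 else
    ksign (sdeg a + sd p + sd q * (sdeg a + sd p + sd n + 1 + sd s + sd m)) * \<Phi> (q @ a # p @ mres C n # s) m)"
  define F2 where "F2 = (\<lambda>p s n t q. if n = [] then 0 else
    ksign (sdeg a + sd p + sd s + sd q * (sdeg a + sd p + sd s + sd n + 1 + sd t)) *
      \<Phi> (q @ a # p) (s @ mres C n # t))"
  define F3 where "F3 = (\<lambda>p m s n q. if n = [] then 0 else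
    ksign (sdeg a + sd p + sd m + sd s + (sd s + sd n + 1 + sd q) * (sdeg a + sd p + sd m)) *
      \<Phi> (s @ mres C n # q @ a # p) m)"
  define F4 where "F4 = (\<lambda>r s m t q.
    ksign (sd q * (sdeg a + sd r + sd s + sd m + sd t) + sd t * (sd q + sdeg a + sd r + 1 + sd s + sd m)) *
      \<Phi> (t @ mres C (q @ a # r) # s) m)"
  let ?S = "\<lambda>F. \<Sum>(x1, x2, x3, x4, x5)\<in>D5 zs. F x1 x2 x3 x4 x5"
  have 1: "(\<Sum>(p, m, q)\<in>D3 zs. (if m = [] then 0 else ksign (sdeg a + sd p)) * MA (a # p @ mres C m # q) \<Phi>) =
      ?S F1 + ?S F2 + ?S F3"
    unfolding sum_D5_fst[of F3, symmetric] sum_D5_out[of F2, symmetric] sum_D5_lst[of F1, symmetric]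
      sum.distrib[symmetric]
  proof (intro sum.cong refl, clarify)
    fix p m q :: "('o, 'v) arr list"
    let ?k = "if m = [] then 0 else ksign (sdeg a + sd p)"
    have "?k * (\<Sum>(s, m', q')\<in>D3 q. ksign (sd q' * (sdeg a + sd (p @ mres C m # s) + sd m')) *
        \<Phi> (q' @ a # p @ mres C m # s) m') = (\<Sum>(a, b, c)\<in>D3 q. F1 p m a b c)"
      unfolding sum_distrib_left by (intro sum.cong refl) (auto simp: F1_def intro!: ksign_mult_eqI)
    moreover have "?k * (\<Sum>(p', s)\<in>D2 p. \<Sum>(s', q')\<in>D2 q. ksign (sd q' * (sdeg a + sd p' + sd (s @ mres C m # s'))) *
        \<Phi> (q' @ a # p') (s @ mres C m # s')) = (\<Sum>(b, c)\<in>D2 p. \<Sum>(d, e)\<in>D2 q. F2 b c m d e)"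
      unfolding sum_distrib_left split_def
      by (intro sum.cong refl) (auto simp: F2_def ksign_def dest!: D2D)
    moreover have "?k * (\<Sum>(p', m', s)\<in>D3 p. ksign (sd (s @ mres C m # q) * (sdeg a + sd p' + sd m')) *
        \<Phi> ((s @ mres C m # q) @ a # p') m') = (\<Sum>(a, b, c)\<in>D3 p. F3 a b c m q)"
      unfolding sum_distrib_left
      by (intro sum.cong refl) (auto simp: F3_def dest!: D3D intro!: ksign_mult_eqI)
    ultimately show "?k * MA (a # p @ mres C m # q) \<Phi> =
      (\<Sum>(a, b, c)\<in>D3 q. F1 p m a b c) + (\<Sum>(b, c)\<in>D2 p. \<Sum>(d, e)\<in>D2 q. F2 b c m d e) +
      (\<Sum>(a, b, c)\<in>D3 p. F3 a b c m q)"
      unfolding MA_Cons sum_D3_mid distrib_left by argo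
  qed
  have 2: "(\<Sum>(p, m, q)\<in>D3 zs. ksign (sd q * (sdeg a + sd p + sd m)) * MA (mres C (q @ a # p) # m) \<Phi>) = ?S F4"
    unfolding sum_D5_mid[of F4, symmetric]
  proof (intro sum.cong refl, clarify)
    fix p m q :: "('o, 'v) arr list"
    show "ksign (sd q * (sdeg a + sd p + sd m)) * MA (mres C (q @ a # p) # m) \<Phi> =
        (\<Sum>(s, m', t)\<in>D3 m. F4 p s m' t q)"
      unfolding MA_Cons sum_distrib_left
      by (intro sum.cong refl) (auto simp: F4_def dest!: D3D intro!: ksign_mult_eqI)
  qed
  have 3: "MA as (\<lambda>A1 A2. ins C A1 (\<lambda>A. \<Phi> A A2)) = ?S F1 + ?S F4 + ?S F3"
    unfolding sum_D5_fst[of F1, symmetric] sum_D5_out[of F4, symmetric] sum_D5_lst[of F3, symmetric]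
      sum.distrib[symmetric] Cons MA_Cons
  proof (intro sum.cong refl, clarify)
    fix p m q :: "('o, 'v) arr list"
    let ?k = "ksign (sd q * (sdeg a + sd p + sd m))"
    have "?k * (\<Sum>(s, n, t)\<in>D3 p. if n = [] then 0 else ksign (sd (q @ a # s)) *
        \<Phi> ((q @ a # s) @ mres C n # t) m) = (\<Sum>(x, b, c)\<in>D3 p. F1 x b c m q)"
      unfolding sum_distrib_left by (intro sum.cong refl) (auto simp: F1_def dest!: D3D intro!: ksign_mult_eqI, auto simp: ksign_def split: if_splits)
    moreover have "?k * (\<Sum>(t, s)\<in>D2 q. \<Sum>(s', u)\<in>D2 p. if s @ a # s' = [] then 0 else
         ksign (sd t) * \<Phi> (t @ mres C (s @ a # s') # u) m) =
        (\<Sum>(x, b)\<in>D2 p. \<Sum>(c, d)\<in>D2 q. F4 x b m c d)"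
      unfolding sum_distrib_left split_def
      by (subst sum.swap, intro sum.cong refl) (auto simp: F4_def dest!: D2D intro!: ksign_mult_eqI, auto simp: ksign_def split: if_splits)
    moreover have "?k * (\<Sum>(s, n, t)\<in>D3 q. if n = [] then 0 else ksign (sd s) *
        \<Phi> (s @ mres C n # t @ a # p) m) = (\<Sum>(x, b, c)\<in>D3 q. F3 p m x b c)"
      unfolding sum_distrib_left by (intro sum.cong refl) (auto simp: F3_def dest!: D3D intro!: ksign_mult_eqI, auto simp: ksign_def split: if_splits)
    ultimately show "?k * ins C (q @ a # p) (\<lambda>A. \<Phi> A m) =
      (\<Sum>(x, b, c)\<in>D3 p. F1 x b c m q) + (\<Sum>(x, b)\<in>D2 p. \<Sum>(c, d)\<in>D2 q. F4 x b m c d) +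
      (\<Sum>(x, b, c)\<in>D3 q. F3 p m x b c)"
      unfolding ins_def sum_D3_mid distrib_left by argo
  qed
  have 4: "MA as (\<lambda>A1 A2. ksign (sd A1) * ins C A2 (\<lambda>A. \<Phi> A1 A)) = ?S F2"
    unfolding sum_D5_mid[of F2, symmetric] Cons MA_Cons
  proof (intro sum.cong refl, clarify)
    fix p m q :: "('o, 'v) arr list"
    show "ksign (sd q * (sdeg a + sd p + sd m)) * (ksign (sd (q @ a # p)) * ins C m (\<Phi> (q @ a # p))) =
        (\<Sum>(s, n, t)\<in>D3 m. F2 p s n t q)"
      unfolding ins_def sum_distrib_left
      by (intro sum.cong refl) (auto simp: F2_def dest!: D3D intro!: ksign_mult_eqI, auto simp: ksign_def split: if_splits)
  qed
  show ?thesis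
    unfolding MA_add 3 4 unfolding Cons ev_hoch_d_Cons 1 2 by simp
qed

section \<open>Traces on the morphism spaces\<close>

text \<open>The setting of the Mukai pairing: the Hom spaces have finite total dimension, so that
  supertraces are finite sums.\<close>

locale fin_ainf =
  fixes C :: "('k::field_char_0, 'o, 'v::ab_group_add, 'z) ainf_scheme"
  assumes ainf: "ainf_category C"
    and fin_deg: "\<lbrakk>X \<in> Obj C; Y \<in> Obj C\<rbrakk> \<Longrightarrow> finite {i. Hom C X Y i \<noteq> {0}}"
    and fin_dim: "\<lbrakk>X \<in> Obj C; Y \<in> Obj C\<rbrakk> \<Longrightarrow>
      \<exists>B. finite B \<and> Hom C X Y i = module.span (scl C) B"

sublocale fin_ainf \<subseteq> V: vector_space "scl C"
  using ainf by (simp add: ainf_category_def)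

text \<open>The operations are linear on the subspaces \<open>Hom\<close> of the ambient space only,
  so linearity is always relative to a subspace.\<close>

definition lin_on :: "('k::field, 'o, 'v::ab_group_add, 'z) ainf_scheme \<Rightarrow> 'v set \<Rightarrow> 'v set \<Rightarrow> ('v \<Rightarrow> 'v) \<Rightarrow> bool" where
  "lin_on C S S' f \<longleftrightarrow> (\<forall>v\<in>S. f v \<in> S') \<and>
     (\<forall>c. \<forall>v\<in>S. \<forall>w\<in>S. f (scl C c v + w) = scl C c (f v) + f w)"

definition tr :: "('k::field, 'o, 'v::ab_group_add, 'z) ainf_scheme \<Rightarrow> 'o \<Rightarrow> 'o \<Rightarrow> int \<Rightarrow> ('v \<Rightarrow> 'v) \<Rightarrow> 'k" where
  "tr C X Y i f = (\<Sum>b\<in>hbasis C X Y i. module.representation (scl C) (hbasis C X Y i) (f b) b)"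

text \<open>With \<open>t\<close> the total degree of the letters that \<open>c\<close> has to pass, this is the supertrace of \<open>F\<close>.\<close>

definition gtr :: "('k::field, 'o, 'v::ab_group_add, 'z) ainf_scheme \<Rightarrow> int \<Rightarrow> 'o \<Rightarrow> 'o \<Rightarrow>
    (('o, 'v) arr \<Rightarrow> 'v) \<Rightarrow> 'k" where
  "gtr C t X Y F = (\<Sum>i | Hom C X Y i \<noteq> {0}. ksign (i + (i - 1) * t) * tr C X Y i (\<lambda>v. F (Arr X Y i v)))"

text \<open>Linearity of \<open>F\<close> is left aside: coordinates are additive and homogeneous as
  soon as the values lie in the space spanned by the basis, and this makes \<open>gtr\<close> linear
  in \<open>F\<close>.\<close>

definition endo :: "('k::field, 'o, 'v::ab_group_add, 'z) ainf_scheme \<Rightarrow> 'o \<Rightarrow> 'o \<Rightarrow>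
    (('o, 'v) arr \<Rightarrow> 'v) \<Rightarrow> bool" where
  "endo C X Y F \<longleftrightarrow> (\<forall>i. \<forall>v\<in>Hom C X Y i. F (Arr X Y i v) \<in> Hom C X Y i)"

context fin_ainf begin

lemma subspace_Hom: "X \<in> Obj C \<Longrightarrow> Y \<in> Obj C \<Longrightarrow> V.subspace (Hom C X Y i)"
  using ainf by (auto simp: ainf_category_def)

lemma mres_in_arrows: "as \<noteq> [] \<Longrightarrow> path C X as Y \<Longrightarrow> mres C as \<in> arrows C"
  using ainf[unfolded ainf_category_def, THEN conjunct2, THEN conjunct2, THEN conjunct1] by blast

lemma mop_lin:
  "path C X (as @ Arr Y Z i v # bs) W \<Longrightarrow> path C X (as @ Arr Y Z i w # bs) W \<Longrightarrow>
   mop C (as @ Arr Y Z i (scl C c v + w) # bs) =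
     scl C c (mop C (as @ Arr Y Z i v # bs)) + mop C (as @ Arr Y Z i w # bs)"
  using ainf[unfolded ainf_category_def, THEN conjunct2, THEN conjunct2, THEN conjunct2, THEN conjunct1] by blast

lemma ainf_rel:
  assumes "as \<noteq> []" "path C X as Y"
  shows "(\<Sum>(p, m, q)\<in>D3 as. if m = [] then 0 else scl C (ksign (sd p)) (mop C (p @ mres C m # q))) = 0"
proof -
  have "(\<Sum>(p, m, q)\<in>D3 as. if m = [] then 0 else scl C (ksign (sd p)) (mop C (p @ mres C m # q))) =
    (\<Sum>j\<le>length as. \<Sum>i<j. scl C (ksign (sd (take i as)))
           (mop C (take i as @ mres C (slice i j as) # drop j as)))"
    unfolding sum_D3_index[symmetric]
    by (intro sum.cong refl sum.mono_neutral_cong_right) (auto simp: slice_def)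
  also have "\<dots> = 0"
    using ainf[unfolded ainf_category_def, THEN conjunct2, THEN conjunct2, THEN conjunct2, THEN conjunct2, THEN conjunct1] assms by blast
  finally show ?thesis .
qed

lemma unit_in_arrows: "X \<in> Obj C \<Longrightarrow> unit_arr C X \<in> arrows C"
  using ainf[unfolded ainf_category_def, THEN conjunct2, THEN conjunct2, THEN conjunct2, THEN conjunct2, THEN conjunct2, THEN conjunct1] by blast

lemma mop_unit:
  "a \<in> arrows C \<Longrightarrow> mop C [unit_arr C (src a), a] = vec a"
  "a \<in> arrows C \<Longrightarrow> mop C [a, unit_arr C (tgt a)] = scl C (ksign (deg a)) (vec a)"
  using ainf[unfolded ainf_category_def, THEN conjunct2, THEN conjunct2, THEN conjunct2, THEN conjunct2, THEN conjunct2, THEN conjunct2, THEN conjunct1] by blast+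

lemma mop_unit_zero: "path C X as Y \<Longrightarrow> unit_arr C Z \<in> set as \<Longrightarrow> length as \<noteq> 2 \<Longrightarrow> mop C as = 0"
  using ainf[unfolded ainf_category_def, THEN conjunct2, THEN conjunct2, THEN conjunct2, THEN conjunct2, THEN conjunct2, THEN conjunct2, THEN conjunct2] by blast

lemma mres_path: "path C X as Y \<Longrightarrow> as \<noteq> [] \<Longrightarrow> mres C as = Arr X Y (sd as + 2) (mop C as)"
  by (simp add: mres_def path_hd path_last)

lemma mop_in_Hom: "path C X as Y \<Longrightarrow> as \<noteq> [] \<Longrightarrow> i = sd as + 2 \<Longrightarrow> mop C as \<in> Hom C X Y i"
  using mres_in_arrows[of as X Y] by (simp add: arrows_def mres_path)

lemma Arr_in_arrows: "Arr X Y i v \<in> arrows C \<longleftrightarrow> X \<in> Obj C \<and> Y \<in> Obj C \<and> v \<in> Hom C X Y i"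
  by (simp add: arrows_def)

lemma path_contract:
  assumes "path C X (p @ m @ q) Y" "m \<noteq> []"
  shows "path C X (p @ mres C m # q) Y"
proof -
  from assms obtain Z W where "path C X p Z" "path C Z m W" "path C W q Y"
    by (auto simp: path_append)
  with assms mres_in_arrows[of m Z W] show ?thesis
    by (auto simp: path_append path_hd path_last intro!: exI[of _ Z])
qed

lemma hbasis_props:
  assumes "X \<in> Obj C" "Y \<in> Obj C"
  shows "V.independent (hbasis C X Y i)" "V.span (hbasis C X Y i) = Hom C X Y i"
    "finite (hbasis C X Y i)" "hbasis C X Y i \<subseteq> Hom C X Y i"
proof -
  obtain B where B: "B \<subseteq> Hom C X Y i" "V.independent B" "Hom C X Y i \<subseteq> V.span B"
    using V.maximal_independent_subset by blast
  then have "V.span B = Hom C X Y i"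
    using subspace_Hom[OF assms] by (metis V.span_minimal subset_antisym)
  with B have *: "\<not> V.dependent (hbasis C X Y i) \<and> V.span (hbasis C X Y i) = Hom C X Y i"
    unfolding hbasis_def
    by (intro someI[of "\<lambda>B. \<not> V.dependent B \<and> V.span B = Hom C X Y i" B]) simp
  then show 1: "V.independent (hbasis C X Y i)" and 2: "V.span (hbasis C X Y i) = Hom C X Y i"
    by auto
  then show 3: "hbasis C X Y i \<subseteq> Hom C X Y i"
    using V.span_superset by metis
  obtain F where "finite F" "Hom C X Y i = V.span F"
    using fin_dim[OF assms] by blast
  with 1 3 show "finite (hbasis C X Y i)"
    using V.independent_span_bound by blast
qed

lemma hbasis_trivial: "X \<in> Obj C \<Longrightarrow> Y \<in> Obj C \<Longrightarrow> Hom C X Y i = {0} \<Longrightarrow> hbasis C X Y i = {}"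
  using hbasis_props[of X Y i] V.dependent_zero by (metis insert_absorb subset_singletonD singletonI)

lemma lin_on_sum:
  assumes f: "lin_on C S S' f" and S: "V.subspace S" and x: "\<And>t. t \<in> T \<Longrightarrow> x t \<in> S"
  shows "f (\<Sum>t\<in>T. scl C (c t) (x t)) = (\<Sum>t\<in>T. scl C (c t) (f (x t)))"
proof -
  have "0 \<in> S"
    using S V.subspace_0 by blast
  then have "f (scl C 1 0 + 0) = scl C 1 (f 0) + f 0"
    using f unfolding lin_on_def by blast
  then have f0: "f 0 = 0"
    by simp
  show ?thesis
    using x
  proof (induction T rule: infinite_finite_induct)
    case (insert t T)
    then have "(\<Sum>t\<in>T. scl C (c t) (x t)) \<in> S" "x t \<in> S"
      using S by (auto intro!: V.subspace_sum V.subspace_scale)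
    with f insert show ?case
      by (simp add: lin_on_def)
  qed (auto simp: f0)
qed

lemma representation_hbasis_sum:
  assumes "X \<in> Obj C" "Y \<in> Obj C" "\<And>t. t \<in> T \<Longrightarrow> x t \<in> Hom C X Y i"
  shows "V.representation (hbasis C X Y i) (\<Sum>t\<in>T. scl C (c t) (x t)) b =
    (\<Sum>t\<in>T. c t * V.representation (hbasis C X Y i) (x t) b)"
proof -
  note B = hbasis_props[OF assms(1,2), of i]
  show ?thesis
    using assms(3)
  proof (induction T rule: infinite_finite_induct)
    case (insert t T)
    then have "(\<Sum>t\<in>T. scl C (c t) (x t)) \<in> Hom C X Y i" "x t \<in> Hom C X Y i"
      using subspace_Hom[OF assms(1,2)] by (auto intro!: V.subspace_sum V.subspace_scale)
    with B insert subspace_Hom[OF assms(1,2), of i] show ?case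
      by (simp add: V.representation_add V.representation_scale V.subspace_scale)
  qed (simp_all add: V.representation_zero)
qed

text \<open>Expanding in both bases, either trace is the double sum of the products of matrix
  entries of \<open>f\<close> and \<open>g\<close>. The two spaces may be different.\<close>

lemma tr_commute:
  assumes "X \<in> Obj C" "Y \<in> Obj C" "X' \<in> Obj C" "Y' \<in> Obj C"
    and f: "lin_on C (Hom C X Y i) (Hom C X' Y' j) f"
    and g: "lin_on C (Hom C X' Y' j) (Hom C X Y i) g"
  shows "tr C X Y i (\<lambda>v. g (f v)) = tr C X' Y' j (\<lambda>v. f (g v))"
proof -
  let ?B = "hbasis C X Y i" and ?B' = "hbasis C X' Y' j"
  let ?r = "V.representation ?B" and ?r' = "V.representation ?B'"
  note B = hbasis_props[OF assms(1,2), of i] and B' = hbasis_props[OF assms(3,4), of j]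
  have 1: "?r (g (f b)) b = (\<Sum>b'\<in>?B'. ?r' (f b) b' * ?r (g b') b)" if "b \<in> ?B" for b
  proof -
    have fb: "f b \<in> Hom C X' Y' j"
      using f B that by (auto simp: lin_on_def)
    then have "f b = (\<Sum>b'\<in>?B'. scl C (?r' (f b) b') b')"
      using V.sum_representation_eq[of ?B' "f b" ?B'] B' by simp
    then have "g (f b) = g (\<Sum>b'\<in>?B'. scl C (?r' (f b) b') b')"
      by simp
    also have "\<dots> = (\<Sum>b'\<in>?B'. scl C (?r' (f b) b') (g b'))"
      using B' subspace_Hom assms by (intro lin_on_sum[OF g]) auto
    finally show ?thesis
      using B B' g assms(1,2) by (simp add: representation_hbasis_sum lin_on_def subset_iff)
  qed
  have 2: "?r' (f (g b')) b' = (\<Sum>b\<in>?B. ?r (g b') b * ?r' (f b) b')" if "b' \<in> ?B'" for b'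
  proof -
    have "g b' \<in> Hom C X Y i"
      using g B' that by (auto simp: lin_on_def)
    then have "g b' = (\<Sum>b\<in>?B. scl C (?r (g b') b) b)"
      using V.sum_representation_eq[of ?B "g b'" ?B] B by simp
    then have "f (g b') = f (\<Sum>b\<in>?B. scl C (?r (g b') b) b)"
      by simp
    also have "\<dots> = (\<Sum>b\<in>?B. scl C (?r (g b') b) (f b))"
      using B subspace_Hom assms by (intro lin_on_sum[OF f]) auto
    finally show ?thesis
      using B B' f assms(3,4) by (simp add: representation_hbasis_sum lin_on_def subset_iff)
  qed
  show ?thesis
    unfolding tr_def using 1 2 by simp (subst sum.swap, simp add: mult.commute)
qed

lemma gtr_cong:
  assumes "X \<in> Obj C" "Y \<in> Obj C" "\<And>i v. v \<in> Hom C X Y i \<Longrightarrow> F (Arr X Y i v) = G (Arr X Y i v)"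
  shows "gtr C t X Y F = gtr C t X Y G"
  unfolding gtr_def tr_def using assms hbasis_props(4)[OF assms(1,2)]
  by (intro sum.cong arg_cong2[where f = "(*)"] refl) (auto simp: subset_iff)

text \<open>Letting one more odd operation pass \<open>c\<close> amounts to one more unit in the
  total degree \<open>t\<close>.\<close>

lemma gtr_shift:
  assumes "X \<in> Obj C" "Y \<in> Obj C" "endo C X Y F"
  shows "gtr C t X Y (\<lambda>c. scl C (ksign (sdeg c)) (F c)) = gtr C (t + 1) X Y F"
proof -
  have "tr C X Y i (\<lambda>v. scl C c (F (Arr X Y i v))) = c * tr C X Y i (\<lambda>v. F (Arr X Y i v))" for i c
    unfolding tr_def sum_distrib_left
    using hbasis_props[OF assms(1,2), of i] assms(3)
    by (intro sum.cong refl) (auto simp: V.representation_scale endo_def subset_iff)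
  then show ?thesis
    unfolding gtr_def by (intro sum.cong refl) (auto simp: sdeg_def ksign_def split: if_splits)
qed

lemma gtr_scale:
  assumes "X \<in> Obj C" "Y \<in> Obj C" "endo C X Y F"
  shows "gtr C t X Y (\<lambda>c. scl C k (F c)) = k * gtr C t X Y F"
proof -
  have "tr C X Y i (\<lambda>v. scl C c (F (Arr X Y i v))) = c * tr C X Y i (\<lambda>v. F (Arr X Y i v))" for i c
    unfolding tr_def sum_distrib_left
    using hbasis_props[OF assms(1,2), of i] assms(3)
    by (intro sum.cong refl) (auto simp: V.representation_scale endo_def subset_iff)
  then show ?thesis
    unfolding gtr_def sum_distrib_left by (intro sum.cong refl) auto
qed

lemma gtr_add:
  assumes "X \<in> Obj C" "Y \<in> Obj C" "endo C X Y F" "endo C X Y G"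
  shows "gtr C t X Y (\<lambda>c. F c + G c) = gtr C t X Y F + gtr C t X Y G"
proof -
  have "tr C X Y i (\<lambda>v. F (Arr X Y i v) + G (Arr X Y i v)) =
      tr C X Y i (\<lambda>v. F (Arr X Y i v)) + tr C X Y i (\<lambda>v. G (Arr X Y i v))" for i
    unfolding tr_def sum.distrib[symmetric]
    using hbasis_props[OF assms(1,2), of i] assms(3,4)
    by (intro sum.cong refl) (auto simp: V.representation_add endo_def subset_iff)
  then show ?thesis
    unfolding gtr_def by (simp add: distrib_left sum.distrib)
qed

lemma gtr_zero [simp]: "gtr C t X Y (\<lambda>c. 0) = 0"
  by (simp add: gtr_def tr_def V.representation_zero)

lemma endo_zero: "X \<in> Obj C \<Longrightarrow> Y \<in> Obj C \<Longrightarrow> endo C X Y (\<lambda>c. 0)"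
  using V.subspace_0[OF subspace_Hom] by (auto simp: endo_def)

lemma endo_add: "X \<in> Obj C \<Longrightarrow> Y \<in> Obj C \<Longrightarrow> endo C X Y F \<Longrightarrow> endo C X Y G \<Longrightarrow> endo C X Y (\<lambda>c. F c + G c)"
  using V.subspace_add[OF subspace_Hom] by (auto simp: endo_def)

lemma endo_scale: "X \<in> Obj C \<Longrightarrow> Y \<in> Obj C \<Longrightarrow> endo C X Y F \<Longrightarrow> endo C X Y (\<lambda>c. scl C (k c) (F c))"
  using V.subspace_scale[OF subspace_Hom] by (auto simp: endo_def)

lemma endo_sum:
  "X \<in> Obj C \<Longrightarrow> Y \<in> Obj C \<Longrightarrow> (\<And>s. s \<in> T \<Longrightarrow> endo C X Y (F s)) \<Longrightarrow> endo C X Y (\<lambda>c. \<Sum>s\<in>T. F s c)"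
  by (induction T rule: infinite_finite_induct) (auto intro: endo_zero endo_add)

lemma gtr_sum:
  assumes "X \<in> Obj C" "Y \<in> Obj C" "\<And>s. s \<in> T \<Longrightarrow> endo C X Y (F s)"
  shows "gtr C t X Y (\<lambda>c. \<Sum>s\<in>T. F s c) = (\<Sum>s\<in>T. gtr C t X Y (F s))"
  using assms(3)
  by (induction T rule: infinite_finite_induct) (auto simp: gtr_add endo_sum assms(1,2))

end

section \<open>Nested operations under the trace\<close>

text \<open>The trace that enters the Mukai pairing. The base points are read off the whole words
  \<open>A1 @ A2\<close> and \<open>B1 @ B2\<close>, so that single arcs may be empty.\<close>

definition T2 :: "('k::field, 'o, 'v::ab_group_add, 'z) ainf_scheme \<Rightarrow> int \<Rightarrow> ('o, 'v) arr list \<Rightarrow>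
    ('o, 'v) arr list \<Rightarrow> ('o, 'v) arr list \<Rightarrow> ('o, 'v) arr list \<Rightarrow> 'k" where
  "T2 C t A1 A2 B1 B2 = gtr C t (src (hd (A1 @ A2))) (src (hd (B1 @ B2)))
     (\<lambda>c. mop C (A1 @ mres C (A2 @ c # B1) # B2))"

text \<open>Three nested operations, i.e. three concentric ones on an annulus with the letters of
  one word on the left and those of the other on the right. These are the terms in which the
  A-infinity relation of an operation with argument \<open>c\<close> differs from insertions into
  the arcs.\<close>

definition T3 :: "('k::field, 'o, 'v::ab_group_add, 'z) ainf_scheme \<Rightarrow> int \<Rightarrow> ('o, 'v) arr list \<Rightarrow>
    ('o, 'v) arr list \<Rightarrow> ('o, 'v) arr list \<Rightarrow> ('o, 'v) arr list \<Rightarrow> ('o, 'v) arr list \<Rightarrow>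
    ('o, 'v) arr list \<Rightarrow> 'k" where
  "T3 C t U V W X Y Z = gtr C t (src (hd (U @ V @ W))) (src (hd (X @ Y @ Z)))
     (\<lambda>c. mop C (U @ mres C (V @ mres C (W @ c # X) # Y) # Z))"

lemma src_hd_contract: "m \<noteq> [] \<Longrightarrow> src (hd (p @ mres C m # q)) = src (hd (p @ m @ q))"
  by (cases p) auto

lemma hochs_cut:
  assumes "p @ q \<in> hochs C"
  obtains X' where "path C (src (hd (p @ q))) p X'" "path C X' q (src (hd (p @ q)))"
    "src (hd (p @ q)) \<in> Obj C" "X' \<in> Obj C"
  using assms path_Obj[of C _ p] path_Obj[of C _ q] by (auto simp: hochs_def path_append)

lemma hochs_cut3:
  assumes "p @ q @ r \<in> hochs C"
  obtains X' X'' where "path C (src (hd (p @ q @ r))) p X'" "path C X' q X''"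
    "path C X'' r (src (hd (p @ q @ r)))" "src (hd (p @ q @ r)) \<in> Obj C" "X' \<in> Obj C" "X'' \<in> Obj C"
proof -
  from assms obtain X' where X': "path C (src (hd (p @ q @ r))) p X'"
    "path C X' (q @ r) (src (hd (p @ q @ r)))" "src (hd (p @ q @ r)) \<in> Obj C" "X' \<in> Obj C"
    by (rule hochs_cut)
  then obtain X'' where "path C X' q X''" "path C X'' r (src (hd (p @ q @ r)))"
    by (auto simp: path_append)
  with X' path_Obj[of C X' q X''] that show thesis
    by auto
qed

lemma hochs_rotate: "p @ q \<in> hochs C \<Longrightarrow> q @ p \<in> hochs C"
proof -
  assume a: "p @ q \<in> hochs C"
  then obtain X' where p: "path C (src (hd (p @ q))) p X'" "path C X' q (src (hd (p @ q)))"
    by (rule hochs_cut)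
  then have "path C X' (q @ p) X'"
    by (auto simp: path_append)
  moreover have "q @ p \<noteq> []"
    using a by (auto simp: hochs_def)
  ultimately show "q @ p \<in> hochs C"
    using path_hd[of C X' "q @ p" X'] by (simp add: hochs_def)
qed

context fin_ainf begin

lemma hochs_contract: "p @ m @ q \<in> hochs C \<Longrightarrow> m \<noteq> [] \<Longrightarrow> p @ mres C m # q \<in> hochs C"
  using path_contract[of _ p m q] by (auto simp: hochs_def src_hd_contract)

lemma wrap_path:
  assumes "path C X A X'" "path C X' L Y'" "path C Y' B Y" "L \<noteq> []"
  shows "path C X (A @ mres C L # B) Y"
proof -
  have "path C X (A @ L @ B) Y"
    using assms(1-3) by (auto simp: path_append)
  then show ?thesis
    using path_contract[of X A L B Y] assms(4) by simp
qed

lemma mop_lin_on: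
  assumes "path C X A X'" "path C Y' B Y" "j = sd A + sd B + i + 1"
  shows "lin_on C (Hom C X' Y' i) (Hom C X Y j) (\<lambda>v. mop C (A @ Arr X' Y' i v # B))"
proof -
  have O: "X' \<in> Obj C" "Y' \<in> Obj C"
    using assms(1,2) path_Obj by fast+
  have p: "path C X (A @ Arr X' Y' i v # B) Y" if "v \<in> Hom C X' Y' i" for v
    using that assms(1,2) O by (auto simp: path_append Arr_in_arrows)
  show ?thesis
    unfolding lin_on_def
    using mop_in_Hom[OF p] mop_lin[OF p p] assms(3) by (auto simp: sdeg_def algebra_simps)
qed

text \<open>Each of the two operations has degree 1 on the shifted spaces, so the composite
  preserves the degree of \<open>c\<close> exactly if the other letters have total degree -2. With
  three operations the number is -3.\<close>

lemma endo_T2: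
  assumes "A1 @ A2 \<in> hochs C" "B1 @ B2 \<in> hochs C" "sd A1 + sd A2 + sd B1 + sd B2 = - 2"
    "X = src (hd (A1 @ A2))" "Y = src (hd (B1 @ B2))"
  shows "endo C X Y (\<lambda>c. mop C (A1 @ mres C (A2 @ c # B1) # B2))"
  unfolding endo_def
proof (intro allI ballI)
  fix i v assume v: "v \<in> Hom C X Y i"
  obtain X' where X: "path C X A1 X'" "path C X' A2 X" "X \<in> Obj C"
    using assms(1,4) by (auto elim: hochs_cut)
  obtain Y' where Y: "path C Y B1 Y'" "path C Y' B2 Y" "Y \<in> Obj C"
    using assms(2,5) by (auto elim: hochs_cut)
  have "path C X' (A2 @ Arr X Y i v # B1) Y'"
    using X Y v by (auto simp: path_append Arr_in_arrows)
  then have "path C X (A1 @ mres C (A2 @ Arr X Y i v # B1) # B2) Y"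
    using wrap_path X Y by blast
  then show "mop C (A1 @ mres C (A2 @ Arr X Y i v # B1) # B2) \<in> Hom C X Y i"
    using assms(3) by (intro mop_in_Hom) (auto simp: sdeg_def)
qed

lemma endo_T3:
  assumes "U @ V @ W \<in> hochs C" "P @ Q @ R \<in> hochs C"
    "sd U + sd V + sd W + sd P + sd Q + sd R = - 3"
    "X = src (hd (U @ V @ W))" "Y = src (hd (P @ Q @ R))"
  shows "endo C X Y (\<lambda>c. mop C (U @ mres C (V @ mres C (W @ c # P) # Q) # R))"
  unfolding endo_def
proof (intro allI ballI)
  fix i v assume v: "v \<in> Hom C X Y i"
  obtain X' X'' where X: "path C X U X'" "path C X' V X''" "path C X'' W X" "X \<in> Obj C"
    using assms(1,4) by (auto elim: hochs_cut3)
  obtain Y' Y'' where Y: "path C Y P Y'" "path C Y' Q Y''" "path C Y'' R Y" "Y \<in> Obj C"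
    using assms(2,5) by (auto elim: hochs_cut3)
  have "path C X'' (W @ Arr X Y i v # P) Y'"
    using X Y v by (auto simp: path_append Arr_in_arrows)
  then have "path C X' (V @ mres C (W @ Arr X Y i v # P) # Q) Y''"
    using wrap_path X Y by blast
  then have "path C X (U @ mres C (V @ mres C (W @ Arr X Y i v # P) # Q) # R) Y"
    using wrap_path X Y by blast
  then show "mop C (U @ mres C (V @ mres C (W @ Arr X Y i v # P) # Q) # R) \<in> Hom C X Y i"
    using assms(3) by (intro mop_in_Hom) (auto simp: sdeg_def)
qed

text \<open>The A-infinity relation for \<open>L\<close> is a vanishing combination of elements of
  one single Hom space, and the outer operation is linear in that slot.\<close>

lemma wrap_rel:
  assumes p: "path C X A X'" "path C X' L Y'" "path C Y' B Y" "L \<noteq> []"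
  shows "(\<Sum>(p, m, q)\<in>D3 L. if m = [] then 0
     else scl C (ksign (sd p)) (mop C (A @ mres C (p @ mres C m # q) # B))) = 0"
proof -
  \<comment> \<open>Two operations raise the shifted degree by 2, and the unshifted degree is one
    more.\<close>
  define j where "j = sd L + 3"
  let ?f = "\<lambda>v. mop C (A @ Arr X' Y' j v # B)"
  define k where "k = (\<lambda>t::('o, 'v) arr list \<times> ('o, 'v) arr list \<times> ('o, 'v) arr list.
    if fst (snd t) = [] then 0 else ksign (sd (fst t)) :: 'k)"
  define x where "x = (\<lambda>t. if fst (snd t) = [] then 0 else mop C (fst t @ mres C (fst (snd t)) # snd (snd t)))"
  have O: "X' \<in> Obj C" "Y' \<in> Obj C"
    using p path_Obj by fast+
  have lin: "lin_on C (Hom C X' Y' j) (Hom C X Y (sd A + sd B + j + 1)) ?f"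
    using p by (intro mop_lin_on) auto
  have x: "x t \<in> Hom C X' Y' j" if "t \<in> D3 L" for t
    using that p(2) mop_in_Hom[OF path_contract[of X' "fst t" "fst (snd t)" "snd (snd t)" Y'], of j]
      V.subspace_0[OF subspace_Hom[OF O]]
    by (auto simp: x_def D3_def j_def)
  have rel: "(\<Sum>t\<in>D3 L. scl C (k t) (x t)) = 0"
    using ainf_rel[OF p(4,2)] unfolding k_def x_def split_def by (simp add: if_distrib cong: if_cong)
  have m: "mres C (p @ mres C m # q) = Arr X' Y' j (mop C (p @ mres C m # q))"
    if "p @ m @ q = L" "m \<noteq> []" for p m q
    using mres_path[OF path_contract[of X' p m q Y']] that p(2) by (auto simp: j_def)
  have "?f 0 = 0"
    using lin_on_sum[OF lin subspace_Hom[OF O], of "{}" x k] by simp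
  then have "0 = ?f (\<Sum>t\<in>D3 L. scl C (k t) (x t))"
    by (simp add: rel)
  also have "\<dots> = (\<Sum>t\<in>D3 L. scl C (k t) (?f (x t)))"
    using x by (rule lin_on_sum[OF lin subspace_Hom[OF O]])
  also have "\<dots> = (\<Sum>(p, m, q)\<in>D3 L. if m = [] then 0
     else scl C (ksign (sd p)) (mop C (A @ mres C (p @ mres C m # q) # B)))"
    by (intro sum.cong refl) (auto simp: k_def x_def m D3_def)
  finally show ?thesis ..
qed

lemma gtr_if_scale:
  assumes "X \<in> Obj C" "Y \<in> Obj C" "\<not> P \<Longrightarrow> endo C X Y F"
  shows "gtr C t X Y (\<lambda>c. if P then 0 else scl C k (F c)) = (if P then 0 else k * gtr C t X Y F)"
    "endo C X Y (\<lambda>c. if P then 0 else scl C k (F c))"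
  using assms by (cases P; simp add: gtr_scale endo_zero endo_scale)+

text \<open>The A-infinity relation for \<open>A2 @ c # B1\<close>, put under the outer operation
  and traced. A block that avoids \<open>c\<close> is an insertion into \<open>A2\<close> or
  \<open>B1\<close>; a block around \<open>c\<close> gives three nested operations. An operation
  inserted into \<open>B1\<close> has to pass \<open>c\<close>, which is the shift of
  \<open>t\<close>. The total degree is -3 because three operations occur.\<close>

lemma T2_inner:
  assumes A: "A1 @ A2 \<in> hochs C" and B: "B1 @ B2 \<in> hochs C"
    and deg: "sd A1 + sd A2 + sd B1 + sd B2 = - 3"
  shows "ins C A2 (\<lambda>A. T2 C t A1 A B1 B2) + ksign (sd A2) * ins C B1 (\<lambda>B. T2 C (t + 1) A1 A2 B B2) +
    (\<Sum>(A', A'')\<in>D2 A2. \<Sum>(B', B'')\<in>D2 B1. ksign (sd A') * T3 C t A1 A' A'' B' B'' B2) = 0"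
proof -
  define X where "X = src (hd (A1 @ A2))"
  define Y where "Y = src (hd (B1 @ B2))"
  obtain X' where X: "path C X A1 X'" "path C X' A2 X" "X \<in> Obj C"
    using A X_def by (auto elim: hochs_cut)
  obtain Y' where Y: "path C Y B1 Y'" "path C Y' B2 Y" "Y \<in> Obj C"
    using B Y_def by (auto elim: hochs_cut)
  note O = X(3) Y(3)
  define G1 where "G1 = (\<lambda>(p, m, q) c. if m = [] then 0 else scl C (ksign (sd p))
    (mop C (A1 @ mres C ((p @ mres C m # q) @ c # B1) # B2)))"
  define G2 where "G2 = (\<lambda>(s, m, q) c. if m = [] then 0 else scl C (ksign (sd A2 + sd s))
    (scl C (ksign (sdeg c)) (mop C (A1 @ mres C (A2 @ c # s @ mres C m # q) # B2))))"
  define G3 where "G3 = (\<lambda>(p, s) (s', q) c. scl C (ksign (sd p))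
    (mop C (A1 @ mres C (p @ mres C (s @ c # s') # q) # B2)))"
  have 1: "gtr C t X Y (G1 (p, m, q)) = (if m = [] then 0 else ksign (sd p) * T2 C t A1 (p @ mres C m # q) B1 B2)
    \<and> endo C X Y (G1 (p, m, q))"
    if "(p, m, q) \<in> D3 A2" for p m q
  proof -
    have "endo C X Y (\<lambda>c. mop C (A1 @ mres C ((p @ mres C m # q) @ c # B1) # B2))" if "m \<noteq> []"
      using that \<open>(p, m, q) \<in> D3 A2\<close> A B hochs_contract[of "A1 @ p" m q] deg
      by (intro endo_T2) (auto simp: X_def Y_def D3_def src_hd_contract[of m "A1 @ p", simplified])
    from gtr_if_scale[OF O this, where P = "m = []"] show ?thesis
      using that src_hd_contract[of m "A1 @ p" C q]
      by (auto simp: G1_def T2_def X_def Y_def D3_def)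
  qed
  have 2: "gtr C t X Y (G2 (s, m, q)) = (if m = [] then 0 else ksign (sd A2 + sd s) * T2 C (t + 1) A1 A2 (s @ mres C m # q) B2)
    \<and> endo C X Y (G2 (s, m, q))"
    if "(s, m, q) \<in> D3 B1" for s m q
  proof -
    have e: "endo C X Y (\<lambda>c. mop C (A1 @ mres C (A2 @ c # s @ mres C m # q) # B2))" if "m \<noteq> []"
      using that \<open>(s, m, q) \<in> D3 B1\<close> A B hochs_contract[of s m "q @ B2"] deg
      by (intro endo_T2) (auto simp: X_def Y_def D3_def src_hd_contract)
    note e' = endo_scale[OF O e, of "\<lambda>c. ksign (sdeg c)"]
    from gtr_if_scale[OF O e', where P = "m = []"] gtr_shift[OF O e] show ?thesis
      using that src_hd_contract[of m s C "q @ B2"]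
      by (auto simp: G2_def T2_def X_def Y_def D3_def)
  qed
  have 3: "gtr C t X Y (G3 (p, s) (s', q)) = ksign (sd p) * T3 C t A1 p s s' q B2
    \<and> endo C X Y (G3 (p, s) (s', q))"
    if "(p, s) \<in> D2 A2" "(s', q) \<in> D2 B1" for p s s' q
  proof -
    have "endo C X Y (\<lambda>c. mop C (A1 @ mres C (p @ mres C (s @ c # s') # q) # B2))"
      using that A B deg by (intro endo_T3) (auto simp: X_def Y_def D2_def)
    from gtr_if_scale[OF O this, where P = False] show ?thesis
      using that by (auto simp: G3_def T3_def X_def Y_def D2_def)
  qed
  have "(\<Sum>x\<in>D3 A2. G1 x c) + (\<Sum>x\<in>D3 B1. G2 x c) + (\<Sum>x\<in>D2 A2. \<Sum>y\<in>D2 B1. G3 x y c) = 0"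
    if c: "c = Arr X Y i v" "v \<in> Hom C X Y i" for c i v
  proof -
    have "path C X' (A2 @ c # B1) Y'"
      using X Y c by (auto simp: path_append Arr_in_arrows)
    from wrap_rel[OF X(1) this Y(2)] show ?thesis
      unfolding sum_D3_mid unfolding G1_def G2_def G3_def split_def
      by (simp add: add_ac mult_ac ksign_add cong: if_cong)
  qed
  then have "gtr C t X Y (\<lambda>c. (\<Sum>x\<in>D3 A2. G1 x c) + (\<Sum>x\<in>D3 B1. G2 x c) +
      (\<Sum>x\<in>D2 A2. \<Sum>y\<in>D2 B1. G3 x y c)) = gtr C t X Y (\<lambda>c. 0)"
    by (intro gtr_cong O) auto
  also have "gtr C t X Y (\<lambda>c. (\<Sum>x\<in>D3 A2. G1 x c) + (\<Sum>x\<in>D3 B1. G2 x c) +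
      (\<Sum>x\<in>D2 A2. \<Sum>y\<in>D2 B1. G3 x y c)) =
     (\<Sum>x\<in>D3 A2. gtr C t X Y (G1 x)) + (\<Sum>x\<in>D3 B1. gtr C t X Y (G2 x)) +
      (\<Sum>x\<in>D2 A2. \<Sum>y\<in>D2 B1. gtr C t X Y (G3 x y))"
    using 1 2 3 by (subst gtr_add gtr_sum; auto intro!: O endo_add endo_sum sum.cong gtr_sum)+
  also have "\<dots> = ins C A2 (\<lambda>A. T2 C t A1 A B1 B2) + ksign (sd A2) * ins C B1 (\<lambda>B. T2 C (t + 1) A1 A2 B B2) +
    (\<Sum>(A', A'')\<in>D2 A2. \<Sum>(B', B'')\<in>D2 B1. ksign (sd A') * T3 C t A1 A' A'' B' B'' B2)"
    unfolding ins_def sum_distrib_left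
    using 1 2 3 by (intro arg_cong2[where f = "(+)"] sum.cong refl) (auto simp: ksign_add intro!: sum.cong)
  finally show ?thesis
    by simp
qed

text \<open>The A-infinity relation for the word of the outer operation, in which the inner result
  is the distinguished letter. The \<open>+ 1\<close> in the sign is the degree of the inner
  operation, which an operation inserted into \<open>B2\<close> has to pass.\<close>

lemma T2_outer:
  assumes A: "A1 @ A2 \<in> hochs C" and B: "B1 @ B2 \<in> hochs C"
    and deg: "sd A1 + sd A2 + sd B1 + sd B2 = - 3"
  shows "ins C A1 (\<lambda>A. T2 C t A A2 B1 B2) +
    ksign (sd A1 + sd A2 + sd B1 + 1) * ins C B2 (\<lambda>B. T2 C (t + 1) A1 A2 B1 B) +
    (\<Sum>(A', A'')\<in>D2 A1. \<Sum>(B', B'')\<in>D2 B2. ksign (sd A') * T3 C t A' A'' A2 B1 B' B'') = 0"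
proof -
  define X where "X = src (hd (A1 @ A2))"
  define Y where "Y = src (hd (B1 @ B2))"
  obtain X' where X: "path C X A1 X'" "path C X' A2 X" "X \<in> Obj C"
    using A X_def by (auto elim: hochs_cut)
  obtain Y' where Y: "path C Y B1 Y'" "path C Y' B2 Y" "Y \<in> Obj C"
    using B Y_def by (auto elim: hochs_cut)
  note O = X(3) Y(3)
  define G1 where "G1 = (\<lambda>(p, m, q) c. if m = [] then 0 else scl C (ksign (sd p))
    (mop C ((p @ mres C m # q) @ mres C (A2 @ c # B1) # B2)))"
  define G2 where "G2 = (\<lambda>(s, m, q) c. if m = [] then 0 else scl C (ksign (sd A1 + sd A2 + sd B1 + 1 + sd s))
    (scl C (ksign (sdeg c)) (mop C (A1 @ mres C (A2 @ c # B1) # s @ mres C m # q))))"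
  define G3 where "G3 = (\<lambda>(p, s) (s', q) c. scl C (ksign (sd p))
    (mop C (p @ mres C (s @ mres C (A2 @ c # B1) # s') # q)))"
  have 1: "gtr C t X Y (G1 (p, m, q)) = (if m = [] then 0 else ksign (sd p) * T2 C t (p @ mres C m # q) A2 B1 B2)
    \<and> endo C X Y (G1 (p, m, q))"
    if "(p, m, q) \<in> D3 A1" for p m q
  proof -
    have "endo C X Y (\<lambda>c. mop C ((p @ mres C m # q) @ mres C (A2 @ c # B1) # B2))" if "m \<noteq> []"
      using that \<open>(p, m, q) \<in> D3 A1\<close> A B hochs_contract[of p m "q @ A2"] deg
      by (intro endo_T2) (auto simp: X_def Y_def D3_def src_hd_contract)
    from gtr_if_scale[OF O this, where P = "m = []"] show ?thesis
      using that src_hd_contract[of m p C "q @ A2"]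
      by (auto simp: G1_def T2_def X_def Y_def D3_def)
  qed
  have 2: "gtr C t X Y (G2 (s, m, q)) = (if m = [] then 0
       else ksign (sd A1 + sd A2 + sd B1 + 1 + sd s) * T2 C (t + 1) A1 A2 B1 (s @ mres C m # q))
    \<and> endo C X Y (G2 (s, m, q))"
    if "(s, m, q) \<in> D3 B2" for s m q
  proof -
    have e: "endo C X Y (\<lambda>c. mop C (A1 @ mres C (A2 @ c # B1) # s @ mres C m # q))" if "m \<noteq> []"
      using that \<open>(s, m, q) \<in> D3 B2\<close> A B hochs_contract[of "B1 @ s" m q] deg
      by (intro endo_T2) (auto simp: X_def Y_def D3_def src_hd_contract[of m "B1 @ s", simplified])
    note e' = endo_scale[OF O e, of "\<lambda>c. ksign (sdeg c)"]
    from gtr_if_scale[OF O e', where P = "m = []"] gtr_shift[OF O e] show ?thesis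
      using that src_hd_contract[of m "B1 @ s" C q]
      by (auto simp: G2_def T2_def X_def Y_def D3_def)
  qed
  have 3: "gtr C t X Y (G3 (p, s) (s', q)) = ksign (sd p) * T3 C t p s A2 B1 s' q
    \<and> endo C X Y (G3 (p, s) (s', q))"
    if "(p, s) \<in> D2 A1" "(s', q) \<in> D2 B2" for p s s' q
  proof -
    have "endo C X Y (\<lambda>c. mop C (p @ mres C (s @ mres C (A2 @ c # B1) # s') # q))"
      using that A B deg by (intro endo_T3) (auto simp: X_def Y_def D2_def)
    from gtr_if_scale[OF O this, where P = False] show ?thesis
      using that by (auto simp: G3_def T3_def X_def Y_def D2_def)
  qed
  have "(\<Sum>x\<in>D3 A1. G1 x c) + (\<Sum>x\<in>D3 B2. G2 x c) + (\<Sum>x\<in>D2 A1. \<Sum>y\<in>D2 B2. G3 x y c) = 0"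
    if c: "c = Arr X Y i v" "v \<in> Hom C X Y i" for c i v
  proof -
    have "path C X' (A2 @ c # B1) Y'"
      using X Y c by (auto simp: path_append Arr_in_arrows)
    from ainf_rel[OF _ wrap_path[OF X(1) this Y(2)]] show ?thesis
      unfolding sum_D3_mid unfolding G1_def G2_def G3_def split_def
      by (simp add: add_ac mult_ac ksign_add cong: if_cong)
  qed
  then have "gtr C t X Y (\<lambda>c. (\<Sum>x\<in>D3 A1. G1 x c) + (\<Sum>x\<in>D3 B2. G2 x c) +
      (\<Sum>x\<in>D2 A1. \<Sum>y\<in>D2 B2. G3 x y c)) = gtr C t X Y (\<lambda>c. 0)"
    by (intro gtr_cong O) auto
  also have "gtr C t X Y (\<lambda>c. (\<Sum>x\<in>D3 A1. G1 x c) + (\<Sum>x\<in>D3 B2. G2 x c) +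
      (\<Sum>x\<in>D2 A1. \<Sum>y\<in>D2 B2. G3 x y c)) =
     (\<Sum>x\<in>D3 A1. gtr C t X Y (G1 x)) + (\<Sum>x\<in>D3 B2. gtr C t X Y (G2 x)) +
      (\<Sum>x\<in>D2 A1. \<Sum>y\<in>D2 B2. gtr C t X Y (G3 x y))"
    using 1 2 3 by (subst gtr_add gtr_sum; auto intro!: O endo_add endo_sum sum.cong gtr_sum)+
  also have "\<dots> = ins C A1 (\<lambda>A. T2 C t A A2 B1 B2) +
    ksign (sd A1 + sd A2 + sd B1 + 1) * ins C B2 (\<lambda>B. T2 C (t + 1) A1 A2 B1 B) +
    (\<Sum>(A', A'')\<in>D2 A1. \<Sum>(B', B'')\<in>D2 B2. ksign (sd A') * T3 C t A' A'' A2 B1 B' B'')"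
    unfolding ins_def sum_distrib_left
    using 1 2 3 by (intro arg_cong2[where f = "(+)"] sum.cong refl) (auto simp: ksign_add intro!: sum.cong)
  finally show ?thesis
    by simp
qed

end

context fin_ainf begin

lemma gtr_superset:
  assumes "X \<in> Obj C" "Y \<in> Obj C" "finite I" "{i. Hom C X Y i \<noteq> {0}} \<subseteq> I"
  shows "gtr C t X Y F = (\<Sum>i\<in>I. ksign (i + (i - 1) * t) * tr C X Y i (\<lambda>v. F (Arr X Y i v)))"
  unfolding gtr_def using assms by (intro sum.mono_neutral_left) (auto simp: tr_def hbasis_trivial)

lemma tr_cong:
  assumes "X \<in> Obj C" "Y \<in> Obj C" "\<And>v. v \<in> Hom C X Y i \<Longrightarrow> f v = g v"
  shows "tr C X Y i f = tr C X Y i g"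
  unfolding tr_def using assms hbasis_props(4)[OF assms(1,2)]
  by (intro sum.cong refl) (auto simp: subset_iff)

lemma lin_on_comp: "lin_on C S S' f \<Longrightarrow> lin_on C S' S'' g \<Longrightarrow> lin_on C S S'' (\<lambda>v. g (f v))"
  by (auto simp: lin_on_def)

lemma lin_on_cong:
  assumes "V.subspace S" "lin_on C S S' f" "\<And>v. v \<in> S \<Longrightarrow> g v = f v"
  shows "lin_on C S S' g"
  using assms(2,3) V.subspace_add[OF assms(1)] V.subspace_scale[OF assms(1)] by (simp add: lin_on_def)

text \<open>Cyclicity of the supertrace. With \<open>F\<close> the innermost operation, of degree
  \<open>e\<close>, and \<open>G\<close> the composite of the two outer ones, the trace of
  \<open>G F\<close> equals that of \<open>F G\<close>, so the innermost operation becomes the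
  outermost. The sign is the quotient of the grading signs in degrees \<open>i\<close> and
  \<open>i + e\<close>.\<close>

lemma T3_rotate:
  assumes A: "U @ V @ W \<in> hochs C" and B: "P @ Q @ R \<in> hochs C"
    and deg: "sd U + sd V + sd W + sd P + sd Q + sd R = - 3"
  shows "T3 C t U V W P Q R = ksign ((sd W + sd P + 1) * (1 + t)) * T3 C t W U V Q R P"
proof -
  define e where "e = sd W + sd P + 1"
  define X where "X = src (hd (U @ V @ W))"
  define Y where "Y = src (hd (P @ Q @ R))"
  obtain X' X'' where X: "path C X U X'" "path C X' V X''" "path C X'' W X" "X \<in> Obj C" "X'' \<in> Obj C" "X' \<in> Obj C"
    using A X_def by (auto elim: hochs_cut3)
  obtain Y' Y'' where Y: "path C Y P Y'" "path C Y' Q Y''" "path C Y'' R Y" "Y \<in> Obj C" "Y' \<in> Obj C" "Y'' \<in> Obj C"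
    using B Y_def by (auto elim: hochs_cut3)
  have X'': "src (hd (W @ U @ V)) = X''"
    using A X path_hd[of C X'' "W @ U @ V" X''] by (auto simp: path_append hochs_def)
  have Y': "src (hd (Q @ R @ P)) = Y'"
    using B Y path_hd[of C Y' "Q @ R @ P" Y'] by (auto simp: path_append hochs_def)
  define F where "F = (\<lambda>i v. mop C (W @ Arr X Y i v # P))"
  define G where "G = (\<lambda>j w. mop C (U @ mres C (V @ Arr X'' Y' j w # Q) # R))"
  have F: "lin_on C (Hom C X Y i) (Hom C X'' Y' (i + e)) (F i)" for i
    unfolding F_def using X Y by (intro mop_lin_on) (auto simp: e_def)
  have mF: "mres C (W @ Arr X Y i v # P) = Arr X'' Y' (i + e) (F i v)" if "v \<in> Hom C X Y i" for i v
    using that X Y mres_path[of X'' "W @ Arr X Y i v # P" Y']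
    by (auto simp: path_append Arr_in_arrows F_def e_def sdeg_def)
  have mG': "mres C (V @ Arr X'' Y' j w # Q) =
      Arr X' Y'' (sd V + sd Q + j + 1) (mop C (V @ Arr X'' Y' j w # Q))"
    if "w \<in> Hom C X'' Y' j" for j w
    using that X Y mres_path[of X' "V @ Arr X'' Y' j w # Q" Y'']
    by (auto simp: path_append Arr_in_arrows sdeg_def)
  have G: "lin_on C (Hom C X'' Y' j) (Hom C X Y (j - e)) (G j)" for j
  proof -
    have "lin_on C (Hom C X'' Y' j) (Hom C X' Y'' (sd V + sd Q + j + 1)) (\<lambda>w. mop C (V @ Arr X'' Y' j w # Q))"
      using X Y by (intro mop_lin_on) auto
    moreover have "lin_on C (Hom C X' Y'' (sd V + sd Q + j + 1)) (Hom C X Y (j - e))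
        (\<lambda>u. mop C (U @ Arr X' Y'' (sd V + sd Q + j + 1) u # R))"
      using X Y deg by (intro mop_lin_on) (auto simp: e_def)
    ultimately have "lin_on C (Hom C X'' Y' j) (Hom C X Y (j - e))
       (\<lambda>w. mop C (U @ Arr X' Y'' (sd V + sd Q + j + 1) (mop C (V @ Arr X'' Y' j w # Q)) # R))"
      by (rule lin_on_comp)
    then show ?thesis
      using X Y mG' by (rule_tac lin_on_cong) (auto simp: G_def subspace_Hom)
  qed
  have mG: "mres C (U @ mres C (V @ Arr X'' Y' j w # Q) # R) = Arr X Y (j - e) (G j w)"
    if "w \<in> Hom C X'' Y' j" for j w
  proof -
    have "path C X' (V @ Arr X'' Y' j w # Q) Y''"
      using X Y that by (auto simp: path_append Arr_in_arrows)
    from mres_path[OF wrap_path[OF X(1) this Y(3)]] show ?thesis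
      using deg by (simp add: G_def e_def sdeg_def)
  qed
  \<comment> \<open>The degrees that matter for either trace are joined, so that both become sums
    over one finite index set, up to the translation by \<open>e\<close>.\<close>
  define I where "I = {i. Hom C X Y i \<noteq> {0}} \<union> (\<lambda>j. j - e) ` {j. Hom C X'' Y' j \<noteq> {0}}"
  have "finite I"
    using fin_deg X Y by (simp add: I_def)
  moreover have "{j. Hom C X'' Y' j \<noteq> {0}} \<subseteq> (\<lambda>i. i + e) ` I"
    by (force simp: I_def image_iff)
  ultimately have 2: "T3 C t W U V Q R P = (\<Sum>j\<in>(\<lambda>i. i + e) ` I. ksign (j + (j - 1) * t) *
      tr C X'' Y' j (\<lambda>w. mop C (W @ mres C (U @ mres C (V @ Arr X'' Y' j w # Q) # R) # P)))"
    unfolding T3_def X'' Y' using X Y by (intro gtr_superset) auto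
  have "T3 C t U V W P Q R = (\<Sum>i\<in>I. ksign (i + (i - 1) * t) *
      tr C X Y i (\<lambda>v. mop C (U @ mres C (V @ mres C (W @ Arr X Y i v # P) # Q) # R)))"
    unfolding T3_def X_def[symmetric] Y_def[symmetric]
    using X Y \<open>finite I\<close> by (intro gtr_superset) (auto simp: I_def)
  also have "\<dots> = (\<Sum>i\<in>I. ksign (i + (i - 1) * t) * tr C X Y i (\<lambda>v. G (i + e) (F i v)))"
    using X Y by (intro sum.cong arg_cong2[where f = "(*)"] refl tr_cong) (auto simp: mF G_def)
  also have "\<dots> = (\<Sum>i\<in>I. ksign (i + (i - 1) * t) * tr C X'' Y' (i + e) (\<lambda>w. F i (G (i + e) w)))"
    using X Y F G[of "_ + e"] by (intro sum.cong arg_cong2[where f = "(*)"] refl tr_commute) auto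
  also have "\<dots> = (\<Sum>i\<in>I. ksign (e * (1 + t)) * (ksign ((i + e) + ((i + e) - 1) * t) *
      tr C X'' Y' (i + e) (\<lambda>w. mop C (W @ mres C (U @ mres C (V @ Arr X'' Y' (i + e) w # Q) # R) # P))))"
  proof (intro sum.cong refl)
    fix i
    have "tr C X'' Y' (i + e) (\<lambda>w. F i (G (i + e) w)) =
        tr C X'' Y' (i + e) (\<lambda>w. mop C (W @ mres C (U @ mres C (V @ Arr X'' Y' (i + e) w # Q) # R) # P))"
      using X Y by (intro tr_cong) (auto simp: mG F_def)
    then show "ksign (i + (i - 1) * t) * tr C X'' Y' (i + e) (\<lambda>w. F i (G (i + e) w)) =
      ksign (e * (1 + t)) * (ksign ((i + e) + ((i + e) - 1) * t) *
      tr C X'' Y' (i + e) (\<lambda>w. mop C (W @ mres C (U @ mres C (V @ Arr X'' Y' (i + e) w # Q) # R) # P)))"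
      by (simp only:) (rule ksign_mult_eqI[symmetric], auto)
  qed
  also have "\<dots> = ksign (e * (1 + t)) * T3 C t W U V Q R P"
    unfolding 2 sum_distrib_left by (subst sum.reindex) (auto simp: inj_on_def)
  finally show ?thesis
    by (simp add: e_def)
qed

end

section \<open>The Mukai pairing and the Hochschild differential\<close>

text \<open>The supertrace as it stands in \<open>mukai\<close>, with its built-in degree test. It
  agrees with \<open>T2\<close> where the words are composable and the total degree is -2.\<close>

definition S2 :: "('k::field, 'o, 'v::ab_group_add, 'z) ainf_scheme \<Rightarrow> int \<Rightarrow> ('o, 'v) arr list \<Rightarrow>
    ('o, 'v) arr list \<Rightarrow> ('o, 'v) arr list \<Rightarrow> ('o, 'v) arr list \<Rightarrow> 'k" where
  "S2 C t A1 A2 B1 B2 = strace C (src (hd A1)) (src (hd B1))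
     (\<lambda>c. let r = mres C (A1 @ mres C (A2 @ c # B1) # B2)
          in Arr (src r) (tgt r) (deg r) (scl C (ksign (sdeg c * t)) (vec r)))"

lemma mukai_S2:
  "mukai C as bs = MA as (\<lambda>A1 A2. MA bs (\<lambda>B1 B2. ksign (sd A1) * S2 C (sd as) A1 A2 B1 B2))"
  unfolding mukai_def MA_index[symmetric] Let_def S2_def sum_distrib_left
  by (intro sum.cong refl) (simp add: ksign_add mult_ac)

lemma MA_eq_0:
  assumes "\<And>p m q. p @ m @ q = as \<Longrightarrow> p \<noteq> [] \<Longrightarrow> \<Phi> (q @ p) m = 0"
  shows "MA as \<Phi> = 0"
  using MA_cong[of as \<Phi> "\<lambda>_ _. 0"] assms by simp

text \<open>In every other total degree the traced map changes the degree of \<open>c\<close>, and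
  the degree test in \<open>strace\<close> fails.\<close>

lemma mukai_eq_0:
  assumes "sd as + sd bs \<noteq> - 2"
  shows "mukai C as bs = 0"
  unfolding mukai_S2
proof (rule MA_eq_0, rule MA_eq_0)
  fix p m q p' m' q' assume *: "p @ m @ q = as" "p' @ m' @ q' = bs"
  have "deg (let r = mres C ((q @ p) @ mres C (m @ Arr X Y i v # q' @ p') # m')
          in Arr (src r) (tgt r) (deg r) (scl C (ksign (sdeg (Arr X Y i v) * sd as)) (vec r))) \<noteq> i" for X Y i v
    using assms * by (auto simp: Let_def sdeg_def)
  then show "ksign (sd (q @ p)) * S2 C (sd as) (q @ p) m (q' @ p') m' = 0"
    unfolding S2_def strace_def by (simp add: sdeg_def)
qed

lemma MA_cong_hochs:
  assumes "as \<in> hochs C"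
    "\<And>A1 A2. A1 @ A2 \<in> hochs C \<Longrightarrow> A1 \<noteq> [] \<Longrightarrow> sd A1 + sd A2 = sd as \<Longrightarrow> \<Phi> A1 A2 = \<Phi>' A1 A2"
  shows "MA as \<Phi> = MA as \<Phi>'"
proof (rule MA_cong)
  fix p m q assume "p @ m @ q = as" "p \<noteq> []"
  then show "\<Phi> (q @ p) m = \<Phi>' (q @ p) m"
    using assms(1) hochs_rotate[of "p @ m" q C] by (intro assms(2)) auto
qed

lemma M1_cong:
  assumes "as \<in> hochs C"
    "\<And>U V W. U @ V @ W \<in> hochs C \<Longrightarrow> sd U + sd V + sd W = sd as \<Longrightarrow> \<Psi> U V W = \<Psi>' U V W"
  shows "M1 as \<Psi> = M1 as \<Psi>'"
  unfolding M1_def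
  using assms by (intro MA_cong_hochs[OF assms(1)] sum.cong refl) (auto simp: D2_def)

context fin_ainf begin

lemma S2_eq_T2:
  assumes A: "A1 @ A2 \<in> hochs C" "A1 \<noteq> []" and B: "B1 @ B2 \<in> hochs C" "B1 \<noteq> []"
    and deg: "sd A1 + sd A2 + sd B1 + sd B2 = - 2"
  shows "S2 C t A1 A2 B1 B2 = T2 C t A1 A2 B1 B2"
proof -
  define X where "X = src (hd A1)"
  define Y where "Y = src (hd B1)"
  have XY: "X = src (hd (A1 @ A2))" "Y = src (hd (B1 @ B2))"
    using A B by (auto simp: X_def Y_def)
  obtain X' where X: "path C X A1 X'" "path C X' A2 X" "X \<in> Obj C"
    using A XY by (auto elim: hochs_cut)
  obtain Y' where Y: "path C Y B1 Y'" "path C Y' B2 Y" "Y \<in> Obj C"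
    using B XY by (auto elim: hochs_cut)
  note O = X(3) Y(3)
  note e = endo_T2[OF A(1) B(1) deg XY]
  have r: "mres C (A1 @ mres C (A2 @ Arr X Y i v # B1) # B2) =
      Arr X Y i (mop C (A1 @ mres C (A2 @ Arr X Y i v # B1) # B2))"
    if "v \<in> Hom C X Y i" for i v
  proof -
    have "path C X' (A2 @ Arr X Y i v # B1) Y'"
      using X Y that by (auto simp: path_append Arr_in_arrows)
    from mres_path[OF wrap_path[OF X(1) this Y(2)]] show ?thesis
      using deg by (auto simp: sdeg_def)
  qed
  have h: "b \<in> hbasis C X Y i \<Longrightarrow> b \<in> Hom C X Y i" for b i
    using hbasis_props(4)[OF O] by auto
  show ?thesis
    unfolding S2_def strace_def T2_def gtr_def XY[symmetric] X_def[symmetric] Y_def[symmetric]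
      tr_def sum_distrib_left
  proof (intro sum.cong refl)
    fix i b assume b: "b \<in> hbasis C X Y i"
    let ?m = "mop C (A1 @ mres C (A2 @ Arr X Y i b # B1) # B2)"
    have "?m \<in> Hom C X Y i"
      using e h[OF b] by (auto simp: endo_def)
    then have "coord C (Arr X Y i (scl C (ksign ((i - 1) * t)) ?m)) b =
        ksign ((i - 1) * t) * V.representation (hbasis C X Y i) ?m b"
      using hbasis_props[OF O, of i] by (simp add: coord_def V.representation_scale)
    then show "(if deg (let r = mres C (A1 @ mres C (A2 @ Arr X Y i b # B1) # B2)
          in Arr (src r) (tgt r) (deg r) (scl C (ksign (sdeg (Arr X Y i b) * t)) (vec r))) = i
        then ksign i * coord C (let r = mres C (A1 @ mres C (A2 @ Arr X Y i b # B1) # B2)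
          in Arr (src r) (tgt r) (deg r) (scl C (ksign (sdeg (Arr X Y i b) * t)) (vec r))) b else 0) =
      ksign (i + (i - 1) * t) * V.representation (hbasis C X Y i) ?m b"
      using r[OF h[OF b]] by (simp add: sdeg_def ksign_add mult_ac)
  qed
qed

lemma mukai_T2:
  assumes "as \<in> hochs C" "bs \<in> hochs C" "sd as + sd bs = - 2"
  shows "mukai C as bs = MA as (\<lambda>A1 A2. MA bs (\<lambda>B1 B2. ksign (sd A1) * T2 C (sd as) A1 A2 B1 B2))"
  unfolding mukai_S2
  using assms by (intro MA_cong_hochs[OF assms(1)] MA_cong_hochs[OF assms(2)]) (auto simp: S2_eq_T2)

lemma T2_parity: "even (t - t') \<Longrightarrow> T2 C t = T2 C t'"
  unfolding T2_def gtr_def fun_eq_iff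
  by (intro allI sum.cong arg_cong2[where f = "(*)"] refl ksign_eqI) (auto simp: algebra_simps)

lemma hoch_d_support:
  assumes "hoch_d C as w \<noteq> 0" "as \<in> hochs C"
  shows "w \<in> hochs C \<and> sd w = sd as + 1"
proof (rule ccontr)
  assume w: "\<not> ?thesis"
  have "smul (if p = [] \<or> m = [] then 0 else ksign (sd p)) (sgl (p @ mres C m # q)) w = (0 :: 'k)"
    if "(p, m, q) \<in> D3 as" for p m q
    using that w hochs_contract[of p m q] assms(2) by (auto simp: smul_def sgl_def D3_def)
  moreover have "(if p = [] then 0 else smul (ksign (sd q * (sd p + sd m))) (sgl (mres C (q @ p) # m))) w = (0 :: 'k)"
    if "(p, m, q) \<in> D3 as" for p m q
    using that w hochs_contract[of "[]" "q @ p" m] hochs_rotate[of "p @ m" q C] assms(2)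
    by (auto simp: smul_def sgl_def D3_def)
  ultimately have "hoch_d C as w = 0"
    unfolding hoch_d_D3 plus_fun_apply sum_fun_apply by (auto intro!: sum.neutral simp: split_def)
  with assms show False by simp
qed

lemma fs_hoch_d: "fs (hoch_d C as)"
proof (cases as)
  case Nil
  then show ?thesis by (simp add: hoch_d_Nil fs_def)
next
  case (Cons a zs)
  have "fs (f + g)" if "fs f" "fs g" for f g :: "('o, 'v) arr list \<Rightarrow> 'k"
    using that unfolding fs_def by (rule_tac finite_subset[of _ "{x. f x \<noteq> 0} \<union> {x. g x \<noteq> 0}"]) auto
  then show ?thesis
    unfolding Cons hoch_d_Cons split_def by (simp add: fs_sum_sgl)
qed

end

lemma ev_cong: "(\<And>x. f x \<noteq> 0 \<Longrightarrow> \<phi> x = \<psi> x) \<Longrightarrow> ev \<phi> f = ev \<psi> f"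
  by (simp add: ev_def)

lemma ev_MA: "ev (\<lambda>w. MA as (\<Psi> w)) f = MA as (\<lambda>A1 A2. ev (\<lambda>w. \<Psi> w A1 A2) f)"
  unfolding ev_def MA_alt sum_distrib_left by (subst sum.swap) (simp only: mult.left_commute)

lemma ins_MA: "ins C A (\<lambda>w. MA as (\<Psi> w)) = MA as (\<lambda>A1 A2. ins C A (\<lambda>w. \<Psi> w A1 A2))"
proof -
  have "ins C A \<phi> = (\<Sum>t\<in>D3 A. (if fst (snd t) = [] then 0 else ksign (sd (fst t))) *
      \<phi> (fst t @ mres C (fst (snd t)) # snd (snd t)))" for \<phi>
    unfolding ins_def by (intro sum.cong) auto
  then show ?thesis
    unfolding MA_alt sum_distrib_left by (simp only: sum_distrib_left, subst sum.swap, simp only: mult.left_commute)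
qed

lemma ins_ksign: "ins C A (\<lambda>w. ksign (sd w) * F w) = ksign (sd A + 1) * ins C A F"
  unfolding ins_def sum_distrib_left by (intro sum.cong refl) (auto dest!: D3D simp: ksign_add)

lemma ins_mult: "ins C A (\<lambda>w. c * F w) = c * ins C A F"
  unfolding ins_def sum_distrib_left by (intro sum.cong refl) auto

context fin_ainf begin

text \<open>Both sides consist of the ways to insert an operation into one of the two operations of
  the pairing. By the \<open>A\<^sub>\<infinity>\<close>-relations these are turned into threefold compositions around the annulus,
  which cancel up to the cyclicity of the supertrace.\<close>

lemma mukai_hoch_d:
  assumes as: "as \<in> hochs C" and bs: "bs \<in> hochs C"
  shows "ev (\<lambda>w. mukai C w bs) (hoch_d C as) = ksign (hdeg as) * ev (mukai C as) (hoch_d C bs)"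
proof (cases "sd as + sd bs = - 3")
  case False
  have "ev (\<lambda>w. mukai C w bs) (hoch_d C as) = ev (\<lambda>w. 0) (hoch_d C as)"
    using False as by (intro ev_cong mukai_eq_0) (auto dest: hoch_d_support)
  moreover have "ev (mukai C as) (hoch_d C bs) = ev (\<lambda>w. 0) (hoch_d C bs)"
    using False bs by (intro ev_cong mukai_eq_0) (auto dest: hoch_d_support)
  ultimately show ?thesis
    by (simp add: ev_def)
next
  case deg: True
  \<comment> \<open>On the left, \<open>c\<close> passes the letters of a term of
    \<open>hoch_d C as\<close>, whose shifted degree is one more than that of
    \<open>as\<close>.\<close>
  define t where "t = sd as + 1"
  \<comment> \<open>\<open>G\<close> is a threefold composition with the sign of its arc
    \<open>V\<close>. Splitting the outer operation produces \<open>So\<close>, splitting the inner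
    one \<open>Si\<close>, and \<open>E\<close> collects the insertions into the arcs of
    \<open>bs\<close>.\<close>
  define G where "G = (\<lambda>U V W P Q R. ksign (sd V) * T3 C t U V W P Q R)"
  define E where "E = (\<lambda>A1 A2 B1 B2. ksign (sd A2) * (ins C B1 (\<lambda>B. T2 C (t + 1) A1 A2 B B2) +
    ksign (sd B1) * ins C B2 (\<lambda>B. T2 C (t + 1) A1 A2 B1 B)))"
  define So where "So = (\<lambda>A1 A2 B1 B2. \<Sum>(A', A'')\<in>D2 A1. \<Sum>(B', B'')\<in>D2 B2. G A' A'' A2 B1 B' B'')"
  define Si where "Si = (\<lambda>A1 A2 B1 B2. \<Sum>(A', A'')\<in>D2 A2. \<Sum>(B', B'')\<in>D2 B1. G A1 A' A'' B' B'' B2)"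
  have "ev (\<lambda>w. mukai C w bs) (hoch_d C as) =
      ev (\<lambda>w. MA w (\<lambda>A1 A2. MA bs (\<lambda>B1 B2. ksign (sd A1) * T2 C t A1 A2 B1 B2))) (hoch_d C as)"
  proof (rule ev_cong)
    fix w assume "hoch_d C as w \<noteq> 0"
    from hoch_d_support[OF this as] show "mukai C w bs =
       MA w (\<lambda>A1 A2. MA bs (\<lambda>B1 B2. ksign (sd A1) * T2 C t A1 A2 B1 B2))"
      using mukai_T2[of w bs] bs deg by (simp add: t_def)
  qed
  also have "\<dots> = MA as (\<lambda>A1 A2. MA bs (\<lambda>B1 B2. ksign (sd A1 + 1) * ins C A1 (\<lambda>A. T2 C t A A2 B1 B2) +
      ins C A2 (\<lambda>A. T2 C t A1 A B1 B2)))"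
    unfolding ev_hoch_d_MA ins_MA ins_ksign ins_mult MA_mult MA_add by simp
  also have "\<dots> = MA as (\<lambda>A1 A2. MA bs (\<lambda>B1 B2. (So A1 A2 B1 B2 - Si A1 A2 B1 B2) - E A1 A2 B1 B2))"
  proof (intro MA_cong_hochs[OF as] MA_cong_hochs[OF bs])
    fix A1 A2 B1 B2 assume A: "A1 @ A2 \<in> hochs C" "sd A1 + sd A2 = sd as"
      and B: "B1 @ B2 \<in> hochs C" "sd B1 + sd B2 = sd bs"
    have d: "sd A1 + sd A2 + sd B1 + sd B2 = - 3"
      using A B deg by simp
    have o: "ksign (sd A1) * (\<Sum>(A', A'')\<in>D2 A1. \<Sum>(B', B'')\<in>D2 B2. ksign (sd A') * T3 C t A' A'' A2 B1 B' B'') =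
        So A1 A2 B1 B2"
      unfolding So_def G_def sum_distrib_left split_def
      by (intro sum.cong refl) (auto dest!: D2D simp: ksign_add)
    have i: "(\<Sum>(A', A'')\<in>D2 A2. \<Sum>(B', B'')\<in>D2 B1. ksign (sd A') * T3 C t A1 A' A'' B' B'' B2) =
        Si A1 A2 B1 B2"
      unfolding Si_def G_def ..
    have "ins C A1 (\<lambda>A. T2 C t A A2 B1 B2) =
      - ksign (sd A1 + sd A2 + sd B1 + 1) * ins C B2 (\<lambda>B. T2 C (t + 1) A1 A2 B1 B) - ksign (sd A1) * So A1 A2 B1 B2"
      using T2_outer[OF A(1) B(1) d, of t] unfolding o[symmetric] by (simp add: algebra_simps eq_neg_iff_add_eq_0)
    moreover have "ins C A2 (\<lambda>A. T2 C t A1 A B1 B2) =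
       - ksign (sd A2) * ins C B1 (\<lambda>B. T2 C (t + 1) A1 A2 B B2) - Si A1 A2 B1 B2"
      using T2_inner[OF A(1) B(1) d, of t] unfolding i by (simp add: algebra_simps eq_neg_iff_add_eq_0)
    ultimately show "ksign (sd A1 + 1) * ins C A1 (\<lambda>A. T2 C t A A2 B1 B2) +
      ins C A2 (\<lambda>A. T2 C t A1 A B1 B2) = (So A1 A2 B1 B2 - Si A1 A2 B1 B2) - E A1 A2 B1 B2"
      unfolding E_def by (simp only:) (simp add: ksign_def)
  qed
  also have "\<dots> = MA as (\<lambda>A1 A2. MA bs (So A1 A2)) - MA as (\<lambda>A1 A2. MA bs (Si A1 A2)) -
     MA as (\<lambda>A1 A2. MA bs (E A1 A2))"
    by (simp add: MA_diff)
  \<comment> \<open>In \<open>So\<close> the marked arc of \<open>as\<close> is cut, in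
    \<open>Si\<close> that of \<open>bs\<close>. Each gives a sum over cuts of both words into three
    arcs and a rotated sum. The former are equal, the latter are identified by
    \<open>T3_rotate\<close>, so that only \<open>E\<close> survives.\<close>
  also have "MA as (\<lambda>A1 A2. MA bs (So A1 A2)) =
     M1 as (\<lambda>U V W. M1 bs (G U V W)) + M1 as (\<lambda>U V W. ksign (sd W * (sd U + sd V)) * M1 bs (G W U V))"
    unfolding MA_split_fst[symmetric]
    unfolding So_def M1_def split_def MA_sum ..
  also have "MA as (\<lambda>A1 A2. MA bs (Si A1 A2)) = M1 as (\<lambda>U V W. M1 bs (G U V W) +
      M1 bs (\<lambda>P Q R. ksign (sd R * (sd P + sd Q)) * G U V W R P Q))"
    unfolding MA_split_fst[symmetric]
    unfolding Si_def M1_def split_def MA_sum ..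
  also have "\<dots> = M1 as (\<lambda>U V W. M1 bs (G U V W)) +
      M1 as (\<lambda>U V W. M1 bs (\<lambda>P Q R. ksign (sd R * (sd P + sd Q)) * G U V W R P Q))"
    unfolding M1_def split_def sum.distrib MA_add ..
  also have "M1 as (\<lambda>U V W. M1 bs (\<lambda>P Q R. ksign (sd R * (sd P + sd Q)) * G U V W R P Q)) =
      M1 as (\<lambda>U V W. M1 bs (\<lambda>P Q R. ksign (sd W * (sd U + sd V)) * G W U V P Q R))"
  proof (intro M1_cong[OF as] M1_cong[OF bs])
    fix U V W P Q R assume A: "U @ V @ W \<in> hochs C" "sd U + sd V + sd W = sd as"
      and B: "P @ Q @ R \<in> hochs C" "sd P + sd Q + sd R = sd bs"
    have "T3 C t U V W R P Q = ksign ((sd W + sd R + 1) * (1 + t)) * T3 C t W U V P Q R"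
      using A B deg hochs_rotate[of "P @ Q" R C] by (intro T3_rotate) auto
    moreover have "even (sd U + sd V + sd W + sd P + sd Q + sd R + 1)"
    proof -
      have "even (sd as + sd bs + 1)"
        by (simp add: deg)
      then show ?thesis
        unfolding A(2)[symmetric] B(2)[symmetric] by (simp only: add.assoc)
    qed
    ultimately show "ksign (sd R * (sd P + sd Q)) * G U V W R P Q =
        ksign (sd W * (sd U + sd V)) * G W U V P Q R"
      unfolding G_def t_def A(2)[symmetric]
      by (simp only:) (auto simp: ksign_def)
  qed
  also have "\<dots> = M1 as (\<lambda>U V W. ksign (sd W * (sd U + sd V)) * M1 bs (G W U V))"
    unfolding M1_def split_def MA_mult[symmetric] sum_distrib_left ..
  finally have "ev (\<lambda>w. mukai C w bs) (hoch_d C as) = - MA as (\<lambda>A1 A2. MA bs (E A1 A2))"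
    by simp
  also have "\<dots> = ksign (hdeg as) * MA as (\<lambda>A1 A2. ev (\<lambda>w. MA w (\<lambda>B1 B2. ksign (sd A1) * T2 C (sd as) A1 A2 B1 B2)) (hoch_d C bs))"
    unfolding MA_mult[symmetric] MA_uminus[symmetric] ev_hoch_d_MA
  proof (intro MA_cong_hochs[OF as])
    fix A1 A2 assume A: "A1 @ A2 \<in> hochs C" "sd A1 + sd A2 = sd as"
    have T: "T2 C (sd as) = T2 C (t + 1)"
      by (rule T2_parity) (simp add: t_def)
    show "MA bs (\<lambda>B1 B2. - E A1 A2 B1 B2) =
        MA bs (\<lambda>B1 B2. ksign (hdeg as) * (ins C B1 (\<lambda>B. ksign (sd A1) * T2 C (sd as) A1 A2 B B2) +
          ksign (sd B1) * ins C B2 (\<lambda>B. ksign (sd A1) * T2 C (sd as) A1 A2 B1 B)))"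
      unfolding T unfolding E_def ins_mult hdeg_def A(2)[symmetric]
      by (intro MA_cong_hochs[OF bs]) (auto simp: ksign_def)
  qed
  also have "MA as (\<lambda>A1 A2. ev (\<lambda>w. MA w (\<lambda>B1 B2. ksign (sd A1) * T2 C (sd as) A1 A2 B1 B2)) (hoch_d C bs)) =
      ev (mukai C as) (hoch_d C bs)"
    unfolding ev_MA[symmetric]
  proof (rule ev_cong)
    fix w assume "hoch_d C bs w \<noteq> 0"
    from hoch_d_support[OF this bs] show "MA as (\<lambda>A1 A2. MA w (\<lambda>B1 B2. ksign (sd A1) * T2 C (sd as) A1 A2 B1 B2)) = mukai C as w"
      using mukai_T2[of as w] as deg by simp
  qed
  finally show ?thesis .
qed

end

section \<open>The Mukai pairing and the Connes operator\<close>

text \<open>The signed cyclic norm. It is the Connes operator without the unit in front, and also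
  the part of \<open>MA\<close> in which the second arc is empty.\<close>

definition rot :: "('o, 'v) arr list \<Rightarrow> (('o, 'v) arr list \<Rightarrow> 'k::field) \<Rightarrow> 'k" where
  "rot as F = (\<Sum>i<length as. ksign (sd (drop i as) * sd (take i as)) * F (drop i as @ take i as))"

lemma MA_uncut: "MA as (\<lambda>A1 A2. if A2 = [] then F A1 else 0) = rot as F"
proof -
  define g where "g = (\<lambda>j. ksign (sd (drop j as) * sd (take j as)) * F (drop j as @ take j as))"
  have "(\<Sum>i<j. ksign (sd (drop j as) * sd (take j as)) *
        (if slice (Suc i) j as = [] then F (drop j as @ take (Suc i) as) else 0)) =
      (if j = 0 then 0 else g j)" if "j \<in> {..length as}" for j
  proof (cases j)
    case (Suc k)
    have "(\<Sum>i<j. ksign (sd (drop j as) * sd (take j as)) *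
        (if slice (Suc i) j as = [] then F (drop j as @ take (Suc i) as) else 0)) =
      (\<Sum>i<j. if i = k then g j else 0)"
      using that Suc by (intro sum.cong refl) (auto simp: slice_def g_def)
    then show ?thesis
      using Suc by simp
  qed simp
  note 1 = sum.cong[OF refl this]
  \<comment> \<open>The cuts with an empty second arc have indices from 1 to
    \<open>length as\<close>, those of \<open>rot\<close> from 0 to \<open>length as - 1\<close>;
    rotation by the full length is the identity.\<close>
  have "(\<Sum>j\<le>length as. if j = 0 then 0 else g j) + g 0 = (\<Sum>j\<le>length as. g j)"
    by (simp add: sum.atMost_shift)
  also have "\<dots> = (\<Sum>j<length as. g j) + g (length as)"
    by (simp flip: lessThan_Suc_atMost)
  also have "g (length as) = g 0"
    by (simp add: g_def)
  finally have "(\<Sum>j\<le>length as. if j = 0 then 0 else g j) = (\<Sum>j<length as. g j)"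
    by simp
  then show ?thesis
    unfolding MA_index[symmetric] rot_def by (subst 1) (auto simp: g_def)
qed

lemma rot_mult: "rot as (\<lambda>A. c * F A) = c * rot as F"
  by (simp add: rot_def sum_distrib_left mult_ac)

lemma rot_swap: "rot as (\<lambda>A. rot bs (\<lambda>B. F A B)) = rot bs (\<lambda>B. rot as (\<lambda>A. F A B))"
  unfolding rot_def sum_distrib_left by (subst sum.swap) (simp add: mult_ac)

lemma rot_cong:
  assumes "\<And>p q. p @ q = as \<Longrightarrow> q \<noteq> [] \<Longrightarrow> F (q @ p) = F' (q @ p)"
  shows "rot as F = rot as F'"
  unfolding rot_def
proof (intro sum.cong refl arg_cong2[where f = "(*)"])
  fix i assume "i \<in> {..<length as}"
  then show "F (drop i as @ take i as) = F' (drop i as @ take i as)"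
    using assms[of "take i as" "drop i as"] by simp
qed

lemma ev_connes_B:
  "ev \<phi> (connes_B C as) = rot as (\<lambda>w. \<phi> (unit_arr C (src (hd w)) # w))"
  unfolding connes_B_def rot_def
  by (subst ev_sum_sgl) (auto simp: hd_append hd_drop_conv_nth intro!: sum.cong)

context fin_ainf begin

lemma unit_Cons_hochs:
  assumes "w \<in> hochs C" shows "unit_arr C (src (hd w)) # w \<in> hochs C"
proof -
  have "src (hd w) \<in> Obj C"
    using assms path_Obj by (fastforce simp: hochs_def)
  with assms unit_in_arrows show ?thesis
    by (auto simp: hochs_def)
qed

lemma mop_zero_arg:
  assumes "path C X A X'" "path C Y' B Y"
  shows "mop C (A @ Arr X' Y' i 0 # B) = 0"
proof -
  have "X' \<in> Obj C" "Y' \<in> Obj C"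
    using assms path_Obj by fast+
  then have "V.subspace (Hom C X' Y' i)"
    by (rule subspace_Hom)
  from lin_on_sum[OF mop_lin_on[OF assms refl] this, of "{}"] show ?thesis
    by simp
qed

text \<open>Together with the inner result the outer operation has at least three arguments, and
  strict unitality kills it.\<close>

lemma T2_unit_outer:
  assumes "A1 @ A2 \<in> hochs C" "B1 @ B2 \<in> hochs C"
    and "unit_arr C Z \<in> set (A1 @ B2)" "length (A1 @ B2) \<ge> 2"
  shows "T2 C t A1 A2 B1 B2 = 0"
proof -
  define X where "X = src (hd (A1 @ A2))"
  define Y where "Y = src (hd (B1 @ B2))"
  obtain X' where X: "path C X A1 X'" "path C X' A2 X" "X \<in> Obj C"
    using assms X_def by (auto elim: hochs_cut)
  obtain Y' where Y: "path C Y B1 Y'" "path C Y' B2 Y" "Y \<in> Obj C"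
    using assms Y_def by (auto elim: hochs_cut)
  have "mop C (A1 @ mres C (A2 @ Arr X Y i v # B1) # B2) = 0" if "v \<in> Hom C X Y i" for i v
  proof -
    have "path C X' (A2 @ Arr X Y i v # B1) Y'"
      using X Y that by (auto simp: path_append Arr_in_arrows)
    from mop_unit_zero[OF wrap_path[OF X(1) this Y(2)], of Z] show ?thesis
      using assms(3,4) by auto
  qed
  then have "T2 C t A1 A2 B1 B2 = gtr C t X Y (\<lambda>c. 0)"
    unfolding T2_def X_def[symmetric] Y_def[symmetric] by (intro gtr_cong X Y) auto
  then show ?thesis by simp
qed

lemma T2_unit_inner:
  assumes "A1 @ A2 \<in> hochs C" "B1 @ B2 \<in> hochs C"
    and "unit_arr C Z \<in> set (A2 @ B1)" "length (A2 @ B1) \<ge> 2"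
  shows "T2 C t A1 A2 B1 B2 = 0"
proof -
  define X where "X = src (hd (A1 @ A2))"
  define Y where "Y = src (hd (B1 @ B2))"
  obtain X' where X: "path C X A1 X'" "path C X' A2 X" "X \<in> Obj C"
    using assms X_def by (auto elim: hochs_cut)
  obtain Y' where Y: "path C Y B1 Y'" "path C Y' B2 Y" "Y \<in> Obj C"
    using assms Y_def by (auto elim: hochs_cut)
  have "mop C (A1 @ mres C (A2 @ Arr X Y i v # B1) # B2) = 0" if "v \<in> Hom C X Y i" for i v
  proof -
    have p: "path C X' (A2 @ Arr X Y i v # B1) Y'"
      using X Y that by (auto simp: path_append Arr_in_arrows)
    have "mop C (A2 @ Arr X Y i v # B1) = 0"
      using mop_unit_zero[OF p, of Z] assms(3,4) by auto
    then show ?thesis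
      using mop_zero_arg[OF X(1) Y(2)] mres_path[OF p] by simp
  qed
  then have "T2 C t A1 A2 B1 B2 = gtr C t X Y (\<lambda>c. 0)"
    unfolding T2_def X_def[symmetric] Y_def[symmetric] by (intro gtr_cong X Y) auto
  then show ?thesis by simp
qed

lemma MA_unit_Cons:
  assumes "\<And>p m q. p @ m @ q = w \<Longrightarrow> q @ p \<noteq> [] \<Longrightarrow> \<Phi> (q @ u # p) m = 0"
  shows "MA (u # w) \<Phi> = \<Phi> [u] w"
proof -
  have "MA (u # w) \<Phi> = (\<Sum>t\<in>D3 w. if t = ([], w, []) then \<Phi> [u] w else 0)"
    unfolding MA_Cons
  proof (intro sum.cong refl)
    fix t assume "t \<in> D3 w"
    moreover obtain p m q where t: "t = (p, m, q)"
      by (cases t)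
    ultimately show "(case t of (p, m, q) \<Rightarrow> ksign (sd q * (sdeg u + sd p + sd m)) * \<Phi> (q @ u # p) m) =
        (if t = ([], w, []) then \<Phi> [u] w else 0)"
      using assms[of p m q] by (cases "q @ p = []") (auto simp: D3_def t)
  qed
  also have "\<dots> = \<Phi> [u] w"
    by (subst sum.delta[OF finite_D3]) (auto simp: D3_def)
  finally show ?thesis .
qed

text \<open>What remains of \<open>T2\<close> when one of its two operations is the product with a
  unit.\<close>

definition T1 :: "int \<Rightarrow> ('o, 'v) arr list \<Rightarrow> ('o, 'v) arr list \<Rightarrow> 'k" where
  "T1 t A B = gtr C t (src (hd A)) (src (hd B)) (\<lambda>c. mop C (A @ c # B))"

lemma T1_parity: "even (t - t') \<Longrightarrow> T1 t = T1 t'"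
  unfolding T1_def gtr_def fun_eq_iff
  by (intro allI sum.cong arg_cong2[where f = "(*)"] refl ksign_eqI) (auto simp: algebra_simps)

lemma T2_unit_left:
  assumes A: "A \<in> hochs C" and B: "B \<in> hochs C" and deg: "sd A + sd B = - 1"
  shows "T2 C t [unit_arr C (src (hd A))] A B [] = T1 t A B"
proof -
  define X where "X = src (hd A)"
  define Y where "Y = src (hd B)"
  have X: "path C X A X" and Y: "path C Y B Y" and ne: "A \<noteq> []" "B \<noteq> []"
    using A B by (auto simp: hochs_def X_def Y_def)
  then have O: "X \<in> Obj C" "Y \<in> Obj C"
    using path_Obj by fast+
  have "mop C ([unit_arr C X] @ mres C (A @ Arr X Y i v # B) # []) = mop C (A @ Arr X Y i v # B)"
    if "v \<in> Hom C X Y i" for i v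
  proof -
    have p: "path C X (A @ Arr X Y i v # B) Y"
      using X Y O that by (auto simp: path_append Arr_in_arrows)
    from mop_unit(1)[OF mres_in_arrows[OF _ p]] ne show ?thesis
      by (simp add: X_def)
  qed
  then have "gtr C t X Y (\<lambda>c. mop C ([unit_arr C X] @ mres C (A @ c # B) # [])) =
      gtr C t X Y (\<lambda>c. mop C (A @ c # B))"
    by (intro gtr_cong O) auto
  then show ?thesis
    by (simp add: T2_def T1_def X_def Y_def)
qed

text \<open>The right unit acts by \<open>m(c,1) = (-1)^|c| c\<close>. In terms of the shifted
  degree this is a global minus sign and one more sign of \<open>c\<close>, whence the shift of
  \<open>t\<close>.\<close>

lemma T2_unit_right:
  assumes A: "A \<in> hochs C" and B: "B \<in> hochs C" and deg: "sd A + sd B = - 1"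
  shows "T2 C t A [] [unit_arr C (src (hd B))] B = - T1 (t + 1) A B"
proof -
  define X where "X = src (hd A)"
  define Y where "Y = src (hd B)"
  have X: "path C X A X" and Y: "path C Y B Y"
    using A B by (auto simp: hochs_def X_def Y_def)
  then have O: "X \<in> Obj C" "Y \<in> Obj C"
    using path_Obj by fast+
  have e: "endo C X Y (\<lambda>c. mop C (A @ c # B))"
    unfolding endo_def
  proof (intro allI ballI)
    fix i v assume "v \<in> Hom C X Y i"
    then have "path C X (A @ Arr X Y i v # B) Y"
      using X Y O by (auto simp: path_append Arr_in_arrows)
    then show "mop C (A @ Arr X Y i v # B) \<in> Hom C X Y i"
      using deg by (intro mop_in_Hom) (auto simp: sdeg_def)
  qed
  have "mop C (A @ mres C ([] @ Arr X Y i v # [unit_arr C Y]) # B) =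
      scl C (- 1) (scl C (ksign (sdeg (Arr X Y i v))) (mop C (A @ Arr X Y i v # B)))"
    if v: "v \<in> Hom C X Y i" for i v
  proof -
    have "mop C [Arr X Y i v, unit_arr C Y] = scl C (ksign i) v"
      using mop_unit(2)[of "Arr X Y i v"] v O by (simp add: Arr_in_arrows)
    then have "mres C ([] @ Arr X Y i v # [unit_arr C Y]) = Arr X Y i (scl C (ksign i) v + 0)"
      by (simp add: mres_def sdeg_def)
    then have "mop C (A @ mres C ([] @ Arr X Y i v # [unit_arr C Y]) # B) =
       mop C (A @ Arr X Y i (scl C (ksign i) v + 0) # B)"
      by simp
    also have "\<dots> = scl C (ksign i) (mop C (A @ Arr X Y i v # B)) + mop C (A @ Arr X Y i 0 # B)"
      using X Y O v V.subspace_0[OF subspace_Hom[OF O]]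
      by (intro mop_lin[of X _ _ _ _ _ _ Y]) (auto simp: path_append Arr_in_arrows)
    also have "mop C (A @ Arr X Y i 0 # B) = 0"
      using mop_zero_arg X Y by blast
    finally show ?thesis
      by (simp add: sdeg_def ksign_def)
  qed
  then have "gtr C t X Y (\<lambda>c. mop C (A @ mres C ([] @ c # [unit_arr C Y]) # B)) =
      gtr C t X Y (\<lambda>c. scl C (- 1) (scl C (ksign (sdeg c)) (mop C (A @ c # B))))"
    by (intro gtr_cong O) auto
  also have "\<dots> = - 1 * gtr C t X Y (\<lambda>c. scl C (ksign (sdeg c)) (mop C (A @ c # B)))"
    by (rule gtr_scale[OF O endo_scale[OF O e]])
  also have "\<dots> = - gtr C (t + 1) X Y (\<lambda>c. mop C (A @ c # B))"
    using gtr_shift[OF O e] by simp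
  finally show ?thesis
    by (simp add: T2_def T1_def X_def Y_def)
qed

text \<open>The outer operation contains the marked unit, so it survives only as the product
  \<open>m(1, _)\<close>: the arc \<open>A1\<close> consists of the unit and \<open>B2\<close> is
  empty.\<close>

lemma mukai_unit_left:
  assumes A: "A \<in> hochs C" and B: "bs \<in> hochs C" and deg: "sd A + sd bs = - 1"
  shows "mukai C (unit_arr C (src (hd A)) # A) bs = - rot bs (\<lambda>B. T1 (sd A + 1) A B)"
proof -
  let ?u = "unit_arr C (src (hd A))"
  have u: "?u # A \<in> hochs C"
    using A by (rule unit_Cons_hochs)
  have "mukai C (?u # A) bs =
      MA (?u # A) (\<lambda>A1 A2. MA bs (\<lambda>B1 B2. ksign (sd A1) * T2 C (sd A - 1) A1 A2 B1 B2))"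
    using mukai_T2[OF u B] deg by simp
  also have "\<dots> = MA bs (\<lambda>B1 B2. ksign (sd [?u]) * T2 C (sd A - 1) [?u] A B1 B2)"
  proof (rule MA_unit_Cons)
    fix p m q assume pmq: "p @ m @ q = A" "q @ p \<noteq> []"
    then have "(q @ ?u # p) @ m \<in> hochs C"
      using u hochs_rotate[of "?u # p @ m" q C] by simp
    then have "MA bs (\<lambda>B1 B2. ksign (sd (q @ ?u # p)) * T2 C (sd A - 1) (q @ ?u # p) m B1 B2) =
        MA bs (\<lambda>_ _. 0)"
      using pmq(2) T2_unit_outer[of "q @ ?u # p" m _ _ "src (hd A)" "sd A - 1"]
      by (intro MA_cong_hochs[OF B]) (auto simp: Suc_le_eq)
    then show "MA bs (\<lambda>B1 B2. ksign (sd (q @ ?u # p)) * T2 C (sd A - 1) (q @ ?u # p) m B1 B2) = 0"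
      by simp
  qed
  also have "\<dots> = MA bs (\<lambda>B1 B2. if B2 = [] then - T1 (sd A + 1) A B1 else 0)"
  proof (rule MA_cong_hochs[OF B])
    fix B1 B2 assume B': "B1 @ B2 \<in> hochs C" "sd B1 + sd B2 = sd bs"
    have "T1 (sd A - 1) = T1 (sd A + 1)"
      by (rule T1_parity) simp
    moreover have "T2 C (sd A - 1) [?u] A B1 B2 = 0" if "B2 \<noteq> []"
      using that B' u by (intro T2_unit_outer[where Z = "src (hd A)"]) (auto simp: Suc_le_eq)
    ultimately show "ksign (sd [?u]) * T2 C (sd A - 1) [?u] A B1 B2 = (if B2 = [] then - T1 (sd A + 1) A B1 else 0)"
      using T2_unit_left[OF A, of B1 "sd A - 1"] B' deg by (auto simp: ksign_def)
  qed
  also have "\<dots> = - rot bs (\<lambda>B. T1 (sd A + 1) A B)"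
    unfolding MA_uncut using rot_mult[of bs "- 1"] by simp
  finally show ?thesis .
qed

text \<open>Here the marked unit belongs to the inner operation, which survives only as
  \<open>m(c, 1)\<close>: the arc \<open>B1\<close> consists of the unit and \<open>A2\<close> is
  empty.\<close>

lemma mukai_unit_right:
  assumes B: "B \<in> hochs C" and A: "as \<in> hochs C" and deg: "sd as + sd B = - 1"
  shows "mukai C as (unit_arr C (src (hd B)) # B) = - ksign (sd as) * rot as (\<lambda>A. T1 (sd as + 1) A B)"
proof -
  let ?u = "unit_arr C (src (hd B))"
  have u: "?u # B \<in> hochs C"
    using B by (rule unit_Cons_hochs)
  have "mukai C as (?u # B) =
      MA as (\<lambda>A1 A2. MA (?u # B) (\<lambda>B1 B2. ksign (sd A1) * T2 C (sd as) A1 A2 B1 B2))"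
    using mukai_T2[OF A u] deg by simp
  also have "\<dots> = MA as (\<lambda>A1 A2. if A2 = [] then - ksign (sd as) * T1 (sd as + 1) A1 B else 0)"
  proof (rule MA_cong_hochs[OF A])
    fix A1 A2 assume A': "A1 @ A2 \<in> hochs C" "sd A1 + sd A2 = sd as"
    have "MA (?u # B) (\<lambda>B1 B2. ksign (sd A1) * T2 C (sd as) A1 A2 B1 B2) =
       ksign (sd A1) * T2 C (sd as) A1 A2 [?u] B"
    proof (rule MA_unit_Cons)
      fix p m q assume pmq: "p @ m @ q = B" "q @ p \<noteq> []"
      then have "(q @ ?u # p) @ m \<in> hochs C"
        using u hochs_rotate[of "?u # p @ m" q C] by simp
      then show "ksign (sd A1) * T2 C (sd as) A1 A2 (q @ ?u # p) m = 0"
        using A' pmq(2) T2_unit_inner[of A1 A2 "q @ ?u # p" m "src (hd B)" "sd as"]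
        by (auto simp: Suc_le_eq)
    qed
    moreover have "T2 C (sd as) A1 A2 [?u] B = 0" if "A2 \<noteq> []"
      using that A' u by (intro T2_unit_inner[where Z = "src (hd B)"]) (auto simp: Suc_le_eq)
    ultimately show "MA (?u # B) (\<lambda>B1 B2. ksign (sd A1) * T2 C (sd as) A1 A2 B1 B2) =
        (if A2 = [] then - ksign (sd as) * T1 (sd as + 1) A1 B else 0)"
      using T2_unit_right[of A1 B "sd as"] A' B deg by auto
  qed
  also have "\<dots> = - ksign (sd as) * rot as (\<lambda>A. T1 (sd as + 1) A B)"
    unfolding MA_uncut rot_mult ..
  finally show ?thesis .
qed

text \<open>In the only relevant degree, both sides are, up to sign, the sum of the traces of a
  single operation \<open>m(A, c, B)\<close> over all rotations \<open>A\<close> of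
  \<open>as\<close> and \<open>B\<close> of \<open>bs\<close>.\<close>

lemma mukai_connes_B:
  assumes as: "as \<in> hochs C" and bs: "bs \<in> hochs C"
  shows "ev (\<lambda>w. mukai C w bs) (connes_B C as) = - ksign (hdeg as) * ev (mukai C as) (connes_B C bs)"
proof (cases "sd as + sd bs = - 1")
  case False
  have "rot as (\<lambda>w. mukai C (unit_arr C (src (hd w)) # w) bs) = rot as (\<lambda>w. 0 * 0)"
    using False by (intro rot_cong) (auto intro!: mukai_eq_0)
  moreover have "rot bs (\<lambda>w. mukai C as (unit_arr C (src (hd w)) # w)) = rot bs (\<lambda>w. 0 * 0)"
    using False by (intro rot_cong) (auto intro!: mukai_eq_0)
  ultimately show ?thesis
    unfolding ev_connes_B rot_mult by simp
next
  case deg: True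
  have 1: "ev (\<lambda>w. mukai C w bs) (connes_B C as) = rot as (\<lambda>A. - 1 * rot bs (\<lambda>B. T1 (sd as + 1) A B))"
    unfolding ev_connes_B
  proof (rule rot_cong)
    fix p q assume pq: "p @ q = as" "q \<noteq> []"
    with as hochs_rotate[of p q C] deg mukai_unit_left[of "q @ p" bs] bs
    show "mukai C (unit_arr C (src (hd (q @ p))) # q @ p) bs = - 1 * rot bs (T1 (sd as + 1) (q @ p))"
      by (auto simp: add_ac)
  qed
  have 2: "ev (mukai C as) (connes_B C bs) = rot bs (\<lambda>B. - ksign (sd as) * rot as (\<lambda>A. T1 (sd as + 1) A B))"
    unfolding ev_connes_B
  proof (rule rot_cong)
    fix p q assume pq: "p @ q = bs" "q \<noteq> []"
    with bs hochs_rotate[of p q C] deg mukai_unit_right[of "q @ p" as] as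
    show "mukai C as (unit_arr C (src (hd (q @ p))) # q @ p) = - ksign (sd as) * rot as (\<lambda>A. T1 (sd as + 1) A (q @ p))"
      by (auto simp: add_ac)
  qed
  show ?thesis
    unfolding 1 2 rot_mult by (subst rot_swap) (simp add: hdeg_def ksign_def)
qed

subsection \<open>Vanishing on the relations of the reduced complex\<close>

text \<open>A unit behind the marked letter is never in a product of two factors: in the arc
  \<open>A1\<close> it meets the marked letter and the inner result, in \<open>A2\<close> it meets
  \<open>c\<close> and the nonempty arc \<open>B1\<close>.\<close>

lemma mukai_unit_eq_0:
  assumes as: "a # xs @ unit_arr C Z # ys \<in> hochs C" and bs: "bs \<in> hochs C"
  shows "mukai C (a # xs @ unit_arr C Z # ys) bs = 0" (is "mukai C ?as bs = 0")
proof (cases "sd ?as + sd bs = - 2")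
  case True
  show ?thesis
    unfolding mukai_T2[OF as bs True]
  proof (rule MA_eq_0)
    fix p m q assume pmq: "p @ m @ q = ?as" "p \<noteq> []"
    have h: "(q @ p) @ m \<in> hochs C"
      using as pmq hochs_rotate[of "p @ m" q C] by simp
    have "MA bs (\<lambda>B1 B2. ksign (sd (q @ p)) * T2 C (sd ?as) (q @ p) m B1 B2) = MA bs (\<lambda>_ _. 0)"
    proof (rule MA_cong_hochs[OF bs])
      fix B1 B2 assume B: "B1 @ B2 \<in> hochs C" "B1 \<noteq> []"
      \<comment> \<open>The marked letter may itself be this unit. If it forms the arc
        \<open>q @ p\<close> alone, the other occurrence lies in \<open>m\<close>.\<close>
      consider "unit_arr C Z \<in> set m" | "unit_arr C Z \<in> set (q @ p)" "length (q @ p) \<ge> 2"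
      proof -
        have "set (p @ m @ q) = set ?as"
          using pmq by simp
        then have "unit_arr C Z \<in> set m \<or> unit_arr C Z \<in> set (q @ p)"
          by auto
        moreover have "unit_arr C Z \<in> set m" if "length (q @ p) < 2"
          using that pmq by (cases p; cases q) auto
        ultimately show thesis
          using that by (meson not_less)
      qed
      then show "ksign (sd (q @ p)) * T2 C (sd ?as) (q @ p) m B1 B2 = 0"
      proof cases
        case 1
        then have "m \<noteq> []"
          by auto
        with 1 B(2) have "T2 C (sd ?as) (q @ p) m B1 B2 = 0"
          by (intro T2_unit_inner[OF h B(1), of Z]) (auto simp: neq_Nil_conv)
        then show ?thesis by simp
      next
        case 2
        then have "T2 C (sd ?as) (q @ p) m B1 B2 = 0"
          by (intro T2_unit_outer[OF h B(1), of Z]) auto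
        then show ?thesis by simp
      qed
    qed
    then show "MA bs (\<lambda>B1 B2. ksign (sd (q @ p)) * T2 C (sd ?as) (q @ p) m B1 B2) = 0"
      by simp
  qed
qed (rule mukai_eq_0)

text \<open>The two operations exchange their roles, since the marked arc of the second word belongs
  to the inner operation.\<close>

lemma mukai_unit_eq_0':
  assumes as: "as \<in> hochs C" and bs: "b # xs @ unit_arr C Z # ys \<in> hochs C"
  shows "mukai C as (b # xs @ unit_arr C Z # ys) = 0" (is "mukai C as ?bs = 0")
proof (cases "sd as + sd ?bs = - 2")
  case True
  show ?thesis
    unfolding mukai_T2[OF as bs True]
  proof (subst MA_swap, rule MA_eq_0)
    fix p m q assume pmq: "p @ m @ q = ?bs" "p \<noteq> []"
    have h: "(q @ p) @ m \<in> hochs C"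
      using bs pmq hochs_rotate[of "p @ m" q C] by simp
    have "MA as (\<lambda>A1 A2. ksign (sd A1) * T2 C (sd as) A1 A2 (q @ p) m) = MA as (\<lambda>_ _. 0)"
    proof (rule MA_cong_hochs[OF as])
      fix A1 A2 assume A: "A1 @ A2 \<in> hochs C" "A1 \<noteq> []"
      consider "unit_arr C Z \<in> set m" | "unit_arr C Z \<in> set (q @ p)" "length (q @ p) \<ge> 2"
      proof -
        have "set (p @ m @ q) = set ?bs"
          using pmq by simp
        then have "unit_arr C Z \<in> set m \<or> unit_arr C Z \<in> set (q @ p)"
          by auto
        moreover have "unit_arr C Z \<in> set m" if "length (q @ p) < 2"
          using that pmq by (cases p; cases q) auto
        ultimately show thesis
          using that by (meson not_less)
      qed
      then show "ksign (sd A1) * T2 C (sd as) A1 A2 (q @ p) m = 0"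
      proof cases
        case 1
        then have "m \<noteq> []"
          by auto
        with 1 A(2) have "T2 C (sd as) A1 A2 (q @ p) m = 0"
          by (intro T2_unit_outer[OF A(1) h, of Z]) (auto simp: neq_Nil_conv)
        then show ?thesis by simp
      next
        case 2
        then have "T2 C (sd as) A1 A2 (q @ p) m = 0"
          by (intro T2_unit_inner[OF A(1) h, of Z]) auto
        then show ?thesis by simp
      qed
    qed
    then show "MA as (\<lambda>A1 A2. ksign (sd A1) * T2 C (sd as) A1 A2 (q @ p) m) = 0"
      by simp
  qed
qed (rule mukai_eq_0)

section \<open>Multilinearity of the Mukai pairing\<close>

lemma gtr_lin:
  assumes "X \<in> Obj C" "Y \<in> Obj C" "endo C X Y G" "endo C X Y H"
    "\<And>i v. v \<in> Hom C X Y i \<Longrightarrow> F (Arr X Y i v) = scl C k (G (Arr X Y i v)) + H (Arr X Y i v)"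
  shows "gtr C t X Y F = k * gtr C t X Y G + gtr C t X Y H"
proof -
  have "gtr C t X Y F = gtr C t X Y (\<lambda>c. scl C k (G c) + H c)"
    using assms by (intro gtr_cong) auto
  also have "\<dots> = k * gtr C t X Y G + gtr C t X Y H"
    using assms by (simp add: gtr_add gtr_scale endo_scale)
  finally show ?thesis .
qed

lemma src_hd_Arr: "src (hd (A @ Arr P Q i v # B)) = src (hd (A @ Arr P Q i w # B))"
  by (cases A) auto

lemma hochs_Arr_lin:
  assumes "A @ Arr P Q i v # B \<in> hochs C" "A @ Arr P Q i w # B \<in> hochs C"
  shows "A @ Arr P Q i (scl C c v + w) # B \<in> hochs C"
  using assms src_hd_Arr[of A P Q i v B w] src_hd_Arr[of A P Q i v B "scl C c v + w"]
    V.subspace_add[OF subspace_Hom] V.subspace_scale[OF subspace_Hom]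
  by (auto simp: hochs_def path_append Arr_in_arrows)

text \<open>Both arcs of the outer operation are allowed to vary, so that the same statement serves
  for a letter of either word.\<close>

lemma T2_lin_outer:
  assumes "A1 @ A2 \<in> hochs C" "A1' @ A2 \<in> hochs C" "A1'' @ A2 \<in> hochs C"
    "B1 @ B2 \<in> hochs C" "B1 @ B2' \<in> hochs C" "B1 @ B2'' \<in> hochs C"
    "sd A1' + sd A2 + sd B1 + sd B2' = - 2" "sd A1'' + sd A2 + sd B1 + sd B2'' = - 2"
    "src (hd (A1' @ A2)) = src (hd (A1 @ A2))" "src (hd (A1'' @ A2)) = src (hd (A1 @ A2))"
    "src (hd (B1 @ B2')) = src (hd (B1 @ B2))" "src (hd (B1 @ B2'')) = src (hd (B1 @ B2))"
  and lin: "\<And>N X Y. path C X (A1' @ N # B2') Y \<Longrightarrow> path C X (A1'' @ N # B2'') Y \<Longrightarrow>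
     mop C (A1 @ N # B2) = scl C c (mop C (A1' @ N # B2')) + mop C (A1'' @ N # B2'')"
  shows "T2 C t A1 A2 B1 B2 = c * T2 C t A1' A2 B1 B2' + T2 C t A1'' A2 B1 B2''"
proof -
  define X where "X = src (hd (A1 @ A2))"
  define Y where "Y = src (hd (B1 @ B2))"
  have O: "X \<in> Obj C" "Y \<in> Obj C"
    using assms(1,4) by (auto simp: X_def Y_def elim: hochs_cut)
  have p: "path C X (A @ mres C (A2 @ Arr X Y i v # B1) # B) Y"
    if v: "v \<in> Hom C X Y i" and A: "A @ A2 \<in> hochs C" "src (hd (A @ A2)) = X"
      and B: "B1 @ B \<in> hochs C" "src (hd (B1 @ B)) = Y" for i v A B
  proof -
    obtain X' where X: "path C X A X'" "path C X' A2 X"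
      using A by (auto elim: hochs_cut)
    obtain Y' where Y: "path C Y B1 Y'" "path C Y' B Y"
      using B by (auto elim: hochs_cut)
    have "path C X' (A2 @ Arr X Y i v # B1) Y'"
      using X Y v O by (auto simp: path_append Arr_in_arrows)
    then show ?thesis
      using wrap_path X Y by blast
  qed
  show ?thesis
    unfolding T2_def assms(9-12) X_def[symmetric] Y_def[symmetric]
    using assms p by (intro gtr_lin O endo_T2 lin) (auto simp: X_def Y_def)
qed

text \<open>The outer operation can be expanded only if the three inner results lie in one Hom
  space. Its endpoints are read off the rotated words, and this is what the assumptions
  \<open>A\<close> and \<open>B\<close> compare.\<close>

lemma T2_lin_inner:
  assumes "A1 @ A2 \<in> hochs C" "A1 @ A2' \<in> hochs C" "A1 @ A2'' \<in> hochs C"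
    "B1 @ B2 \<in> hochs C" "B1' @ B2 \<in> hochs C" "B1'' @ B2 \<in> hochs C"
    "sd A1 + sd A2' + sd B1' + sd B2 = - 2" "sd A1 + sd A2'' + sd B1'' + sd B2 = - 2"
    "sd A1 + sd A2 + sd B1 + sd B2 = - 2"
    "src (hd (A1 @ A2')) = src (hd (A1 @ A2))" "src (hd (A1 @ A2'')) = src (hd (A1 @ A2))"
    "src (hd (B1' @ B2)) = src (hd (B1 @ B2))" "src (hd (B1'' @ B2)) = src (hd (B1 @ B2))"
  and A: "src (hd (A2' @ A1)) = src (hd (A2 @ A1))" "src (hd (A2'' @ A1)) = src (hd (A2 @ A1))"
  and B: "src (hd (B2 @ B1')) = src (hd (B2 @ B1))" "src (hd (B2 @ B1'')) = src (hd (B2 @ B1))"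
  and lin: "\<And>N X Y. path C X (A2' @ N # B1') Y \<Longrightarrow> path C X (A2'' @ N # B1'') Y \<Longrightarrow>
     mop C (A2 @ N # B1) = scl C c (mop C (A2' @ N # B1')) + mop C (A2'' @ N # B1'')"
  shows "T2 C t A1 A2 B1 B2 = c * T2 C t A1 A2' B1' B2 + T2 C t A1 A2'' B1'' B2"
proof -
  define X where "X = src (hd (A1 @ A2))"
  define Y where "Y = src (hd (B1 @ B2))"
  have O: "X \<in> Obj C" "Y \<in> Obj C"
    using assms(1,4) by (auto simp: X_def Y_def elim: hochs_cut)
  define X' where "X' = src (hd (A2 @ A1))"
  define Y' where "Y' = src (hd (B2 @ B1))"
  have pA: "path C X A1 X' \<and> path C X' A X"
    if h: "A1 @ A \<in> hochs C" "src (hd (A1 @ A)) = X" "src (hd (A @ A1)) = X'" for A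
  proof -
    obtain Z where Z: "path C X A1 Z" "path C Z A X"
      using h(1,2) by (auto elim: hochs_cut)
    moreover have "A @ A1 \<noteq> []"
      using h(1) by (auto simp: hochs_def)
    moreover have "path C Z (A @ A1) Z"
      using Z by (auto simp: path_append)
    ultimately show ?thesis
      using path_hd[of C Z "A @ A1" Z] h(3) by auto
  qed
  have pB: "path C Y B Y' \<and> path C Y' B2 Y"
    if h: "B @ B2 \<in> hochs C" "src (hd (B @ B2)) = Y" "src (hd (B2 @ B)) = Y'" for B
  proof -
    obtain Z where Z: "path C Y B Z" "path C Z B2 Y"
      using h(1,2) by (auto elim: hochs_cut)
    moreover have "B2 @ B \<noteq> []"
      using h(1) by (auto simp: hochs_def)
    moreover have "path C Z (B2 @ B) Z"
      using Z by (auto simp: path_append)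
    ultimately show ?thesis
      using path_hd[of C Z "B2 @ B" Z] h(3) by auto
  qed
  have a: "path C X A1 X'" "path C X' A2 X" "path C X' A2' X" "path C X' A2'' X"
    using pA[of A2] pA[of A2'] pA[of A2''] assms A by (auto simp: X_def X'_def)
  have b: "path C Y' B2 Y" "path C Y B1 Y'" "path C Y B1' Y'" "path C Y B1'' Y'"
    using pB[of B1] pB[of B1'] pB[of B1''] assms B by (auto simp: Y_def Y'_def)
  have m: "mop C (A1 @ mres C (A2 @ Arr X Y i v # B1) # B2) =
      scl C c (mop C (A1 @ mres C (A2' @ Arr X Y i v # B1') # B2)) + mop C (A1 @ mres C (A2'' @ Arr X Y i v # B1'') # B2)"
    if v: "v \<in> Hom C X Y i" for i v
  proof -
    have p: "path C X' (A2 @ Arr X Y i v # B1) Y'" "path C X' (A2' @ Arr X Y i v # B1') Y'"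
      "path C X' (A2'' @ Arr X Y i v # B1'') Y'"
      using a b v O by (auto simp: path_append Arr_in_arrows)
    define j where "j = sd A2 + i + sd B1 + 1"
    have j: "sd A2' + i + sd B1' + 1 = j" "sd A2'' + i + sd B1'' + 1 = j"
      using assms(7,8,9) by (auto simp: j_def)
    have r: "mres C (A2 @ Arr X Y i v # B1) = Arr X' Y' j (mop C (A2 @ Arr X Y i v # B1))"
      "mres C (A2' @ Arr X Y i v # B1') = Arr X' Y' j (mop C (A2' @ Arr X Y i v # B1'))"
      "mres C (A2'' @ Arr X Y i v # B1'') = Arr X' Y' j (mop C (A2'' @ Arr X Y i v # B1''))"
      using mres_path[OF p(1)] mres_path[OF p(2)] mres_path[OF p(3)] j by (auto simp: sdeg_def j_def)
    have w: "path C X (A1 @ mres C (A2' @ Arr X Y i v # B1') # B2) Y"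
      "path C X (A1 @ mres C (A2'' @ Arr X Y i v # B1'') # B2) Y"
      using wrap_path a(1) b(1) p by auto
    show ?thesis
      using mop_lin[of X A1 X' Y' j _ B2 Y] w lin[OF p(2,3)] unfolding r by simp
  qed
  show ?thesis
    unfolding T2_def assms(10-13) X_def[symmetric] Y_def[symmetric]
    using assms m by (intro gtr_lin O endo_T2) (auto simp: X_def Y_def)
qed

end

text \<open>Under each cut the replaced letter lies in one of the two arcs, and the signs depend on
  degrees only. Hence linearity of \<open>\<Phi>\<close> in each arc is enough.\<close>

lemma MA_lin:
  assumes h: "us @ xv # vs \<in> hochs C" "us @ xw # vs \<in> hochs C"
    and d: "sdeg xu = sdeg xv" "sdeg xw = sdeg xv"
    and L1: "\<And>A B m. (A @ xv # B) @ m \<in> hochs C \<Longrightarrow> (A @ xw # B) @ m \<in> hochs C \<Longrightarrow>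
      sd A + sd B + sd m + sdeg xv = sd (us @ xv # vs) \<Longrightarrow>
      \<Phi> (A @ xu # B) m = c * \<Phi> (A @ xv # B) m + \<Phi> (A @ xw # B) m"
    and L2: "\<And>A B m. m @ (A @ xv # B) \<in> hochs C \<Longrightarrow> m @ (A @ xw # B) \<in> hochs C \<Longrightarrow>
      sd A + sd B + sd m + sdeg xv = sd (us @ xv # vs) \<Longrightarrow>
      \<Phi> m (A @ xu # B) = c * \<Phi> m (A @ xv # B) + \<Phi> m (A @ xw # B)"
  shows "MA (us @ xu # vs) \<Phi> = c * MA (us @ xv # vs) \<Phi> + MA (us @ xw # vs) \<Phi>"
proof -
  have 1: "(\<Sum>(s, m, q)\<in>D3 vs. if us @ xu # s = [] then 0 else ksign (sd q * (sd (us @ xu # s) + sd m)) * \<Phi> (q @ us @ xu # s) m) =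
    c * (\<Sum>(s, m, q)\<in>D3 vs. if us @ xv # s = [] then 0 else ksign (sd q * (sd (us @ xv # s) + sd m)) * \<Phi> (q @ us @ xv # s) m) +
    (\<Sum>(s, m, q)\<in>D3 vs. if us @ xw # s = [] then 0 else ksign (sd q * (sd (us @ xw # s) + sd m)) * \<Phi> (q @ us @ xw # s) m)"
    unfolding sum_distrib_left sum.distrib[symmetric]
  proof (intro sum.cong refl, clarify)
    fix s m q assume "(s, m, q) \<in> D3 vs"
    then have "\<Phi> ((q @ us) @ xu # s) m = c * \<Phi> ((q @ us) @ xv # s) m + \<Phi> ((q @ us) @ xw # s) m"
      using h hochs_rotate[of "us @ xv # s @ m" q C] hochs_rotate[of "us @ xw # s @ m" q C]
      by (intro L1) (auto dest!: D3D)
    then show "(if us @ xu # s = [] then 0 else ksign (sd q * (sd (us @ xu # s) + sd m)) * \<Phi> (q @ us @ xu # s) m) =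
      c * (if us @ xv # s = [] then 0 else ksign (sd q * (sd (us @ xv # s) + sd m)) * \<Phi> (q @ us @ xv # s) m) +
      (if us @ xw # s = [] then 0 else ksign (sd q * (sd (us @ xw # s) + sd m)) * \<Phi> (q @ us @ xw # s) m)"
      by (simp add: d algebra_simps)
  qed
  have 2: "(\<Sum>(p, s)\<in>D2 us. \<Sum>(s', q)\<in>D2 vs. if p = [] then 0 else ksign (sd q * (sd p + sd (s @ xu # s'))) * \<Phi> (q @ p) (s @ xu # s')) =
    c * (\<Sum>(p, s)\<in>D2 us. \<Sum>(s', q)\<in>D2 vs. if p = [] then 0 else ksign (sd q * (sd p + sd (s @ xv # s'))) * \<Phi> (q @ p) (s @ xv # s')) +
    (\<Sum>(p, s)\<in>D2 us. \<Sum>(s', q)\<in>D2 vs. if p = [] then 0 else ksign (sd q * (sd p + sd (s @ xw # s'))) * \<Phi> (q @ p) (s @ xw # s'))"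
    unfolding split_def sum_distrib_left sum.distrib[symmetric]
  proof (intro sum.cong refl)
    fix x y assume "x \<in> D2 us" "y \<in> D2 vs"
    then obtain p s s' q where xy: "x = (p, s)" "y = (s', q)" "us = p @ s" "vs = s' @ q"
      by (cases x; cases y) (auto simp: D2_def)
    have "\<Phi> (q @ p) (s @ xu # s') = c * \<Phi> (q @ p) (s @ xv # s') + \<Phi> (q @ p) (s @ xw # s')"
      using h hochs_rotate[of "p @ s @ xv # s'" q C] hochs_rotate[of "p @ s @ xw # s'" q C]
      by (intro L2) (auto simp: xy)
    then show "(if fst x = [] then 0 else ksign (sd (snd y) * (sd (fst x) + sd (snd x @ xu # fst y))) * \<Phi> (snd y @ fst x) (snd x @ xu # fst y)) =
      c * (if fst x = [] then 0 else ksign (sd (snd y) * (sd (fst x) + sd (snd x @ xv # fst y))) * \<Phi> (snd y @ fst x) (snd x @ xv # fst y)) +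
      (if fst x = [] then 0 else ksign (sd (snd y) * (sd (fst x) + sd (snd x @ xw # fst y))) * \<Phi> (snd y @ fst x) (snd x @ xw # fst y))"
      by (simp add: d xy algebra_simps)
  qed
  have 3: "(\<Sum>(p, m, s)\<in>D3 us. if p = [] then 0 else ksign (sd (s @ xu # vs) * (sd p + sd m)) * \<Phi> ((s @ xu # vs) @ p) m) =
    c * (\<Sum>(p, m, s)\<in>D3 us. if p = [] then 0 else ksign (sd (s @ xv # vs) * (sd p + sd m)) * \<Phi> ((s @ xv # vs) @ p) m) +
    (\<Sum>(p, m, s)\<in>D3 us. if p = [] then 0 else ksign (sd (s @ xw # vs) * (sd p + sd m)) * \<Phi> ((s @ xw # vs) @ p) m)"
    unfolding sum_distrib_left sum.distrib[symmetric]
  proof (intro sum.cong refl, clarify)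
    fix p m s assume "(p, m, s) \<in> D3 us"
    then have "\<Phi> (s @ xu # (vs @ p)) m = c * \<Phi> (s @ xv # (vs @ p)) m + \<Phi> (s @ xw # (vs @ p)) m"
      using h hochs_rotate[of "p @ m" "s @ xv # vs" C] hochs_rotate[of "p @ m" "s @ xw # vs" C]
      by (intro L1) (auto dest!: D3D)
    then show "(if p = [] then 0 else ksign (sd (s @ xu # vs) * (sd p + sd m)) * \<Phi> ((s @ xu # vs) @ p) m) =
      c * (if p = [] then 0 else ksign (sd (s @ xv # vs) * (sd p + sd m)) * \<Phi> ((s @ xv # vs) @ p) m) +
      (if p = [] then 0 else ksign (sd (s @ xw # vs) * (sd p + sd m)) * \<Phi> ((s @ xw # vs) @ p) m)"
      by (simp add: d algebra_simps)
  qed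
  show ?thesis
    unfolding MA_def sum_D3_mid 1 2 3 by (simp add: algebra_simps)
qed

context fin_ainf begin

lemma mukai_lin_left:
  assumes h: "us @ Arr X Y i v # vs \<in> hochs C" "us @ Arr X Y i w # vs \<in> hochs C" and bs: "bs \<in> hochs C"
  shows "mukai C (us @ Arr X Y i (scl C c v + w) # vs) bs =
    c * mukai C (us @ Arr X Y i v # vs) bs + mukai C (us @ Arr X Y i w # vs) bs"
proof (cases "sd (us @ Arr X Y i v # vs) + sd bs = - 2")
  case False
  then show ?thesis
    by (auto simp: mukai_eq_0 sdeg_def)
next
  case True
  let ?x = "Arr X Y i"
  let ?\<Phi> = "\<lambda>A1 A2. MA bs (\<lambda>B1 B2. ksign (sd A1) * T2 C (sd us + (i - 1) + sd vs) A1 A2 B1 B2)"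
  have "MA (us @ ?x (scl C c v + w) # vs) ?\<Phi> = c * MA (us @ ?x v # vs) ?\<Phi> + MA (us @ ?x w # vs) ?\<Phi>"
  proof (rule MA_lin[OF h])
    fix A B m assume a: "(A @ ?x v # B) @ m \<in> hochs C" "(A @ ?x w # B) @ m \<in> hochs C"
      and s: "sd A + sd B + sd m + sdeg (?x v) = sd (us @ ?x v # vs)"
    have u: "(A @ ?x (scl C c v + w) # B) @ m \<in> hochs C"
      using hochs_Arr_lin[of A X Y i v "B @ m" w c] a by simp
    show "?\<Phi> (A @ ?x (scl C c v + w) # B) m = c * ?\<Phi> (A @ ?x v # B) m + ?\<Phi> (A @ ?x w # B) m"
      unfolding MA_mult[symmetric] MA_add[symmetric]
    proof (rule MA_cong_hochs[OF bs])
      fix B1 B2 assume b: "B1 @ B2 \<in> hochs C" "sd B1 + sd B2 = sd bs"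
      have "T2 C t (A @ ?x (scl C c v + w) # B) m B1 B2 = c * T2 C t (A @ ?x v # B) m B1 B2 + T2 C t (A @ ?x w # B) m B1 B2" for t
        using True s a b u src_hd_Arr[of A X Y i _ "B @ m"]
        by (intro T2_lin_outer) (auto simp: sdeg_def intro!: mop_lin)
      then show "ksign (sd (A @ ?x (scl C c v + w) # B)) * T2 C (sd us + (i - 1) + sd vs) (A @ ?x (scl C c v + w) # B) m B1 B2 =
          c * (ksign (sd (A @ ?x v # B)) * T2 C (sd us + (i - 1) + sd vs) (A @ ?x v # B) m B1 B2) +
          ksign (sd (A @ ?x w # B)) * T2 C (sd us + (i - 1) + sd vs) (A @ ?x w # B) m B1 B2"
        by (simp add: sdeg_def algebra_simps)
    qed
  next
    fix A B m assume a: "m @ (A @ ?x v # B) \<in> hochs C" "m @ (A @ ?x w # B) \<in> hochs C"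
      and s: "sd A + sd B + sd m + sdeg (?x v) = sd (us @ ?x v # vs)"
    have u: "m @ (A @ ?x (scl C c v + w) # B) \<in> hochs C"
      using hochs_Arr_lin[of "m @ A" X Y i v B w c] a by simp
    show "?\<Phi> m (A @ ?x (scl C c v + w) # B) = c * ?\<Phi> m (A @ ?x v # B) + ?\<Phi> m (A @ ?x w # B)"
      unfolding MA_mult[symmetric] MA_add[symmetric]
    proof (rule MA_cong_hochs[OF bs])
      fix B1 B2 assume b: "B1 @ B2 \<in> hochs C" "sd B1 + sd B2 = sd bs"
      have "T2 C t m (A @ ?x (scl C c v + w) # B) B1 B2 = c * T2 C t m (A @ ?x v # B) B1 B2 + T2 C t m (A @ ?x w # B) B1 B2" for t
        using True s a b u src_hd_Arr[of "m @ A" X Y i _ B] src_hd_Arr[of A X Y i _ "B @ m"]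
        by (intro T2_lin_inner) (auto simp: sdeg_def intro!: mop_lin)
      then show "ksign (sd m) * T2 C (sd us + (i - 1) + sd vs) m (A @ ?x (scl C c v + w) # B) B1 B2 =
          c * (ksign (sd m) * T2 C (sd us + (i - 1) + sd vs) m (A @ ?x v # B) B1 B2) +
          ksign (sd m) * T2 C (sd us + (i - 1) + sd vs) m (A @ ?x w # B) B1 B2"
        by (simp add: algebra_simps)
    qed
  qed (auto simp: sdeg_def)
  then show ?thesis
    using True mukai_T2[OF h(1) bs] mukai_T2[OF h(2) bs] mukai_T2[OF hochs_Arr_lin[OF h] bs]
    by (simp add: sdeg_def algebra_simps)
qed

lemma mukai_lin_right:
  assumes h: "us @ Arr X Y i v # vs \<in> hochs C" "us @ Arr X Y i w # vs \<in> hochs C" and as: "as \<in> hochs C"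
  shows "mukai C as (us @ Arr X Y i (scl C c v + w) # vs) =
    c * mukai C as (us @ Arr X Y i v # vs) + mukai C as (us @ Arr X Y i w # vs)"
proof (cases "sd as + sd (us @ Arr X Y i v # vs) = - 2")
  case False
  then show ?thesis
    by (auto simp: mukai_eq_0 sdeg_def)
next
  case True
  let ?x = "Arr X Y i"
  let ?\<Phi> = "\<lambda>B1 B2. MA as (\<lambda>A1 A2. ksign (sd A1) * T2 C (sd as) A1 A2 B1 B2)"
  have "MA (us @ ?x (scl C c v + w) # vs) ?\<Phi> = c * MA (us @ ?x v # vs) ?\<Phi> + MA (us @ ?x w # vs) ?\<Phi>"
  proof (rule MA_lin[OF h])
    fix A B m assume a: "(A @ ?x v # B) @ m \<in> hochs C" "(A @ ?x w # B) @ m \<in> hochs C"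
      and s: "sd A + sd B + sd m + sdeg (?x v) = sd (us @ ?x v # vs)"
    have u: "(A @ ?x (scl C c v + w) # B) @ m \<in> hochs C"
      using hochs_Arr_lin[of A X Y i v "B @ m" w c] a by simp
    show "?\<Phi> (A @ ?x (scl C c v + w) # B) m = c * ?\<Phi> (A @ ?x v # B) m + ?\<Phi> (A @ ?x w # B) m"
      unfolding MA_mult[symmetric] MA_add[symmetric]
    proof (rule MA_cong_hochs[OF as])
      fix A1 A2 assume b: "A1 @ A2 \<in> hochs C" "sd A1 + sd A2 = sd as"
      have "T2 C t A1 A2 (A @ ?x (scl C c v + w) # B) m = c * T2 C t A1 A2 (A @ ?x v # B) m + T2 C t A1 A2 (A @ ?x w # B) m" for t
        using True s a b u src_hd_Arr[of A X Y i _ "B @ m"] src_hd_Arr[of "m @ A" X Y i _ B]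
          mop_lin[of _ "A2 @ _ # A"]
        by (intro T2_lin_inner) (auto simp: sdeg_def)
      then show "ksign (sd A1) * T2 C (sd as) A1 A2 (A @ ?x (scl C c v + w) # B) m =
          c * (ksign (sd A1) * T2 C (sd as) A1 A2 (A @ ?x v # B) m) +
          ksign (sd A1) * T2 C (sd as) A1 A2 (A @ ?x w # B) m"
        by (simp add: algebra_simps)
    qed
  next
    fix A B m assume a: "m @ (A @ ?x v # B) \<in> hochs C" "m @ (A @ ?x w # B) \<in> hochs C"
      and s: "sd A + sd B + sd m + sdeg (?x v) = sd (us @ ?x v # vs)"
    have u: "m @ (A @ ?x (scl C c v + w) # B) \<in> hochs C"
      using hochs_Arr_lin[of "m @ A" X Y i v B w c] a by simp
    show "?\<Phi> m (A @ ?x (scl C c v + w) # B) = c * ?\<Phi> m (A @ ?x v # B) + ?\<Phi> m (A @ ?x w # B)"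
      unfolding MA_mult[symmetric] MA_add[symmetric]
    proof (rule MA_cong_hochs[OF as])
      fix A1 A2 assume b: "A1 @ A2 \<in> hochs C" "sd A1 + sd A2 = sd as"
      have "T2 C t A1 A2 m (A @ ?x (scl C c v + w) # B) = c * T2 C t A1 A2 m (A @ ?x v # B) + T2 C t A1 A2 m (A @ ?x w # B)" for t
        using True s a b u src_hd_Arr[of "m @ A" X Y i _ B] mop_lin[of _ "A1 @ _ # A"]
        by (intro T2_lin_outer) (auto simp: sdeg_def)
      then show "ksign (sd A1) * T2 C (sd as) A1 A2 m (A @ ?x (scl C c v + w) # B) =
          c * (ksign (sd A1) * T2 C (sd as) A1 A2 m (A @ ?x v # B)) +
          ksign (sd A1) * T2 C (sd as) A1 A2 m (A @ ?x w # B)"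
        by (simp add: algebra_simps)
    qed
  qed (auto simp: sdeg_def)
  then show ?thesis
    using True mukai_T2[OF as h(1)] mukai_T2[OF as h(2)] mukai_T2[OF as hochs_Arr_lin[OF h]]
    by (subst (asm) (1 2 3) MA_swap) (simp add: sdeg_def algebra_simps)
qed

end

section \<open>Linear extension\<close>

global_interpretation fv: vector_space "smul :: 'k::field \<Rightarrow> ('a \<Rightarrow> 'k) \<Rightarrow> 'a \<Rightarrow> 'k"
  by unfold_locales (auto simp: smul_def fun_eq_iff algebra_simps)

lemma smul_apply: "smul c f x = c * f x"
  by (simp add: smul_def)

lemma fs_0 [simp]: "fs (0 :: 'a \<Rightarrow> 'k::zero)"
  by (simp add: fs_def)

lemma fs_sgl [simp]: "fs (sgl a :: 'a \<Rightarrow> 'k::zero_neq_one)"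
  by (simp add: fs_def sgl_def)

lemma fs_add [simp]: "fs f \<Longrightarrow> fs g \<Longrightarrow> fs (f + g :: 'a \<Rightarrow> 'k::monoid_add)"
  unfolding fs_def by (rule finite_subset[of _ "{x. f x \<noteq> 0} \<union> {x. g x \<noteq> 0}"]) auto

lemma fs_smul [simp]: "fs f \<Longrightarrow> fs (smul (c::'k::field) f)"
  unfolding fs_def smul_def by (rule finite_subset[of _ "{x. f x \<noteq> 0}"]) auto

lemma fs_uminus [simp]: "fs f \<Longrightarrow> fs (- f :: 'a \<Rightarrow> 'k::field)"
  by (simp add: fs_def)

lemma fs_diff [simp]: "fs f \<Longrightarrow> fs g \<Longrightarrow> fs (f - g :: 'a \<Rightarrow> 'k::field)"
  using fs_add[of f "- g"] by simp

lemma fs_sum [simp]: "(\<And>t. t \<in> T \<Longrightarrow> fs (f t)) \<Longrightarrow> fs (\<Sum>t\<in>T. f t :: 'a \<Rightarrow> 'k::field)"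
  by (induction T rule: infinite_finite_induct) auto

lemma lext_apply_sum:
  assumes "finite S" "{a. x a \<noteq> 0} \<subseteq> S"
  shows "lext F x y = (\<Sum>a\<in>S. x a * F a y)"
  unfolding lext_def using assms by (intro sum.mono_neutral_left) auto

lemma lext_eq_sum:
  assumes "finite S" "{a. x a \<noteq> 0} \<subseteq> S"
  shows "lext F x = (\<Sum>a\<in>S. smul (x a) (F a))"
  by (rule ext) (simp add: lext_apply_sum[OF assms] sum_fun_apply smul_def)

lemma fs_lext [simp]:
  assumes "fs f" "\<And>a. f a \<noteq> 0 \<Longrightarrow> fs (F a)"
  shows "fs (lext F f)"
proof -
  have "lext F f = (\<Sum>a | f a \<noteq> 0. smul (f a) (F a))"
    using assms(1) by (intro lext_eq_sum) (auto simp: fs_def)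
  then show ?thesis
    using assms(2) by (simp only:) (rule fs_sum, simp)
qed

lemma lext_0 [simp]: "lext F 0 = 0"
  by (simp add: lext_def fun_eq_iff)

lemma lext_fun_0 [simp]: "lext (\<lambda>a. 0) f = 0"
  by (simp add: lext_def fun_eq_iff)

lemma lext_sgl [simp]: "lext F (sgl a) = F a"
  using lext_eq_sum[of "{a}" "sgl a" F] by (simp add: sgl_def fun_eq_iff smul_def split: if_splits)

lemma lext_add [simp]:
  assumes "fs f" "fs g" shows "lext F (f + g) = lext F f + lext F g"
proof -
  let ?S = "{a. f a \<noteq> 0} \<union> {a. g a \<noteq> 0}"
  have "finite ?S"
    using assms by (simp add: fs_def)
  moreover from this have "lext F (f + g) = (\<Sum>a\<in>?S. smul ((f + g) a) (F a))"
    "lext F f = (\<Sum>a\<in>?S. smul (f a) (F a))" "lext F g = (\<Sum>a\<in>?S. smul (g a) (F a))"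
    by (rule lext_eq_sum; auto)+
  ultimately show ?thesis
    by (simp add: fv.scale_left_distrib sum.distrib)
qed

lemma lext_smul [simp]: "lext F (smul c f) = smul c (lext F f)"
proof (cases "c = 0")
  case False
  then have "{a. smul c f a * F a y \<noteq> 0} = {a. f a * F a y \<noteq> 0}" for y
    by (auto simp: smul_def)
  then show ?thesis
    by (simp add: lext_def smul_def fun_eq_iff sum_distrib_left mult.assoc)
qed simp

lemma lext_uminus [simp]: "lext F (- f) = - lext F f"
proof -
  have "- g = smul (- 1) g" for g :: "'x \<Rightarrow> 'k::field"
    by (simp add: smul_def fun_eq_iff)
  then show ?thesis
    using lext_smul by metis
qed

lemma lext_diff [simp]: "fs f \<Longrightarrow> fs g \<Longrightarrow> lext F (f - g) = lext F f - lext F g"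
  using lext_add[of f "- g" F] by simp

lemma lext_sum [simp]: "(\<And>t. t \<in> T \<Longrightarrow> fs (f t)) \<Longrightarrow> lext F (\<Sum>t\<in>T. f t) = (\<Sum>t\<in>T. lext F (f t))"
  by (induction T rule: infinite_finite_induct) auto

lemma lext_cong: "(\<And>a. f a \<noteq> 0 \<Longrightarrow> F a = G a) \<Longrightarrow> lext F f = lext G f"
  unfolding lext_def by (intro ext sum.cong Collect_cong) (metis mult_zero_left)+

lemma lext_fun_add: "fs f \<Longrightarrow> lext (\<lambda>a. F a + G a) f = lext F f + lext G f"
  unfolding fs_def by (subst (1 2 3) lext_eq_sum[of "{a. f a \<noteq> 0}"])
    (auto simp: fv.scale_right_distrib sum.distrib)

lemma lext_fun_smul: "lext (\<lambda>a. smul c (F a)) f = smul c (lext F f)"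
proof (cases "c = 0")
  case False
  then have "{a. f a * smul c (F a) y \<noteq> 0} = {a. f a * F a y \<noteq> 0}" for y
    by (auto simp: smul_def)
  then show ?thesis
    by (simp add: lext_def smul_def fun_eq_iff sum_distrib_left mult_ac)
qed simp

lemma lext_fun_sum: "fs f \<Longrightarrow> lext (\<lambda>a. \<Sum>t\<in>T. F t a) f = (\<Sum>t\<in>T. lext (F t) f)"
  by (induction T rule: infinite_finite_induct) (auto simp: lext_fun_add)

lemma lext_lext [simp]:
  assumes "fs f" "\<And>a. f a \<noteq> 0 \<Longrightarrow> fs (G a)"
  shows "lext F (lext G f) = lext (\<lambda>a. lext F (G a)) f"
proof -
  have 1: "lext H f = (\<Sum>a | f a \<noteq> 0. smul (f a) (H a))" for H :: "'a \<Rightarrow> 'x \<Rightarrow> 'b"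
    using assms(1) by (intro lext_eq_sum) (auto simp: fs_def)
  have "lext F (lext G f) = (\<Sum>a | f a \<noteq> 0. lext F (smul (f a) (G a)))"
    unfolding 1 using assms(2) by (intro lext_sum) auto
  also have "\<dots> = (\<Sum>a | f a \<noteq> 0. smul (f a) (lext F (G a)))"
    by simp
  also have "\<dots> = lext (\<lambda>a. lext F (G a)) f"
    using assms(1) by (intro lext_eq_sum[symmetric]) (auto simp: fs_def)
  finally show ?thesis .
qed

lemma lext_sgl_id [simp]: "lext sgl f = f"
proof
  fix y
  have "{a. f a * sgl a y \<noteq> 0} = (if f y = 0 then {} else {y})"
    by (auto simp: sgl_def split: if_splits)
  then show "lext sgl f y = f y"
    by (simp add: lext_def) (simp add: sgl_def)
qed

lemma lext_swap:
  assumes "fs f" "fs g"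
  shows "lext (\<lambda>a. lext (\<lambda>b. F a b) g) f = lext (\<lambda>b. lext (\<lambda>a. F a b) f) g"
proof -
  have 1: "lext H f = (\<Sum>a | f a \<noteq> 0. smul (f a) (H a))" for H :: "'a \<Rightarrow> 'x \<Rightarrow> 'b"
    using assms(1) by (intro lext_eq_sum) (auto simp: fs_def)
  have 2: "lext H g = (\<Sum>a | g a \<noteq> 0. smul (g a) (H a))" for H :: "'c \<Rightarrow> 'x \<Rightarrow> 'b"
    using assms(2) by (intro lext_eq_sum) (auto simp: fs_def)
  show ?thesis
    unfolding 1 2 fv.scale_sum_right by (subst sum.swap) (simp add: mult.commute)
qed

lemma lext_support:
  assumes "lext F f y \<noteq> 0"
  obtains a where "f a \<noteq> 0" "F a y \<noteq> 0"
proof -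
  have "{a. f a * F a y \<noteq> 0} \<noteq> {}"
    using assms unfolding lext_def by (metis sum.empty)
  then show thesis
    using that by auto
qed

lemma lext_smul_sgl_eq: "lext (\<lambda>a. smul (c a) (sgl a)) f = (\<lambda>a. c a * f a)"
proof
  fix y
  have "{a. f a * smul (c a) (sgl a) y \<noteq> 0} = (if f y * c y = 0 then {} else {y})"
    by (auto simp: sgl_def smul_def split: if_splits)
  then show "lext (\<lambda>a. smul (c a) (sgl a)) f y = c y * f y"
    by (simp add: lext_def) (auto simp add: sgl_def smul_def)
qed

text \<open>From here on identities between formal combinations are treated as identities of
  vectors; automatic evaluation at points would break them up, so it is invoked by name.\<close>

lemmas pointwise = plus_fun_apply zero_fun_apply minus_apply uminus_apply

declare plus_fun_apply [simp del] zero_fun_apply [simp del] minus_apply [simp del] uminus_apply [simp del]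

lemma lext_in_fspan:
  assumes "\<And>a. f a \<noteq> 0 \<Longrightarrow> F a \<in> fspan S" "fs f"
  shows "lext F f \<in> fspan S"
proof -
  have "lext F f = (\<Sum>a | f a \<noteq> 0. smul (f a) (F a))"
    using assms(2) by (intro lext_eq_sum) (auto simp: fs_def)
  then show ?thesis
    using assms(1) by (auto intro!: fv.span_sum fv.span_scale)
qed

text \<open>Finite support is carried through the induction because \<open>lext\<close> is additive
  only on finitely supported combinations.\<close>

lemma fspan_lext_induct:
  assumes "\<And>\<rho>. \<rho> \<in> S \<Longrightarrow> fs \<rho> \<and> lext F \<rho> \<in> fspan S'" "f \<in> fspan S"
  shows "fs f \<and> lext F f \<in> fspan S'"
  using assms(2)
proof (induction rule: fv.span_induct_alt)
  case (step c x y)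
  then show ?case
    using assms(1)[of x] by (simp add: fv.span_add fv.span_scale)
qed (simp add: fv.span_zero)

lemma ev_sgl [simp]: "ev \<phi> (sgl a) = \<phi> a"
  using ev_eq_sum[of "{a}" "sgl a" \<phi>] by (auto simp: sgl_def split: if_splits)

lemma ev_smul [simp]: "ev \<phi> (smul c f) = c * ev \<phi> f"
proof (cases "c = 0")
  case False
  then have "{a. smul c f a \<noteq> 0} = {a. f a \<noteq> 0}"
    by (auto simp: smul_def)
  then show ?thesis
    by (simp add: ev_def smul_def sum_distrib_left mult.assoc)
qed (simp add: ev_def pointwise)

lemma ev_0 [simp]: "ev \<phi> 0 = 0"
  by (simp add: ev_def pointwise)

lemma ev_uminus [simp]: "ev \<phi> (- f) = - ev \<phi> f"
proof -
  have "- f = smul (- 1) f"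
    by (simp add: smul_def fun_eq_iff pointwise)
  then show ?thesis
    using ev_smul[of \<phi> "- 1" f] by simp
qed

lemma ev_diff: "fs f \<Longrightarrow> fs g \<Longrightarrow> ev \<phi> (f - g) = ev \<phi> f - ev \<phi> g"
  using ev_add[of f "- g" \<phi>] by simp

lemma ev_lext:
  assumes "fs f" "\<And>a. f a \<noteq> 0 \<Longrightarrow> fs (F a)"
  shows "ev \<phi> (lext F f) = ev (\<lambda>a. ev \<phi> (F a)) f"
proof -
  have "ev \<phi> (\<Sum>a\<in>T. smul (f a) (F a)) = (\<Sum>a\<in>T. f a * ev \<phi> (F a))"
    if "\<And>a. a \<in> T \<Longrightarrow> f a \<noteq> 0" for T
    using that by (induction T rule: infinite_finite_induct) (auto simp: ev_add assms(2))
  from this[of "{a. f a \<noteq> 0}"] show ?thesis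
    using assms(1) lext_eq_sum[of "{a. f a \<noteq> 0}" f F] by (simp add: fs_def ev_def)
qed

lemma fspan_ev_0:
  assumes "\<And>\<rho>. \<rho> \<in> S \<Longrightarrow> fs \<rho> \<and> ev \<phi> \<rho> = 0" "f \<in> fspan S"
  shows "fs f \<and> ev \<phi> f = 0"
  using assms(2)
proof (induction rule: fv.span_induct_alt)
  case (step c x y)
  then show ?case
    using assms(1)[of x] by (simp add: ev_add)
qed simp

section \<open>The pairing on the reduced complex\<close>

lemma mukai_l_ev: "mukai_l C x bs = ev (\<lambda>as. mukai C as bs) x"
  by (simp add: mukai_l_def ev_def)

lemma hrel_props:
  assumes "\<rho> \<in> hrel C"
  shows "fs \<rho>" "\<exists>n. \<forall>as. \<rho> as \<noteq> 0 \<longrightarrow> hdeg as = n"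
proof -
  from assms consider (lin) as X Y i c v w bs where "\<rho> = sgl (as @ Arr X Y i (scl C c v + w) # bs)
        - smul c (sgl (as @ Arr X Y i v # bs)) - sgl (as @ Arr X Y i w # bs)"
    | (unit) a as X bs where "\<rho> = sgl (a # as @ unit_arr C X # bs)"
    unfolding hrel_def by blast
  note cs = this
  show "fs \<rho>"
    by (cases rule: cs) simp_all
  show "\<exists>n. \<forall>as. \<rho> as \<noteq> 0 \<longrightarrow> hdeg as = n"
  proof (cases rule: cs)
    case lin
    have "\<rho> zs \<noteq> 0 \<Longrightarrow> zs = as @ Arr X Y i (scl C c v + w) # bs \<or>
        zs = as @ Arr X Y i v # bs \<or> zs = as @ Arr X Y i w # bs" for zs
      unfolding lin by (auto simp: sgl_def smul_def pointwise split: if_splits)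
    then show ?thesis
      by (intro exI[of _ "hdeg (as @ Arr X Y i v # bs)"]) (fastforce simp: hdeg_def sdeg_def)
  next
    case unit
    then show ?thesis
      by (auto simp: sgl_def)
  qed
qed

context fin_ainf begin

lemma hrel_hochs: "\<rho> \<in> hrel C \<Longrightarrow> \<rho> as \<noteq> 0 \<Longrightarrow> as \<in> hochs C"
  unfolding hrel_def by (auto simp: sgl_def smul_def pointwise hochs_Arr_lin split: if_splits)

text \<open>The first argument matters because the boundary of \<open>h\<close> is the Chern
  character only modulo \<open>hrel\<close>, the second because the pairing with \<open>h\<close>
  has to be a functional on classes of generators.\<close>

lemma mukai_hrel:
  assumes "\<rho> \<in> hrel C" "bs \<in> hochs C"
  shows "ev (\<lambda>as. mukai C as bs) \<rho> = 0" "ev (mukai C bs) \<rho> = 0"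
proof -
  from assms(1) consider (lin) as X Y i c v w zs where "\<rho> = sgl (as @ Arr X Y i (scl C c v + w) # zs)
        - smul c (sgl (as @ Arr X Y i v # zs)) - sgl (as @ Arr X Y i w # zs)"
        "as @ Arr X Y i v # zs \<in> hochs C" "as @ Arr X Y i w # zs \<in> hochs C"
    | (unit) a as X zs where "\<rho> = sgl (a # as @ unit_arr C X # zs)" "a # as @ unit_arr C X # zs \<in> hochs C"
    unfolding hrel_def by blast
  note cs = this
  show "ev (\<lambda>as. mukai C as bs) \<rho> = 0"
    using assms(2) by (cases rule: cs) (simp_all add: ev_diff mukai_lin_left mukai_unit_eq_0)
  show "ev (mukai C bs) \<rho> = 0"
    using assms(2) by (cases rule: cs) (simp_all add: ev_diff mukai_lin_right mukai_unit_eq_0')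
qed

lemma mukai_fspan_hrel:
  assumes "f \<in> fspan (hrel C)" "bs \<in> hochs C"
  shows "fs f" "ev (\<lambda>as. mukai C as bs) f = 0"
  using fspan_ev_0[of "hrel C" "\<lambda>as. mukai C as bs" f] assms mukai_hrel(1)[of _ bs] hrel_props(1)[of _ C] by auto

end

section \<open>Operators on words\<close>

definition cns :: "'g \<Rightarrow> ('g list \<Rightarrow> 'k) \<Rightarrow> 'g list \<Rightarrow> 'k::field" where
  "cns x f = lext (\<lambda>ys. sgl (x # ys)) f"

definition tw :: "('g \<Rightarrow> int) \<Rightarrow> int \<Rightarrow> ('g list \<Rightarrow> 'k) \<Rightarrow> 'g list \<Rightarrow> 'k::field" where
  "tw gd e f = lext (\<lambda>ys. smul (ksign (e * ldeg gd ys)) (sgl ys)) f"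

text \<open>Removes a letter \<open>x\<close> in all possible ways, with coefficient \<open>\<beta> x\<close>; passing a letter to the left
  (resp. right) counts \<open>s\<close> (resp. \<open>e\<close>) times its degree.\<close>

fun dlt :: "('g \<Rightarrow> int) \<Rightarrow> int \<Rightarrow> int \<Rightarrow> ('g \<Rightarrow> 'k) \<Rightarrow> 'g list \<Rightarrow> 'g list \<Rightarrow> 'k::field" where
  "dlt gd s e \<beta> [] = 0"
| "dlt gd s e \<beta> (x # xs) = smul (\<beta> x * ksign (e * ldeg gd xs)) (sgl xs) +
     smul (ksign (s * gd x)) (cns x (dlt gd s e \<beta> xs))"

lemma ldeg_simps [simp]:
  "ldeg gd [] = 0" "ldeg gd (x # xs) = gd x + ldeg gd xs" "ldeg gd (xs @ ys) = ldeg gd xs + ldeg gd ys"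
  by (simp_all add: ldeg_def)

lemma fs_cns [simp]: "fs f \<Longrightarrow> fs (cns x f)"
  by (simp add: cns_def)

lemma cns_sgl [simp]: "cns x (sgl ys) = sgl (x # ys)"
  by (simp add: cns_def)

lemma cns_add [simp]: "fs f \<Longrightarrow> fs g \<Longrightarrow> cns x (f + g) = cns x f + cns x g"
  by (simp add: cns_def)

lemma cns_smul [simp]: "cns x (smul c f) = smul c (cns x f)"
  by (simp add: cns_def)

lemma cns_0 [simp]: "cns x 0 = 0"
  by (simp add: cns_def)

lemma fs_dlt [simp]: "fs (dlt gd s e \<beta> xs)"
  by (induction xs) (simp_all)

lemma lext_cns [simp]: "fs f \<Longrightarrow> lext F (cns x f) = lext (\<lambda>ys. F (x # ys)) f"
  by (simp add: cns_def)

lemma tw_hom: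
  assumes "\<And>ys. f ys \<noteq> 0 \<Longrightarrow> ldeg gd ys = n"
  shows "tw gd e f = smul (ksign (e * n)) f"
proof
  fix ys
  show "tw gd e f ys = smul (ksign (e * n)) f ys"
    unfolding tw_def lext_smul_sgl_eq
    by (cases "f ys = 0") (simp_all add: assms smul_def)
qed

lemma dlt_support:
  assumes "dlt gd s e \<beta> xs ys \<noteq> 0"
  shows "\<exists>us x vs. xs = us @ x # vs \<and> ys = us @ vs \<and> \<beta> x \<noteq> 0"
  using assms
proof (induction xs arbitrary: ys)
  case (Cons x xs)
  then consider "\<beta> x \<noteq> 0" "ys = xs" | "cns x (dlt gd s e \<beta> xs) ys \<noteq> 0"
    by (cases "\<beta> x \<noteq> 0 \<and> ys = xs") (auto simp: smul_def sgl_def plus_fun_apply split: if_splits)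
  then show ?case
  proof cases
    case 1
    then show ?thesis by (intro exI[of _ "[]"]) auto
  next
    case 2
    then obtain zs where "dlt gd s e \<beta> xs zs \<noteq> 0" "ys = x # zs"
      unfolding cns_def by (elim lext_support) (auto simp: sgl_def split: if_splits)
    with Cons.IH[of zs] show ?thesis
      by (metis append_Cons)
  qed
qed (simp add: pointwise)

lemma dlt_hom:
  assumes "dlt gd s e \<beta> xs ys \<noteq> 0" "\<And>x. x \<in> set xs \<Longrightarrow> \<beta> x \<noteq> 0 \<Longrightarrow> gd x = p"
  shows "ldeg gd ys = ldeg gd xs - p"
proof -
  obtain us x vs where "xs = us @ x # vs" "ys = us @ vs" "\<beta> x \<noteq> 0"
    using dlt_support[OF assms(1)] by (elim exE conjE)
  with assms(2)[of x] show ?thesis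
    by simp
qed

lemma lext_dlt_Cons:
  assumes "fs f"
  shows "lext (\<lambda>ys. dlt gd s e \<beta> (x # ys)) f =
    smul (\<beta> x) (tw gd e f) + smul (ksign (s * gd x)) (cns x (lext (dlt gd s e \<beta>) f))"
proof -
  have "lext (\<lambda>ys. dlt gd s e \<beta> (x # ys)) f =
     lext (\<lambda>ys. smul (\<beta> x) (smul (ksign (e * ldeg gd ys)) (sgl ys))) f +
     lext (\<lambda>ys. smul (ksign (s * gd x)) (cns x (dlt gd s e \<beta> ys))) f"
    using assms by (simp add: lext_fun_add)
  then show ?thesis
    using assms by (simp add: lext_fun_smul tw_def cns_def del: fv.scale_scale)
qed

lemma tw_dlt:
  assumes "\<And>x. x \<in> set xs \<Longrightarrow> \<beta> x \<noteq> 0 \<Longrightarrow> gd x = p"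
  shows "tw gd e' (dlt gd s e \<beta> xs) = smul (ksign (e' * (ldeg gd xs - p))) (dlt gd s e \<beta> xs)"
  using assms by (intro tw_hom) (auto dest: dlt_hom)

text \<open>Both sides remove the same pair of letters. The two parity conditions compare the signs
  for the two relative positions of the pair: which letter is passed depends on which removal is
  performed while the other letter is still present.\<close>

lemma dlt_commute:
  assumes "\<And>x. x \<in> set xs \<Longrightarrow> \<beta> x \<noteq> 0 \<Longrightarrow> gd x = p" "\<And>x. x \<in> set xs \<Longrightarrow> \<beta>' x \<noteq> 0 \<Longrightarrow> gd x = p'"
    and "even (e * p' + s' * p - \<kappa>)" "even (s * p' + e' * p - \<kappa>)"
  shows "lext (dlt gd s' e' \<beta>') (dlt gd s e \<beta> xs) = smul (ksign \<kappa>) (lext (dlt gd s e \<beta>) (dlt gd s' e' \<beta>' xs))"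
  using assms(1,2)
proof (induction xs)
  case (Cons x xs)
  note [simp] = fv.scale_right_distrib
  have IH: "lext (dlt gd s' e' \<beta>') (dlt gd s e \<beta> xs) = smul (ksign \<kappa>) (lext (dlt gd s e \<beta>) (dlt gd s' e' \<beta>' xs))"
    using Cons by simp
  have 1: "tw gd e' (dlt gd s e \<beta> xs) = smul (ksign (e' * (ldeg gd xs - p))) (dlt gd s e \<beta> xs)"
    using Cons.prems by (intro tw_dlt) auto
  have 2: "tw gd e (dlt gd s' e' \<beta>' xs) = smul (ksign (e * (ldeg gd xs - p'))) (dlt gd s' e' \<beta>' xs)"
    using Cons.prems by (intro tw_dlt) auto
  have 3: "\<beta> x * ksign (e * ldeg gd xs) = ksign \<kappa> * (ksign (s' * gd x) * (\<beta> x * ksign (e * (ldeg gd xs - p'))))"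
  proof (cases "\<beta> x = 0")
    case False
    then have "gd x = p"
      using Cons.prems by simp
    then show ?thesis
      using assms(3) by (auto simp: ksign_def)
  qed simp
  have 4: "ksign (s * gd x) * (\<beta>' x * ksign (e' * (ldeg gd xs - p))) = ksign \<kappa> * (\<beta>' x * ksign (e' * ldeg gd xs))"
  proof (cases "\<beta>' x = 0")
    case False
    then have "gd x = p'"
      using Cons.prems by simp
    then show ?thesis
      using assms(4) by (auto simp: ksign_def)
  qed simp
  have L: "lext (dlt gd s' e' \<beta>') (dlt gd s e \<beta> (x # xs)) =
     smul (\<beta> x * ksign (e * ldeg gd xs)) (dlt gd s' e' \<beta>' xs) +
     smul (ksign (s * gd x) * (\<beta>' x * ksign (e' * (ldeg gd xs - p)))) (dlt gd s e \<beta> xs) +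
     smul (ksign (s * gd x) * ksign (s' * gd x) * ksign \<kappa>) (cns x (lext (dlt gd s e \<beta>) (dlt gd s' e' \<beta>' xs)))"
    unfolding dlt.simps(2)[of gd s e \<beta> x xs]
    by (simp add: lext_dlt_Cons 1 IH mult_ac add_ac del: dlt.simps)
  have R: "lext (dlt gd s e \<beta>) (dlt gd s' e' \<beta>' (x # xs)) =
     smul (\<beta>' x * ksign (e' * ldeg gd xs)) (dlt gd s e \<beta> xs) +
     smul (ksign (s' * gd x) * (\<beta> x * ksign (e * (ldeg gd xs - p')))) (dlt gd s' e' \<beta>' xs) +
     smul (ksign (s * gd x) * ksign (s' * gd x)) (cns x (lext (dlt gd s e \<beta>) (dlt gd s' e' \<beta>' xs)))"
    unfolding dlt.simps(2)[of gd s' e' \<beta>' x xs]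
    by (simp add: lext_dlt_Cons 2 mult_ac add_ac del: dlt.simps)
  show ?case
    unfolding L R fv.scale_right_distrib fv.scale_scale 3 4 by (simp add: mult_ac add_ac)
qed simp

lemma dlt_append:
  "dlt gd s e \<beta> (xs @ ys) =
    smul (ksign (e * ldeg gd ys)) (lext (\<lambda>zs. sgl (zs @ ys)) (dlt gd s e \<beta> xs)) +
    smul (ksign (s * ldeg gd xs)) (lext (\<lambda>zs. sgl (xs @ zs)) (dlt gd s e \<beta> ys))"
proof (induction xs)
  case (Cons x xs)
  then show ?case
    by (simp add: fv.scale_right_distrib ksign_add distrib_left mult_ac add_ac)
      (simp add: cns_def)
qed simp

lemma dlt_index:
  "(\<Sum>k<length xs. smul (ksign (s * ldeg gd (take k xs) + e * ldeg gd (drop (Suc k) xs)) * \<beta> (xs ! k))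
     (sgl (take k xs @ drop (Suc k) xs))) = dlt gd s e \<beta> xs"
proof (induction xs)
  case (Cons x xs)
  have "cns x (\<Sum>k\<in>K. smul (c k) (sgl (w k))) = (\<Sum>k\<in>K. smul (c k) (sgl (x # w k)))" for K :: "nat set" and c :: "nat \<Rightarrow> 'b" and w
    by (simp add: cns_def)
  then show ?case
    unfolding length_Cons sum.lessThan_Suc_shift dlt.simps Cons[symmetric]
    by (simp add: fv.scale_sum_right ksign_add distrib_left mult_ac)
qed simp

lemma der1_Nil [simp]: "der1 gd \<theta> [] = 0"
  by (simp add: der1_def)

lemma der1_Cons:
  assumes "\<And>x. fs (\<theta> x)"
  shows "der1 gd \<theta> (x # xs) = lext (\<lambda>ys. sgl (ys @ xs)) (\<theta> x) + smul (ksign (gd x)) (cns x (der1 gd \<theta> xs))"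
  unfolding der1_def length_Cons sum.lessThan_Suc_shift
  by (simp add: assms cns_def fv.scale_sum_right ksign_add)

lemma fs_der1 [simp]: "(\<And>x. fs (\<theta> x)) \<Longrightarrow> fs (der1 gd \<theta> xs)"
  by (simp add: der1_def)

definition pre :: "'g list \<Rightarrow> ('g list \<Rightarrow> 'k) \<Rightarrow> 'g list \<Rightarrow> 'k::field" where
  "pre xs f = lext (\<lambda>ys. sgl (xs @ ys)) f"

lemma fs_pre [simp]: "fs f \<Longrightarrow> fs (pre xs f)"
  by (simp add: pre_def)

lemma lext_const: "fs f \<Longrightarrow> lext (\<lambda>a. smul (c a) g) f = smul (ev c f) g"
  unfolding fs_def by (subst lext_eq_sum[of "{a. f a \<noteq> 0}"]) (auto simp: ev_def fv.scale_sum_left)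

lemma lext_fun_diff:
  assumes "fs f"
  shows "lext (\<lambda>a. F a - G a) f = lext F f - lext G f"
proof -
  have "lext (\<lambda>a. F a - G a) f = lext (\<lambda>a. F a + smul (- 1) (G a)) f"
    by (rule lext_cong) simp
  also have "\<dots> = lext F f + smul (- 1) (lext G f)"
    by (simp only: lext_fun_add[OF assms] lext_fun_smul)
  finally show ?thesis
    by simp
qed

lemma plus_neq_0: "(f + g) y \<noteq> (0 :: 'k::field) \<Longrightarrow> f y \<noteq> 0 \<or> g y \<noteq> 0"
  by (auto simp: pointwise)

lemma smul_neq_0: "smul c f y \<noteq> (0 :: 'k::field) \<Longrightarrow> f y \<noteq> 0"
  by (auto simp: smul_def)

lemma der1_hom:
  assumes "der1 gd \<theta> xs ys \<noteq> 0" "\<And>x. fs (\<theta> x)"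
    "\<And>x zs. x \<in> set xs \<Longrightarrow> \<theta> x zs \<noteq> 0 \<Longrightarrow> ldeg gd zs = gd x + 1"
  shows "ldeg gd ys = ldeg gd xs + 1"
  using assms(1,3)
proof (induction xs arbitrary: ys)
  case (Cons x xs)
  then consider "lext (\<lambda>ys. sgl (ys @ xs)) (\<theta> x) ys \<noteq> 0" | "cns x (der1 gd \<theta> xs) ys \<noteq> 0"
    by (auto simp: der1_Cons[OF assms(2)] dest!: plus_neq_0 smul_neq_0)
  then show ?case
  proof cases
    case 1
    then show ?thesis
      by (elim lext_support) (auto simp: sgl_def Cons.prems(2) split: if_splits)
  next
    case 2
    then obtain zs where "der1 gd \<theta> xs zs \<noteq> 0" "ys = x # zs"
      unfolding cns_def by (elim lext_support) (auto simp: sgl_def split: if_splits)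
    with Cons.IH[of zs] Cons.prems(2) show ?thesis
      by simp
  qed
qed (simp add: pointwise)

text \<open>Acting at different letters, removal and derivation commute. A letter that is removed
  right after \<open>\<theta>\<close> has acted on it contributes \<open>- \<beta>'\<close>. In the
  correction term the 1 is the degree of \<open>\<theta>\<close>, which had to pass the letters on
  the left.\<close>

lemma dlt_der1:
  fixes \<beta> :: "'g \<Rightarrow> 'k::field"
  assumes fs: "\<And>x. fs (\<theta> x)"
    and \<theta>: "\<And>x zs. x \<in> set xs \<Longrightarrow> \<theta> x zs \<noteq> 0 \<Longrightarrow> \<exists>z. zs = [z] \<and> gd z = gd x + 1"
    and \<beta>: "\<And>x. x \<in> set xs \<Longrightarrow> \<beta> x \<noteq> 0 \<Longrightarrow> gd x = e"
      "\<And>x. x \<in> set xs \<Longrightarrow> ev (\<lambda>zs. \<beta> (hd zs)) (\<theta> x) = - \<beta>' x"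
  shows "lext (dlt gd 0 e \<beta>) (der1 gd \<theta> xs) + dlt gd 1 e \<beta>' xs = lext (der1 gd \<theta>) (dlt gd 0 e \<beta> xs)"
  using \<theta> \<beta>
proof (induction xs)
  case (Cons x xs)
  let ?d = "dlt gd 0 e \<beta>" and ?D = "der1 gd \<theta>"
  have D: "fs (?D ys)" for ys
    by (simp add: fs)
  have IH: "lext ?d (?D xs) + dlt gd 1 e \<beta>' xs = lext ?D (?d xs)"
    using Cons by simp
  have tw: "tw gd e (?D xs) = smul (ksign (e * (ldeg gd xs + 1))) (?D xs)"
    using Cons.prems(1) by (intro tw_hom der1_hom[OF _ fs]) (auto, fastforce)
  have "lext ?d (lext (\<lambda>ys. sgl (ys @ xs)) (\<theta> x)) = lext (\<lambda>ys. ?d (ys @ xs)) (\<theta> x)"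
    by (simp add: fs)
  also have "\<dots> = lext (\<lambda>ys. smul (\<beta> (hd ys)) (smul (ksign (e * ldeg gd xs)) (sgl xs)) +
      lext (\<lambda>zs. sgl (ys @ zs)) (?d xs)) (\<theta> x)"
  proof (rule lext_cong)
    fix ys assume "\<theta> x ys \<noteq> 0"
    then obtain z where "ys = [z]"
      using Cons.prems(1)[of x] by auto
    then show "?d (ys @ xs) = smul (\<beta> (hd ys)) (smul (ksign (e * ldeg gd xs)) (sgl xs)) +
      lext (\<lambda>zs. sgl (ys @ zs)) (?d xs)"
      by (simp add: cns_def)
  qed
  also have "\<dots> = smul (- \<beta>' x) (smul (ksign (e * ldeg gd xs)) (sgl xs)) +
      lext (\<lambda>ys. lext (\<lambda>zs. sgl (ys @ zs)) (?d xs)) (\<theta> x)"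
    using Cons.prems(3)[of x] by (simp only: lext_fun_add[OF fs] lext_const[OF fs]) simp
  finally have 1: "lext ?d (lext (\<lambda>ys. sgl (ys @ xs)) (\<theta> x)) = smul (- \<beta>' x) (smul (ksign (e * ldeg gd xs)) (sgl xs)) +
      lext (\<lambda>zs. lext (\<lambda>ys. sgl (ys @ zs)) (\<theta> x)) (?d xs)"
    by (simp add: lext_swap[OF fs fs_dlt])
  have 2: "lext ?d (cns x (?D xs)) = smul (\<beta> x) (smul (ksign (e * (ldeg gd xs + 1))) (?D xs)) + cns x (lext ?d (?D xs))"
    by (simp only: lext_cns[OF D] lext_dlt_Cons[OF D] tw) simp
  have 3: "lext (\<lambda>ys. ?D (x # ys)) (?d xs) = lext (\<lambda>zs. lext (\<lambda>ys. sgl (ys @ zs)) (\<theta> x)) (?d xs) +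
      smul (ksign (gd x)) (cns x (lext ?D (?d xs)))"
    by (simp add: der1_Cons[OF fs] lext_fun_add lext_fun_smul cns_def fs)
  have 4: "\<beta> x = 0 \<or> ksign (gd x) * ksign (e * (1 + ldeg gd xs)) = (ksign (e * ldeg gd xs) :: 'k)"
    using Cons.prems(2)[of x] by (cases "\<beta> x = 0") (auto simp: ksign_def)
  have "lext ?d (?D (x # xs)) + dlt gd 1 e \<beta>' (x # xs) =
     (smul (- \<beta>' x) (smul (ksign (e * ldeg gd xs)) (sgl xs)) +
      lext (\<lambda>zs. lext (\<lambda>ys. sgl (ys @ zs)) (\<theta> x)) (?d xs)) +
     smul (ksign (gd x)) (smul (\<beta> x) (smul (ksign (e * (ldeg gd xs + 1))) (?D xs)) + cns x (lext ?d (?D xs))) +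
     (smul (\<beta>' x * ksign (e * ldeg gd xs)) (sgl xs) + smul (ksign (gd x)) (cns x (dlt gd 1 e \<beta>' xs)))"
    by (simp only: der1_Cons[OF fs] dlt.simps(2)) (simp only: lext_add lext_smul fs_lext fs fs_sgl fs_smul fs_cns D 1 2, simp)
  also have "\<dots> = lext (\<lambda>zs. lext (\<lambda>ys. sgl (ys @ zs)) (\<theta> x)) (?d xs) +
      smul (\<beta> x * ksign (e * ldeg gd xs)) (?D xs) + smul (ksign (gd x)) (cns x (lext ?D (?d xs)))"
    unfolding IH[symmetric] using 4 by (auto simp: fv.scale_right_distrib D fs add_ac)
  also have "\<dots> = lext ?D (?d (x # xs))"
    by (simp add: 3 add_ac del: lext_lext)
  finally show ?case .
qed simp

text \<open>Recursive forms of the sums of \<open>contr\<close> that define \<open>\<Delta>\<close> and its bracket, for a \<open>\<Delta>\<close> that contracts two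
  letters of odd total degree to a scalar.\<close>

fun lap :: "('g \<Rightarrow> int) \<Rightarrow> ('g \<Rightarrow> 'g \<Rightarrow> 'k) \<Rightarrow> 'g list \<Rightarrow> 'g list \<Rightarrow> 'k::field" where
  "lap gd \<delta> [] = 0"
| "lap gd \<delta> (x # xs) = dlt gd (gd x + 1) 0 (\<delta> x) xs + smul (ksign (gd x)) (cns x (lap gd \<delta> xs))"

fun brc :: "('g \<Rightarrow> int) \<Rightarrow> ('g \<Rightarrow> 'g \<Rightarrow> 'k) \<Rightarrow> 'g list \<Rightarrow> 'g list \<Rightarrow> 'g list \<Rightarrow> 'k::field" where
  "brc gd \<delta> [] ys = 0"
| "brc gd \<delta> (x # xs) ys = smul (ksign ((gd x + 1) * ldeg gd xs)) (pre xs (dlt gd (gd x + 1) 0 (\<delta> x) ys)) +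
     smul (ksign (gd x)) (cns x (brc gd \<delta> xs ys))"

lemma fs_lap [simp]: "fs (lap gd \<delta> xs)"
  by (induction xs) simp_all

lemma brc_Nil: "brc gd \<delta> [] = (\<lambda>ys. 0)"
  by (rule ext) simp

lemma fs_brc [simp]: "fs (brc gd \<delta> xs ys)"
  by (induction xs) simp_all

lemma contr_scalar:
  "contr gd (\<lambda>x y. smul (\<delta> x y) (sgl [])) xs i j =
   smul (ksign (gd (xs ! i) * ldeg gd (take i xs) + gd (xs ! j) * (ldeg gd (take j xs) - gd (xs ! i))) * \<delta> (xs ! i) (xs ! j))
     (sgl (take i xs @ slice (Suc i) j xs @ drop (Suc j) xs))"
  unfolding contr_def by simp

lemma contr_scalar_Cons:
  "contr gd (\<lambda>x y. smul (\<delta> x y) (sgl [])) (x # xs) (Suc i) (Suc j) =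
   smul (ksign (gd x * (gd (xs ! i) + gd (xs ! j)))) (cns x (contr gd (\<lambda>x y. smul (\<delta> x y) (sgl [])) xs i j))"
  unfolding contr_scalar by (simp add: slice_def) (auto simp: ksign_def)

text \<open>Only pairs of odd total degree are contracted, so in all signs the degree of the second
  letter may be replaced by \<open>gd x + 1\<close>. The sign then no longer depends on the letter
  that is removed, as \<open>dlt\<close> requires.\<close>

lemma lap_contr:
  assumes "\<And>x y. x \<in> set xs \<Longrightarrow> y \<in> set xs \<Longrightarrow> \<delta> x y \<noteq> 0 \<Longrightarrow> odd (gd x + gd y)"
  shows "(\<Sum>j<length xs. \<Sum>i<j. contr gd (\<lambda>x y. smul (\<delta> x y) (sgl [])) xs i j) = lap gd \<delta> xs"
  using assms
proof (induction xs)
  case (Cons x xs)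
  let ?c = "contr gd (\<lambda>x y. smul (\<delta> x y) (sgl []))"
  have IH: "(\<Sum>j<length xs. \<Sum>i<j. ?c xs i j) = lap gd \<delta> xs"
    using Cons by simp
  have 1: "(\<Sum>j<length xs. ?c (x # xs) 0 (Suc j)) = dlt gd (gd x + 1) 0 (\<delta> x) xs"
    unfolding dlt_index[symmetric]
  proof (intro sum.cong refl)
    fix j assume "j \<in> {..<length xs}"
    then have "xs ! j \<in> set xs"
      by simp
    then have "\<delta> x (xs ! j) \<noteq> 0 \<Longrightarrow> even (gd (xs ! j)) = even (gd x + 1)"
      using Cons.prems[of x "xs ! j"] by auto
    then have "ksign (gd (xs ! j) * ldeg gd (take j xs)) * \<delta> x (xs ! j) =
       ksign ((gd x + 1) * ldeg gd (take j xs)) * \<delta> x (xs ! j)"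
      by (cases "\<delta> x (xs ! j) = 0") (auto simp: ksign_def)
    then show "?c (x # xs) 0 (Suc j) = smul (ksign ((gd x + 1) * ldeg gd (take j xs) + 0 * ldeg gd (drop (Suc j) xs)) * \<delta> x (xs ! j))
     (sgl (take j xs @ drop (Suc j) xs))"
      unfolding contr_scalar by (simp add: slice_def)
  qed
  have 2: "(\<Sum>j<length xs. \<Sum>i<j. ?c (x # xs) (Suc i) (Suc j)) = smul (ksign (gd x)) (cns x (lap gd \<delta> xs))"
  proof -
    have "?c (x # xs) (Suc i) (Suc j) = smul (ksign (gd x)) (cns x (?c xs i j))" if "i < j" "j < length xs" for i j
    proof (cases "\<delta> (xs ! i) (xs ! j) = 0")
      case True
      then show ?thesis
        by (simp add: contr_scalar)
    next
      case False
      then have "odd (gd (xs ! i) + gd (xs ! j))"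
        using that by (intro Cons.prems) auto
      then have "ksign (gd x * (gd (xs ! i) + gd (xs ! j))) = (ksign (gd x) :: 'b)"
        by (auto simp: ksign_def)
      then show ?thesis
        unfolding contr_scalar_Cons by simp
    qed
    then have "(\<Sum>j<length xs. \<Sum>i<j. ?c (x # xs) (Suc i) (Suc j)) =
        (\<Sum>j<length xs. \<Sum>i<j. smul (ksign (gd x)) (cns x (?c xs i j)))"
      by (intro sum.cong refl) auto
    also have "\<dots> = smul (ksign (gd x)) (cns x (\<Sum>j<length xs. \<Sum>i<j. ?c xs i j))"
      by (simp add: cns_def fv.scale_sum_right contr_scalar)
    finally show ?thesis
      by (simp only: IH)
  qed
  show ?case
    unfolding length_Cons sum.lessThan_Suc_shift lap.simps
    by (simp only: sum.distrib 1 2) simp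
qed simp

lemma brc_contr:
  assumes "\<And>x y. x \<in> set xs \<Longrightarrow> y \<in> set ys \<Longrightarrow> \<delta> x y \<noteq> 0 \<Longrightarrow> odd (gd x + gd y)"
  shows "(\<Sum>i<length xs. \<Sum>j<length ys. contr gd (\<lambda>x y. smul (\<delta> x y) (sgl [])) (xs @ ys) i (length xs + j)) = brc gd \<delta> xs ys"
  using assms
proof (induction xs)
  case (Cons x xs)
  let ?c = "contr gd (\<lambda>x y. smul (\<delta> x y) (sgl []))"
  have IH: "(\<Sum>i<length xs. \<Sum>j<length ys. ?c (xs @ ys) i (length xs + j)) = brc gd \<delta> xs ys"
    using Cons by simp
  have 1: "(\<Sum>j<length ys. ?c (x # xs @ ys) 0 (Suc (length xs + j))) =
      smul (ksign ((gd x + 1) * ldeg gd xs)) (pre xs (dlt gd (gd x + 1) 0 (\<delta> x) ys))"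
    unfolding dlt_index[symmetric] pre_def
    apply (subst lext_sum)
     apply simp
    unfolding fv.scale_sum_right
  proof (intro sum.cong refl)
    fix j assume "j \<in> {..<length ys}"
    then have "ys ! j \<in> set ys"
      by simp
    then have "\<delta> x (ys ! j) \<noteq> 0 \<Longrightarrow> even (gd (ys ! j)) = even (gd x + 1)"
      using Cons.prems[of x "ys ! j"] by auto
    then have "ksign (gd (ys ! j) * (ldeg gd xs + ldeg gd (take j ys))) * \<delta> x (ys ! j) =
       ksign ((gd x + 1) * ldeg gd xs) * (ksign ((gd x + 1) * ldeg gd (take j ys)) * \<delta> x (ys ! j))"
      by (cases "\<delta> x (ys ! j) = 0") (auto simp: ksign_def)
    then show "?c (x # xs @ ys) 0 (Suc (length xs + j)) = smul (ksign ((gd x + 1) * ldeg gd xs)) (lext (\<lambda>ys. sgl (xs @ ys))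
       (smul (ksign ((gd x + 1) * ldeg gd (take j ys) + 0 * ldeg gd (drop (Suc j) ys)) * \<delta> x (ys ! j))
     (sgl (take j ys @ drop (Suc j) ys))))"
      unfolding contr_scalar by (simp add: slice_def nth_append)
  qed
  have 2: "(\<Sum>i<length xs. \<Sum>j<length ys. ?c (x # xs @ ys) (Suc i) (Suc (length xs + j))) =
      smul (ksign (gd x)) (cns x (brc gd \<delta> xs ys))"
  proof -
    have "?c (x # xs @ ys) (Suc i) (Suc (length xs + j)) = smul (ksign (gd x)) (cns x (?c (xs @ ys) i (length xs + j)))"
      if "i < length xs" "j < length ys" for i j
    proof (cases "\<delta> (xs ! i) (ys ! j) = 0")
      case True
      then show ?thesis
        using that by (simp add: contr_scalar nth_append)
    next
      case False
      then have "odd (gd (xs ! i) + gd (ys ! j))"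
        using that by (intro Cons.prems) auto
      then have "ksign (gd x * (gd (xs ! i) + gd (ys ! j))) = (ksign (gd x) :: 'b)"
        by (auto simp: ksign_def)
      then show ?thesis
        unfolding contr_scalar_Cons using that by (simp add: nth_append)
    qed
    then have "(\<Sum>i<length xs. \<Sum>j<length ys. ?c (x # xs @ ys) (Suc i) (Suc (length xs + j))) =
        (\<Sum>i<length xs. \<Sum>j<length ys. smul (ksign (gd x)) (cns x (?c (xs @ ys) i (length xs + j))))"
      by (intro sum.cong refl) auto
    also have "\<dots> = smul (ksign (gd x)) (cns x (\<Sum>i<length xs. \<Sum>j<length ys. ?c (xs @ ys) i (length xs + j)))"
      by (simp add: cns_def fv.scale_sum_right contr_scalar)
    finally show ?thesis
      by (simp only: IH)
  qed
  show ?case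
    unfolding length_Cons sum.lessThan_Suc_shift brc.simps append_Cons add_Suc
    by (simp only: 1 2)
qed simp

lemma lap_hom:
  assumes "lap gd \<delta> xs ys \<noteq> 0" "\<And>x y. x \<in> set xs \<Longrightarrow> y \<in> set xs \<Longrightarrow> \<delta> x y \<noteq> 0 \<Longrightarrow> gd x + gd y = N"
  shows "ldeg gd ys = ldeg gd xs - N"
  using assms
proof (induction xs arbitrary: ys)
  case (Cons x xs)
  then consider "dlt gd (gd x + 1) 0 (\<delta> x) xs ys \<noteq> 0" | "cns x (lap gd \<delta> xs) ys \<noteq> 0"
    by (auto dest!: plus_neq_0 smul_neq_0)
  then show ?case
  proof cases
    case 1
    then have "ldeg gd ys = ldeg gd xs - (N - gd x)"
      by (rule dlt_hom) (use Cons.prems(2)[of x] in force)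
    then show ?thesis by simp
  next
    case 2
    then obtain zs where "lap gd \<delta> xs zs \<noteq> 0" "ys = x # zs"
      unfolding cns_def by (elim lext_support) (auto simp: sgl_def split: if_splits)
    with Cons.IH[of zs] Cons.prems(2) show ?thesis
      by simp
  qed
qed (simp add: pointwise)

lemma brc_hom:
  assumes "brc gd \<delta> xs ys zs \<noteq> 0" "\<And>x y. x \<in> set xs \<Longrightarrow> y \<in> set ys \<Longrightarrow> \<delta> x y \<noteq> 0 \<Longrightarrow> gd x + gd y = N"
  shows "ldeg gd zs = ldeg gd xs + ldeg gd ys - N"
  using assms
proof (induction xs arbitrary: zs)
  case (Cons x xs)
  then consider "pre xs (dlt gd (gd x + 1) 0 (\<delta> x) ys) zs \<noteq> 0" | "cns x (brc gd \<delta> xs ys) zs \<noteq> 0"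
    by (auto dest!: plus_neq_0 smul_neq_0)
  then show ?case
  proof cases
    case 1
    then obtain us where us: "dlt gd (gd x + 1) 0 (\<delta> x) ys us \<noteq> 0" "zs = xs @ us"
      unfolding pre_def by (elim lext_support) (auto simp: sgl_def split: if_splits)
    from us(1) have "ldeg gd us = ldeg gd ys - (N - gd x)"
      by (rule dlt_hom) (use Cons.prems(2)[of x] in force)
    then show ?thesis using us by simp
  next
    case 2
    then obtain us where "brc gd \<delta> xs ys us \<noteq> 0" "zs = x # us"
      unfolding cns_def by (elim lext_support) (auto simp: sgl_def split: if_splits)
    with Cons.IH[of us] Cons.prems(2) show ?thesis
      by simp
  qed
qed (simp add: pointwise)

text \<open>At distinct letters the operators commute by \<open>dlt_commute\<close>. If
  \<open>x\<close> itself is removed, the sign of the contraction passing \<open>x\<close> cancels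
  against the change of the remaining degree by the odd number \<open>N\<close>.\<close>

lemma dlt_lap:
  assumes \<delta>: "\<And>x y. x \<in> set xs \<Longrightarrow> y \<in> set xs \<Longrightarrow> \<delta> x y \<noteq> 0 \<Longrightarrow> gd x + gd y = N" and "odd N"
    and \<beta>: "\<And>x. x \<in> set xs \<Longrightarrow> \<beta> x \<noteq> 0 \<Longrightarrow> gd x = e"
  shows "lext (dlt gd 0 e \<beta>) (lap gd \<delta> xs) = lext (lap gd \<delta>) (dlt gd 0 e \<beta> xs)"
  using \<delta> \<beta>
proof (induction xs)
  case (Cons x xs)
  let ?d = "dlt gd 0 e \<beta>" and ?L = "lap gd \<delta>" and ?i = "dlt gd (gd x + 1) 0 (\<delta> x)"
  have IH: "lext ?d (?L xs) = lext ?L (?d xs)"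
    using Cons by simp
  have tw: "tw gd e (?L xs) = smul (ksign (e * (ldeg gd xs - N))) (?L xs)"
    using Cons.prems(1) by (intro tw_hom lap_hom) auto
  have c: "lext ?d (?i xs) = lext ?i (?d xs)"
  proof -
    have "lext ?d (?i xs) = smul (ksign 0) (lext ?i (?d xs))"
    proof (rule dlt_commute)
      show "gd y = N - gd x" if "y \<in> set xs" "\<delta> x y \<noteq> 0" for y
        using Cons.prems(1)[of x y] that by simp
      show "gd y = e" if "y \<in> set xs" "\<beta> y \<noteq> 0" for y
        using Cons.prems(2) that by simp
    qed (use \<open>odd N\<close> in auto)
    then show ?thesis by simp
  qed
  have 4: "ksign (gd x) * (\<beta> x * ksign (e * (ldeg gd xs - N))) = \<beta> x * ksign (e * ldeg gd xs)"
    using Cons.prems(2)[of x] \<open>odd N\<close> by (cases "\<beta> x = 0") (auto simp: ksign_def)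
  have "lext ?d (?L (x # xs)) = lext ?i (?d xs) + smul (ksign (gd x)) (smul (\<beta> x) (smul (ksign (e * (ldeg gd xs - N))) (?L xs)) +
      cns x (lext ?L (?d xs)))"
    by (simp only: lap.simps lext_add lext_smul lext_cns fs_lap fs_dlt fs_cns fs_smul lext_dlt_Cons tw c IH) simp
  also have "\<dots> = lext ?i (?d xs) + smul (\<beta> x * ksign (e * ldeg gd xs)) (?L xs) + smul (ksign (gd x)) (cns x (lext ?L (?d xs)))"
    by (simp add: fv.scale_right_distrib 4 add_ac)
  also have "\<dots> = lext ?L (?d (x # xs))"
    by (simp add: lext_fun_add lext_fun_smul cns_def add_ac)
  finally show ?case .
qed simp

lemma dlt_pre:
  assumes "fs f" "\<And>ys. f ys \<noteq> 0 \<Longrightarrow> ldeg gd ys = n"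
  shows "lext (dlt gd 0 e \<beta>) (pre xs f) =
    smul (ksign (e * n)) (lext (\<lambda>us. pre us f) (dlt gd 0 e \<beta> xs)) + pre xs (lext (dlt gd 0 e \<beta>) f)"
proof -
  have "lext (dlt gd 0 e \<beta>) (pre xs f) = lext (\<lambda>ys. dlt gd 0 e \<beta> (xs @ ys)) f"
    using assms(1) by (simp add: pre_def)
  also have "\<dots> = lext (\<lambda>ys. smul (ksign (e * n)) (lext (\<lambda>zs. sgl (zs @ ys)) (dlt gd 0 e \<beta> xs)) +
     pre xs (dlt gd 0 e \<beta> ys)) f"
    by (rule lext_cong) (simp add: dlt_append assms(2) pre_def)
  also have "\<dots> = smul (ksign (e * n)) (lext (\<lambda>ys. lext (\<lambda>zs. sgl (zs @ ys)) (dlt gd 0 e \<beta> xs)) f) +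
      lext (\<lambda>ys. pre xs (dlt gd 0 e \<beta> ys)) f"
    using assms(1) by (simp add: lext_fun_add lext_fun_smul)
  also have "lext (\<lambda>ys. lext (\<lambda>zs. sgl (zs @ ys)) (dlt gd 0 e \<beta> xs)) f = lext (\<lambda>us. pre us f) (dlt gd 0 e \<beta> xs)"
    unfolding pre_def by (rule lext_swap[OF assms(1) fs_dlt])
  also have "lext (\<lambda>ys. pre xs (dlt gd 0 e \<beta> ys)) f = pre xs (lext (dlt gd 0 e \<beta>) f)"
    using assms(1) by (simp add: pre_def)
  finally show ?thesis .
qed

text \<open>The removed letter lies in \<open>xs\<close>, where it has all of \<open>ys\<close> on
  its right and picks up the corresponding sign, or in \<open>ys\<close>. Apart from this the
  argument is that of \<open>dlt_lap\<close>.\<close>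

lemma dlt_brc:
  fixes \<beta> :: "'g \<Rightarrow> 'k::field"
  assumes \<delta>: "\<And>x y. x \<in> set xs \<Longrightarrow> y \<in> set ys \<Longrightarrow> \<delta> x y \<noteq> 0 \<Longrightarrow> gd x + gd y = N" and "odd N"
    and \<beta>: "\<And>x. x \<in> set xs \<union> set ys \<Longrightarrow> \<beta> x \<noteq> 0 \<Longrightarrow> gd x = e"
  shows "lext (dlt gd 0 e \<beta>) (brc gd \<delta> xs ys) =
    smul (ksign (e * ldeg gd ys)) (lext (\<lambda>us. brc gd \<delta> us ys) (dlt gd 0 e \<beta> xs)) +
    lext (brc gd \<delta> xs) (dlt gd 0 e \<beta> ys)"
  using \<delta> \<beta>
proof (induction xs)
  case (Cons x xs)
  let ?d = "dlt gd 0 e \<beta>" and ?B = "brc gd \<delta>" and ?i = "dlt gd (gd x + 1) 0 (\<delta> x)"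
  let ?E = "ksign (e * ldeg gd ys) :: 'k" and ?A = "ksign ((gd x + 1) * ldeg gd xs) :: 'k"
    and ?s = "ksign (gd x) :: 'k"
  have IH: "lext ?d (?B xs ys) = smul ?E (lext (\<lambda>us. ?B us ys) (?d xs)) + lext (?B xs) (?d ys)"
    using Cons by simp
  have tw: "tw gd e (?B xs ys) = smul (ksign (e * (ldeg gd xs + ldeg gd ys - N))) (?B xs ys)"
    using Cons.prems(1) by (intro tw_hom brc_hom) auto
  have deg: "gd y = N - gd x" if "y \<in> set ys" "\<delta> x y \<noteq> 0" for y
    using Cons.prems(1)[of x y] that by simp
  have c: "lext ?d (?i ys) = lext ?i (?d ys)"
  proof -
    have "lext ?d (?i ys) = smul (ksign 0) (lext ?i (?d ys))"
    proof (rule dlt_commute[OF deg])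
      show "gd y = e" if "y \<in> set ys" "\<beta> y \<noteq> 0" for y
        using Cons.prems(2) that by simp
    qed (use \<open>odd N\<close> in auto)
    then show ?thesis by simp
  qed
  have i: "?i ys zs \<noteq> 0 \<Longrightarrow> ldeg gd zs = ldeg gd ys - (N - gd x)" for zs
    by (rule dlt_hom[OF _ deg])
  have 1: "lext ?d (pre xs (?i ys)) = smul (ksign (e * (ldeg gd ys - (N - gd x)))) (lext (\<lambda>us. pre us (?i ys)) (?d xs)) +
      pre xs (lext ?i (?d ys))"
    unfolding c[symmetric] by (rule dlt_pre[OF fs_dlt i])
  have 2: "lext ?d (cns x (?B xs ys)) = smul (\<beta> x) (smul (ksign (e * (ldeg gd xs + ldeg gd ys - N))) (?B xs ys)) +
      cns x (lext ?d (?B xs ys))"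
    by (simp only: lext_cns lext_dlt_Cons fs_brc tw) simp
  have 3: "lext (\<lambda>us. ?B us ys) (?d (x # xs)) = smul (\<beta> x * ksign (e * ldeg gd xs)) (?B xs ys) +
      smul (ksign ((gd x + 1) * (ldeg gd xs - e))) (lext (\<lambda>us. pre us (?i ys)) (?d xs)) +
      smul ?s (cns x (lext (\<lambda>us. ?B us ys) (?d xs)))"
  proof -
    have "lext (\<lambda>us. ?B (x # us) ys) (?d xs) =
        lext (\<lambda>us. smul (ksign ((gd x + 1) * (ldeg gd xs - e))) (pre us (?i ys)) + smul ?s (cns x (?B us ys))) (?d xs)"
    proof (rule lext_cong)
      fix us assume "?d xs us \<noteq> 0"
      then have "ldeg gd us = ldeg gd xs - e"
        by (rule dlt_hom) (use Cons.prems(2) in auto)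
      then show "?B (x # us) ys = smul (ksign ((gd x + 1) * (ldeg gd xs - e))) (pre us (?i ys)) + smul ?s (cns x (?B us ys))"
        by simp
    qed
    also have "\<dots> = smul (ksign ((gd x + 1) * (ldeg gd xs - e))) (lext (\<lambda>us. pre us (?i ys)) (?d xs)) +
      smul ?s (cns x (lext (\<lambda>us. ?B us ys) (?d xs)))"
      by (simp add: lext_fun_add lext_fun_smul cns_def)
    finally show ?thesis
      by (simp del: brc.simps add: add_ac)
  qed
  have 4: "lext (?B (x # xs)) (?d ys) = smul ?A (pre xs (lext ?i (?d ys))) + smul ?s (cns x (lext (?B xs) (?d ys)))"
  proof -
    have "?B (x # xs) = (\<lambda>zs. smul ?A (pre xs (?i zs)) + smul ?s (cns x (?B xs zs)))"
      by (rule ext) simp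
    then show ?thesis
      by (simp add: lext_fun_add lext_fun_smul cns_def pre_def)
  qed
  have 5: "?s * (\<beta> x * ksign (e * (ldeg gd xs + ldeg gd ys - N))) = ?E * (\<beta> x * ksign (e * ldeg gd xs))"
    using Cons.prems(2)[of x] \<open>odd N\<close> by (cases "\<beta> x = 0") (auto simp: ksign_def)
  have 6: "?A * ksign (e * (ldeg gd ys - (N - gd x))) = ?E * ksign ((gd x + 1) * (ldeg gd xs - e))"
    using \<open>odd N\<close> by (auto simp: ksign_def)
  have s5: "smul ?s (smul (\<beta> x) (smul (ksign (e * (ldeg gd xs + ldeg gd ys - N))) f)) =
      smul ?E (smul (\<beta> x * ksign (e * ldeg gd xs)) f)" for f
    unfolding fv.scale_scale using 5 by (simp only: mult_ac)
  have s6: "smul ?A (smul (ksign (e * (ldeg gd ys - (N - gd x)))) f) =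
      smul ?E (smul (ksign ((gd x + 1) * (ldeg gd xs - e))) f)" for f
    unfolding fv.scale_scale using 6 by (simp only:)
  have "lext ?d (?B (x # xs) ys) = smul ?A (lext ?d (pre xs (?i ys))) + smul ?s (lext ?d (cns x (?B xs ys)))"
    by (simp only: brc.simps lext_add lext_smul fs_pre fs_dlt fs_smul fs_cns fs_brc)
  also have "\<dots> = smul ?E (lext (\<lambda>us. ?B us ys) (?d (x # xs))) + lext (?B (x # xs)) (?d ys)"
    unfolding 1 2 3 4 IH fv.scale_right_distrib s5 s6
    by (simp add: fv.scale_right_distrib add_ac mult_ac del: dlt.simps brc.simps)
  finally show ?case .
qed (simp add: brc_Nil)

section \<open>Relations in symmetric algebras\<close>

text \<open>The relations of \<open>sym_bd\<close>, isolated because the closed and the open algebra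
  share their form.\<close>

definition symrel :: "'g set \<Rightarrow> ('g \<Rightarrow> int) \<Rightarrow> ('g \<Rightarrow> 'k) set \<Rightarrow> ('g list \<Rightarrow> 'k::field) set" where
  "symrel G gd R = {sgl (us @ x # y # vs) - smul (ksign (gd x * gd y)) (sgl (us @ y # x # vs))
              | us x y vs. us \<in> lists G \<and> x \<in> G \<and> y \<in> G \<and> vs \<in> lists G} \<union>
            {lext (\<lambda>x. sgl (us @ x # vs)) \<rho>
              | us \<rho> vs. us \<in> lists G \<and> \<rho> \<in> R \<and> vs \<in> lists G}"

lemma symrel_cases:
  assumes "f \<in> symrel G gd R"
  obtains (swap) us x y vs where "f = sgl (us @ x # y # vs) - smul (ksign (gd x * gd y)) (sgl (us @ y # x # vs))"
      "us \<in> lists G" "x \<in> G" "y \<in> G" "vs \<in> lists G"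
    | (lin) us \<rho> vs where "f = lext (\<lambda>x. sgl (us @ x # vs)) \<rho>" "us \<in> lists G" "\<rho> \<in> R" "vs \<in> lists G"
  using assms unfolding symrel_def by blast

lemma symrel_swapI:
  "us \<in> lists G \<Longrightarrow> x \<in> G \<Longrightarrow> y \<in> G \<Longrightarrow> vs \<in> lists G \<Longrightarrow>
   sgl (us @ x # y # vs) - smul (ksign (gd x * gd y)) (sgl (us @ y # x # vs)) \<in> symrel G gd R"
  unfolding symrel_def by blast

lemma symrel_linI:
  "us \<in> lists G \<Longrightarrow> \<rho> \<in> R \<Longrightarrow> vs \<in> lists G \<Longrightarrow> lext (\<lambda>x. sgl (us @ x # vs)) \<rho> \<in> symrel G gd R"
  unfolding symrel_def by blast

lemma fs_symrel: "f \<in> symrel G gd R \<Longrightarrow> (\<And>\<rho>. \<rho> \<in> R \<Longrightarrow> fs \<rho>) \<Longrightarrow> fs f"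
  by (erule symrel_cases) simp_all

lemma cns_symrel:
  assumes "f \<in> symrel G gd R" "x \<in> G" "\<And>\<rho>. \<rho> \<in> R \<Longrightarrow> fs \<rho>"
  shows "cns x f \<in> symrel G gd R"
  using assms(1)
proof (cases rule: symrel_cases)
  case (swap us a b vs)
  then have "cns x f = sgl ((x # us) @ a # b # vs) - smul (ksign (gd a * gd b)) (sgl ((x # us) @ b # a # vs))"
    by (simp add: cns_def)
  with swap assms(2) show ?thesis
    using symrel_swapI[of "x # us" G a b vs] by simp
next
  case (lin us \<rho> vs)
  then have "cns x f = lext (\<lambda>a. sgl ((x # us) @ a # vs)) \<rho>"
    using assms(3) by (simp add: cns_def)
  with lin assms(2) show ?thesis
    using symrel_linI[of "x # us" G \<rho> R vs gd] by simp
qed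

lemma cns_fspan_symrel:
  assumes "f \<in> fspan (symrel G gd R)" "x \<in> G" "\<And>\<rho>. \<rho> \<in> R \<Longrightarrow> fs \<rho>"
  shows "cns x f \<in> fspan (symrel G gd R)"
  unfolding cns_def
  using fspan_lext_induct[OF _ assms(1), of "\<lambda>ys. sgl (x # ys)" "symrel G gd R"]
    cns_symrel[OF _ assms(2,3)] fs_symrel[OF _ assms(3)]
  by (auto simp: cns_def intro: fv.span_base)

lemma symrel_move:
  assumes "us \<in> lists G" "y \<in> G" "vs \<in> lists G"
  shows "sgl (us @ y # vs) - smul (ksign (gd y * ldeg gd us)) (sgl (y # us @ vs)) \<in> fspan (symrel G gd R)"
  using assms
proof (induction us arbitrary: vs rule: rev_induct)
  case Nil
  then show ?case by (simp add: fv.span_zero)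
next
  case (snoc x us)
  have "sgl (us @ x # y # vs) - smul (ksign (gd x * gd y)) (sgl (us @ y # x # vs)) \<in> fspan (symrel G gd R)"
    using snoc.prems by (intro fv.span_base symrel_swapI) auto
  moreover have "sgl (us @ y # x # vs) - smul (ksign (gd y * ldeg gd us)) (sgl (y # us @ x # vs)) \<in> fspan (symrel G gd R)"
    using snoc.prems snoc.IH[of "x # vs"] by auto
  then have "smul (ksign (gd x * gd y)) (sgl (us @ y # x # vs) - smul (ksign (gd y * ldeg gd us)) (sgl (y # us @ x # vs)))
      \<in> fspan (symrel G gd R)"
    by (rule fv.span_scale)
  ultimately have "(sgl (us @ x # y # vs) - smul (ksign (gd x * gd y)) (sgl (us @ y # x # vs))) +
      smul (ksign (gd x * gd y)) (sgl (us @ y # x # vs) - smul (ksign (gd y * ldeg gd us)) (sgl (y # us @ x # vs)))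
      \<in> fspan (symrel G gd R)"
    by (rule fv.span_add)
  then show ?case
    by (simp add: fv.scale_right_diff_distrib ksign_add distrib_left mult_ac)
qed

text \<open>The removal is well defined on the symmetric algebra: it respects transpositions because
  \<open>\<beta>\<close> is concentrated in the degree \<open>e\<close> that governs its sign, and
  linear relations because \<open>\<beta>\<close> annihilates them.\<close>

lemma dlt_symrel:
  assumes f: "f \<in> symrel G gd R"
    and \<beta>: "\<And>x. x \<in> G \<Longrightarrow> \<beta> x \<noteq> 0 \<Longrightarrow> gd x = e"
    and R: "\<And>\<rho>. \<rho> \<in> R \<Longrightarrow> fs \<rho>" "\<And>\<rho> x. \<rho> \<in> R \<Longrightarrow> \<rho> x \<noteq> 0 \<Longrightarrow> x \<in> G"
      "\<And>\<rho>. \<rho> \<in> R \<Longrightarrow> \<exists>n. \<forall>x. \<rho> x \<noteq> 0 \<longrightarrow> gd x = n" "\<And>\<rho>. \<rho> \<in> R \<Longrightarrow> ev \<beta> \<rho> = 0"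
  shows "lext (dlt gd 0 e \<beta>) f \<in> fspan (symrel G gd R)"
proof -
  let ?d = "dlt gd 0 e \<beta>" and ?S = "fspan (symrel G gd R)"
  have supp: "zs \<in> lists G" if "?d us zs \<noteq> 0" "us \<in> lists G" for us zs
    using dlt_support[OF that(1)] that(2) by auto
  show ?thesis
    using f
  proof (cases rule: symrel_cases)
    case (swap us x y vs)
    let ?k = "ksign (gd x * gd y)"
    \<comment> \<open>Where \<open>\<beta>\<close> is nonzero the letter has degree
      \<open>e\<close>, and then the sign of the transposition is the sign of passing the other
      letter.\<close>
    have cx: "\<beta> x * ksign (e * (gd y + ldeg gd vs)) = ?k * (\<beta> x * ksign (e * ldeg gd vs))"
      using \<beta>[of x] swap by (cases "\<beta> x = 0") (auto simp: ksign_def)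
    have cy: "\<beta> y * ksign (e * ldeg gd vs) = ?k * (\<beta> y * ksign (e * (gd x + ldeg gd vs)))"
      using \<beta>[of y] swap by (cases "\<beta> y = 0") (auto simp: ksign_def)
    have d1: "?d (us @ x # y # vs) = smul (ksign (e * (gd x + gd y + ldeg gd vs))) (lext (\<lambda>zs. sgl (zs @ x # y # vs)) (?d us)) +
        (smul (\<beta> x * ksign (e * (gd y + ldeg gd vs))) (sgl (us @ y # vs)) +
         smul (\<beta> y * ksign (e * ldeg gd vs)) (sgl (us @ x # vs)) +
         lext (\<lambda>zs. sgl (us @ x # y # zs)) (?d vs))" for x y
      by (simp add: dlt_append cns_def add_ac)
    have "lext ?d f = smul (ksign (e * (gd x + gd y + ldeg gd vs)))
        (lext (\<lambda>zs. sgl (zs @ x # y # vs) - smul ?k (sgl (zs @ y # x # vs))) (?d us)) +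
        lext (\<lambda>zs. sgl (us @ x # y # zs) - smul ?k (sgl (us @ y # x # zs))) (?d vs)"
    proof -
      have m: "lext (\<lambda>a. F a - smul ?k (H a)) g = lext F g - smul ?k (lext H g)" if "fs g"
        for F H :: "'a list \<Rightarrow> 'a list \<Rightarrow> 'b" and g
        using that by (simp only: lext_fun_diff lext_fun_smul)
      show ?thesis
        unfolding swap(1) m[OF fs_dlt]
        by (simp add: d1 fv.scale_right_distrib fv.scale_right_diff_distrib cx cy add_ac del: dlt.simps)
    qed
    also have "\<dots> \<in> ?S"
      using swap supp[of us] supp[of vs]
      by (intro fv.span_add fv.span_scale lext_in_fspan fv.span_base symrel_swapI) auto
    finally show ?thesis .
  next
    case (lin us \<rho> vs)
    obtain n where n: "\<And>x. \<rho> x \<noteq> 0 \<Longrightarrow> gd x = n"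
      using R(3)[OF lin(3)] by blast
    note fsr = R(1)[OF lin(3)]
    have "lext ?d f = lext (\<lambda>x. ?d (us @ x # vs)) \<rho>"
      unfolding lin(1) using fsr by simp
    also have "\<dots> = lext (\<lambda>x. smul (ksign (e * (n + ldeg gd vs))) (lext (\<lambda>zs. sgl (zs @ x # vs)) (?d us)) +
       (smul (\<beta> x) (smul (ksign (e * ldeg gd vs)) (sgl (us @ vs))) + lext (\<lambda>zs. sgl (us @ x # zs)) (?d vs))) \<rho>"
      by (rule lext_cong) (auto simp: dlt_append cns_def n)
    also have "\<dots> = smul (ksign (e * (n + ldeg gd vs))) (lext (\<lambda>x. lext (\<lambda>zs. sgl (zs @ x # vs)) (?d us)) \<rho>) +
       (smul (ev \<beta> \<rho>) (smul (ksign (e * ldeg gd vs)) (sgl (us @ vs))) + lext (\<lambda>x. lext (\<lambda>zs. sgl (us @ x # zs)) (?d vs)) \<rho>)"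
      by (simp only: lext_fun_add[OF fsr] lext_fun_smul lext_const[OF fsr])
    also have "\<dots> = smul (ksign (e * (n + ldeg gd vs))) (lext (\<lambda>zs. lext (\<lambda>x. sgl (zs @ x # vs)) \<rho>) (?d us)) +
       lext (\<lambda>zs. lext (\<lambda>x. sgl (us @ x # zs)) \<rho>) (?d vs)"
      using R(4)[OF lin(3)] lext_swap[OF fsr fs_dlt, of "\<lambda>x zs. sgl (zs @ x # vs)"]
        lext_swap[OF fsr fs_dlt, of "\<lambda>x zs. sgl (us @ x # zs)"] by simp
    also have "\<dots> \<in> ?S"
      using lin supp[of us] supp[of vs]
      by (intro fv.span_add fv.span_scale lext_in_fspan fv.span_base symrel_linI) auto
    finally show ?thesis .
  qed
qed

text \<open>The words of \<open>f\<close> enter the sign only through their degree modulo 2, so it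
  is enough that they have a common parity.\<close>

lemma lext_move:
  assumes f: "fs f" "\<And>ys. f ys \<noteq> 0 \<Longrightarrow> ys \<in> lists G \<and> even (ldeg gd ys - n)"
    and "B1 \<in> lists G" "B2 \<in> lists G" "v \<in> G" "c = c' * ksign (gd v * (n + ldeg gd B1))"
  shows "smul c' (lext (\<lambda>ys. sgl (ys @ B1 @ v # B2)) f) - smul c (cns v (lext (\<lambda>ys. sgl (ys @ B1 @ B2)) f))
    \<in> fspan (symrel G gd R)"
proof -
  have "smul c' (lext (\<lambda>ys. sgl (ys @ B1 @ v # B2)) f) - smul c (cns v (lext (\<lambda>ys. sgl (ys @ B1 @ B2)) f)) =
      lext (\<lambda>ys. smul c' (sgl (ys @ B1 @ v # B2)) - smul c (sgl (v # ys @ B1 @ B2))) f"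
    using f(1) by (simp add: lext_fun_diff lext_fun_smul cns_def)
  also have "\<dots> \<in> fspan (symrel G gd R)"
  proof (rule lext_in_fspan[OF _ f(1)])
    fix ys assume "f ys \<noteq> 0"
    then have ys: "ys \<in> lists G" "even (ldeg gd ys - n)"
      using f(2) by auto
    have "ksign (gd v * (n + ldeg gd B1)) = (ksign (gd v * ldeg gd (ys @ B1)) :: 'b)"
      using ys(2) by (intro ksign_eqI) auto
    then have c: "c = c' * ksign (gd v * ldeg gd (ys @ B1))"
      using assms(6) by simp
    have "sgl ((ys @ B1) @ v # B2) - smul (ksign (gd v * ldeg gd (ys @ B1))) (sgl (v # (ys @ B1) @ B2)) \<in> fspan (symrel G gd R)"
      using assms ys by (intro symrel_move) auto
    then have "smul c' (sgl ((ys @ B1) @ v # B2) - smul (ksign (gd v * ldeg gd (ys @ B1))) (sgl (v # (ys @ B1) @ B2))) \<in> fspan (symrel G gd R)"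
      by (rule fv.span_scale)
    then show "smul c' (sgl (ys @ B1 @ v # B2)) - smul c (sgl (v # ys @ B1 @ B2)) \<in> fspan (symrel G gd R)"
      unfolding c by (simp add: fv.scale_right_diff_distrib)
  qed
  finally show ?thesis .
qed

section \<open>Contractions in the presence of a central letter\<close>

text \<open>Modelled on the open algebra, with \<open>v\<close> in the role of \<open>\<nu>\<close>.
  The value of a contraction is a combination of words that \<open>contr\<close> puts in front of
  the product; pulling \<open>v\<close> out therefore works only modulo the commutation
  relations.\<close>

locale contr_sym =
  fixes G :: "'g set" and gd :: "'g \<Rightarrow> int" and \<delta> :: "'g \<Rightarrow> 'g \<Rightarrow> 'g list \<Rightarrow> 'k::field"
    and R :: "('g \<Rightarrow> 'k) set" and v :: 'g
  assumes fs\<delta>: "\<And>x y. fs (\<delta> x y)"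
    and \<delta>: "\<And>x y zs. x \<in> G \<Longrightarrow> y \<in> G \<Longrightarrow> \<delta> x y zs \<noteq> 0 \<Longrightarrow> zs \<in> lists G \<and> even (ldeg gd zs - (gd x + gd y + 1))"
    and v: "v \<in> G" "\<And>x. \<delta> x v = 0" "\<And>x. \<delta> v x = 0"
begin

lemma fs_contr [simp]: "fs (contr gd \<delta> xs i j)"
  unfolding contr_def by (simp add: fs\<delta>)

lemma contr_Cons_move:
  assumes "i < j" "j < length xs" "xs \<in> lists G"
  shows "contr gd \<delta> (v # xs) (Suc i) (Suc j) - smul (ksign (gd v)) (cns v (contr gd \<delta> xs i j)) \<in> fspan (symrel G gd R)"
proof -
  let ?x = "xs ! i" and ?y = "xs ! j"
  have x: "?x \<in> G" "?y \<in> G"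
    using assms by auto
  have l: "take i xs @ slice (Suc i) j xs @ drop (Suc j) xs \<in> lists G"
    using assms(3) by (auto simp: slice_def dest: in_set_takeD in_set_dropD)
  define k where "k = gd ?x * ldeg gd (take i xs) + gd ?y * (ldeg gd (take j xs) - gd ?x)"
  define k' where "k' = gd ?x * (gd v + ldeg gd (take i xs)) + gd ?y * (gd v + ldeg gd (take j xs) - gd ?x)"
  have "smul (ksign k') (lext (\<lambda>ys. sgl (ys @ [] @ v # (take i xs @ slice (Suc i) j xs @ drop (Suc j) xs))) (\<delta> ?x ?y)) -
     smul (ksign (gd v) * ksign k) (cns v (lext (\<lambda>ys. sgl (ys @ [] @ (take i xs @ slice (Suc i) j xs @ drop (Suc j) xs))) (\<delta> ?x ?y)))
     \<in> fspan (symrel G gd R)"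
  proof (rule lext_move[OF fs\<delta> \<delta>[OF x] _ l v(1)])
    show "ksign (gd v) * ksign k = ksign k' * ksign (gd v * (gd ?x + gd ?y + 1 + ldeg gd []))"
      unfolding k_def k'_def by (auto simp: ksign_def)
  qed auto
  then show ?thesis
    unfolding contr_def by (simp add: k_def k'_def slice_def)
qed

lemma contr_append_move:
  assumes "i < length xs" "j < length ys" "xs \<in> lists G" "ys \<in> lists G"
  shows "contr gd \<delta> (xs @ v # ys) i (length xs + Suc j) -
    smul (ksign (gd v * (ldeg gd xs + 1))) (cns v (contr gd \<delta> (xs @ ys) i (length xs + j))) \<in> fspan (symrel G gd R)"
proof -
  let ?x = "xs ! i" and ?y = "ys ! j"
  have x: "?x \<in> G" "?y \<in> G"
    using assms by auto
  have l: "take i xs @ drop (Suc i) xs \<in> lists G" "take j ys @ drop (Suc j) ys \<in> lists G"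
    using assms(3,4) by (auto dest: in_set_takeD in_set_dropD)
  have d: "ldeg gd xs = ldeg gd (take i xs) + gd ?x + ldeg gd (drop (Suc i) xs)"
    using assms(1) id_take_nth_drop[of i xs] by (metis ldeg_simps(2,3) add.assoc)
  define k where "k = gd ?x * ldeg gd (take i xs) + gd ?y * (ldeg gd xs + ldeg gd (take j ys) - gd ?x)"
  define k' where "k' = gd ?x * ldeg gd (take i xs) + gd ?y * (ldeg gd xs + gd v + ldeg gd (take j ys) - gd ?x)"
  have "smul (ksign k') (lext (\<lambda>zs. sgl (zs @ (take i xs @ drop (Suc i) xs) @ v # (take j ys @ drop (Suc j) ys))) (\<delta> ?x ?y)) -
     smul (ksign (gd v * (ldeg gd xs + 1)) * ksign k) (cns v (lext (\<lambda>zs. sgl (zs @ (take i xs @ drop (Suc i) xs) @ (take j ys @ drop (Suc j) ys))) (\<delta> ?x ?y)))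
     \<in> fspan (symrel G gd R)"
  proof (rule lext_move[OF fs\<delta> \<delta>[OF x] l v(1)])
    show "ksign (gd v * (ldeg gd xs + 1)) * ksign k =
        ksign k' * ksign (gd v * (gd ?x + gd ?y + 1 + ldeg gd (take i xs @ drop (Suc i) xs)))"
      unfolding k_def k'_def d by (auto simp: ksign_def)
  qed auto
  then show ?thesis
    using assms(1,2) unfolding contr_def by (simp add: k_def k'_def slice_def nth_append d add_ac Suc_diff_le)
qed

lemma contr_v:
  "contr gd \<delta> (v # xs) 0 j = 0" "contr gd \<delta> (xs @ v # ys) i (length xs) = 0"
  unfolding contr_def by (simp_all add: v(2,3))

text \<open>Contractions that involve \<open>v\<close> vanish. The others correspond to those of
  \<open>xs\<close> by a shift of indices, and \<open>v\<close> has to be moved across the word that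
  the contraction created.\<close>

lemma sum_contr_Cons_move:
  assumes "xs \<in> lists G"
  shows "(\<Sum>j<length (v # xs). \<Sum>i<j. contr gd \<delta> (v # xs) i j) -
    smul (ksign (gd v)) (cns v (\<Sum>j<length xs. \<Sum>i<j. contr gd \<delta> xs i j)) \<in> fspan (symrel G gd R)"
proof -
  have "(\<Sum>j<length (v # xs). \<Sum>i<j. contr gd \<delta> (v # xs) i j) -
    smul (ksign (gd v)) (cns v (\<Sum>j<length xs. \<Sum>i<j. contr gd \<delta> xs i j)) =
    (\<Sum>j<length xs. \<Sum>i<j. contr gd \<delta> (v # xs) (Suc i) (Suc j) - smul (ksign (gd v)) (cns v (contr gd \<delta> xs i j)))"
    unfolding length_Cons sum.lessThan_Suc_shift
    by (simp add: contr_v cns_def fv.scale_sum_right sum_subtractf)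
  also have "\<dots> \<in> fspan (symrel G gd R)"
    using assms by (intro fv.span_sum contr_Cons_move) auto
  finally show ?thesis .
qed

lemma sum_contr_left_move:
  assumes "xs \<in> lists G" "ys \<in> lists G"
  shows "(\<Sum>i<length (v # xs). \<Sum>j<length ys. contr gd \<delta> ((v # xs) @ ys) i (length (v # xs) + j)) -
    smul (ksign (gd v)) (cns v (\<Sum>i<length xs. \<Sum>j<length ys. contr gd \<delta> (xs @ ys) i (length xs + j))) \<in> fspan (symrel G gd R)"
proof -
  have "(\<Sum>i<length (v # xs). \<Sum>j<length ys. contr gd \<delta> ((v # xs) @ ys) i (length (v # xs) + j)) -
    smul (ksign (gd v)) (cns v (\<Sum>i<length xs. \<Sum>j<length ys. contr gd \<delta> (xs @ ys) i (length xs + j))) =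
    (\<Sum>i<length xs. \<Sum>j<length ys. contr gd \<delta> (v # xs @ ys) (Suc i) (Suc (length xs + j)) -
      smul (ksign (gd v)) (cns v (contr gd \<delta> (xs @ ys) i (length xs + j))))"
    unfolding length_Cons sum.lessThan_Suc_shift
    by (simp add: contr_v cns_def fv.scale_sum_right sum_subtractf)
  also have "\<dots> \<in> fspan (symrel G gd R)"
    using assms by (intro fv.span_sum contr_Cons_move) auto
  finally show ?thesis .
qed

lemma sum_contr_right_move:
  assumes "xs \<in> lists G" "ys \<in> lists G"
  shows "(\<Sum>i<length xs. \<Sum>j<length (v # ys). contr gd \<delta> (xs @ v # ys) i (length xs + j)) -
    smul (ksign (gd v * (ldeg gd xs + 1))) (cns v (\<Sum>i<length xs. \<Sum>j<length ys. contr gd \<delta> (xs @ ys) i (length xs + j))) \<in> fspan (symrel G gd R)"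
proof -
  have "(\<Sum>i<length xs. \<Sum>j<length (v # ys). contr gd \<delta> (xs @ v # ys) i (length xs + j)) -
    smul (ksign (gd v * (ldeg gd xs + 1))) (cns v (\<Sum>i<length xs. \<Sum>j<length ys. contr gd \<delta> (xs @ ys) i (length xs + j))) =
    (\<Sum>i<length xs. \<Sum>j<length ys. contr gd \<delta> (xs @ v # ys) i (length xs + Suc j) -
      smul (ksign (gd v * (ldeg gd xs + 1))) (cns v (contr gd \<delta> (xs @ ys) i (length xs + j))))"
    unfolding length_Cons sum.lessThan_Suc_shift
    by (simp add: contr_v cns_def fv.scale_sum_right sum_subtractf del: add_Suc_right)
  also have "\<dots> \<in> fspan (symrel G gd R)"
    using assms by (intro fv.span_sum contr_append_move) auto
  finally show ?thesis .
qed

end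

section \<open>Tensor products\<close>

definition tens :: "('a \<Rightarrow> 'k) \<Rightarrow> ('b \<Rightarrow> 'k) \<Rightarrow> 'a \<times> 'b \<Rightarrow> 'k::field" where
  "tens f g = (\<lambda>(x, y). f x * g y)"

lemma tens_sgl: "tens (sgl a) (sgl b) = sgl (a, b)"
  by (auto simp: tens_def sgl_def fun_eq_iff)

lemma tens_0 [simp]: "tens 0 g = 0" "tens f 0 = 0"
  by (auto simp: tens_def fun_eq_iff pointwise)

lemma tens_smul [simp]: "tens (smul c f) g = smul c (tens f g)" "tens f (smul c g) = smul c (tens f g)"
  by (auto simp: tens_def fun_eq_iff smul_def)

lemma tens_add: "tens (f + f') g = tens f g + tens f' g" "tens f (g + g') = tens f g + tens f g'"
  by (auto simp: tens_def fun_eq_iff pointwise algebra_simps)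

lemma tens_diff: "tens (f - f') g = tens f g - tens f' g" "tens f (g - g') = tens f g - tens f g'"
  by (auto simp: tens_def fun_eq_iff pointwise algebra_simps)

lemma fs_tens [simp]:
  assumes "fs f" "fs g" shows "fs (tens f g)"
  using assms unfolding fs_def
  by (rule_tac finite_subset[of _ "{x. f x \<noteq> 0} \<times> {y. g y \<noteq> 0}"]) (auto simp: tens_def)

lemma tens_sum: "tens (\<Sum>t\<in>T. f t) g = (\<Sum>t\<in>T. tens (f t) g)" "tens h (\<Sum>t\<in>T. g' t) = (\<Sum>t\<in>T. tens h (g' t))"
  by (induction T rule: infinite_finite_induct) (auto simp: tens_add)

lemma tens_lext_left:
  assumes "fs f" shows "tens (lext F f) g = lext (\<lambda>a. tens (F a) g) f"
proof -
  have 1: "lext H f = (\<Sum>a | f a \<noteq> 0. smul (f a) (H a))" for H :: "'a \<Rightarrow> 'x \<Rightarrow> 'b"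
    using assms(1) by (intro lext_eq_sum) (auto simp: fs_def)
  show ?thesis
    unfolding 1 by (simp add: tens_sum)
qed

lemma tens_lext_right:
  fixes g :: "'b \<Rightarrow> 'k::field"
  assumes "fs g" shows "tens f (lext G g) = lext (\<lambda>a. tens f (G a)) g"
proof -
  have 1: "lext H g = (\<Sum>a | g a \<noteq> 0. smul (g a) (H a))" for H :: "'b \<Rightarrow> 'x \<Rightarrow> 'k"
    using assms(1) by (intro lext_eq_sum) (auto simp: fs_def)
  show ?thesis
    unfolding 1 by (simp add: tens_sum)
qed

lemma tens_expand:
  assumes "fs f" "fs g" shows "tens f g = lext (\<lambda>a. lext (\<lambda>b. sgl (a, b)) g) f"
proof -
  have "tens f g = tens (lext sgl f) (lext sgl g)"
    by simp
  also have "\<dots> = lext (\<lambda>a. tens (sgl a) (lext sgl g)) f"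
    by (rule tens_lext_left[OF assms(1)])
  also have "\<dots> = lext (\<lambda>a. lext (\<lambda>b. tens (sgl a) (sgl b)) g) f"
    by (simp only: tens_lext_right[OF assms(2)])
  finally show ?thesis
    by (simp only: tens_sgl)
qed

lemma lext_tens:
  assumes "fs f" "fs g" shows "lext F (tens f g) = lext (\<lambda>a. lext (\<lambda>b. F (a, b)) g) f"
  unfolding tens_expand[OF assms] using assms by simp

lemma lext_tens_tens:
  assumes "fs f" "fs g" shows "lext (\<lambda>x. tens (F (fst x)) (G (snd x))) (tens f g) = tens (lext F f) (lext G g)"
  unfolding tens_lext_left[OF assms(1)] unfolding tens_lext_right[OF assms(2)]
  using assms by (simp only: lext_tens fst_conv snd_conv)

definition tensrel :: "'g set \<Rightarrow> ('g list \<Rightarrow> 'k) set \<Rightarrow> 'h set \<Rightarrow> ('h list \<Rightarrow> 'k) set \<Rightarrow> ('g list \<times> 'h list \<Rightarrow> 'k::field) set" where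
  "tensrel G S H T = {tens \<rho> (sgl b) | \<rho> b. \<rho> \<in> S \<and> b \<in> lists H} \<union> {tens (sgl a) \<rho> | a \<rho>. a \<in> lists G \<and> \<rho> \<in> T}"

lemma tens_in_tensrel_left:
  assumes "f \<in> fspan S" "b \<in> lists H"
  shows "tens f (sgl b) \<in> fspan (tensrel G S H T)"
  using assms(1)
proof (induction rule: fv.span_induct_alt)
  case (step c x y)
  then have "tens x (sgl b) \<in> fspan (tensrel G S H T)"
    using assms(2) by (intro fv.span_base) (auto simp: tensrel_def)
  with step show ?case
    by (simp add: tens_add fv.span_add fv.span_scale)
qed (simp add: fv.span_zero)

lemma tens_in_tensrel_right:
  assumes "g \<in> fspan T" "fs f" "\<And>a. f a \<noteq> 0 \<Longrightarrow> a \<in> lists G"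
  shows "tens f g \<in> fspan (tensrel G S H T)"
proof -
  have "tens (sgl a) g \<in> fspan (tensrel G S H T)" if a: "a \<in> lists G" for a
    using assms(1)
  proof (induction rule: fv.span_induct_alt)
    case (step c x y)
    then have "tens (sgl a) x \<in> fspan (tensrel G S H T)"
      using a by (intro fv.span_base) (auto simp: tensrel_def)
    with step show ?case
      by (simp add: tens_add fv.span_add fv.span_scale)
  qed (simp add: fv.span_zero)
  then have "lext (\<lambda>a. tens (sgl a) g) f \<in> fspan (tensrel G S H T)"
    using assms by (intro lext_in_fspan) auto
  moreover have "lext (\<lambda>a. tens (sgl a) g) f = tens (lext sgl f) g"
    by (rule tens_lext_left[OF assms(2), symmetric])
  ultimately show ?thesis by simp
qed

lemma fspan_tens_diff_smul:
  assumes "g - smul c g' \<in> fspan T" "fs f" "\<And>a. f a \<noteq> 0 \<Longrightarrow> a \<in> lists G"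
  shows "tens f g - smul c (tens f g') \<in> fspan (tensrel G S H T)"
  using tens_in_tensrel_right[OF assms] by (simp add: tens_diff)

section \<open>The operator removing a closed letter and creating a central one\<close>

text \<open>What the conjugation argument uses of Hochschild chains and cyclic words:
  \<open>\<beta>\<close> and \<open>\<beta>'\<close> stand for the pairings with \<open>h\<close>
  and with the Chern character, and \<open>ev\<beta>\<close> expresses the adjointness together with
  the equation for \<open>h\<close>. As \<open>\<beta>\<close> lives in the degree of
  \<open>v\<close>, exchanging a closed letter for \<open>v\<close> has degree 0;
  \<open>\<beta>'\<close> lives one degree lower.\<close>

locale nu_op = contr_sym Go og \<delta>o Ro v
  for Go :: "'h set" and og :: "'h \<Rightarrow> int" and \<delta>o :: "'h \<Rightarrow> 'h \<Rightarrow> 'h list \<Rightarrow> 'k::field_char_0"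
    and Ro :: "('h \<Rightarrow> 'k) set" and v :: 'h +
  fixes \<theta>o :: "'h \<Rightarrow> 'h list \<Rightarrow> 'k"
    and Gc :: "'g set" and cg :: "'g \<Rightarrow> int" and \<theta>c :: "'g \<Rightarrow> 'g list \<Rightarrow> 'k"
    and \<delta>c :: "'g \<Rightarrow> 'g \<Rightarrow> 'k" and Rc :: "('g \<Rightarrow> 'k) set"
    and \<beta> :: "'g \<Rightarrow> 'k" and \<beta>' :: "'g \<Rightarrow> 'k" and N :: int
  assumes fs\<theta>o: "\<And>x. fs (\<theta>o x)" and \<theta>o_v: "\<theta>o v = 0" and fsRo: "\<And>\<rho>. \<rho> \<in> Ro \<Longrightarrow> fs \<rho>"
    and fs\<theta>c: "\<And>x. fs (\<theta>c x)"
    and \<theta>c: "\<And>x zs. x \<in> Gc \<Longrightarrow> \<theta>c x zs \<noteq> 0 \<Longrightarrow> \<exists>z\<in>Gc. zs = [z] \<and> cg z = cg x + 1"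
    and \<delta>c: "\<And>x y. x \<in> Gc \<Longrightarrow> y \<in> Gc \<Longrightarrow> \<delta>c x y \<noteq> 0 \<Longrightarrow> cg x + cg y = N" and odd_N: "odd N"
    and \<beta>: "\<And>x. x \<in> Gc \<Longrightarrow> \<beta> x \<noteq> 0 \<Longrightarrow> cg x = og v"
    and \<beta>': "\<And>x. x \<in> Gc \<Longrightarrow> \<beta>' x \<noteq> 0 \<Longrightarrow> cg x = og v - 1"
    and ev\<beta>: "\<And>x. x \<in> Gc \<Longrightarrow> ev (\<lambda>zs. \<beta> (hd zs)) (\<theta>c x) = - \<beta>' x"
    and Rc: "\<And>\<rho>. \<rho> \<in> Rc \<Longrightarrow> fs \<rho>" "\<And>\<rho> x. \<rho> \<in> Rc \<Longrightarrow> \<rho> x \<noteq> 0 \<Longrightarrow> x \<in> Gc"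
      "\<And>\<rho>. \<rho> \<in> Rc \<Longrightarrow> \<exists>n. \<forall>x. \<rho> x \<noteq> 0 \<longrightarrow> cg x = n" "\<And>\<rho>. \<rho> \<in> Rc \<Longrightarrow> ev \<beta> \<rho> = 0"
begin

abbreviation "e \<equiv> og v"

text \<open>\<open>pk\<close> and \<open>qk\<close> are the kernels of \<open>\<nu>\<langle>h,_\<rangle>\<close> and \<open>\<nu>\<langle>ch(\<lambda>),_\<rangle>\<close>; \<open>D0\<close>, \<open>D1\<close> are the coefficients of
  \<open>\<gamma>\<^sup>0\<close>, \<open>\<gamma>\<^sup>1\<close> in the differential of the tensor product, and \<open>K0\<close> is its bracket.\<close>

definition "P0 = dlt cg 0 e \<beta>"
definition "Q0 = dlt cg 1 e \<beta>'"
definition "pk x = tens (P0 (fst x)) (sgl (v # snd x))"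
definition "qk x = tens (Q0 (fst x)) (sgl (v # snd x))"
definition "Lo ws = (\<Sum>j<length ws. \<Sum>i<j. contr og \<delta>o ws i j)"
definition "Bo xs ys = (\<Sum>i<length xs. \<Sum>j<length ys. contr og \<delta>o (xs @ ys) i (length xs + j))"
definition "D0 x = tens (der1 cg \<theta>c (fst x)) (sgl (snd x)) +
   smul (ksign (ldeg cg (fst x))) (tens (sgl (fst x)) (der1 og \<theta>o (snd x)))"
definition "D1 x = tens (lap cg \<delta>c (fst x)) (sgl (snd x)) +
   smul (ksign (ldeg cg (fst x))) (tens (sgl (fst x)) (Lo (snd x)))"
definition "K0 x y =
   smul (ksign (ldeg cg (fst y) * (ldeg og (snd x) + 1)) * ksign (ldeg og (snd x)))
     (tens (sgl (fst x @ fst y)) (Bo (snd x) (snd y))) +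
   smul (ksign (ldeg og (snd x) * (ldeg cg (fst y) + 1)) * ksign (ldeg cg (fst x)))
     (tens (brc cg \<delta>c (fst x) (fst y)) (sgl (snd x @ snd y)))"

definition "SC = symrel Gc cg Rc"
definition "SO = symrel Go og Ro"
definition "S = tensrel Gc SC Go SO"
definition "M = lists Gc \<times> lists Go"

lemma fs_P0 [simp]: "fs (P0 cs)" and fs_Q0 [simp]: "fs (Q0 cs)"
  by (simp_all add: P0_def Q0_def)

lemma fs_Lo [simp]: "fs (Lo ws)" and fs_Bo [simp]: "fs (Bo xs ys)"
  by (simp_all add: Lo_def Bo_def)

lemma fs_pk [simp]: "fs (pk x)" and fs_qk [simp]: "fs (qk x)"
  by (simp_all add: pk_def qk_def)

lemma fs_D0 [simp]: "fs (D0 x)" and fs_D1 [simp]: "fs (D1 x)" and fs_K0 [simp]: "fs (K0 x y)"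
  by (simp_all add: D0_def D1_def K0_def fs\<theta>c fs\<theta>o)

lemma P0_support: "P0 cs zs \<noteq> 0 \<Longrightarrow> cs \<in> lists Gc \<Longrightarrow>
    zs \<in> lists Gc \<and> ldeg cg zs = ldeg cg cs - e \<and> Suc (length zs) = length cs"
  unfolding P0_def using dlt_support[of cg 0 e \<beta> cs zs] \<beta> by fastforce

lemma Q0_support: "Q0 cs zs \<noteq> 0 \<Longrightarrow> cs \<in> lists Gc \<Longrightarrow>
    zs \<in> lists Gc \<and> ldeg cg zs = ldeg cg cs - (e - 1) \<and> Suc (length zs) = length cs"
  unfolding Q0_def using dlt_support[of cg 1 e \<beta>' cs zs] \<beta>' by fastforce

lemma P0_der1: "cs \<in> lists Gc \<Longrightarrow> lext P0 (der1 cg \<theta>c cs) + Q0 cs = lext (der1 cg \<theta>c) (P0 cs)"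
proof -
  assume cs: "cs \<in> lists Gc"
  have "\<exists>z. zs = [z] \<and> cg z = cg x + 1" if "x \<in> Gc" "\<theta>c x zs \<noteq> 0" for x zs
    using \<theta>c[OF that] by blast
  with cs show ?thesis
    unfolding P0_def Q0_def using \<beta> ev\<beta> by (intro dlt_der1[OF fs\<theta>c]) auto
qed

lemma P0_lap: "cs \<in> lists Gc \<Longrightarrow> lext P0 (lap cg \<delta>c cs) = lext (lap cg \<delta>c) (P0 cs)"
  unfolding P0_def using \<delta>c odd_N \<beta> by (intro dlt_lap) auto

lemma P0_brc: "as \<in> lists Gc \<Longrightarrow> bs \<in> lists Gc \<Longrightarrow> lext P0 (brc cg \<delta>c as bs) =
    smul (ksign (e * ldeg cg bs)) (lext (\<lambda>us. brc cg \<delta>c us bs) (P0 as)) + lext (brc cg \<delta>c as) (P0 bs)"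
  unfolding P0_def using \<delta>c odd_N \<beta> by (intro dlt_brc) auto

lemma P0_append: "P0 (as @ bs) = smul (ksign (e * ldeg cg bs)) (lext (\<lambda>us. sgl (us @ bs)) (P0 as)) +
    lext (\<lambda>us. sgl (as @ us)) (P0 bs)"
  unfolding P0_def dlt_append by simp

lemma P0_Q0: "cs \<in> lists Gc \<Longrightarrow> lext Q0 (P0 cs) = smul (ksign e) (lext P0 (Q0 cs))"
  unfolding P0_def Q0_def using \<beta> \<beta>' by (intro dlt_commute[where p = e and p' = "e - 1"]) auto

lemma lext_pk_tens: "fs f \<Longrightarrow> fs g \<Longrightarrow> lext pk (tens f g) = tens (lext P0 f) (cns v g)"
  unfolding pk_def cns_def by (rule lext_tens_tens)

lemma lext_qk_tens: "fs f \<Longrightarrow> fs g \<Longrightarrow> lext qk (tens f g) = tens (lext Q0 f) (cns v g)"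
  unfolding qk_def cns_def by (rule lext_tens_tens)

lemma lext_tens_sgl: "fs f \<Longrightarrow> lext F (tens f (sgl b)) = lext (\<lambda>a. F (a, b)) f"
  by (simp add: lext_tens)

lemma lext_P0_ksign:
  assumes "cs \<in> lists Gc" "fs g"
  shows "lext (\<lambda>a. smul (ksign (ldeg cg a)) (tens (sgl a) g)) (P0 cs) = smul (ksign (ldeg cg cs - e)) (tens (P0 cs) g)"
proof -
  have "lext (\<lambda>a. smul (ksign (ldeg cg a)) (tens (sgl a) g)) (P0 cs) =
      lext (\<lambda>a. smul (ksign (ldeg cg cs - e)) (tens (sgl a) g)) (P0 cs)"
    using P0_support[OF _ assms(1)] by (intro lext_cong) auto
  also have "\<dots> = smul (ksign (ldeg cg cs - e)) (tens (lext sgl (P0 cs)) g)"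
    by (simp only: lext_fun_smul tens_lext_left fs_P0)
  finally show ?thesis by simp
qed

text \<open>An equality on the nose. The term \<open>qk\<close> comes from \<open>dlt_der1\<close>
  in the closed factor. In the open factor the derivation kills \<open>v\<close>, and the sign for
  passing it makes up for the degree that \<open>P0\<close> has taken from the closed
  factor.\<close>

lemma pk_D0:
  assumes "x \<in> M" shows "lext D0 (pk x) = lext pk (D0 x) + qk x"
proof -
  obtain cs ws where x: "x = (cs, ws)" "cs \<in> lists Gc" "ws \<in> lists Go"
    using assms by (auto simp: M_def)
  have dv: "der1 og \<theta>o (v # ws) = smul (ksign e) (cns v (der1 og \<theta>o ws))"
    by (simp add: der1_Cons[OF fs\<theta>o] \<theta>o_v)
  have L: "lext D0 (pk x) = tens (lext (der1 cg \<theta>c) (P0 cs)) (sgl (v # ws)) +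
      smul (ksign (ldeg cg cs - e)) (tens (P0 cs) (der1 og \<theta>o (v # ws)))"
    unfolding x pk_def D0_def
    by (simp add: lext_tens_sgl lext_fun_add lext_P0_ksign x fs\<theta>o flip: tens_lext_left)
  have R: "lext pk (D0 x) = tens (lext P0 (der1 cg \<theta>c cs)) (sgl (v # ws)) +
      smul (ksign (ldeg cg cs)) (tens (P0 cs) (cns v (der1 og \<theta>o ws)))"
    unfolding x D0_def by (simp add: lext_pk_tens fs\<theta>c fs\<theta>o)
  have k: "ksign (ldeg cg cs - e) * ksign e = (ksign (ldeg cg cs) :: 'k)"
    by (auto simp: ksign_def)
  show ?thesis
    unfolding L R P0_der1[OF x(2), symmetric] dv by (simp add: tens_add k qk_def x add_ac)
qed

lemma pk_D1:
  assumes "x \<in> M" shows "lext D1 (pk x) - lext pk (D1 x) \<in> fspan S"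
proof -
  obtain cs ws where x: "x = (cs, ws)" "cs \<in> lists Gc" "ws \<in> lists Go"
    using assms by (auto simp: M_def)
  have L: "lext D1 (pk x) = tens (lext (lap cg \<delta>c) (P0 cs)) (sgl (v # ws)) +
      smul (ksign (ldeg cg cs - e)) (tens (P0 cs) (Lo (v # ws)))"
    unfolding x pk_def D1_def
    by (simp add: lext_tens_sgl lext_fun_add lext_P0_ksign x flip: tens_lext_left)
  have R: "lext pk (D1 x) = tens (lext P0 (lap cg \<delta>c cs)) (sgl (v # ws)) +
      smul (ksign (ldeg cg cs)) (tens (P0 cs) (cns v (Lo ws)))"
    unfolding x D1_def by (simp add: lext_pk_tens)
  have k: "ksign (ldeg cg cs - e) * ksign e = (ksign (ldeg cg cs) :: 'k)"
    by (auto simp: ksign_def)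
  have "tens (P0 cs) (Lo (v # ws)) - smul (ksign e) (tens (P0 cs) (cns v (Lo ws))) \<in> fspan S"
    unfolding S_def SO_def Lo_def using x P0_support[of cs]
    by (intro fspan_tens_diff_smul sum_contr_Cons_move) auto
  then have "smul (ksign (ldeg cg cs - e)) (tens (P0 cs) (Lo (v # ws)) - smul (ksign e) (tens (P0 cs) (cns v (Lo ws)))) \<in> fspan S"
    by (rule fv.span_scale)
  then show ?thesis
    unfolding L R P0_lap[OF x(2)] by (simp add: fv.scale_right_diff_distrib k)
qed

text \<open>The removals commute up to \<open>ksign e\<close>. If \<open>e\<close> is odd, both
  products contain the odd letter \<open>v\<close> twice, and its square is zero in the symmetric
  algebra because 2 is invertible.\<close>

lemma pk_qk:
  assumes "x \<in> M" shows "lext pk (qk x) - lext qk (pk x) \<in> fspan S"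
proof -
  obtain cs ws where x: "x = (cs, ws)" "cs \<in> lists Gc" "ws \<in> lists Go"
    using assms by (auto simp: M_def)
  have L: "lext pk (qk x) = tens (lext P0 (Q0 cs)) (sgl (v # v # ws))"
    unfolding x qk_def by (simp add: lext_pk_tens)
  have R: "lext qk (pk x) = smul (ksign e) (tens (lext P0 (Q0 cs)) (sgl (v # v # ws)))"
    unfolding x pk_def using x by (simp add: lext_qk_tens P0_Q0)
  show ?thesis
  proof (cases "even e")
    case True
    then show ?thesis
      unfolding L R by (simp add: ksign_def fv.span_zero)
  next
    case False
    have "sgl ([] @ v # v # ws) - smul (ksign (e * e)) (sgl ([] @ v # v # ws)) \<in> fspan SO"
      unfolding SO_def using x v by (intro fv.span_base symrel_swapI) auto
    then have "smul (1 / 2) (sgl (v # v # ws) + sgl (v # v # ws)) \<in> fspan SO"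
      using False by (intro fv.span_scale) (simp add: ksign_def)
    moreover have "smul (1 / 2) (f + f) = f" for f :: "'h list \<Rightarrow> 'k"
      by (simp add: smul_def pointwise fun_eq_iff)
    ultimately have "sgl (v # v # ws) \<in> fspan SO"
      by simp
    moreover have "a \<in> lists Gc" if "lext P0 (Q0 cs) a \<noteq> 0" for a
      using that x P0_support Q0_support by (elim lext_support) blast
    ultimately have "tens (lext P0 (Q0 cs)) (sgl (v # v # ws)) \<in> fspan S"
      unfolding S_def by (intro tens_in_tensrel_right) auto
    then show ?thesis
      unfolding L R by (intro fv.span_diff fv.span_scale)
  qed
qed

lemma pk_S:
  assumes "\<rho> \<in> S" shows "fs \<rho>" "lext pk \<rho> \<in> fspan S"
proof -
  from assms consider (l) \<sigma> b where "\<rho> = tens \<sigma> (sgl b)" "\<sigma> \<in> SC" "b \<in> lists Go"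
    | (r) a \<sigma> where "\<rho> = tens (sgl a) \<sigma>" "a \<in> lists Gc" "\<sigma> \<in> SO"
    unfolding S_def tensrel_def by blast
  then have "fs \<rho> \<and> lext pk \<rho> \<in> fspan S"
  proof cases
    case l
    have fs: "fs \<sigma>"
      using fs_symrel[of \<sigma> Gc cg Rc] Rc(1) l by (simp add: SC_def)
    have "lext P0 \<sigma> \<in> fspan SC"
      unfolding P0_def SC_def using l \<beta> Rc by (intro dlt_symrel) (auto simp: SC_def)
    then have "tens (lext P0 \<sigma>) (sgl (v # b)) \<in> fspan S"
      unfolding S_def using l v by (intro tens_in_tensrel_left) auto
    then show ?thesis
      using fs by (simp add: l(1) lext_pk_tens)
  next
    case r
    have fs: "fs \<sigma>"
      using fs_symrel[of \<sigma> Go og Ro] fsRo r by (simp add: SO_def)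
    have "cns v \<sigma> \<in> fspan SO"
      unfolding SO_def using r v fsRo by (intro cns_fspan_symrel fv.span_base) (auto simp: SO_def)
    then have "tens (P0 a) (cns v \<sigma>) \<in> fspan S"
      unfolding S_def using P0_support[of a] r by (intro tens_in_tensrel_right) auto
    then show ?thesis
      using fs by (simp add: r(1) lext_pk_tens)
  qed
  then show "fs \<rho>" "lext pk \<rho> \<in> fspan S"
    by auto
qed

text \<open>The removed closed letter comes from \<open>x\<close> or from \<open>y\<close>. In
  \<open>f1\<close> and \<open>f2\<close> the bracket contracts open words, in \<open>g1\<close> and
  \<open>g2\<close> closed letters. Only for \<open>g1\<close> does the new \<open>v\<close> stand
  in front on both sides; the other three terms need it to be moved there modulo
  \<open>S\<close>.\<close>

lemma pk_K0:
  assumes "x \<in> M" "y \<in> M"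
  shows "lext pk (K0 x y) - (lext (\<lambda>x'. K0 x' y) (pk x) + lext (\<lambda>y'. K0 x y') (pk y)) \<in> fspan S"
proof -
  obtain a1 b1 where x: "x = (a1, b1)" "a1 \<in> lists Gc" "b1 \<in> lists Go"
    using assms by (auto simp: M_def)
  obtain a2 b2 where y: "y = (a2, b2)" "a2 \<in> lists Gc" "b2 \<in> lists Go"
    using assms by (auto simp: M_def)
  let ?A1 = "ldeg cg a1" and ?A2 = "ldeg cg a2" and ?B1 = "ldeg og b1"
  let ?B = "brc cg \<delta>c"
  define f1 where "f1 = lext (\<lambda>us. sgl (us @ a2)) (P0 a1)"
  define f2 where "f2 = lext (\<lambda>us. sgl (a1 @ us)) (P0 a2)"
  define g1 where "g1 = lext (\<lambda>us. ?B us a2) (P0 a1)"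
  define g2 where "g2 = lext (?B a1) (P0 a2)"
  have fs [simp]: "fs f1" "fs f2" "fs g1" "fs g2"
    by (simp_all add: f1_def f2_def g1_def g2_def)
  have sup1: "a \<in> lists Gc" if "f1 a \<noteq> 0" for a
    using that P0_support[OF _ x(2)] y unfolding f1_def
    by (elim lext_support) (auto simp: sgl_def split: if_splits)
  have sup2: "a \<in> lists Gc" if "f2 a \<noteq> 0" for a
    using that P0_support[OF _ y(2)] x unfolding f2_def
    by (elim lext_support) (auto simp: sgl_def split: if_splits)
  have sup3: "a \<in> lists Gc" if "g2 a \<noteq> 0" for a
  proof -
    have sup: "zs \<in> lists Gc" if "?B us us' zs \<noteq> 0" "us \<in> lists Gc" "us' \<in> lists Gc" for us us' zs
      using that
    proof (induction us arbitrary: zs)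
      case (Cons u us)
      then consider "pre us (dlt cg (cg u + 1) 0 (\<delta>c u) us') zs \<noteq> 0" | "cns u (?B us us') zs \<noteq> 0"
        by (auto dest!: plus_neq_0 smul_neq_0)
      then show ?case
      proof cases
        case 1
        then obtain ws where "dlt cg (cg u + 1) 0 (\<delta>c u) us' ws \<noteq> 0" "zs = us @ ws"
          unfolding pre_def by (elim lext_support) (auto simp: sgl_def split: if_splits)
        with Cons.prems dlt_support[of cg "cg u + 1" 0 "\<delta>c u" us' ws] show ?thesis
          by auto
      next
        case 2
        then obtain ws where "?B us us' ws \<noteq> 0" "zs = u # ws"
          unfolding cns_def by (elim lext_support) (auto simp: sgl_def split: if_splits)
        with Cons.IH[of ws] Cons.prems show ?thesis
          by simp
      qed
    qed (simp add: pointwise)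
    show ?thesis
      using that P0_support[OF _ y(2)] sup x unfolding g2_def by (elim lext_support) blast
  qed
  have pK: "lext pk (K0 x y) =
      smul (ksign (?A2 * (?B1 + 1)) * ksign ?B1 * ksign (e * ?A2)) (tens f1 (cns v (Bo b1 b2))) +
      smul (ksign (?A2 * (?B1 + 1)) * ksign ?B1) (tens f2 (cns v (Bo b1 b2))) +
      smul (ksign (?B1 * (?A2 + 1)) * ksign ?A1 * ksign (e * ?A2)) (tens g1 (sgl (v # b1 @ b2))) +
      smul (ksign (?B1 * (?A2 + 1)) * ksign ?A1) (tens g2 (sgl (v # b1 @ b2)))"
    unfolding K0_def x(1) y(1) fst_conv snd_conv
    by (simp add: lext_pk_tens P0_append P0_brc[OF x(2) y(2)] tens_add fv.scale_right_distrib
        f1_def f2_def g1_def g2_def add_ac mult_ac)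
  have Kx: "lext (\<lambda>x'. K0 x' y) (pk x) =
      smul (ksign (?A2 * (e + ?B1 + 1)) * ksign (e + ?B1)) (tens f1 (Bo (v # b1) b2)) +
      smul (ksign ((e + ?B1) * (?A2 + 1)) * ksign (?A1 - e)) (tens g1 (sgl (v # b1 @ b2)))"
  proof -
    have "lext (\<lambda>x'. K0 x' y) (pk x) = lext (\<lambda>a. K0 (a, v # b1) y) (P0 a1)"
      by (simp add: pk_def x lext_tens_sgl)
    also have "\<dots> = lext (\<lambda>a. smul (ksign (?A2 * (e + ?B1 + 1)) * ksign (e + ?B1)) (tens (sgl (a @ a2)) (Bo (v # b1) b2)) +
      smul (ksign ((e + ?B1) * (?A2 + 1)) * ksign (?A1 - e)) (tens (?B a a2) (sgl (v # b1 @ b2)))) (P0 a1)"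
      using P0_support[OF _ x(2)] by (intro lext_cong) (simp add: K0_def y)
    finally show ?thesis
      by (simp add: lext_fun_add lext_fun_smul f1_def g1_def flip: tens_lext_left)
  qed
  have Ky: "lext (\<lambda>y'. K0 x y') (pk y) =
      smul (ksign ((?A2 - e) * (?B1 + 1)) * ksign ?B1) (tens f2 (Bo b1 (v # b2))) +
      smul (ksign (?B1 * (?A2 - e + 1)) * ksign ?A1) (tens g2 (sgl (b1 @ v # b2)))"
  proof -
    have "lext (\<lambda>y'. K0 x y') (pk y) = lext (\<lambda>a. K0 x (a, v # b2)) (P0 a2)"
      by (simp add: pk_def y lext_tens_sgl)
    also have "\<dots> = lext (\<lambda>a. smul (ksign ((?A2 - e) * (?B1 + 1)) * ksign ?B1) (tens (sgl (a1 @ a)) (Bo b1 (v # b2))) +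
      smul (ksign (?B1 * (?A2 - e + 1)) * ksign ?A1) (tens (?B a1 a) (sgl (b1 @ v # b2)))) (P0 a2)"
      using P0_support[OF _ y(2)] by (intro lext_cong) (simp add: K0_def x)
    finally show ?thesis
      by (simp add: lext_fun_add lext_fun_smul f2_def g2_def flip: tens_lext_left)
  qed
  have m1: "tens f1 (Bo (v # b1) b2) - smul (ksign e) (tens f1 (cns v (Bo b1 b2))) \<in> fspan S"
    unfolding S_def SO_def Bo_def using x y sup1
    by (intro fspan_tens_diff_smul sum_contr_left_move) auto
  have m2: "tens f2 (Bo b1 (v # b2)) - smul (ksign (e * (?B1 + 1))) (tens f2 (cns v (Bo b1 b2))) \<in> fspan S"
    unfolding S_def SO_def Bo_def using x y sup2
    by (intro fspan_tens_diff_smul sum_contr_right_move) auto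
  have m3: "tens g2 (sgl (b1 @ v # b2)) - smul (ksign (e * ?B1)) (tens g2 (sgl (v # b1 @ b2))) \<in> fspan S"
    unfolding S_def SO_def using x y sup3 v
    by (intro fspan_tens_diff_smul symrel_move) auto
  \<comment> \<open>These are the coefficients that occur in \<open>Kx\<close> and
    \<open>Ky\<close>; multiplied by the signs of the three moves they become those of
    \<open>pK\<close>.\<close>
  define c1 c2 c3 c4 :: 'k where "c1 = ksign (?A2 * (e + ?B1 + 1)) * ksign (e + ?B1)"
    and "c2 = ksign ((?A2 - e) * (?B1 + 1)) * ksign ?B1"
    and "c3 = ksign (?B1 * (?A2 - e + 1)) * ksign ?A1"
    and "c4 = ksign ((e + ?B1) * (?A2 + 1)) * ksign (?A1 - e)"
  have c: "ksign (?A2 * (?B1 + 1)) * ksign ?B1 * ksign (e * ?A2) = c1 * ksign e"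
    "ksign (?A2 * (?B1 + 1)) * ksign ?B1 = c2 * ksign (e * (?B1 + 1))"
    "ksign (?B1 * (?A2 + 1)) * ksign ?A1 = c3 * ksign (e * ?B1)"
    "ksign (?B1 * (?A2 + 1)) * ksign ?A1 * ksign (e * ?A2) = c4"
    unfolding c1_def c2_def c3_def c4_def ksign_add[symmetric] by (rule ksign_eqI; simp; blast)+
  have "smul (- c1) (tens f1 (Bo (v # b1) b2) - smul (ksign e) (tens f1 (cns v (Bo b1 b2)))) +
     smul (- c2) (tens f2 (Bo b1 (v # b2)) - smul (ksign (e * (?B1 + 1))) (tens f2 (cns v (Bo b1 b2)))) +
     smul (- c3) (tens g2 (sgl (b1 @ v # b2)) - smul (ksign (e * ?B1)) (tens g2 (sgl (v # b1 @ b2)))) \<in> fspan S"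
    by (intro fv.span_add fv.span_scale m1 m2 m3)
  also have "smul (- c1) (tens f1 (Bo (v # b1) b2) - smul (ksign e) (tens f1 (cns v (Bo b1 b2)))) +
     smul (- c2) (tens f2 (Bo b1 (v # b2)) - smul (ksign (e * (?B1 + 1))) (tens f2 (cns v (Bo b1 b2)))) +
     smul (- c3) (tens g2 (sgl (b1 @ v # b2)) - smul (ksign (e * ?B1)) (tens g2 (sgl (v # b1 @ b2)))) =
     lext pk (K0 x y) - (lext (\<lambda>x'. K0 x' y) (pk x) + lext (\<lambda>y'. K0 x y') (pk y))"
    unfolding pK Kx Ky c1_def[symmetric] c2_def[symmetric] c3_def[symmetric] c4_def[symmetric]
    unfolding c(1) c(4)
    unfolding c(2) c(3)
    by (simp add: fv.scale_right_diff_distrib fun_eq_iff pointwise smul_def algebra_simps)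
  finally show ?thesis .
qed

end

section \<open>Locally finite families\<close>

definition lfin :: "('a \<Rightarrow> nat) \<Rightarrow> ('a \<Rightarrow> 'k::zero) \<Rightarrow> bool" where
  "lfin s u \<longleftrightarrow> (\<forall>n. finite {x. u x \<noteq> 0 \<and> s x \<le> n})"

text \<open>The bound has one constant for the whole kernel, so composites satisfy it again, with
  the sum of the constants.\<close>

definition bker :: "('a \<Rightarrow> nat) \<Rightarrow> ('b \<Rightarrow> nat) \<Rightarrow> ('a \<Rightarrow> 'b \<Rightarrow> 'k::zero) \<Rightarrow> bool" where
  "bker s t K \<longleftrightarrow> (\<forall>x. fs (K x)) \<and> (\<exists>c. \<forall>x y. K x y \<noteq> 0 \<longrightarrow> s x \<le> t y + c)"

text \<open>For one coefficient of the result a locally finite family may be replaced by a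
  truncation, which has finite support. This reduces statements about the completion to finite
  sums.\<close>

definition trunc :: "('a \<Rightarrow> nat) \<Rightarrow> nat \<Rightarrow> ('a \<Rightarrow> 'k::zero) \<Rightarrow> 'a \<Rightarrow> 'k" where
  "trunc s n u = (\<lambda>x. if s x \<le> n then u x else 0)"

lemma bkerI: "(\<And>x. fs (K x)) \<Longrightarrow> (\<And>x y. K x y \<noteq> 0 \<Longrightarrow> s x \<le> t y + c) \<Longrightarrow> bker s t K"
  by (auto simp: bker_def)

lemma bker_fs: "bker s t K \<Longrightarrow> fs (K x)"
  by (simp add: bker_def)

lemma bker_bound:
  assumes "bker s t K"
  obtains c where "\<And>x y. K x y \<noteq> 0 \<Longrightarrow> s x \<le> t y + c"
  using assms by (auto simp: bker_def)

lemma fs_trunc: "lfin s u \<Longrightarrow> fs (trunc s n u)"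
  unfolding fs_def lfin_def trunc_def by (rule finite_subset[of _ "{x. u x \<noteq> 0 \<and> s x \<le> n}"]) auto

lemma lext_trunc:
  assumes "\<And>x. K x y \<noteq> 0 \<Longrightarrow> s x \<le> n"
  shows "lext K u y = lext K (trunc s n u) y"
proof -
  have "u x * K x y = trunc s n u x * K x y" for x
    using assms[of x] by (cases "K x y = 0") (auto simp: trunc_def)
  then show ?thesis
    unfolding lext_def by (simp only:)
qed

lemma lfin_lext:
  assumes "lfin s u" "bker s t K" shows "lfin t (lext K u)"
  unfolding lfin_def
proof
  fix n
  obtain c where c: "\<And>x y. K x y \<noteq> 0 \<Longrightarrow> s x \<le> t y + c"
    by (rule bker_bound[OF assms(2)]) (rule that)
  have "{y. lext K u y \<noteq> 0 \<and> t y \<le> n} \<subseteq> (\<Union>x\<in>{x. u x \<noteq> 0 \<and> s x \<le> n + c}. {y. K x y \<noteq> 0})"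
    using c by (fastforce elim!: lext_support)
  moreover have "finite (\<Union>x\<in>{x. u x \<noteq> 0 \<and> s x \<le> n + c}. {y. K x y \<noteq> 0})"
    using assms bker_fs[OF assms(2)] by (auto simp: lfin_def fs_def)
  ultimately show "finite {y. lext K u y \<noteq> 0 \<and> t y \<le> n}"
    by (rule finite_subset)
qed

lemma bker_comp:
  assumes "bker s t K" "bker t r L" shows "bker s r (\<lambda>x. lext L (K x))"
proof -
  obtain c where c: "\<And>x y. K x y \<noteq> 0 \<Longrightarrow> s x \<le> t y + c"
    by (rule bker_bound[OF assms(1)]) (rule that)
  obtain c' where c': "\<And>x y. L x y \<noteq> 0 \<Longrightarrow> t x \<le> r y + c'"
    by (rule bker_bound[OF assms(2)]) (rule that)
  show ?thesis
  proof (rule bkerI)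
    show "fs (lext L (K x))" for x
      using assms by (simp add: bker_fs)
    show "s x \<le> r z + (c + c')" if "lext L (K x) z \<noteq> 0" for x z
      using that by (elim lext_support) (use c c' in fastforce)
  qed
qed

lemma bker_add:
  assumes "bker s t K" "bker s t L" shows "bker s t (\<lambda>x. K x + L x :: 'b \<Rightarrow> 'k::field)"
proof -
  obtain c where c: "\<And>x y. K x y \<noteq> 0 \<Longrightarrow> s x \<le> t y + c"
    by (rule bker_bound[OF assms(1)]) (rule that)
  obtain c' where c': "\<And>x y. L x y \<noteq> 0 \<Longrightarrow> s x \<le> t y + c'"
    by (rule bker_bound[OF assms(2)]) (rule that)
  show ?thesis
    by (rule bkerI[where c = "c + c'"]) (use assms c c' in \<open>fastforce simp: bker_fs dest!: plus_neq_0\<close>)+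
qed

lemma bker_diff:
  assumes "bker s t K" "bker s t L" shows "bker s t (\<lambda>x. K x - L x :: 'b \<Rightarrow> 'k::field)"
proof -
  have "bker s t (\<lambda>x. - L x)"
    using assms(2) by (simp add: bker_def pointwise)
  then show ?thesis
    using bker_add[OF assms(1), of "\<lambda>x. - L x"] by simp
qed

lemma lfin_add: "lfin s u \<Longrightarrow> lfin s w \<Longrightarrow> lfin s (u + w :: 'a \<Rightarrow> 'k::field)"
  unfolding lfin_def
  by (intro allI, rule_tac B = "{x. u x \<noteq> 0 \<and> s x \<le> n} \<union> {x. w x \<noteq> 0 \<and> s x \<le> n}" in finite_subset)
    (auto simp: pointwise)

lemma lfin_smul: "lfin s u \<Longrightarrow> lfin s (smul (c::'k::field) u)"
  unfolding lfin_def smul_def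
  by (intro allI, rule_tac B = "{x. u x \<noteq> 0 \<and> s x \<le> n}" in finite_subset) auto

lemma lfin_0: "lfin s (0 :: 'a \<Rightarrow> 'k::field)"
  by (simp add: lfin_def pointwise)

lemma lfin_sum: "(\<And>i. i \<in> I \<Longrightarrow> lfin s (u i)) \<Longrightarrow> lfin s (\<Sum>i\<in>I. u i :: 'a \<Rightarrow> 'k::field)"
  by (induction I rule: infinite_finite_induct) (auto simp: lfin_0 lfin_add)

text \<open>Fixing \<open>z\<close> bounds the size of the intermediate terms, and then the size of
  the terms of \<open>u\<close>, so at \<open>z\<close> both sides involve only a finite part of
  \<open>u\<close>.\<close>

lemma lext_comp_lfin:
  assumes "lfin s u" "bker s t K" "bker t r L"
  shows "lext L (lext K u) = lext (\<lambda>x. lext L (K x)) u"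
proof
  fix z
  obtain c where c: "\<And>x y. K x y \<noteq> 0 \<Longrightarrow> s x \<le> t y + c"
    by (rule bker_bound[OF assms(2)]) (rule that)
  obtain c' where c': "\<And>x y. L x y \<noteq> 0 \<Longrightarrow> t x \<le> r y + c'"
    by (rule bker_bound[OF assms(3)]) (rule that)
  let ?n = "r z + c'" and ?u = "trunc s (r z + c' + c) u"
  have "lext L (lext K u) z = lext L (trunc t ?n (lext K u)) z"
    using c' by (rule lext_trunc)
  also have "trunc t ?n (lext K u) = trunc t ?n (lext K ?u)"
  proof
    fix y
    show "trunc t ?n (lext K u) y = trunc t ?n (lext K ?u) y"
    proof (cases "t y \<le> ?n")
      case True
      then have "lext K u y = lext K ?u y"
        using c[of _ y] by (intro lext_trunc) (meson add_le_cancel_right le_trans)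
      then show ?thesis
        by (simp add: trunc_def)
    qed (simp add: trunc_def)
  qed
  also have "lext L (trunc t ?n (lext K ?u)) z = lext L (lext K ?u) z"
    using c' by (rule lext_trunc[symmetric])
  also have "\<dots> = lext (\<lambda>x. lext L (K x)) ?u z"
    using fs_trunc[OF assms(1)] bker_fs[OF assms(2)] by simp
  also have "\<dots> = lext (\<lambda>x. lext L (K x)) u z"
  proof (rule lext_trunc[symmetric])
    show "s x \<le> r z + c' + c" if "lext L (K x) z \<noteq> 0" for x
      using that by (elim lext_support) (use c c' in fastforce)
  qed
  finally show "lext L (lext K u) z = lext (\<lambda>x. lext L (K x)) u z" .
qed

lemma lext_add_lfin:
  assumes "lfin s u" "lfin s w" "bker s t K"
  shows "lext K (u + w) = lext K u + lext K w"
proof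
  fix y
  obtain c where c: "\<And>x y. K x y \<noteq> 0 \<Longrightarrow> s x \<le> t y + c"
    by (rule bker_bound[OF assms(3)]) (rule that)
  have "trunc s n (u + w) = trunc s n u + trunc s n w" for n
    by (auto simp: trunc_def pointwise fun_eq_iff)
  then show "lext K (u + w) y = (lext K u + lext K w) y"
    using fs_trunc[OF assms(1)] fs_trunc[OF assms(2)] c[of _ y]
      lext_trunc[of K y s "t y + c" u] lext_trunc[of K y s "t y + c" w] lext_trunc[of K y s "t y + c" "u + w"]
    by (simp add: pointwise)
qed

lemma lext_sum_lfin:
  assumes "\<And>i. i \<in> I \<Longrightarrow> lfin s (u i)" "bker s t K"
  shows "lext K (\<Sum>i\<in>I. u i) = (\<Sum>i\<in>I. lext K (u i))"
  using assms(1)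
  by (induction I rule: infinite_finite_induct) (auto simp: lext_add_lfin[OF _ _ assms(2)] lfin_sum)

lemma lext_fun_add_lfin:
  assumes "lfin s u" "bker s t K" "bker s t L"
  shows "lext (\<lambda>x. K x + L x) u = lext K u + lext L u"
proof
  fix y
  obtain c where c: "\<And>x y. K x y \<noteq> 0 \<Longrightarrow> s x \<le> t y + c"
    by (rule bker_bound[OF assms(2)]) (rule that)
  obtain c' where c': "\<And>x y. L x y \<noteq> 0 \<Longrightarrow> s x \<le> t y + c'"
    by (rule bker_bound[OF assms(3)]) (rule that)
  let ?n = "t y + c + c'"
  have 1: "lext K u y = lext K (trunc s ?n u) y"
    by (rule lext_trunc) (use c in fastforce)
  have 2: "lext L u y = lext L (trunc s ?n u) y"
    by (rule lext_trunc) (use c' in fastforce)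
  have 3: "lext (\<lambda>x. K x + L x) u y = lext (\<lambda>x. K x + L x) (trunc s ?n u) y"
    by (rule lext_trunc) (use c c' in \<open>fastforce dest!: plus_neq_0\<close>)
  show "lext (\<lambda>x. K x + L x) u y = (lext K u + lext L u) y"
    using 1 2 3 fun_cong[OF lext_fun_add[OF fs_trunc[OF assms(1)], of K L ?n], of y]
    by (simp only: plus_fun_apply)
qed

lemma lext_fun_diff_lfin:
  assumes "lfin s u" "bker s t K" "bker s t L"
  shows "lext (\<lambda>x. K x - L x) u = lext K u - lext L u"
proof -
  have "bker s t (\<lambda>x. smul (- 1) (L x))"
    using assms(3) by (simp add: bker_def pointwise)
  then have "lext (\<lambda>x. K x + smul (- 1) (L x)) u = lext K u + smul (- 1) (lext L u)"
    using lext_fun_add_lfin[OF assms(1,2)] by (simp only: lext_fun_smul)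
  then show ?thesis
    by simp
qed

section \<open>Vanishing modulo relations in the completion\<close>

definition res :: "('a \<Rightarrow> 'b) \<Rightarrow> 'b \<Rightarrow> ('a \<Rightarrow> 'k::zero) \<Rightarrow> 'a \<Rightarrow> 'k" where
  "res bl \<beta> u = (\<lambda>m. if bl m = \<beta> then u m else 0)"

text \<open>\<open>RZ bl S u\<close>: \<open>u\<close> is zero in the completion, i.e. in the product over all blocks of the quotients
  by the relations \<open>S\<close>.\<close>

definition RZ :: "('a \<Rightarrow> 'b) \<Rightarrow> ('a \<Rightarrow> 'k) set \<Rightarrow> ('a \<Rightarrow> 'k::field) \<Rightarrow> bool" where
  "RZ bl S u \<longleftrightarrow> (\<forall>\<beta>. res bl \<beta> u \<in> fspan S)"

lemma res_add: "res bl \<beta> (u + w :: 'a \<Rightarrow> 'k::field) = res bl \<beta> u + res bl \<beta> w"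
  by (auto simp: res_def fun_eq_iff pointwise)

lemma res_smul: "res bl \<beta> (smul (c::'k::field) u) = smul c (res bl \<beta> u)"
  by (auto simp: res_def fun_eq_iff smul_def)

lemma res_0: "res bl \<beta> (0 :: 'a \<Rightarrow> 'k::field) = 0"
  by (auto simp: res_def fun_eq_iff pointwise)

lemma RZ_0: "RZ bl S 0"
  by (simp add: RZ_def res_0 fv.span_zero)

lemma RZ_add: "RZ bl S u \<Longrightarrow> RZ bl S w \<Longrightarrow> RZ bl S (u + w)"
  by (simp add: RZ_def res_add fv.span_add)

lemma RZ_smul: "RZ bl S u \<Longrightarrow> RZ bl S (smul c u)"
  by (simp add: RZ_def res_smul fv.span_scale)

lemma RZ_sum: "(\<And>i. i \<in> I \<Longrightarrow> RZ bl S (u i)) \<Longrightarrow> RZ bl S (\<Sum>i\<in>I. u i)"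
  by (induction I rule: infinite_finite_induct) (auto simp: RZ_0 RZ_add)

text \<open>Each relation lies in one block, so membership in the span may be tested block by block;
  \<open>sz\<close> links the blocks with the size that controls local finiteness.\<close>

locale blocks =
  fixes bl :: "'a \<Rightarrow> 'b" and sz :: "'b \<Rightarrow> nat" and S :: "('a \<Rightarrow> 'k::field) set"
  assumes S_homog: "\<And>\<rho>. \<rho> \<in> S \<Longrightarrow> \<exists>\<beta>. \<forall>m. \<rho> m \<noteq> 0 \<longrightarrow> bl m = \<beta>"
begin

abbreviation "s \<equiv> \<lambda>m. sz (bl m)"

lemma res_fspan:
  assumes "u \<in> fspan S" shows "res bl \<beta> u \<in> fspan S"
  using assms
proof (induction rule: fv.span_induct_alt)
  case base
  then show ?case
    by (simp add: res_0 fv.span_zero)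
next
  case (step c x y)
  obtain \<beta>' where "\<And>m. x m \<noteq> 0 \<Longrightarrow> bl m = \<beta>'"
    using S_homog[OF step(1)] by blast
  then have "res bl \<beta> x = (if \<beta> = \<beta>' then x else 0)"
    by (auto simp: res_def fun_eq_iff pointwise)
  then have "res bl \<beta> x \<in> fspan S"
    using step(1) by (auto simp: fv.span_zero fv.span_base)
  with step show ?case
    by (simp add: res_add res_smul fv.span_add fv.span_scale)
qed

lemma res_lext_trunc:
  assumes c: "\<And>x y. K x y \<noteq> 0 \<Longrightarrow> t x \<le> s y + c"
  shows "res bl \<beta> (lext K u) = res bl \<beta> (lext K (trunc t (sz \<beta> + c) u))"
proof
  fix y
  show "res bl \<beta> (lext K u) y = res bl \<beta> (lext K (trunc t (sz \<beta> + c) u)) y"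
  proof (cases "bl y = \<beta>")
    case True
    then have "lext K u y = lext K (trunc t (sz \<beta> + c) u) y"
      using c[of _ y] by (intro lext_trunc) auto
    then show ?thesis by (simp add: res_def)
  qed (simp add: res_def)
qed

lemma RZ_lext:
  assumes "lfin t u" "bker t s E" "\<And>x. u x \<noteq> 0 \<Longrightarrow> E x \<in> fspan S"
  shows "RZ bl S (lext E u)"
  unfolding RZ_def
proof
  fix \<beta>
  obtain c where c: "\<And>x y. E x y \<noteq> 0 \<Longrightarrow> t x \<le> s y + c"
    by (rule bker_bound[OF assms(2)]) (rule that)
  have "lext E (trunc t (sz \<beta> + c) u) \<in> fspan S"
    using assms by (intro lext_in_fspan fs_trunc) (auto simp: trunc_def split: if_splits)
  moreover have "res bl \<beta> (lext E u) = res bl \<beta> (lext E (trunc t (sz \<beta> + c) u))"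
    using c by (rule res_lext_trunc)
  ultimately show "res bl \<beta> (lext E u) \<in> fspan S"
    by (simp only: res_fspan)
qed

text \<open>A size is constant on a block, so the truncation is a sum of full restrictions to
  blocks, and by local finiteness only finitely many of them are nonzero.\<close>

lemma trunc_fspan:
  assumes "lfin s u" "RZ bl S u" shows "trunc s n u \<in> fspan S"
proof -
  let ?B = "bl ` {x. trunc s n u x \<noteq> 0}"
  have fin: "finite ?B"
    using fs_trunc[OF assms(1)] by (simp add: fs_def)
  have "trunc s n u = (\<Sum>\<beta>\<in>?B. res bl \<beta> u)"
  proof
    fix x
    have "(\<Sum>\<beta>\<in>?B. res bl \<beta> u) x = (\<Sum>\<beta>\<in>?B. if \<beta> = bl x then u x else 0)"
      unfolding sum_fun_apply res_def by (intro sum.cong) auto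
    also have "\<dots> = (if bl x \<in> ?B then u x else 0)"
      using fin by simp
    also have "\<dots> = trunc s n u x"
      by (auto simp: trunc_def image_iff)
    finally show "trunc s n u x = (\<Sum>\<beta>\<in>?B. res bl \<beta> u) x" ..
  qed
  moreover have "(\<Sum>\<beta>\<in>?B. res bl \<beta> u) \<in> fspan S"
    by (rule fv.span_sum) (use assms(2) in \<open>simp add: RZ_def\<close>)
  ultimately show ?thesis
    by (simp only:)
qed

text \<open>In a given block only a truncation of \<open>u\<close> matters. It lies in the span,
  which \<open>X\<close> preserves, although \<open>u\<close> itself is in general no finite
  combination of relations.\<close>

lemma RZ_lext_preserve:
  assumes "lfin s u" "RZ bl S u" "bker s s X" "\<And>\<rho>. \<rho> \<in> S \<Longrightarrow> fs \<rho> \<and> lext X \<rho> \<in> fspan S"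
  shows "RZ bl S (lext X u)"
  unfolding RZ_def
proof
  fix \<beta>
  obtain c where c: "\<And>x y. X x y \<noteq> 0 \<Longrightarrow> s x \<le> s y + c"
    by (rule bker_bound[OF assms(3)]) (rule that)
  have "lext X (trunc s (sz \<beta> + c) u) \<in> fspan S"
    using fspan_lext_induct[OF assms(4) trunc_fspan[OF assms(1,2)]] by blast
  moreover have "res bl \<beta> (lext X u) = res bl \<beta> (lext X (trunc s (sz \<beta> + c) u))"
    using c by (rule res_lext_trunc)
  ultimately show "res bl \<beta> (lext X u) \<in> fspan S"
    by (simp only: res_fspan)
qed

end

lemma tens_lext_lfin:
  fixes K :: "'a \<Rightarrow> 'c \<Rightarrow> 'k::field" and L :: "'b \<Rightarrow> 'd \<Rightarrow> 'k"
  assumes "lfin s u" "lfin s' w" and K: "\<And>x y. K x y \<noteq> 0 \<Longrightarrow> s x \<le> t y + c"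
    and L: "\<And>x y. L x y \<noteq> 0 \<Longrightarrow> s' x \<le> t' y + c'"
  shows "tens (lext K u) (lext L w) = lext (\<lambda>x. tens (K (fst x)) (L (snd x))) (tens u w)"
proof
  fix z :: "'c \<times> 'd"
  obtain a b where z: "z = (a, b)"
    by (cases z)
  let ?u = "trunc s (t a + c) u" and ?w = "trunc s' (t' b + c') w"
  have "tens (lext K u) (lext L w) z = tens (lext K ?u) (lext L ?w) z"
    using lext_trunc[of K a s "t a + c" u] lext_trunc[of L b s' "t' b + c'" w] K[of _ a] L[of _ b]
    by (simp add: tens_def z)
  also have "\<dots> = lext (\<lambda>x. tens (K (fst x)) (L (snd x))) (tens ?u ?w) z"
    using assms(1,2) by (simp add: lext_tens_tens fs_trunc)
  also have "\<dots> = lext (\<lambda>x. tens (K (fst x)) (L (snd x))) (tens u w) z"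
  proof -
    have "tens ?u ?w x * tens (K (fst x)) (L (snd x)) z = tens u w x * tens (K (fst x)) (L (snd x)) z" for x
      using K[of "fst x" a] L[of "snd x" b] by (cases x) (auto simp: tens_def z trunc_def)
    then show ?thesis
      unfolding lext_def by (simp only:)
  qed
  finally show "tens (lext K u) (lext L w) z = lext (\<lambda>x. tens (K (fst x)) (L (snd x))) (tens u w) z" .
qed

lemma lfin_tens:
  assumes "lfin s u" "lfin s' w" shows "lfin (\<lambda>x. s (fst x) + s' (snd x)) (tens u w)"
  unfolding lfin_def
proof
  fix n
  have "{x. tens u w x \<noteq> 0 \<and> s (fst x) + s' (snd x) \<le> n} \<subseteq> {x. u x \<noteq> 0 \<and> s x \<le> n} \<times> {x. w x \<noteq> 0 \<and> s' x \<le> n}"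
    by (auto simp: tens_def)
  moreover have "finite ({x. u x \<noteq> 0 \<and> s x \<le> n} \<times> {x. w x \<noteq> 0 \<and> s' x \<le> n})"
    using assms by (auto simp: lfin_def)
  ultimately show "finite {x. tens u w x \<noteq> 0 \<and> s (fst x) + s' (snd x) \<le> n}"
    by (rule finite_subset)
qed

section \<open>The exponential\<close>

context nu_op begin

abbreviation "pp \<equiv> lext pk"
definition "onM u \<longleftrightarrow> (\<forall>x. u x \<noteq> 0 \<longrightarrow> x \<in> M)"
definition "eqS u w \<longleftrightarrow> u - w \<in> fspan S"

lemma eqS_refl: "eqS u u"
  by (simp add: eqS_def fv.span_zero)

lemma eqS_trans: "eqS u w \<Longrightarrow> eqS w z \<Longrightarrow> eqS u z"
  unfolding eqS_def using fv.span_add by fastforce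

lemma eqS_add: "eqS u u' \<Longrightarrow> eqS w w' \<Longrightarrow> eqS (u + w) (u' + w')"
  unfolding eqS_def using fv.span_add[of "u - u'" S "w - w'"] by (simp add: algebra_simps)

lemma eqS_smul: "eqS u u' \<Longrightarrow> eqS (smul c u) (smul c u')"
  unfolding eqS_def using fv.span_scale[of "u - u'" S c] by (simp add: fv.scale_right_diff_distrib)

lemma eqS_sum: "(\<And>i. i \<in> I \<Longrightarrow> eqS (u i) (w i)) \<Longrightarrow> eqS (\<Sum>i\<in>I. u i) (\<Sum>i\<in>I. w i)"
  unfolding eqS_def sum_subtractf[symmetric] by (rule fv.span_sum)

lemma eqS_pp: "eqS u w \<Longrightarrow> fs u \<Longrightarrow> fs w \<Longrightarrow> eqS (pp u) (pp w)"
  unfolding eqS_def using fspan_lext_induct[of S pk S "u - w"] pk_S by auto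

lemma onM_lext: "onM u \<Longrightarrow> (\<And>x. x \<in> M \<Longrightarrow> onM (F x)) \<Longrightarrow> onM (lext F u)"
  unfolding onM_def by (metis lext_support)

lemma onM_pk:
  assumes "x \<in> M" shows "onM (pk x)"
  unfolding onM_def
proof (intro allI impI)
  fix y assume "pk x y \<noteq> 0"
  then have "P0 (fst x) (fst y) \<noteq> 0" "snd y = v # snd x"
    by (cases y; auto simp: pk_def tens_def sgl_def split: if_splits)+
  with assms P0_support[of "fst x" "fst y"] v show "y \<in> M"
    by (cases x, cases y) (simp add: M_def)
qed

lemma onM_sgl: "x \<in> M \<Longrightarrow> onM (sgl x)"
  by (auto simp: onM_def sgl_def)

lemma fs_pow [simp]: "fs u \<Longrightarrow> fs ((pp ^^ k) u)"
  by (induction k) simp_all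

lemma onM_pow: "onM u \<Longrightarrow> onM ((pp ^^ k) u)"
  by (induction k) (auto intro: onM_lext onM_pk)

lemma eqS_pow: "eqS u w \<Longrightarrow> fs u \<Longrightarrow> fs w \<Longrightarrow> eqS ((pp ^^ k) u) ((pp ^^ k) w)"
  by (induction k) (auto intro: eqS_pp)

lemma pow_lext: "fs u \<Longrightarrow> (pp ^^ k) u = lext (\<lambda>x. (pp ^^ k) (sgl x)) u"
  by (induction k) simp_all

lemma pow_smul: "(pp ^^ k) (smul c u) = smul c ((pp ^^ k) u)"
  by (induction k) simp_all

text \<open>Each application removes a closed letter and prepends \<open>v\<close>. The exponent is
  thus bounded by the closed length of the input, which makes the series finite on monomials, and by
  the number of words of the output, which makes it finite in each coefficient of an infinite
  family.\<close>

lemma pow_length: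
  assumes "(pp ^^ k) u y \<noteq> 0"
  shows "\<exists>x. u x \<noteq> 0 \<and> length (fst x) = length (fst y) + k \<and> snd y = replicate k v @ snd x"
  using assms
proof (induction k arbitrary: y)
  case (Suc k)
  then obtain z where z: "(pp ^^ k) u z \<noteq> 0" "pk z y \<noteq> 0"
    by (auto elim: lext_support)
  from z(2) have "P0 (fst z) (fst y) \<noteq> 0" and 2: "snd y = v # snd z"
    by (cases y; auto simp: pk_def tens_def sgl_def split: if_splits)+
  then have 1: "Suc (length (fst y)) = length (fst z)"
    unfolding P0_def using dlt_support[of cg 0 e \<beta> "fst z" "fst y"] by fastforce
  from Suc.IH[OF z(1)] obtain x where "u x \<noteq> 0" "length (fst x) = length (fst z) + k" "snd z = replicate k v @ snd x"
    by blast
  with 1 2 show ?case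
    by (intro exI[of _ x]) simp
qed auto

lemma pp_lext_commute:
  assumes "fs u" "onM u" "\<And>x. fs (F x)" "\<And>x. x \<in> M \<Longrightarrow> eqS (lext F (pk x)) (pp (F x) + G x)" "\<And>x. fs (G x)"
  shows "eqS (lext F (pp u)) (pp (lext F u) + lext G u)"
proof -
  have "lext F (pp u) - (pp (lext F u) + lext G u) = lext (\<lambda>x. lext F (pk x) - (pp (F x) + G x)) u"
    using assms(1,3,5) by (simp add: lext_fun_diff lext_fun_add)
  also have "\<dots> \<in> fspan S"
    using assms(1,2,4) by (intro lext_in_fspan) (auto simp: onM_def eqS_def)
  finally show ?thesis
    by (simp add: eqS_def)
qed

lemma pow_commute_qk:
  assumes "fs u" "onM u"
  shows "eqS (lext qk ((pp ^^ k) u)) ((pp ^^ k) (lext qk u))"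
proof (induction k)
  case (Suc k)
  have "eqS (lext qk (pp ((pp ^^ k) u))) (pp (lext qk ((pp ^^ k) u)) + lext (\<lambda>x. 0) ((pp ^^ k) u))"
  proof (rule pp_lext_commute)
    fix x assume "x \<in> M"
    from pk_qk[OF this] have "- (pp (qk x) - lext qk (pk x)) \<in> fspan S"
      by (rule fv.span_neg)
    then show "eqS (lext qk (pk x)) (pp (qk x) + 0)"
      by (simp add: eqS_def)
  qed (use assms in \<open>simp_all add: onM_pow\<close>)
  also have "pp (lext qk ((pp ^^ k) u)) + lext (\<lambda>x. 0) ((pp ^^ k) u) = pp (lext qk ((pp ^^ k) u))"
    by simp
  finally have "eqS (lext qk (pp ((pp ^^ k) u))) (pp (lext qk ((pp ^^ k) u)))" .
  moreover have "eqS (pp (lext qk ((pp ^^ k) u))) (pp ((pp ^^ k) (lext qk u)))"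
    using Suc assms by (intro eqS_pp) auto
  ultimately show ?case
    by (auto intro: eqS_trans)
qed (simp add: eqS_refl)

lemma pow_commute_D1:
  assumes "fs u" "onM u"
  shows "eqS (lext D1 ((pp ^^ k) u)) ((pp ^^ k) (lext D1 u))"
proof (induction k)
  case (Suc k)
  have "eqS (lext D1 (pp ((pp ^^ k) u))) (pp (lext D1 ((pp ^^ k) u)) + lext (\<lambda>x. 0) ((pp ^^ k) u))"
    using assms pk_D1 by (intro pp_lext_commute) (auto simp: onM_pow eqS_def)
  then have "eqS (lext D1 (pp ((pp ^^ k) u))) (pp (lext D1 ((pp ^^ k) u)))"
    by simp
  moreover have "eqS (pp (lext D1 ((pp ^^ k) u))) (pp ((pp ^^ k) (lext D1 u)))"
    using Suc assms by (intro eqS_pp) auto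
  ultimately show ?case
    by (auto intro: eqS_trans)
qed (simp add: eqS_refl)

text \<open>Moving \<open>D0\<close> across one factor \<open>pp\<close> leaves a \<open>qk\<close>,
  which commutes with the remaining factors; this happens at \<open>k\<close> places. For
  \<open>k = 0\<close> the truncated exponent \<open>k - 1\<close> is harmless because of the factor
  0.\<close>

lemma pow_commute_D0:
  assumes "fs u" "onM u"
  shows "eqS (lext D0 ((pp ^^ k) u)) ((pp ^^ k) (lext D0 u) + smul (of_nat k) ((pp ^^ (k - 1)) (lext qk u)))"
proof (induction k)
  case (Suc k)
  have 1: "eqS (lext D0 (pp ((pp ^^ k) u))) (pp (lext D0 ((pp ^^ k) u)) + lext qk ((pp ^^ k) u))"
    using assms pk_D0 by (intro pp_lext_commute) (auto simp: onM_pow eqS_refl)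
  have 2: "eqS (pp (lext D0 ((pp ^^ k) u)) + lext qk ((pp ^^ k) u))
      (pp ((pp ^^ k) (lext D0 u) + smul (of_nat k) ((pp ^^ (k - 1)) (lext qk u))) + (pp ^^ k) (lext qk u))"
    using Suc assms by (intro eqS_add eqS_pp pow_commute_qk) auto
  have 3: "pp ((pp ^^ k) (lext D0 u) + smul (of_nat k) ((pp ^^ (k - 1)) (lext qk u))) + (pp ^^ k) (lext qk u) =
      (pp ^^ Suc k) (lext D0 u) + smul (of_nat (Suc k)) ((pp ^^ (Suc k - 1)) (lext qk u))"
  proof (cases k)
    case (Suc j)
    have "smul (of_nat (Suc k)) u = smul (of_nat k) u + u" for u :: "'g list \<times> 'h list \<Rightarrow> 'k"
      by (simp only: of_nat_Suc fv.scale_left_distrib fv.scale_one add_ac)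
    with Suc assms show ?thesis
      by (simp del: of_nat_Suc add: add_ac)
  qed (use assms in simp)
  show ?case
    using eqS_trans[OF 1 2] unfolding 3 by simp
qed (simp add: eqS_refl)

section \<open>The exponential of a derivation and the bracket\<close>

definition "lb u w = lext (\<lambda>x. lext (K0 x) w) u"

lemma fs_lb [simp]: "fs u \<Longrightarrow> fs w \<Longrightarrow> fs (lb u w)"
  by (simp add: lb_def)

lemma lb_add_left: "fs u \<Longrightarrow> fs u' \<Longrightarrow> lb (u + u') w = lb u w + lb u' w"
  unfolding lb_def by (rule lext_add)

lemma lb_add_right:
  assumes "fs u" "fs w" "fs w'" shows "lb u (w + w') = lb u w + lb u w'"
proof -
  have "lb u (w + w') = lext (\<lambda>x. lext (K0 x) w + lext (K0 x) w') u"
    unfolding lb_def by (simp only: lext_add[OF assms(2,3)])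
  also have "\<dots> = lext (\<lambda>x. lext (K0 x) w) u + lext (\<lambda>x. lext (K0 x) w') u"
    by (rule lext_fun_add[OF assms(1), of "\<lambda>x. lext (K0 x) w" "\<lambda>x. lext (K0 x) w'"])
  finally show ?thesis
    unfolding lb_def .
qed

lemma lb_smul: "lb (smul c u) w = smul c (lb u w)" "lb u (smul c w) = smul c (lb u w)"
  unfolding lb_def by (simp_all only: lext_smul lext_fun_smul)

lemma lb_0 [simp]: "lb 0 w = 0" "lb u 0 = 0"
  unfolding lb_def by (simp_all only: lext_0 lext_fun_0)

lemma lb_sum_left: "(\<And>i. i \<in> I \<Longrightarrow> fs (u i)) \<Longrightarrow> lb (\<Sum>i\<in>I. u i) w = (\<Sum>i\<in>I. lb (u i) w)"
  by (induction I rule: infinite_finite_induct) (simp_all add: lb_add_left)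

lemma lb_sum_right: "fs u \<Longrightarrow> (\<And>i. i \<in> I \<Longrightarrow> fs (w i)) \<Longrightarrow> lb u (\<Sum>i\<in>I. w i) = (\<Sum>i\<in>I. lb u (w i))"
  by (induction I rule: infinite_finite_induct) (simp_all add: lb_add_right)

lemma pp_lb:
  assumes "fs u" "onM u" "fs w" "onM w"
  shows "eqS (pp (lb u w)) (lb (pp u) w + lb u (pp w))"
proof -
  have "lb (pp u) w = lext (\<lambda>x. lext (\<lambda>x'. lext (K0 x') w) (pk x)) u"
    unfolding lb_def using assms by (intro lext_lext) auto
  also have "\<dots> = lext (\<lambda>x. lext (\<lambda>y. lext (\<lambda>x'. K0 x' y) (pk x)) w) u"
    by (simp only: lext_swap[OF fs_pk assms(3)])
  finally have 1: "lb (pp u) w = lext (\<lambda>x. lext (\<lambda>y. lext (\<lambda>x'. K0 x' y) (pk x)) w) u" .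
  have 2: "lb u (pp w) = lext (\<lambda>x. lext (\<lambda>y. lext (\<lambda>y'. K0 x y') (pk y)) w) u"
    unfolding lb_def by (simp only: lext_lext[OF assms(3) fs_pk])
  have 3: "pp (lb u w) = lext (\<lambda>x. lext (\<lambda>y. pp (K0 x y)) w) u"
    unfolding lb_def using assms by simp
  have "pp (lb u w) - (lb (pp u) w + lb u (pp w)) =
     lext (\<lambda>x. lext (\<lambda>y. pp (K0 x y) - (lext (\<lambda>x'. K0 x' y) (pk x) + lext (\<lambda>y'. K0 x y') (pk y))) w) u"
    unfolding 1 2 3 by (simp only: lext_fun_diff lext_fun_add assms)
  also have "\<dots> \<in> fspan S"
    using assms pk_K0 by (intro lext_in_fspan) (auto simp: onM_def)
  finally show ?thesis
    by (simp add: eqS_def)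
qed

lemma pow_lb:
  assumes "fs u" "onM u" "fs w" "onM w"
  shows "eqS ((pp ^^ n) (lb u w)) (\<Sum>k\<le>n. smul (of_nat (n choose k)) (lb ((pp ^^ k) u) ((pp ^^ (n - k)) w)))"
proof (induction n)
  case 0
  then show ?case by (simp add: eqS_refl)
next
  case (Suc n)
  let ?b = "\<lambda>k l. lb ((pp ^^ k) u) ((pp ^^ l) w)"
  have 1: "eqS ((pp ^^ Suc n) (lb u w)) (pp (\<Sum>k\<le>n. smul (of_nat (n choose k)) (?b k (n - k))))"
    unfolding funpow.simps comp_apply using assms by (intro eqS_pp Suc) auto
  have 2: "eqS (pp (\<Sum>k\<le>n. smul (of_nat (n choose k)) (?b k (n - k))))
     (\<Sum>k\<le>n. smul (of_nat (n choose k)) (?b (Suc k) (n - k) + ?b k (Suc n - k)))"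
  proof -
    have "pp (\<Sum>k\<le>n. smul (of_nat (n choose k)) (?b k (n - k))) = (\<Sum>k\<le>n. smul (of_nat (n choose k)) (pp (?b k (n - k))))"
      using assms by simp
    moreover have "eqS \<dots> (\<Sum>k\<le>n. smul (of_nat (n choose k)) (?b (Suc k) (n - k) + ?b k (Suc n - k)))"
    proof (intro eqS_sum eqS_smul)
      fix k assume "k \<in> {..n}"
      then have "Suc n - k = Suc (n - k)"
        by auto
      then show "eqS (pp (?b k (n - k))) (?b (Suc k) (n - k) + ?b k (Suc n - k))"
        using pp_lb[of "(pp ^^ k) u" "(pp ^^ (n - k)) w"] assms by (simp add: onM_pow)
    qed
    ultimately show ?thesis by simp
  qed
  \<comment> \<open>Pascal's rule. The sum may be extended to \<open>k = Suc n\<close>, where the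
    binomial coefficient \<open>n choose k\<close> is 0.\<close>
  have 3: "(\<Sum>k\<le>n. smul (of_nat (n choose k)) (?b (Suc k) (n - k) + ?b k (Suc n - k))) =
     (\<Sum>k\<le>Suc n. smul (of_nat (Suc n choose k)) (?b k (Suc n - k)))"
  proof -
    have "(\<Sum>k\<le>Suc n. smul (of_nat (Suc n choose k)) (?b k (Suc n - k))) =
      ?b 0 (Suc n) + (\<Sum>k\<le>n. smul (of_nat (n choose k) + of_nat (n choose Suc k)) (?b (Suc k) (n - k)))"
      by (simp add: sum.atMost_Suc_shift del: sum.atMost_Suc)
    also have "\<dots> = (\<Sum>k\<le>n. smul (of_nat (n choose k)) (?b (Suc k) (n - k))) +
       (?b 0 (Suc n) + (\<Sum>k\<le>n. smul (of_nat (n choose Suc k)) (?b (Suc k) (n - k))))"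
      by (simp add: fv.scale_left_distrib sum.distrib add_ac)
    also have "?b 0 (Suc n) + (\<Sum>k\<le>n. smul (of_nat (n choose Suc k)) (?b (Suc k) (n - k))) =
       (\<Sum>k\<le>Suc n. smul (of_nat (n choose k)) (?b k (Suc n - k)))"
      by (simp add: sum.atMost_Suc_shift del: sum.atMost_Suc)
    also have "\<dots> = (\<Sum>k\<le>n. smul (of_nat (n choose k)) (?b k (Suc n - k)))"
      by simp
    finally show ?thesis
      by (simp add: fv.scale_right_distrib sum.distrib)
  qed
  show ?case
    using eqS_trans[OF 1 2] unfolding 3 .
qed

text \<open>The exponential series is finite on monomials, since every term removes a closed letter.\<close>

definition "X x = (\<Sum>k\<le>length (fst x). smul (1 / fact k) ((pp ^^ k) (sgl x)))"

lemma fs_X [simp]: "fs (X x)"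
  by (simp add: X_def)

lemma pow_eq_0:
  assumes "\<And>x. u x \<noteq> 0 \<Longrightarrow> length (fst x) < k"
  shows "(pp ^^ k) u = 0"
proof
  fix y
  show "(pp ^^ k) u y = 0 y"
  proof (rule ccontr)
    assume "(pp ^^ k) u y \<noteq> 0 y"
    then obtain x where "u x \<noteq> 0" "length (fst x) = length (fst y) + k"
      using pow_length[of k u y] by (auto simp: pointwise)
    with assms[of x] show False by simp
  qed
qed

text \<open>The cutoff in \<open>X\<close> depends on the monomial. Terms beyond it vanish, so one
  bound can be used for all monomials of \<open>u\<close>, and then the series can be exchanged with
  \<open>lext\<close>.\<close>

lemma lext_X:
  assumes "fs u" "\<And>x. u x \<noteq> 0 \<Longrightarrow> length (fst x) \<le> n"
  shows "lext X u = (\<Sum>k\<le>n. smul (1 / fact k) ((pp ^^ k) u))"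
proof -
  have "lext X u = lext (\<lambda>x. \<Sum>k\<le>n. smul (1 / fact k) ((pp ^^ k) (sgl x))) u"
  proof (rule lext_cong)
    fix x assume x: "u x \<noteq> 0"
    show "X x = (\<Sum>k\<le>n. smul (1 / fact k) ((pp ^^ k) (sgl x)))"
      unfolding X_def using assms(2)[OF x]
      by (intro sum.mono_neutral_left) (auto simp: sgl_def intro!: arg_cong[where f = "smul _", THEN trans] pow_eq_0 split: if_splits)
  qed
  then show ?thesis
    by (simp only: lext_fun_sum[OF assms(1)] lext_fun_smul pow_lext[OF assms(1), symmetric])
qed

lemma X_eq: "length (fst x) \<le> n \<Longrightarrow> X x = (\<Sum>k\<le>n. smul (1 / fact k) ((pp ^^ k) (sgl x)))"
proof -
  assume "length (fst x) \<le> n"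
  then have "lext X (sgl x) = (\<Sum>k\<le>n. smul (1 / fact k) ((pp ^^ k) (sgl x)))"
    by (intro lext_X fs_sgl) (auto simp: sgl_def split: if_splits)
  then show ?thesis by simp
qed

text \<open>As the number of closed letters never grows, a cutoff that is valid for \<open>x\<close>
  is valid after applying the operators too.\<close>

lemma D_length:
  assumes "x \<in> M"
  shows "D0 x y \<noteq> 0 \<Longrightarrow> length (fst y) \<le> length (fst x)" "D1 x y \<noteq> 0 \<Longrightarrow> length (fst y) \<le> length (fst x)"
    "qk x y \<noteq> 0 \<Longrightarrow> length (fst y) \<le> length (fst x)"
proof -
  have d: "der1 cg \<theta>c cs zs \<noteq> 0 \<Longrightarrow> cs \<in> lists Gc \<Longrightarrow> length zs = length cs \<and> zs \<in> lists Gc" for cs zs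
  proof (induction cs arbitrary: zs)
    case (Cons c cs)
    then consider "lext (\<lambda>ys. sgl (ys @ cs)) (\<theta>c c) zs \<noteq> 0" | "cns c (der1 cg \<theta>c cs) zs \<noteq> 0"
      by (auto simp: der1_Cons[OF fs\<theta>c] dest!: plus_neq_0 smul_neq_0)
    then show ?case
    proof cases
      case 1
      then show ?thesis
        using Cons.prems \<theta>c[of c] by (elim lext_support) (fastforce simp: sgl_def split: if_splits)
    next
      case 2
      then show ?thesis
        using Cons unfolding cns_def by (elim lext_support) (auto simp: sgl_def split: if_splits)
    qed
  qed (simp add: pointwise)
  have l: "lap cg \<delta>c cs zs \<noteq> 0 \<Longrightarrow> length zs \<le> length cs" for cs zs
  proof (induction cs arbitrary: zs)
    case (Cons c cs)
    then consider "dlt cg (cg c + 1) 0 (\<delta>c c) cs zs \<noteq> 0" | "cns c (lap cg \<delta>c cs) zs \<noteq> 0"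
      by (auto dest!: plus_neq_0 smul_neq_0)
    then show ?case
    proof cases
      case 1
      then show ?thesis
        using dlt_support[OF 1] by auto
    next
      case 2
      then show ?thesis
        using Cons unfolding cns_def by (elim lext_support) (auto simp: sgl_def split: if_splits)
    qed
  qed (simp add: pointwise)
  have cs: "fst x \<in> lists Gc"
    using assms by (cases x) (simp add: M_def)
  show "D0 x y \<noteq> 0 \<Longrightarrow> length (fst y) \<le> length (fst x)"
    using d[OF _ cs, of "fst y"]
    by (cases y) (auto simp: D0_def sgl_def tens_def dest!: plus_neq_0 smul_neq_0 split: if_splits)
  show "D1 x y \<noteq> 0 \<Longrightarrow> length (fst y) \<le> length (fst x)"
    using l[of "fst x" "fst y"] by (cases y) (auto simp: D1_def sgl_def tens_def dest!: plus_neq_0 smul_neq_0 split: if_splits)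
  show "qk x y \<noteq> 0 \<Longrightarrow> length (fst y) \<le> length (fst x)"
    using Q0_support[OF _ cs, of "fst y"] by (cases y) (auto simp: qk_def tens_def)
qed

lemma K0_length:
  assumes "K0 x y z \<noteq> 0" shows "length (fst z) \<le> length (fst x) + length (fst y)"
proof -
  have l: "brc cg \<delta>c as bs zs \<noteq> 0 \<Longrightarrow> length zs \<le> length as + length bs" for as bs zs
  proof (induction as arbitrary: zs)
    case (Cons c cs)
    then consider "pre cs (dlt cg (cg c + 1) 0 (\<delta>c c) bs) zs \<noteq> 0" | "cns c (brc cg \<delta>c cs bs) zs \<noteq> 0"
      by (auto dest!: plus_neq_0 smul_neq_0)
    then show ?case
    proof cases
      case 1
      then obtain ws where "dlt cg (cg c + 1) 0 (\<delta>c c) bs ws \<noteq> 0" "zs = cs @ ws"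
        unfolding pre_def by (elim lext_support) (auto simp: sgl_def split: if_splits)
      then show ?thesis
        using dlt_support[of cg "cg c + 1" 0 "\<delta>c c" bs ws] by auto
    next
      case 2
      then show ?thesis
        using Cons unfolding cns_def by (elim lext_support) (auto simp: sgl_def split: if_splits)
    qed
  qed (simp add: pointwise)
  show ?thesis
    using assms l[of "fst x" "fst y" "fst z"] by (cases z) (auto simp: K0_def tens_def sgl_def dest!: plus_neq_0 smul_neq_0 split: if_splits)
qed

lemma D0_X:
  assumes "x \<in> M" shows "eqS (lext D0 (X x)) (lext X (D0 x) + lext X (qk x))"
proof -
  let ?n = "length (fst x)"
  \<comment> \<open>The series is taken one term too far, because the shift of index in
    \<open>k / k! = 1 / (k-1)!\<close> then leaves the series of \<open>qk x\<close> up to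
    \<open>?n\<close>.\<close>
  have "lext D0 (X x) = (\<Sum>k\<le>Suc ?n. smul (1 / fact k) (lext D0 ((pp ^^ k) (sgl x))))"
    by (subst X_eq[of x "Suc ?n"]) (simp_all del: sum.atMost_Suc)
  moreover have "eqS \<dots> (\<Sum>k\<le>Suc ?n. smul (1 / fact k) ((pp ^^ k) (lext D0 (sgl x)) +
      smul (of_nat k) ((pp ^^ (k - 1)) (lext qk (sgl x)))))"
    using assms by (intro eqS_sum eqS_smul pow_commute_D0) (auto intro: onM_sgl)
  moreover have "(\<Sum>k\<le>Suc ?n. smul (1 / fact k) ((pp ^^ k) (lext D0 (sgl x)) +
      smul (of_nat k) ((pp ^^ (k - 1)) (lext qk (sgl x))))) =
      (\<Sum>k\<le>Suc ?n. smul (1 / fact k) ((pp ^^ k) (D0 x))) + (\<Sum>k\<le>Suc ?n. smul (of_nat k / fact k) ((pp ^^ (k - 1)) (qk x)))"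
    by (simp add: fv.scale_right_distrib sum.distrib del: sum.atMost_Suc)
  moreover have "(\<Sum>k\<le>Suc ?n. smul (of_nat k / fact k) ((pp ^^ (k - 1)) (qk x))) =
      (\<Sum>k\<le>?n. smul (1 / fact k) ((pp ^^ k) (qk x)))"
  proof -
    have "of_nat (Suc k) / fact (Suc k) = (1 / fact k :: 'k)" for k
      by (simp add: field_simps del: of_nat_Suc)
    then show ?thesis
      unfolding sum.atMost_Suc_shift by (simp del: fact_Suc of_nat_Suc)
  qed
  moreover have "(\<Sum>k\<le>Suc ?n. smul (1 / fact k) ((pp ^^ k) (D0 x))) = lext X (D0 x)"
    using D_length(1)[OF assms] by (intro lext_X[symmetric]) (auto intro: le_SucI)
  moreover have "(\<Sum>k\<le>?n. smul (1 / fact k) ((pp ^^ k) (qk x))) = lext X (qk x)"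
    using D_length(3)[OF assms] by (intro lext_X[symmetric]) auto
  ultimately show ?thesis
    by simp
qed

lemma D1_X:
  assumes "x \<in> M" shows "eqS (lext D1 (X x)) (lext X (D1 x))"
proof -
  let ?n = "length (fst x)"
  have "lext D1 (X x) = (\<Sum>k\<le>?n. smul (1 / fact k) (lext D1 ((pp ^^ k) (sgl x))))"
    by (subst X_eq[of x ?n]) simp_all
  moreover have "eqS \<dots> (\<Sum>k\<le>?n. smul (1 / fact k) ((pp ^^ k) (lext D1 (sgl x))))"
    using assms by (intro eqS_sum eqS_smul pow_commute_D1) (auto intro: onM_sgl)
  moreover have "(\<Sum>k\<le>?n. smul (1 / fact k) ((pp ^^ k) (lext D1 (sgl x)))) = lext X (D1 x)"
    using D_length(2)[OF assms] by (subst lext_X[of "D1 x" ?n]) auto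
  ultimately show ?thesis
    by simp
qed

lemma K0_X:
  assumes "x \<in> M" "y \<in> M" shows "eqS (lb (X x) (X y)) (lext X (K0 x y))"
proof -
  let ?l = "length (fst x)" and ?m = "length (fst y)"
  define n where "n = ?l + ?m"
  define a where "a = (\<lambda>k. smul (1 / fact k) ((pp ^^ k) (sgl x)))"
  define b where "b = (\<lambda>k. smul (1 / fact k) ((pp ^^ k) (sgl y)))"
  have fs [simp]: "fs (a k)" "fs (b k)" for k
    by (simp_all add: a_def b_def)
  have a0: "a k = 0" if "k > ?l" for k
  proof -
    have "(pp ^^ k) (sgl x) = 0"
      using that by (intro pow_eq_0) (auto simp: sgl_def split: if_splits)
    then show ?thesis by (simp add: a_def)
  qed
  have b0: "b k = 0" if "k > ?m" for k
  proof -
    have "(pp ^^ k) (sgl y) = 0"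
      using that by (intro pow_eq_0) (auto simp: sgl_def split: if_splits)
    then show ?thesis by (simp add: b_def)
  qed
  have "lext X (K0 x y) = (\<Sum>i\<le>n. smul (1 / fact i) ((pp ^^ i) (lb (sgl x) (sgl y))))"
    using K0_length[of x y] by (subst lext_X[of _ n]) (auto simp: n_def lb_def)
  moreover have "eqS \<dots> (\<Sum>i\<le>n. smul (1 / fact i) (\<Sum>k\<le>i. smul (of_nat (i choose k)) (lb ((pp ^^ k) (sgl x)) ((pp ^^ (i - k)) (sgl y)))))"
    using assms by (intro eqS_sum eqS_smul pow_lb) (auto intro: onM_sgl)
  moreover have "smul (1 / fact i) (\<Sum>k\<le>i. smul (of_nat (i choose k)) (lb ((pp ^^ k) (sgl x)) ((pp ^^ (i - k)) (sgl y)))) =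
      (\<Sum>k\<le>i. lb (a k) (b (i - k)))" for i
    unfolding fv.scale_sum_right a_def b_def lb_smul fv.scale_scale
    by (intro sum.cong refl arg_cong2[where f = smul]) (simp add: binomial_fact)
  moreover have "(\<Sum>i\<le>n. \<Sum>k\<le>i. lb (a k) (b (i - k))) = lb (X x) (X y)"
  proof -
    \<comment> \<open>The Cauchy product of the two exponential series: the triangle contains the
      rectangle of possibly nonzero terms.\<close>
    have "(\<Sum>i\<le>n. \<Sum>k\<le>i. lb (a k) (b (i - k))) = (\<Sum>(k, l)\<in>{(k, l). k + l \<le> n}. lb (a k) (b l))"
      by (rule sum.triangle_reindex_eq[symmetric])
    also have "\<dots> = (\<Sum>(k, l)\<in>{..?l} \<times> {..?m}. lb (a k) (b l))"
    proof (rule sum.mono_neutral_right)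
      show "finite {(k, l). k + l \<le> n}"
        by (rule finite_subset[of _ "{..n} \<times> {..n}"]) auto
      show "\<forall>p\<in>{(k, l). k + l \<le> n} - {..?l} \<times> {..?m}. (case p of (k, l) \<Rightarrow> lb (a k) (b l)) = 0"
        using a0 b0 by (auto simp: not_le)
    qed (auto simp: n_def)
    also have "\<dots> = lb (X x) (X y)"
      unfolding X_def a_def[symmetric] b_def[symmetric]
      by (subst lb_sum_left) (simp_all add: lb_sum_right sum.cartesian_product)
    finally show ?thesis .
  qed
  ultimately have "eqS (lext X (K0 x y)) (lb (X x) (X y))"
    by simp
  then show ?thesis
    unfolding eqS_def using fv.span_neg by fastforce
qed

lemma X_S: "\<rho> \<in> S \<Longrightarrow> fs \<rho> \<and> lext X \<rho> \<in> fspan S"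
proof -
  assume \<rho>: "\<rho> \<in> S"
  then have fs: "fs \<rho>"
    by (rule pk_S)
  define n where "n = Max (insert 0 ((\<lambda>x. length (fst x)) ` {x. \<rho> x \<noteq> 0}))"
  have "length (fst x) \<le> n" if "\<rho> x \<noteq> 0" for x
    using that fs unfolding n_def fs_def by (intro Max_ge) auto
  then have "lext X \<rho> = (\<Sum>k\<le>n. smul (1 / fact k) ((pp ^^ k) \<rho>))"
    using fs by (intro lext_X) auto
  \<comment> \<open>The element \<open>\<rho>\<close> is congruent to 0, and \<open>pow_smul\<close>
    with scalar 0 says that powers of \<open>pp\<close> send 0 to 0.\<close>
  moreover have "(pp ^^ k) \<rho> \<in> fspan S" for k
    using eqS_pow[of \<rho> 0 k] fs pow_smul[of k 0 0] \<rho> by (simp add: eqS_def fv.span_base)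
  ultimately show "fs \<rho> \<and> lext X \<rho> \<in> fspan S"
    using fs by (auto intro!: fv.span_sum fv.span_scale)
qed

end

section \<open>Sizes of open monomials\<close>

lemma contr_support:
  assumes "contr gd \<delta> xs i j zs \<noteq> 0" "i < j" "j < length xs"
  shows "\<exists>us x vs y ts ys. xs = us @ x # vs @ y # ts \<and> \<delta> x y ys \<noteq> 0 \<and> zs = ys @ us @ vs @ ts"
proof -
  from assms(1) obtain ys where ys: "\<delta> (xs ! i) (xs ! j) ys \<noteq> 0"
    "zs = ys @ take i xs @ slice (Suc i) j xs @ drop (Suc j) xs"
    unfolding contr_def by (auto simp: sgl_def dest!: smul_neq_0 elim!: lext_support split: if_splits)
  have "drop (Suc i) xs = slice (Suc i) j xs @ drop j xs"
    using assms(2) unfolding slice_def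
    by (metis Suc_leI append_take_drop_id drop_drop le_add_diff_inverse2)
  then have "xs = take i xs @ xs ! i # slice (Suc i) j xs @ xs ! j # drop (Suc j) xs"
    using assms(2,3) by (metis Cons_nth_drop_Suc id_take_nth_drop less_trans)
  with ys show ?thesis
    by blast
qed

lemma sum_fun_neq_0:
  assumes "(\<Sum>i\<in>I. f i) y \<noteq> (0 :: 'k::field)" obtains i where "i \<in> I" "f i y \<noteq> 0"
  using assms unfolding sum_fun_apply by (meson sum.not_neutral_contains_not_neutral)

text \<open>The two inequalities reflect that \<open>\<nabla>\<close> trades two letters for one
  more word, and that the open bracket loses two letters and merges two words. Counting words and
  letters, the size drops by at most 1 and by 3, respectively, which are the constants used for the
  kernels \<open>D0\<close>, \<open>D1\<close> and \<open>K\<close>.\<close>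

locale nu_op_sized = nu_op Go og \<delta>o Ro v \<theta>o Gc cg \<theta>c \<delta>c Rc \<beta> \<beta>' N
  for Go :: "'h set" and og :: "'h \<Rightarrow> int" and \<delta>o :: "'h \<Rightarrow> 'h \<Rightarrow> 'h list \<Rightarrow> 'k::field_char_0"
    and Ro :: "('h \<Rightarrow> 'k) set" and v :: 'h and \<theta>o :: "'h \<Rightarrow> 'h list \<Rightarrow> 'k"
    and Gc :: "'g set" and cg :: "'g \<Rightarrow> int" and \<theta>c :: "'g \<Rightarrow> 'g list \<Rightarrow> 'k"
    and \<delta>c :: "'g \<Rightarrow> 'g \<Rightarrow> 'k" and Rc :: "('g \<Rightarrow> 'k) set"
    and \<beta> :: "'g \<Rightarrow> 'k" and \<beta>' :: "'g \<Rightarrow> 'k" and N :: int +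
  fixes len :: "'h \<Rightarrow> nat"
  assumes \<theta>o_len: "\<And>x zs. \<theta>o x zs \<noteq> 0 \<Longrightarrow> len x \<le> length zs + sum_list (map len zs)"
    and \<delta>o_len: "\<And>x y zs. \<delta>o x y zs \<noteq> 0 \<Longrightarrow> len x + len y \<le> Suc (length zs + sum_list (map len zs))"
    and Ro_len: "\<And>\<rho>. \<rho> \<in> Ro \<Longrightarrow> \<exists>n. \<forall>w. \<rho> w \<noteq> 0 \<longrightarrow> len w = n"
begin

definition osz :: "'h list \<Rightarrow> nat" where
  "osz ws = length ws + sum_list (map len ws)"

definition bl :: "'g list \<times> 'h list \<Rightarrow> unit \<times> nat \<times> nat" where
  "bl m = ((), length (snd m), sum_list (map len (snd m)))"

definition sz :: "unit \<times> nat \<times> nat \<Rightarrow> nat" where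
  "sz b = fst (snd b) + snd (snd b)"

lemma osz_simps [simp]: "osz [] = 0" "osz (w # ws) = Suc (len w) + osz ws" "osz (ws @ ws') = osz ws + osz ws'"
  by (simp_all add: osz_def)

lemma sz_bl: "sz (bl m) = osz (snd m)"
  by (simp add: sz_def bl_def osz_def)

lemma SO_homog:
  assumes "\<sigma> \<in> SO"
  obtains a b where "\<And>ws. \<sigma> ws \<noteq> 0 \<Longrightarrow> length ws = a \<and> sum_list (map len ws) = b"
  using assms unfolding SO_def
proof (cases rule: symrel_cases)
  case (swap us x y vs)
  then show ?thesis
    by (intro that[of "length us + 2 + length vs" "sum_list (map len us) + len x + len y + sum_list (map len vs)"])
      (auto simp: sgl_def smul_def pointwise split: if_splits)
next
  case (lin us \<rho> vs)
  obtain n where n: "\<And>w. \<rho> w \<noteq> 0 \<Longrightarrow> len w = n"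
    using Ro_len[OF lin(3)] by blast
  show ?thesis
  proof (rule that[of "length us + 1 + length vs" "sum_list (map len us) + n + sum_list (map len vs)"])
    fix ws assume "\<sigma> ws \<noteq> 0"
    then obtain w where "\<rho> w \<noteq> 0" "ws = us @ w # vs"
      unfolding lin by (elim lext_support) (auto simp: sgl_def split: if_splits)
    with n[of w] show "length ws = length us + 1 + length vs \<and> sum_list (map len ws) = sum_list (map len us) + n + sum_list (map len vs)"
      by simp
  qed
qed

sublocale blocks bl sz S
proof
  fix \<rho> assume "\<rho> \<in> S"
  then consider (l) \<sigma> b where "\<rho> = tens \<sigma> (sgl b)" | (r) a \<sigma> where "\<rho> = tens (sgl a) \<sigma>" "\<sigma> \<in> SO"
    unfolding S_def tensrel_def by blast
  then show "\<exists>\<beta>. \<forall>m. \<rho> m \<noteq> 0 \<longrightarrow> bl m = \<beta>"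
  proof cases
    case l
    then show ?thesis
      by (intro exI[of _ "((), length b, sum_list (map len b))"]) (auto simp: bl_def tens_def sgl_def split: if_splits)
  next
    case r
    obtain a' b' where "\<And>ws. \<sigma> ws \<noteq> 0 \<Longrightarrow> length ws = a' \<and> sum_list (map len ws) = b'"
      using SO_homog[OF r(2)] by blast
    then show ?thesis
      by (intro exI[of _ "((), a', b')"]) (auto simp: bl_def r tens_def sgl_def split: if_splits)
  qed
qed

lemma der1_osz:
  assumes "der1 og \<theta>o ws zs \<noteq> 0" shows "osz ws \<le> Suc (osz zs)"
proof -
  obtain i where i: "i < length ws" "lext (\<lambda>ys. sgl (take i ws @ ys @ drop (Suc i) ws)) (\<theta>o (ws ! i)) zs \<noteq> 0"
    using assms unfolding der1_def by (elim sum_fun_neq_0) (auto dest!: smul_neq_0)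
  then obtain ys where "\<theta>o (ws ! i) ys \<noteq> 0" and zs: "zs = take i ws @ ys @ drop (Suc i) ws"
    by (elim lext_support) (auto simp: sgl_def split: if_splits)
  then have "len (ws ! i) \<le> osz ys"
    using \<theta>o_len by (simp add: osz_def)
  moreover have "osz ws = osz (take i ws @ ws ! i # drop (Suc i) ws)"
    using i(1) by (simp only: id_take_nth_drop[symmetric])
  ultimately show ?thesis
    by (simp add: zs)
qed

lemma contr_osz:
  assumes "contr og \<delta>o ws i j zs \<noteq> 0" "i < j" "j < length ws" shows "osz ws \<le> osz zs + 3"
proof -
  obtain us x vs y ts ys where *: "ws = us @ x # vs @ y # ts" "\<delta>o x y ys \<noteq> 0" "zs = ys @ us @ vs @ ts"
    using contr_support[OF assms] by blast
  have "len x + len y \<le> Suc (osz ys)"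
    using \<delta>o_len[OF *(2)] by (simp add: osz_def)
  then show ?thesis
    by (simp add: *)
qed

abbreviation K :: "('g list \<times> 'h list) \<times> ('g list \<times> 'h list) \<Rightarrow> 'g list \<times> 'h list \<Rightarrow> 'k" where
  "K p \<equiv> K0 (fst p) (snd p)"

abbreviation "s2 \<equiv> \<lambda>p :: ('g list \<times> 'h list) \<times> ('g list \<times> 'h list). s (fst p) + s (snd p)"

lemma bker_pk: "bker s s pk"
  by (rule bkerI[where c = 0], simp) (auto simp: sz_bl pk_def tens_def sgl_def split: if_splits)

lemma bker_qk: "bker s s qk"
  by (rule bkerI[where c = 0], simp) (auto simp: sz_bl qk_def tens_def sgl_def split: if_splits)

lemma bker_D0: "bker s s D0"
proof (rule bkerI[where c = 1])
  fix x y assume "D0 x y \<noteq> 0"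
  then have "snd y = snd x \<or> der1 og \<theta>o (snd x) (snd y) \<noteq> 0"
    by (cases y) (auto simp: D0_def tens_def sgl_def dest!: plus_neq_0 smul_neq_0 split: if_splits)
  then show "s x \<le> s y + 1"
    using der1_osz by (auto simp: sz_bl)
qed simp

lemma bker_D1: "bker s s D1"
proof (rule bkerI[where c = 3])
  fix x y assume "D1 x y \<noteq> 0"
  then consider "snd y = snd x" | "Lo (snd x) (snd y) \<noteq> 0"
    by (cases y) (auto simp: D1_def tens_def sgl_def dest!: plus_neq_0 smul_neq_0 split: if_splits)
  then show "s x \<le> s y + 3"
  proof cases
    case 2
    then obtain i j where "j < length (snd x)" "i < j" "contr og \<delta>o (snd x) i j (snd y) \<noteq> 0"
      unfolding Lo_def by (elim sum_fun_neq_0) auto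
    then show ?thesis
      using contr_osz by (simp add: sz_bl)
  qed (simp add: sz_bl)
qed simp

lemma bker_K: "bker s2 s K"
proof (rule bkerI[where c = 3])
  fix p y assume "K p y \<noteq> 0"
  then consider "snd y = snd (fst p) @ snd (snd p)" | "Bo (snd (fst p)) (snd (snd p)) (snd y) \<noteq> 0"
    by (cases y) (auto simp: K0_def tens_def sgl_def dest!: plus_neq_0 smul_neq_0 split: if_splits)
  then show "s2 p \<le> s y + 3"
  proof cases
    case 2
    let ?a = "snd (fst p)" and ?b = "snd (snd p)"
    from 2 obtain i j where "i < length ?a" "j < length ?b" "contr og \<delta>o (?a @ ?b) i (length ?a + j) (snd y) \<noteq> 0"
      unfolding Bo_def by (elim sum_fun_neq_0) auto
    then show ?thesis
      using contr_osz[of "?a @ ?b" i "length ?a + j" "snd y"] by (simp add: sz_bl)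
  qed (simp add: sz_bl)
qed simp

lemma X_osz:
  assumes "X x y \<noteq> 0" shows "osz (snd x) \<le> osz (snd y)"
proof -
  obtain k where "(pp ^^ k) (sgl x) y \<noteq> 0"
    using assms unfolding X_def by (elim sum_fun_neq_0) (auto dest!: smul_neq_0)
  from pow_length[OF this] have "snd y = replicate k v @ snd x"
    by (auto simp: sgl_def split: if_splits)
  then show ?thesis by simp
qed

lemma bker_X: "bker s s X"
  by (rule bkerI[where c = 0]) (auto simp: sz_bl X_osz)

lemma bker_XX: "bker s2 s2 (\<lambda>p. tens (X (fst p)) (X (snd p)))"
  by (rule bkerI[where c = 0], simp) (auto simp: sz_bl tens_def dest!: X_osz)

section \<open>Conjugation by the exponential\<close>

lemma onM_X: "x \<in> M \<Longrightarrow> onM (X x)"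
  unfolding onM_def X_def using onM_pow[OF onM_sgl, of x]
  by (auto simp: onM_def elim!: sum_fun_neq_0 dest!: smul_neq_0)

text \<open>All composites are kernels of bounded loss of size, so they may be combined on
  monomials, where \<open>D0_X\<close> applies, before being evaluated on an infinite
  family.\<close>

lemma D0_exp:
  assumes "lfin s u" "onM u"
  shows "RZ bl S (lext D0 (lext X u) - (lext X (lext D0 u) + lext X (lext qk u)))"
proof -
  have "lext D0 (lext X u) - (lext X (lext D0 u) + lext X (lext qk u)) =
      lext (\<lambda>x. lext D0 (X x) - (lext X (D0 x) + lext X (qk x))) u"
    by (simp only: lext_comp_lfin[OF assms(1) bker_X bker_D0] lext_comp_lfin[OF assms(1) bker_D0 bker_X]
      lext_comp_lfin[OF assms(1) bker_qk bker_X]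
      lext_fun_diff_lfin[OF assms(1) bker_comp[OF bker_X bker_D0] bker_add[OF bker_comp[OF bker_D0 bker_X] bker_comp[OF bker_qk bker_X]]]
      lext_fun_add_lfin[OF assms(1) bker_comp[OF bker_D0 bker_X] bker_comp[OF bker_qk bker_X]])
  moreover have "RZ bl S \<dots>"
    using D0_X assms(2)
    by (intro RZ_lext[OF assms(1) bker_diff[OF bker_comp[OF bker_X bker_D0] bker_add[OF bker_comp[OF bker_D0 bker_X] bker_comp[OF bker_qk bker_X]]]])
      (auto simp: onM_def eqS_def)
  ultimately show ?thesis
    by (simp only:)
qed

lemma D1_exp:
  assumes "lfin s u" "onM u"
  shows "RZ bl S (lext D1 (lext X u) - lext X (lext D1 u))"
proof -
  have "lext D1 (lext X u) - lext X (lext D1 u) = lext (\<lambda>x. lext D1 (X x) - lext X (D1 x)) u"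
    by (simp only: lext_comp_lfin[OF assms(1) bker_X bker_D1] lext_comp_lfin[OF assms(1) bker_D1 bker_X]
      lext_fun_diff_lfin[OF assms(1) bker_comp[OF bker_X bker_D1] bker_comp[OF bker_D1 bker_X]])
  moreover have "RZ bl S \<dots>"
    using D1_X assms(2)
    by (intro RZ_lext[OF assms(1) bker_diff[OF bker_comp[OF bker_X bker_D1] bker_comp[OF bker_D1 bker_X]]])
      (auto simp: onM_def eqS_def)
  ultimately show ?thesis
    by (simp only:)
qed

lemma K_exp:
  assumes "lfin s u" "onM u" "lfin s w" "onM w"
  shows "RZ bl S (lext K (tens (lext X u) (lext X w)) - lext X (lext K (tens u w)))"
proof -
  let ?XX = "\<lambda>p. tens (X (fst p)) (X (snd p))"
  have t: "lfin s2 (tens u w)"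
    by (rule lfin_tens[OF assms(1,3)])
  have 1: "tens (lext X u) (lext X w) = lext ?XX (tens u w)"
    by (rule tens_lext_lfin[OF assms(1,3), where t = s and t' = s and c = 0 and c' = 0]) (auto simp: sz_bl X_osz)
  have "lext K (tens (lext X u) (lext X w)) - lext X (lext K (tens u w)) =
     lext (\<lambda>p. lext K (?XX p) - lext X (K p)) (tens u w)"
    unfolding 1
    by (simp only: lext_comp_lfin[OF t bker_XX bker_K] lext_comp_lfin[OF t bker_K bker_X]
      lext_fun_diff_lfin[OF t bker_comp[OF bker_XX bker_K] bker_comp[OF bker_K bker_X]])
  moreover have "RZ bl S \<dots>"
  proof (rule RZ_lext[OF t bker_diff[OF bker_comp[OF bker_XX bker_K] bker_comp[OF bker_K bker_X]]])
    fix p assume "tens u w p \<noteq> 0"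
    then have "fst p \<in> M" "snd p \<in> M"
      using assms(2,4) by (auto simp: tens_def onM_def split: prod.splits)
    moreover have "lext K (?XX p) = lb (X (fst p)) (X (snd p))"
      unfolding lb_def by (simp add: lext_tens)
    ultimately show "lext K (?XX p) - lext X (K p) \<in> fspan S"
      using K0_X[of "fst p" "snd p"] by (simp add: eqS_def)
  qed
  ultimately show ?thesis
    by (simp only:)
qed

text \<open>\<open>F g\<close> is the coefficient of \<open>\<gamma>^g\<close>; \<open>D1\<close>
  raises the power by one and the bracket adds powers. Applying \<open>X\<close> to the given
  equation is legitimate because it preserves the relations, and exchanging it with
  \<open>D0\<close> absorbs the term with \<open>qk\<close>.\<close>

lemma exp_master:
  assumes fin: "\<And>g. lfin s (F g)" and on: "\<And>g. onM (F g)"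
    and eq: "RZ bl S (lext D0 (F g) + (if g = 0 then 0 else lext D1 (F (g - 1))) +
      smul (1 / 2) (\<Sum>h\<le>g. lext K (tens (F h) (F (g - h)))) + lext qk (F g))"
  shows "RZ bl S (lext D0 (lext X (F g)) + (if g = 0 then 0 else lext D1 (lext X (F (g - 1)))) +
      smul (1 / 2) (\<Sum>h\<le>g. lext K (tens (lext X (F h)) (lext X (F (g - h))))))"
proof -
  define a0 where "a0 = lext D0 (F g)"
  define a1 where "a1 = (if g = 0 then 0 else lext D1 (F (g - 1)))"
  define a2 where "a2 = (\<Sum>h\<le>g. lext K (tens (F h) (F (g - h))))"
  define a3 where "a3 = lext qk (F g)"
  have l: "lfin s a0" "lfin s a1" "lfin s a2" "lfin s a3"
    unfolding a0_def a1_def a2_def a3_def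
    using lfin_lext[OF fin bker_D0] lfin_lext[OF fin bker_D1] lfin_lext[OF fin bker_qk] lfin_lext[OF lfin_tens[OF fin fin] bker_K]
    by (auto simp: lfin_0 intro!: lfin_sum)
  have "RZ bl S (a0 + a1 + smul (1 / 2) a2 + a3)"
    using eq by (simp only: a0_def a1_def a2_def a3_def)
  then have "RZ bl S (lext X (a0 + a1 + smul (1 / 2) a2 + a3))"
    using l X_S by (intro RZ_lext_preserve bker_X lfin_add lfin_smul) auto
  then have 1: "RZ bl S (lext X a0 + lext X a1 + smul (1 / 2) (lext X a2) + lext X a3)"
    using l by (simp only: lext_add_lfin[OF _ _ bker_X] lfin_add lfin_smul lext_smul)
  have 2: "RZ bl S (lext D0 (lext X (F g)) - (lext X a0 + lext X a3))"
    unfolding a0_def a3_def by (rule D0_exp[OF fin on])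
  have 3: "RZ bl S ((if g = 0 then 0 else lext D1 (lext X (F (g - 1)))) - lext X a1)"
    unfolding a1_def using D1_exp[OF fin on] by (simp add: RZ_0)
  have "lext X a2 = (\<Sum>h\<le>g. lext X (lext K (tens (F h) (F (g - h)))))"
    unfolding a2_def by (intro lext_sum_lfin[OF _ bker_X] lfin_lext[OF lfin_tens[OF fin fin] bker_K])
  then have "RZ bl S ((\<Sum>h\<le>g. lext K (tens (lext X (F h)) (lext X (F (g - h))))) - lext X a2)"
    using K_exp[OF fin on fin on] by (simp only: sum_subtractf[symmetric]) (intro RZ_sum)
  then have 4: "RZ bl S (smul (1 / 2) ((\<Sum>h\<le>g. lext K (tens (lext X (F h)) (lext X (F (g - h))))) - lext X a2))"
    by (rule RZ_smul)
  \<comment> \<open>The three defects of commutation, added to the image of the given equation,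
    leave exactly the new equation.\<close>
  have alg: "(p0 - (x0 + x3)) + (p1 - x1) + smul c (p2 - x2) + (x0 + x1 + smul c x2 + x3) = p0 + p1 + smul c p2"
    for p0 p1 p2 x0 x1 x2 x3 :: "'g list \<times> 'h list \<Rightarrow> 'k" and c
    by (simp add: fun_eq_iff pointwise smul_def algebra_simps)
  from RZ_add[OF RZ_add[OF RZ_add[OF 2 3] 4] 1] show ?thesis
    unfolding alg .
qed

lemma pow_lfin: "lfin s u \<Longrightarrow> (pp ^^ k) u = lext (\<lambda>x. (pp ^^ k) (sgl x)) u \<and> bker s s (\<lambda>x. (pp ^^ k) (sgl x))"
proof (induction k)
  case 0
  have "bker s s (\<lambda>x. sgl x :: 'g list \<times> 'h list \<Rightarrow> 'k)"
    by (rule bkerI[where c = 0]) (simp, auto simp: sgl_def split: if_splits)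
  then show ?case by simp
next
  case (Suc k)
  then have "bker s s (\<lambda>x. (pp ^^ k) (sgl x))"
    by blast
  with Suc show ?case
    using lext_comp_lfin[OF Suc.prems _ bker_pk, of "\<lambda>x. (pp ^^ k) (sgl x)"] bker_comp[OF _ bker_pk]
    by (simp del: lext_lext)
qed

lemma lext_fun_sum_lfin:
  fixes F :: "nat \<Rightarrow> 'g list \<times> 'h list \<Rightarrow> 'g list \<times> 'h list \<Rightarrow> 'k"
  assumes "lfin s u" "\<And>k. bker s s (F k)"
  shows "lext (\<lambda>x. \<Sum>k\<le>n. smul (c k) (F k x)) u = (\<Sum>k\<le>n. smul (c k) (lext (F k) u))"
proof -
  have 1: "bker s s (\<lambda>x. smul (c k) (F k x))" for k
    using assms(2)[of k] unfolding bker_def by (meson fs_smul smul_neq_0)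
  have 2: "bker s s (\<lambda>x. \<Sum>k\<le>n. smul (c k) (F k x))" for n
    by (induction n) (use 1 in \<open>auto intro: bker_add\<close>)
  show ?thesis
    by (induction n) (simp_all add: lext_fun_add_lfin[OF assms(1) 2 1] lext_fun_smul)
qed

text \<open>Here the exponents are restricted by the coefficient, in \<open>X\<close> by the
  monomial. At \<open>y\<close> only exponents up to the number of words of \<open>y\<close>
  contribute, since that many factors \<open>v\<close> have to be present, so both ranges may be
  enlarged to a common one.\<close>

lemma exp_series:
  assumes "lfin s u"
  shows "(\<Sum>k | (pp ^^ k) u y \<noteq> 0. (pp ^^ k) u y / fact k) = lext X u y"
proof -
  let ?L = "length (snd y)"
  have L: "k \<le> ?L" if "(pp ^^ k) w y \<noteq> 0" for k w
    using pow_length[OF that] by auto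
  have X: "X x y = (\<Sum>k\<le>?L. smul (1 / fact k) ((pp ^^ k) (sgl x))) y" for x
  proof -
    have "X x y = (\<Sum>k\<le>length (fst x) + ?L. smul (1 / fact k) ((pp ^^ k) (sgl x)) y)"
      using X_eq[of x "length (fst x) + ?L"] by (simp add: sum_fun_apply)
    also have "\<dots> = (\<Sum>k\<le>?L. smul (1 / fact k) ((pp ^^ k) (sgl x)) y)"
      by (rule sum.mono_neutral_right) (auto simp: smul_def dest: L)
    finally show ?thesis by (simp add: sum_fun_apply)
  qed
  have "lext X u y = lext (\<lambda>x. \<Sum>k\<le>?L. smul (1 / fact k) ((pp ^^ k) (sgl x))) u y"
    unfolding lext_def X ..
  also have "\<dots> = (\<Sum>k\<le>?L. smul (1 / fact k) ((pp ^^ k) u)) y"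
    using pow_lfin[OF assms] by (subst lext_fun_sum_lfin[OF assms]) auto
  also have "\<dots> = (\<Sum>k\<le>?L. (pp ^^ k) u y / fact k)"
    by (simp add: sum_fun_apply smul_def)
  also have "\<dots> = (\<Sum>k | (pp ^^ k) u y \<noteq> 0. (pp ^^ k) u y / fact k)"
    by (rule sum.mono_neutral_right) (auto dest: L)
  finally show ?thesis ..
qed

lemma X_degree:
  assumes "X x y \<noteq> 0" "x \<in> M"
  shows "ldeg cg (fst y) + ldeg og (snd y) = ldeg cg (fst x) + ldeg og (snd x)"
proof -
  have "(pp ^^ k) (sgl x) y \<noteq> 0 \<Longrightarrow> ldeg cg (fst y) + ldeg og (snd y) = ldeg cg (fst x) + ldeg og (snd x)" for k
  proof (induction k arbitrary: y)
    case 0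
    then show ?case by (simp add: sgl_def split: if_splits)
  next
    case (Suc k)
    then obtain z where z: "(pp ^^ k) (sgl x) z \<noteq> 0" "pk z y \<noteq> 0"
      by (auto elim: lext_support)
    then have "z \<in> M"
      using onM_pow[OF onM_sgl[OF assms(2)], of k] unfolding onM_def by blast
    then have "fst z \<in> lists Gc"
      by (cases z) (simp add: M_def)
    moreover from z(2) have "P0 (fst z) (fst y) \<noteq> 0" "snd y = v # snd z"
      by (cases y; auto simp: pk_def tens_def sgl_def split: if_splits)+
    ultimately show ?case
      using Suc.IH[OF z(1)] P0_support[of "fst z" "fst y"] by simp
  qed
  then show ?thesis
    using assms(1) unfolding X_def by (elim sum_fun_neq_0) (auto dest!: smul_neq_0)
qed

end

section \<open>The open-closed algebra\<close>

lemma ogdeg_Nil [simp]: "ogdeg d [] = 3 - d"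
  by (simp add: ogdeg_def wd_def)

lemma wd_simps [simp]: "wd [] = 0" "wd (l # ls) = ltdeg l + wd ls" "wd (ls @ ls') = wd ls + wd ls'"
  by (simp_all add: wd_def)

lemma open_bracket_support:
  assumes "open_bracket C d X x y zs \<noteq> 0"
  obtains us l us' vs l' vs' where "x = us @ l # us'" "y = vs @ l' # vs'" "ltdeg l + ltdeg l' = 2 - d"
    "zs = [us' @ us @ vs' @ vs]"
proof -
  obtain i j where ij: "i < length x" "j < length y" "ipair C d X (x ! i) (y ! j) \<noteq> 0"
    and zs: "zs = [(drop (Suc i) x @ take i x) @ drop (Suc j) y @ take j y]"
    using assms unfolding open_bracket_def Let_def
    by (elim sum_fun_neq_0) (auto simp: smul_def sgl_def split: if_splits)
  have "ltdeg (x ! i) + ltdeg (y ! j) = 2 - d"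
    using ij(3) by (simp add: ipair_def split: if_splits)
  then show thesis
    using that[of "take i x" "x ! i" "drop (Suc i) x" "take j y" "y ! j" "drop (Suc j) y"] ij(1,2) zs
    by (simp add: id_take_nth_drop[symmetric])
qed

lemma open_theta_size:
  assumes "(open_d C d X w + open_nabla C d X w) zs \<noteq> 0"
  shows "length w \<le> length zs + sum_list (map length zs)"
  using plus_neq_0[OF assms]
proof
  assume "open_d C d X w zs \<noteq> 0"
  then obtain i where "i < length w" "zs = [take i w @ dlett C X (w ! i) # drop (Suc i) w]"
    unfolding open_d_def by (elim sum_fun_neq_0) (auto simp: smul_def sgl_def split: if_splits)
  then show ?thesis by simp
next
  assume "open_nabla C d X w zs \<noteq> 0"
  then obtain i j where "j < length w" "i < j" "zs = [slice (Suc i) j w, drop (Suc j) w @ take i w]"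
    unfolding open_nabla_def Let_def
    by (elim sum_fun_neq_0) (auto simp: smul_def sgl_def split: if_splits)
  then show ?thesis by (simp add: slice_def)
qed

lemma fs_orel: "\<rho> \<in> orel C X \<Longrightarrow> fs \<rho>"
  unfolding orel_def by auto

lemma orel_length:
  assumes "\<rho> \<in> orel C X" shows "\<exists>n. \<forall>w. \<rho> w \<noteq> 0 \<longrightarrow> length w = n"
  using assms unfolding orel_def
proof (elim UnE CollectE exE conjE)
  fix us n \<phi> c \<psi> \<chi> vs
  assume "\<rho> = sgl (us @ Lett n \<phi> # vs) - smul c (sgl (us @ Lett n \<psi> # vs)) - sgl (us @ Lett n \<chi> # vs)"
  then show ?thesis
    by (intro exI[of _ "length us + 1 + length vs"]) (auto simp: sgl_def smul_def pointwise split: if_splits)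
next
  fix x ws
  assume "\<rho> = sgl (x # ws) - smul (ksign (ltdeg x * wd ws)) (sgl (ws @ [x]))"
  then show ?thesis
    by (intro exI[of _ "Suc (length ws)"]) (auto simp: sgl_def smul_def pointwise split: if_splits)
qed

lemma fs_connes_B: "fs (connes_B C as)"
  by (simp add: connes_B_def)

context fin_ainf begin

lemma fs_closed_theta: "fs (closed_theta C x)"
  by (cases x) (simp add: closed_theta_def fs_hoch_d fs_connes_B)

lemma connes_B_support:
  assumes "connes_B C as w \<noteq> 0" "as \<in> hochs C"
  shows "w \<in> hochs C \<and> sd w = sd as - 1"
proof -
  obtain i where i: "i < length as" "w = unit_arr C (src (as ! i)) # drop i as @ take i as"
    using assms(1) unfolding connes_B_def
    by (elim sum_fun_neq_0) (auto simp: smul_def sgl_def split: if_splits)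
  have "drop i as @ take i as \<in> hochs C"
    using hochs_rotate[of "take i as" "drop i as"] assms(2) by simp
  from unit_Cons_hochs[OF this] have "w \<in> hochs C"
    using i by (simp add: hd_append hd_drop_conv_nth)
  moreover have "sd as = sd (take i as @ drop i as)"
    by simp
  ultimately show ?thesis
    using i unfolding sd_def by (simp del: append_take_drop_id add: sdeg_def unit_arr_def)
qed

lemma closed_theta_support:
  assumes "closed_theta C x zs \<noteq> 0" "x \<in> hochs C \<times> UNIV"
  shows "\<exists>z\<in>hochs C \<times> UNIV. zs = [z] \<and> cgdeg d z = cgdeg d x + 1"
proof -
  obtain as i where x: "x = (as, i)" "as \<in> hochs C"
    using assms(2) by (cases x) auto
  consider w where "hoch_d C as w \<noteq> 0" "zs = [(w, i)]"
    | w where "i \<noteq> 0" "connes_B C as w \<noteq> 0" "zs = [(w, i - 1)]"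
    using assms(1) unfolding x closed_theta_def
    by (auto simp: sgl_def dest!: plus_neq_0 elim!: lext_support split: if_splits)
  then show ?thesis
  proof cases
    case 1
    then show ?thesis
      using hoch_d_support[of as w] x by (intro bexI[of _ "(w, i)"]) (auto simp: cgdeg_def hdeg_def)
  next
    case 2
    then show ?thesis
      using connes_B_support[of as w] x
      by (intro bexI[of _ "(w, i - 1)"]) (auto simp: cgdeg_def hdeg_def of_nat_diff)
  qed
qed

lemma mukai_l_neq_0:
  assumes "mukai_l C f bs \<noteq> 0" obtains as where "f as \<noteq> 0" "sd as + sd bs = - 2"
proof -
  obtain as where "as \<in> {as. f as \<noteq> 0}" "f as * mukai C as bs \<noteq> 0"
    using assms unfolding mukai_l_def by (rule sum.not_neutral_contains_not_neutral)
  then show thesis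
    using that[of as] mukai_eq_0[of as bs] by auto
qed

end

section \<open>The operator given by a primitive of the Chern character\<close>

locale open_closed =
  fixes C :: "('k::field_char_0, 'o, 'v::ab_group_add) cyc_ainf" and d :: int and lam :: 'o
    and h :: "nat \<Rightarrow> ('o, 'v) arr list \<Rightarrow> 'k"
  assumes cyc: "cyclic_ainf_category d C"
    and h_deg: "neg_chain C 1 h"
    and h_eq: "neg_eq C (neg_d C h) (chern C lam)"
begin

sublocale fin_ainf C
proof
  note * = cyc[unfolded cyclic_ainf_category_def]
  show "ainf_category C"
    by (rule conjunct1[OF *])
  have fin: "\<forall>X\<in>Obj C. \<forall>Y\<in>Obj C. finite {i. Hom C X Y i \<noteq> {0}} \<and> (\<forall>i. \<exists>B. finite B \<and> Hom C X Y i = module.span (scl C) B)"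
    by (rule conjunct1[OF conjunct2[OF *]])
  fix X Y i assume "X \<in> Obj C" "Y \<in> Obj C"
  with fin show "finite {i. Hom C X Y i \<noteq> {0}}" "\<exists>B. finite B \<and> Hom C X Y i = module.span (scl C) B"
    by blast+
qed

lemma h_props: "fs (h i)" "h i as \<noteq> 0 \<Longrightarrow> as \<in> hochs C \<and> hdeg as = 1 + 2 * int i"
proof -
  show "fs (h i)"
    using h_deg by (simp add: neg_chain_def fs_def)
  assume "h i as \<noteq> 0"
  then have "as \<in> hochs C \<and> hdeg as - 2 * int i = 1"
    using h_deg unfolding neg_chain_def by blast
  then show "as \<in> hochs C \<and> hdeg as = 1 + 2 * int i"
    by simp
qed

definition pairing :: "(nat \<Rightarrow> ('o, 'v) arr list \<Rightarrow> 'k) \<Rightarrow> ('o, 'v) arr list \<times> nat \<Rightarrow> 'k" where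
  "pairing f = (\<lambda>(as, i). (- 1) ^ i * mukai_l C (f i) as)"

definition cdelta :: "('o, 'v) arr list \<times> nat \<Rightarrow> ('o, 'v) arr list \<times> nat \<Rightarrow> 'k" where
  "cdelta = (\<lambda>(as, i) (bs, j). if i = 0 \<and> j = 0
     then ksign ((d + 1) * hdeg as) * mukai_l C (connes_B C as) bs else 0)"

abbreviation "otheta w \<equiv> open_d C d lam w + open_nabla C d lam w"
abbreviation "odelta x y \<equiv> smul (ksign (ogdeg d x)) (open_bracket C d lam x y)"
abbreviation crel :: "(('o, 'v) arr list \<times> nat \<Rightarrow> 'k) set" where
  "crel \<equiv> {(\<lambda>(as, j). \<rho> as * sgl i j) | \<rho> i. \<rho> \<in> hrel C}"

lemma closed_delta_eq: "closed_delta d C = (\<lambda>x y. smul (cdelta x y) (sgl []))"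
  by (auto simp: closed_delta_def cdelta_def fun_eq_iff smul_def pointwise)

text \<open>The operator \<open>\<gamma>\<Delta>\<close> has degree 1 and \<open>\<gamma>\<close>
  has degree \<open>6 - 2 * d\<close>, so a contracted pair has the opposite of the degree
  \<open>2 * d - 5\<close>.\<close>

lemma cdelta_degree:
  assumes "cdelta x y \<noteq> 0" "x \<in> hochs C \<times> UNIV" shows "cgdeg d x + cgdeg d y = 5 - 2 * d"
proof -
  obtain as bs where xy: "x = (as, 0)" "y = (bs, 0)" "mukai_l C (connes_B C as) bs \<noteq> 0"
    using assms(1) by (cases x; cases y) (auto simp: cdelta_def split: if_splits)
  obtain w where "connes_B C as w \<noteq> 0" "sd w + sd bs = - 2"
    using mukai_l_neq_0[OF xy(3)] by blast
  with connes_B_support[of as w] assms(2) show ?thesis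
    by (simp add: xy cgdeg_def hdeg_def)
qed

lemma pairing_h_degree:
  assumes "pairing h x \<noteq> 0" shows "cgdeg d x = 3 - d"
proof -
  obtain as i where x: "x = (as, i)" "mukai_l C (h i) as \<noteq> 0"
    using assms by (cases x) (auto simp: pairing_def)
  obtain w where "h i w \<noteq> 0" "sd w + sd as = - 2"
    using mukai_l_neq_0[OF x(2)] by blast
  with h_props(2)[of i w] show ?thesis
    by (simp add: x cgdeg_def hdeg_def)
qed

lemma pairing_chern_degree:
  assumes "pairing (chern C lam) x \<noteq> 0" shows "cgdeg d x = 2 - d"
proof -
  obtain as i where x: "x = (as, i)" "mukai_l C (chern C lam i) as \<noteq> 0"
    using assms by (cases x) (auto simp: pairing_def)
  obtain w where "chern C lam i w \<noteq> 0" "sd w + sd as = - 2"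
    using mukai_l_neq_0[OF x(2)] by blast
  then show ?thesis
    by (auto simp: x chern_def sgl_def cgdeg_def hdeg_def sd_def sdeg_def unit_arr_def pointwise split: if_splits)
qed

lemma ev_pairing_h:
  assumes "fs f" "\<And>bs. f bs \<noteq> 0 \<Longrightarrow> bs \<in> hochs C"
  shows "ev (\<lambda>bs. pairing h (bs, i)) f = (- 1) ^ i * ev (\<lambda>cs. ev (mukai C cs) f) (h i)"
proof -
  have "ev (\<lambda>bs. pairing h (bs, i)) f = (\<Sum>bs | f bs \<noteq> 0. f bs * ((- 1) ^ i * (\<Sum>cs | h i cs \<noteq> 0. h i cs * mukai C cs bs)))"
    by (simp add: ev_def pairing_def mukai_l_def)
  also have "\<dots> = (- 1) ^ i * (\<Sum>bs | f bs \<noteq> 0. \<Sum>cs | h i cs \<noteq> 0. h i cs * (f bs * mukai C cs bs))"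
    by (simp add: sum_distrib_left mult_ac)
  also have "\<dots> = (- 1) ^ i * (\<Sum>cs | h i cs \<noteq> 0. \<Sum>bs | f bs \<noteq> 0. h i cs * (f bs * mukai C cs bs))"
    by (subst sum.swap) (rule refl)
  finally show ?thesis
    by (simp add: ev_def sum_distrib_left)
qed

text \<open>All components of \<open>h\<close> have odd degree, so adjointness gives the sign -1 for
  \<open>hoch_d\<close> and +1 for \<open>connes_B\<close>. The latter goes along with a step from
  \<open>i\<close> to \<open>i - 1\<close>, where the sign \<open>(- 1) ^ i\<close> changes. Hence
  the two contributions combine to minus the pairing with \<open>neg_d C h\<close>.\<close>

lemma pairing_theta:
  assumes "x \<in> hochs C \<times> UNIV"
  shows "ev (\<lambda>zs. pairing h (hd zs)) (closed_theta C x) = - pairing (chern C lam) x"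
proof -
  obtain as i where x: "x = (as, i)" and as: "as \<in> hochs C"
    using assms by (cases x) auto
  let ?mu = "\<lambda>cs. mukai C cs as"
  have odd: "ksign (hdeg cs) = (- 1 :: 'k)" if "h j cs \<noteq> 0" for j cs
    using h_props(2)[OF that] by (simp add: ksign_def)
  have ev1: "ev (\<lambda>zs. \<phi> (hd zs)) (lext (\<lambda>bs. sgl [(bs, j)]) f) = ev (\<lambda>bs. \<phi> (bs, j)) f" if "fs f" for \<phi> j f
    using that by (subst ev_lext) auto
  have hoch: "ev (\<lambda>bs. pairing h (bs, i)) (hoch_d C as) = - ((- 1) ^ i * ev ?mu (lext (hoch_d C) (h i)))"
  proof -
    have "ev (\<lambda>cs. ev (mukai C cs) (hoch_d C as)) (h i) = ev (\<lambda>cs. - 1 * ev ?mu (hoch_d C cs)) (h i)"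
      using mukai_hoch_d[OF _ as] h_props(2) odd by (intro ev_cong) auto
    also have "\<dots> = - ev (\<lambda>cs. ev ?mu (hoch_d C cs)) (h i)"
      by (simp add: ev_def sum_negf)
    finally show ?thesis
      using hoch_d_support[OF _ as] by (simp add: ev_pairing_h fs_hoch_d ev_lext h_props)
  qed
  have connes: "ev (\<lambda>bs. pairing h (bs, j)) (connes_B C as) = (- 1) ^ j * ev ?mu (lext (connes_B C) (h j))" for j
  proof -
    have "ev (\<lambda>cs. ev (mukai C cs) (connes_B C as)) (h j) = ev (\<lambda>cs. ev ?mu (connes_B C cs)) (h j)"
      using mukai_connes_B[OF _ as] h_props(2) odd by (intro ev_cong) auto
    then show ?thesis
      using connes_B_support[OF _ as] by (simp add: ev_pairing_h fs_connes_B ev_lext h_props)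
  qed
  have "ev (\<lambda>zs. pairing h (hd zs)) (closed_theta C x) = - ((- 1) ^ i * ev ?mu (neg_d C h i))"
  proof (cases i)
    case 0
    then show ?thesis
      using hoch by (simp add: x closed_theta_def ev1 fs_hoch_d neg_d_def)
  next
    case (Suc j)
    have "ev (\<lambda>zs. pairing h (hd zs)) (closed_theta C x) =
        ev (\<lambda>bs. pairing h (bs, i)) (hoch_d C as) + ev (\<lambda>bs. pairing h (bs, j)) (connes_B C as)"
      by (simp add: x Suc closed_theta_def ev_add fs_hoch_d fs_connes_B ev1)
    then show ?thesis
      unfolding hoch connes by (simp add: Suc neg_d_def ev_add h_props fs_hoch_d fs_connes_B algebra_simps)
  qed
  \<comment> \<open>The equation for \<open>h\<close> enters here; it holds modulo the relations of
    the reduced complex, which the pairing annihilates.\<close>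
  also have "ev ?mu (neg_d C h i) = ev ?mu (chern C lam i)"
  proof -
    have f: "fs (neg_d C h i)" "fs (chern C lam i)"
      by (simp_all add: neg_d_def chern_def h_props fs_hoch_d fs_connes_B)
    have "neg_d C h i - chern C lam i \<in> fspan (hrel C)"
      using h_eq by (simp add: neg_eq_def)
    from mukai_fspan_hrel(2)[OF this as] show ?thesis
      by (simp add: ev_diff f)
  qed
  finally show ?thesis
    by (simp add: x pairing_def mukai_l_ev)
qed

lemma crel_props:
  assumes "\<rho> \<in> crel"
  shows "fs \<rho>" "\<rho> x \<noteq> 0 \<Longrightarrow> x \<in> hochs C \<times> UNIV" "\<exists>n. \<forall>x. \<rho> x \<noteq> 0 \<longrightarrow> cgdeg d x = n" "ev (pairing h) \<rho> = 0"
proof -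
  obtain \<sigma> i where \<sigma>: "\<sigma> \<in> hrel C" and \<rho>: "\<rho> = tens \<sigma> (sgl i)"
    using assms by (auto simp: tens_def)
  have fs\<sigma>: "fs \<sigma>"
    using hrel_props(1)[OF \<sigma>] .
  then show "fs \<rho>"
    by (simp add: \<rho>)
  show "x \<in> hochs C \<times> UNIV" if "\<rho> x \<noteq> 0"
    using that hrel_hochs[OF \<sigma>] by (cases x) (simp add: \<rho> tens_def)
  obtain n where "\<And>as. \<sigma> as \<noteq> 0 \<Longrightarrow> hdeg as = n"
    using hrel_props(2)[OF \<sigma>] by blast
  then show "\<exists>n. \<forall>x. \<rho> x \<noteq> 0 \<longrightarrow> cgdeg d x = n"
    by (intro exI[of _ "2 - d - n - 2 * int i"]) (auto simp: \<rho> tens_def sgl_def cgdeg_def split: if_splits)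
  have "tens \<sigma> (sgl i) = lext (\<lambda>as. sgl (as, i)) \<sigma>"
    using tens_expand[OF fs\<sigma>, of "sgl i"] by simp
  then have "ev (pairing h) \<rho> = ev (\<lambda>as. pairing h (as, i)) \<sigma>"
    using fs\<sigma> by (simp add: \<rho> ev_lext)
  also have "\<dots> = (- 1) ^ i * ev (\<lambda>cs. ev (mukai C cs) \<sigma>) (h i)"
    using fs\<sigma> hrel_hochs[OF \<sigma>] by (rule ev_pairing_h)
  also have "ev (\<lambda>cs. ev (mukai C cs) \<sigma>) (h i) = ev (\<lambda>cs. 0) (h i)"
    using mukai_hrel(2)[OF \<sigma>] h_props(2) by (intro ev_cong) auto
  finally show "ev (pairing h) \<rho> = 0"
    by (simp add: ev_def)
qed

text \<open>The empty word is the letter \<open>v\<close>: it has nothing to contract or to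
  differentiate, so it is central and closed. Its degree \<open>3 - d\<close> is the degree in which
  the pairing with \<open>h\<close> lives.\<close>

sublocale nu_op_sized "lists (letters C lam)" "ogdeg d" odelta "orel C lam" "[]" otheta
  "hochs C \<times> UNIV" "cgdeg d" "closed_theta C" cdelta crel "pairing h" "pairing (chern C lam)" "5 - 2 * d" length
proof
  show "fs (odelta x y)" for x y
    by (simp add: open_bracket_def Let_def)
  show "zs \<in> lists (lists (letters C lam)) \<and> even (ldeg (ogdeg d) zs - (ogdeg d x + ogdeg d y + 1))"
    if xy: "x \<in> lists (letters C lam)" "y \<in> lists (letters C lam)" "odelta x y zs \<noteq> 0" for x y zs
  proof -
    obtain us l us' vs l' vs' where *: "x = us @ l # us'" "y = vs @ l' # vs'" "ltdeg l + ltdeg l' = 2 - d"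
        "zs = [us' @ us @ vs' @ vs]"
      by (rule open_bracket_support[OF smul_neq_0[OF xy(3)]])
    \<comment> \<open>Two letters of total degree \<open>2 - d\<close> are lost and two shifts by
      \<open>3 - d\<close> become one. Only the parity of the result matters.\<close>
    have "ldeg (ogdeg d) zs - (ogdeg d x + ogdeg d y + 1) = 2 * (d - 3)"
      using *(3) by (simp add: *(1,2,4) ogdeg_def)
    moreover have "zs \<in> lists (lists (letters C lam))"
      using xy(1,2) by (simp add: *(1,2,4))
    ultimately show ?thesis
      by (simp only: dvd_triv_left simp_thms)
  qed
  show "length x + length y \<le> Suc (length zs + sum_list (map length zs))" if "odelta x y zs \<noteq> 0" for x y zs
    using smul_neq_0[OF that] by (elim open_bracket_support) simp
  show "length x \<le> length zs + sum_list (map length zs)" if "otheta x zs \<noteq> 0" for x zs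
    using that by (rule open_theta_size)
  show "odelta x [] = 0" "odelta [] x = 0" for x
    by (simp_all add: open_bracket_def)
  show "fs (otheta x)" for x
    by (simp add: open_d_def open_nabla_def Let_def)
  show "otheta [] = 0"
    by (simp add: open_d_def open_nabla_def)
  show "ev (pairing h) \<rho> = 0" "fs \<rho>" "\<exists>n. \<forall>x. \<rho> x \<noteq> 0 \<longrightarrow> cgdeg d x = n" if "\<rho> \<in> crel" for \<rho>
    using crel_props[OF that] by blast+
  show "x \<in> hochs C \<times> UNIV" if "\<rho> \<in> crel" "\<rho> x \<noteq> 0" for \<rho> x
    by (rule crel_props(2)[of \<rho>]) (rule that)+
  show "fs \<rho>" "\<exists>n. \<forall>w. \<rho> w \<noteq> 0 \<longrightarrow> length w = n" if "\<rho> \<in> orel C lam" for \<rho>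
    using that by (rule fs_orel, rule orel_length)
  show "fs (closed_theta C x)" for x
    by (rule fs_closed_theta)
  show "\<exists>z\<in>hochs C \<times> UNIV. zs = [z] \<and> cgdeg d z = cgdeg d x + 1"
    if "x \<in> hochs C \<times> UNIV" "closed_theta C x zs \<noteq> 0" for x zs
    by (rule closed_theta_support[OF that(2,1)])
  show "cgdeg d x + cgdeg d y = 5 - 2 * d"
    if "x \<in> hochs C \<times> UNIV" "y \<in> hochs C \<times> UNIV" "cdelta x y \<noteq> 0" for x y
    by (rule cdelta_degree[OF that(3,1)])
  show "cgdeg d x = ogdeg d []" if "x \<in> hochs C \<times> UNIV" "pairing h x \<noteq> 0" for x
    using pairing_h_degree[OF that(2)] by simp
  show "cgdeg d x = ogdeg d [] - 1" if "x \<in> hochs C \<times> UNIV" "pairing (chern C lam) x \<noteq> 0" for x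
    using pairing_chern_degree[OF that(2)] by simp
  show "ev (\<lambda>zs. pairing h (hd zs)) (closed_theta C x) = - pairing (chern C lam) x" if "x \<in> hochs C \<times> UNIV" for x
    by (rule pairing_theta[OF that])
  show "odd (5 - 2 * d)" "[] \<in> lists (letters C lam)"
    by simp_all
qed

end

section \<open>The operations of the open-closed algebra in powers of \<gamma>\<close>

lemma lfin_bker_finite:
  fixes u :: "'a \<Rightarrow> 'k::field"
  assumes "lfin s u" "bker s t K" shows "finite {x. u x * K x y \<noteq> 0}"
proof -
  obtain c where c: "\<And>x y. K x y \<noteq> 0 \<Longrightarrow> s x \<le> t y + c"
    by (rule bker_bound[OF assms(2)]) (rule that)
  have "x \<in> {x. u x \<noteq> 0 \<and> s x \<le> t y + c}" if "u x * K x y \<noteq> 0" for x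
    using that c[of x y] by auto
  then have "{x. u x * K x y \<noteq> 0} \<subseteq> {x. u x \<noteq> 0 \<and> s x \<le> t y + c}"
    by blast
  then show ?thesis
    by (rule finite_subset) (use assms(1) in \<open>simp add: lfin_def\<close>)
qed

lemma lext_cong_at: "(\<And>x. u x \<noteq> 0 \<Longrightarrow> K x y = L x y) \<Longrightarrow> lext K u y = lext L u y"
  unfolding lext_def by (intro sum.cong Collect_cong) (metis mult_zero_left)+

text \<open>A sum over an infinite set of nonzero terms would have the default value 0. Finiteness
  for each \<open>h\<close> is what permits splitting by the power of
  \<open>\<gamma>\<close>.\<close>

lemma bd_D_slice:
  assumes "\<And>h. h \<le> g \<Longrightarrow> finite {n. f (h, n) * dif A n (g - h, m) \<noteq> 0}"
  shows "bd_D A f (g, m) = (\<Sum>h\<le>g. lext (\<lambda>n m. dif A n (g - h, m)) (\<lambda>n. f (h, n)) m)"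
proof -
  have "{(h, n). h \<le> g \<and> f (h, n) * dif A n (g - h, m) \<noteq> 0} =
      Sigma {..g} (\<lambda>h. {n. f (h, n) * dif A n (g - h, m) \<noteq> 0})"
    by auto
  then show ?thesis
    unfolding bd_D_def lext_def using assms by (simp only: prod.case) (subst sum.Sigma, auto)
qed

context open_closed begin

abbreviation "Oc \<equiv> Foc d C lam"

lemma blk_Foc: "blk Oc = bl"
  by (auto simp: Foc_def tensor_bd_def Fc_def Fo_def sym_bd_def bl_def fun_eq_iff)

lemma mons_Foc: "mons Oc = M"
  by (simp add: Foc_def tensor_bd_def Fc_def Fo_def sym_bd_def M_def)

lemma mdeg_Foc: "mdeg Oc m = ldeg (cgdeg d) (fst m) + ldeg (ogdeg d) (snd m)"
  by (simp add: Foc_def tensor_bd_def Fc_def Fo_def sym_bd_def split: prod.split)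

lemma rels_Foc: "rels Oc = S"
  unfolding S_def tensrel_def SC_def SO_def symrel_def tens_def
    Foc_def tensor_bd_def Fc_def Fo_def sym_bd_def bd.select_convs ..

lemma mlt_nu: "mlt Oc ([], [[]]) (cs, ws) = smul (ksign ((3 - d) * ldeg (cgdeg d) cs)) (tens (sgl cs) (sgl ([] # ws)))"
  by (simp add: Foc_def tensor_bd_def Fc_def Fo_def sym_bd_def tens_def smul_def fun_eq_iff)

lemma cdelta_odd: "x \<in> hochs C \<times> UNIV \<Longrightarrow> cdelta x y \<noteq> 0 \<Longrightarrow> odd (cgdeg d x + cgdeg d y)"
  using cdelta_degree by fastforce

lemma dif_Foc:
  assumes "x \<in> M"
  shows "dif Oc x (0, m) = D0 x m" "dif Oc x (Suc 0, m) = D1 x m" "dif Oc x (Suc (Suc k), m) = 0"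
proof -
  obtain cs ws a b where x: "x = (cs, ws)" and m: "m = (a, b)" and cs: "cs \<in> lists (hochs C \<times> UNIV)"
    using assms by (cases x; cases m) (auto simp: M_def)
  have l: "(\<Sum>j<length cs. \<Sum>i<j. contr (cgdeg d) (closed_delta d C) cs i j) = lap (cgdeg d) cdelta cs"
    unfolding closed_delta_eq using cs cdelta_odd by (intro lap_contr) auto
  show "dif Oc x (0, m) = D0 x m" "dif Oc x (Suc 0, m) = D1 x m" "dif Oc x (Suc (Suc k), m) = 0"
    unfolding x m
    by (simp_all add: Foc_def tensor_bd_def Fc_def Fo_def sym_bd_def D0_def D1_def Lo_def l tens_def smul_apply pointwise)
qed

lemma brk_Foc:
  assumes "x \<in> M" "y \<in> M"
  shows "brk Oc x y (0, m) = K0 x y m" "brk Oc x y (Suc k, m) = 0"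
proof -
  obtain a1 b1 a2 b2 a b where x: "x = (a1, b1)" and y: "y = (a2, b2)" and m: "m = (a, b)"
      and cs: "a1 \<in> lists (hochs C \<times> UNIV)"
    using assms by (cases x; cases y; cases m) (auto simp: M_def)
  have l: "(\<Sum>i<length a1. \<Sum>j<length a2. contr (cgdeg d) (closed_delta d C) (a1 @ a2) i (length a1 + j)) = brc (cgdeg d) cdelta a1 a2"
    unfolding closed_delta_eq using cs cdelta_odd by (intro brc_contr) auto
  have k: "ksign (i * (j + (2 * d - 5))) = (ksign (i * (j + 1)) :: 'k)" for i j
    by (rule ksign_eqI) simp
  show "brk Oc x y (0, m) = K0 x y m" "brk Oc x y (Suc k, m) = 0"
    unfolding x y m
    by (simp_all add: Foc_def tensor_bd_def Fc_def Fo_def sym_bd_def K0_def Bo_def l k tens_def smul_apply pointwise)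
qed

text \<open>Letters to the left of the removed one are passed by the derivation, of degree
  \<open>d - 2 - n\<close>, and by \<open>\<nu>\<close>, of degree \<open>3 - d\<close>, in total
  \<open>1 - n\<close>; letters to the right only by \<open>\<nu>\<close>. This is the origin of the
  two sign parameters of \<open>dlt\<close>: \<open>n = 1\<close> gives \<open>P0\<close> and
  \<open>n = 0\<close> gives \<open>Q0\<close>.\<close>

lemma nu_pair_kernel:
  "lext (\<lambda>cs'. mlt Oc ([], [[]]) (cs', ws)) (mukai_der d C n f cs) =
   tens (dlt (cgdeg d) (1 - n) (3 - d) (pairing f) cs) (sgl ([] # ws))"
proof -
  let ?a = "\<lambda>k. ldeg (cgdeg d) (take k cs)" and ?b = "\<lambda>k. ldeg (cgdeg d) (drop (Suc k) cs)"
  have "mukai_der d C n f cs = (\<Sum>k<length cs. smul (ksign ((d - 2 - n) * ?a k) * pairing f (cs ! k))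
      (sgl (take k cs @ drop (Suc k) cs)))"
    unfolding mukai_der_def pairing_def by (intro sum.cong refl) (simp split: prod.split)
  then have "lext (\<lambda>cs'. mlt Oc ([], [[]]) (cs', ws)) (mukai_der d C n f cs) =
    (\<Sum>k<length cs. smul (ksign ((d - 2 - n) * ?a k) * pairing f (cs ! k) * ksign ((3 - d) * (?a k + ?b k)))
      (tens (sgl (take k cs @ drop (Suc k) cs)) (sgl ([] # ws))))"
    by (simp add: mlt_nu)
  also have "\<dots> = (\<Sum>k<length cs. smul (ksign ((1 - n) * ?a k + (3 - d) * ?b k) * pairing f (cs ! k))
      (tens (sgl (take k cs @ drop (Suc k) cs)) (sgl ([] # ws))))"
  proof (intro sum.cong refl arg_cong2[where f = smul])
    fix k
    have "ksign ((d - 2 - n) * ?a k) * ksign ((3 - d) * (?a k + ?b k)) = (ksign ((1 - n) * ?a k + (3 - d) * ?b k) :: 'k)"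
      unfolding ksign_add[symmetric] by (rule ksign_eqI) (simp; blast)
    then show "ksign ((d - 2 - n) * ?a k) * pairing f (cs ! k) * ksign ((3 - d) * (?a k + ?b k)) =
        ksign ((1 - n) * ?a k + (3 - d) * ?b k) * pairing f (cs ! k)"
      by (simp only: mult.commute mult.left_commute)
  qed
  finally show ?thesis
    unfolding dlt_index[symmetric] by (simp add: tens_sum)
qed

lemma nu_pair_h: "(\<lambda>m. nu_pair d C lam 1 h f (g, m)) = lext pk (\<lambda>m. f (g, m))"
  by (simp add: nu_pair_def nu_pair_kernel pk_def[abs_def] P0_def case_prod_unfold)

lemma nu_pair_chern: "(\<lambda>m. nu_pair d C lam 0 (chern C lam) f (g, m)) = lext qk (\<lambda>m. f (g, m))"
  by (simp add: nu_pair_def nu_pair_kernel qk_def[abs_def] Q0_def case_prod_unfold)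

lemma exp_op_slice:
  assumes "lfin s (\<lambda>m. f (g, m))"
  shows "(\<lambda>m. exp_op (nu_pair d C lam 1 h) f (g, m)) = lext X (\<lambda>m. f (g, m))"
proof -
  have "(\<lambda>m. (nu_pair d C lam 1 h ^^ k) f (g, m)) = (pp ^^ k) (\<lambda>m. f (g, m))" for k
    by (induction k) (simp_all add: nu_pair_h)
  from fun_cong[OF this] have *: "(nu_pair d C lam 1 h ^^ k) f (g, m) = (pp ^^ k) (\<lambda>m. f (g, m)) m" for k m .
  show ?thesis
    unfolding exp_op_def * exp_series[OF assms] ..
qed

context
  fixes f :: "nat \<times> (('o, 'v) arr list \<times> nat) list \<times> ('k, 'v) lett list list \<Rightarrow> 'k"
  assumes fin: "\<And>g. lfin s (\<lambda>m. f (g, m))" and on: "\<And>g. onM (\<lambda>m. f (g, m))"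
begin

lemma f_M: "f (g, m) \<noteq> 0 \<Longrightarrow> m \<in> M"
  using on unfolding onM_def by blast

lemma bd_D_Foc:
  "(\<lambda>m. bd_D Oc f (g, m)) = lext D0 (\<lambda>m. f (g, m)) + (if g = 0 then 0 else lext D1 (\<lambda>m. f (g - 1, m)))"
proof
  fix m
  define D where "D k = (if k = 0 then D0 else if k = Suc 0 then D1 else 0)" for k :: nat
  have D: "dif Oc n (k, m) = D k n m" if "f (h, n) \<noteq> 0" for h n k
  proof -
    have "k = 0 \<or> k = Suc 0 \<or> (\<exists>j. k = Suc (Suc j))"
      by presburger
    then show ?thesis
      using dif_Foc[OF f_M[OF that], where m = m] by (elim disjE exE) (simp_all add: D_def pointwise)
  qed
  have bk: "bker s s (D k)" for k
  proof -
    have "bker s s (0 :: _ \<Rightarrow> _ \<Rightarrow> 'k)"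
      by (rule bkerI[where c = 0]) (simp_all add: pointwise)
    then show ?thesis
      using bker_D0 bker_D1 by (simp add: D_def)
  qed
  have fin_D: "finite {n. f (h, n) * dif Oc n (k, m) \<noteq> 0}" for h k
  proof (rule finite_subset[OF _ lfin_bker_finite[OF fin[of h] bk[of k], of m]])
    show "{n. f (h, n) * dif Oc n (k, m) \<noteq> 0} \<subseteq> {n. f (h, n) * D k n m \<noteq> 0}"
      using D by auto
  qed
  have "bd_D Oc f (g, m) = (\<Sum>h\<le>g. lext (D (g - h)) (\<lambda>n. f (h, n)) m)"
    by (subst bd_D_slice[OF fin_D]) (intro sum.cong refl lext_cong_at D)
  \<comment> \<open>Only \<open>h = g\<close> and \<open>h = g - 1\<close> contribute. For
    \<open>g = 0\<close> the two coincide in the natural numbers, hence the case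
    distinction.\<close>
  also have "\<dots> = (\<Sum>h\<in>(if g = 0 then {g} else {g - 1, g}). lext (D (g - h)) (\<lambda>n. f (h, n)) m)"
  proof (rule sum.mono_neutral_right)
    show "\<forall>h\<in>{..g} - (if g = 0 then {g} else {g - 1, g}). lext (D (g - h)) (\<lambda>n. f (h, n)) m = 0"
    proof
      fix h assume "h \<in> {..g} - (if g = 0 then {g} else {g - 1, g})"
      then have "D (g - h) = (\<lambda>_. 0)"
        by (auto simp: D_def fun_eq_iff pointwise split: if_splits)
      then show "lext (D (g - h)) (\<lambda>n. f (h, n)) m = 0"
        by (simp add: pointwise)
    qed
  qed auto
  also have "\<dots> = (lext D0 (\<lambda>m. f (g, m)) + (if g = 0 then 0 else lext D1 (\<lambda>m. f (g - 1, m)))) m"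
    by (cases g) (simp_all add: D_def pointwise)
  finally show "bd_D Oc f (g, m) = (lext D0 (\<lambda>m. f (g, m)) + (if g = 0 then 0 else lext D1 (\<lambda>m. f (g - 1, m)))) m" .
qed

lemma bd_br_Foc:
  "(\<lambda>m. bd_br Oc f f (g, m)) = (\<Sum>h\<le>g. lext K (tens (\<lambda>m. f (h, m)) (\<lambda>m. f (g - h, m))))"
proof
  fix m
  let ?t = "\<lambda>h. tens (\<lambda>m. f (h, m)) (\<lambda>m. f (g - h, m))"
  have fin_K: "finite {p. ?t h p * K p m \<noteq> 0}" for h
    by (rule lfin_bker_finite[OF lfin_tens[OF fin fin] bker_K])
  \<comment> \<open>The bracket involves no positive power of \<open>\<gamma>\<close>, so the
    exponents of the two factors add up to exactly \<open>g\<close>.\<close>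
  have B: "h' = g - h \<and> brk Oc n n' (g - h - h', m) = K0 n n' m"
    if "h + h' \<le> g" "f (h, n) * f (h', n') * brk Oc n n' (g - h - h', m) \<noteq> 0" for h h' n n'
  proof -
    have M: "n \<in> M" "n' \<in> M"
      using that(2) f_M[of h n] f_M[of h' n'] by simp_all
    with that(2) brk_Foc(2)[OF M] have "g - h - h' = 0"
      by (cases "g - h - h'") auto
    with that(1) brk_Foc(1)[OF M] show ?thesis
      by auto
  qed
  have B': "brk Oc n n' (0, m) = K0 n n' m" if "f (h, n) * f (h', n') \<noteq> 0" for h h' n n'
    using that f_M[of h n] f_M[of h' n'] by (intro brk_Foc) simp_all
  have "bd_br Oc f f (g, m) = (\<Sum>(h, p)\<in>Sigma {..g} (\<lambda>h. {p. ?t h p * K p m \<noteq> 0}). ?t h p * K p m)"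
    unfolding bd_br_def prod.case
    by (rule sum.reindex_bij_witness[where i = "\<lambda>(h, (n, n')). ((h, n), (g - h, n'))" and j = "\<lambda>((h, n), (h', n')). (h, (n, n'))"])
      (use B B' in \<open>auto simp: tens_def\<close>)
  also have "\<dots> = (\<Sum>h\<le>g. lext K (?t h) m)"
    unfolding lext_def using fin_K by (subst sum.Sigma) auto
  finally show "bd_br Oc f f (g, m) = (\<Sum>h\<le>g. lext K (?t h)) m"
    by (simp add: sum_fun_apply)
qed

end

lemma bd_eq_Foc: "bd_eq Oc f 0 \<longleftrightarrow> (\<forall>g. RZ bl S (\<lambda>m. f (g, m)))"
  unfolding bd_eq_def RZ_def res_def blk_Foc rels_Foc zero_fun_apply diff_zero ..

text \<open>Up to a given size there are only finitely many blocks, since the numbers of words and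
  of letters are both bounded by it; conversely a block has a single size.\<close>

lemma bd_elem_Foc: "bd_elem Oc f \<longleftrightarrow> (\<forall>g. lfin s (\<lambda>m. f (g, m)) \<and> onM (\<lambda>m. f (g, m)))"
proof -
  have "(\<forall>\<beta>. finite {m. f (g, m) \<noteq> 0 \<and> bl m = \<beta>}) \<longleftrightarrow> lfin s (\<lambda>m. f (g, m))" for g
  proof
    assume *: "\<forall>\<beta>. finite {m. f (g, m) \<noteq> 0 \<and> bl m = \<beta>}"
    show "lfin s (\<lambda>m. f (g, m))"
      unfolding lfin_def
    proof
      fix n
      have "bl m \<in> {()} \<times> {..n} \<times> {..n}" if "s m \<le> n" for m
        using that by (simp add: sz_def bl_def)
      then have "{m. f (g, m) \<noteq> 0 \<and> s m \<le> n} \<subseteq> (\<Union>\<beta>\<in>{()} \<times> {..n} \<times> {..n}. {m. f (g, m) \<noteq> 0 \<and> bl m = \<beta>})"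
        by blast
      then show "finite {m. f (g, m) \<noteq> 0 \<and> s m \<le> n}"
        by (rule finite_subset) (use * in auto)
    qed
  next
    assume *: "lfin s (\<lambda>m. f (g, m))"
    show "\<forall>\<beta>. finite {m. f (g, m) \<noteq> 0 \<and> bl m = \<beta>}"
    proof
      fix \<beta>
      show "finite {m. f (g, m) \<noteq> 0 \<and> bl m = \<beta>}"
        using *[unfolded lfin_def, rule_format, of "sz \<beta>"] by (rule finite_subset[rotated]) blast
    qed
  qed
  note fin = this
  show ?thesis
    unfolding bd_elem_def blk_Foc mons_Foc onM_def fin by blast
qed

lemma exp_MCE:
  assumes elem: "bd_elem Oc Soc"
    and deg: "bd_homog (2 * d - 5) Oc (6 - 2 * d) Soc"
    and eq: "bd_eq Oc (bd_D Oc Soc + smul (1 / 2) (bd_br Oc Soc Soc) + nu_pair d C lam 0 (chern C lam) Soc) 0"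
  shows "exp_op (nu_pair d C lam 1 h) Soc \<in> MCE (2 * d - 5) Oc"
proof -
  let ?E = "exp_op (nu_pair d C lam 1 h) Soc"
  have S: "lfin s (\<lambda>m. Soc (g, m))" "onM (\<lambda>m. Soc (g, m))" for g
    using elem by (simp_all add: bd_elem_Foc)
  have E: "(\<lambda>m. ?E (g, m)) = lext X (\<lambda>m. Soc (g, m))" for g
    by (rule exp_op_slice[OF S(1)])
  have E': "?E (g, m) = lext X (\<lambda>m. Soc (g, m)) m" for g m
    using fun_cong[OF E] .
  have finE: "lfin s (\<lambda>m. ?E (g, m))" "onM (\<lambda>m. ?E (g, m))" for g
    unfolding E by (rule lfin_lext[OF S(1) bker_X], rule onM_lext[OF S(2) onM_X])
  have "bd_elem Oc ?E"
    using finE by (simp add: bd_elem_Foc)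
  moreover have "bd_homog (2 * d - 5) Oc (1 - (2 * d - 5)) ?E"
    unfolding bd_homog_def
  proof (intro allI impI)
    fix g m assume "?E (g, m) \<noteq> 0"
    then obtain x where x: "Soc (g, x) \<noteq> 0" "X x m \<noteq> 0"
      unfolding E' by (rule lext_support)
    moreover have "x \<in> M"
      using S(2)[of g] x(1) unfolding onM_def by blast
    ultimately have "mdeg Oc m = mdeg Oc x"
      using X_degree[of x m] by (simp add: mdeg_Foc)
    then show "mdeg Oc m + int g * (1 - (2 * d - 5)) = 1 - (2 * d - 5)"
      using deg[unfolded bd_homog_def, rule_format, OF x(1)] by simp
  qed
  moreover have "bd_eq Oc (bd_D Oc ?E + smul (1 / 2) (bd_br Oc ?E ?E)) 0"
    unfolding bd_eq_Foc
  proof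
    fix g
    have slice: "(\<lambda>m. smul c f1 (g, m)) = smul c (\<lambda>m. f1 (g, m))"
      for f1 :: "nat \<times> (('o, 'v) arr list \<times> nat) list \<times> ('k, 'v) lett list list \<Rightarrow> 'k" and c
      by (simp add: smul_def)
    have slice': "(\<lambda>m. (f1 + f2) (g, m)) = (\<lambda>m. f1 (g, m)) + (\<lambda>m. f2 (g, m))"
      for f1 f2 :: "nat \<times> (('o, 'v) arr list \<times> nat) list \<times> ('k, 'v) lett list list \<Rightarrow> 'k"
      by (simp add: fun_eq_iff pointwise)
    have "RZ bl S (\<lambda>m. (bd_D Oc Soc + smul (1 / 2) (bd_br Oc Soc Soc) + nu_pair d C lam 0 (chern C lam) Soc) (g, m))"
      using eq by (simp only: bd_eq_Foc)
    then have "RZ bl S (lext D0 (\<lambda>m. Soc (g, m)) + (if g = 0 then 0 else lext D1 (\<lambda>m. Soc (g - 1, m))) +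
      smul (1 / 2) (\<Sum>h\<le>g. lext K (tens (\<lambda>m. Soc (h, m)) (\<lambda>m. Soc (g - h, m)))) + lext qk (\<lambda>m. Soc (g, m)))"
      unfolding slice' slice nu_pair_chern bd_D_Foc[of Soc, OF S] bd_br_Foc[of Soc, OF S] .
    from exp_master[of "\<lambda>g m. Soc (g, m)", OF S this]
    show "RZ bl S (\<lambda>m. (bd_D Oc ?E + smul (1 / 2) (bd_br Oc ?E ?E)) (g, m))"
      unfolding slice' slice bd_D_Foc[of ?E, OF finE] bd_br_Foc[of ?E, OF finE] unfolding E .
  qed
  ultimately show ?thesis
    by (simp add: MCE_def)
qed

end

theorem lemmaB:
  fixes C :: "('k::field_char_0, 'o, 'v::ab_group_add) cyc_ainf"
    and d :: int and lam :: 'o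
    and Soc :: "nat \<times> ('k, 'o, 'v) oc_mon \<Rightarrow> 'k"
    and h :: "nat \<Rightarrow> ('o, 'v) arr list \<Rightarrow> 'k"
  assumes cyc: "cyclic_ainf_category d C"
    and sm: "smooth C"
    and lam: "lam \<in> Obj C"
    and S_elem: "bd_elem (Foc d C lam) Soc"
    and S_deg: "bd_homog (2 * d - 5) (Foc d C lam) (6 - 2 * d) Soc"
    and S_eq: "bd_eq (Foc d C lam)
      (bd_D (Foc d C lam) Soc + smul (1 / 2) (bd_br (Foc d C lam) Soc Soc)
        + nu_pair d C lam 0 (chern C lam) Soc) 0"
    and S_I: "is_cyclic_potential C lam (proj_I Soc)"
    and h_deg: "neg_chain C 1 h"
    and h_eq: "neg_eq C (neg_d C h) (chern C lam)"
  shows "exp_op (nu_pair d C lam 1 h) Soc \<in> MCE (2 * d - 5) (Foc d C lam)"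
proof -
  interpret open_closed C d lam h
    by (rule open_closed.intro[OF cyc h_deg h_eq])
  show ?thesis
    by (rule exp_MCE[OF S_elem S_deg S_eq])
qed

end
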